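(* Let $N\ge2$ and let $A\in M_N(\{0,1\})$ be primitive. The compact quantum group $\mathbb G_A^\infty$ contains $\widehat{\mathbb F}_N$, the dual of the free group on $N$ generators, as a quantum subgroup, as does $\mathbb G_A^\ell$ for all $\ell\in\mathbb N$.
   Context: $A\in M_N(\{0,1\})$ primitive means some power of $A$ has strictly positive entries; $\vec u$ is its right Perron--Frobenius eigenvector (positive entries summing to $1$). $V_A^n$ is the set of words $x_1\cdots x_n$ over $\{1,\dots,N\}$ with $A_{x_i,x_{i+1}}=1$ for all $i$. A magic unitary is a square matrix of projections in a unital $C^*$-algebra with all rows and columns summing to $1$. For $\ell\in\mathbb N\cup\{\infty\}$, $C(\mathbb G_A^\ell)$ is the universal unital $C^*$-algebra generated by partial isometries $(u_{\alpha,\beta})_{1\le\alpha,\beta\le N}$ such that, with $p_{\alpha,\beta}=u_{\alpha,\beta}u_{\alpha,\beta}^*$ and $q_{\alpha,\beta}=u_{\alpha,\beta}^*u_{\alpha,\beta}$: (I) $p,q$ are magic unitaries with $p\vec u=\vec u1=q\vec u$; (II) $Ap=qA$; (III) for all finite $n\le\ell$ and $\alpha,\beta\in V_A^n$, $u_{\alpha_1,\beta_1}\cdots u_{\alpha_n,\beta_n}$ is a partial isometry. Its coproduct is $u_{\alpha,\beta}\mapsto\sum_\gamma u_{\alpha,\gamma}\otimes u_{\gamma,\beta}$. $\widehat{\mathbb F}_N$ is the compact quantum group with $C(\widehat{\mathbb F}_N)=C^*(\mathbb F_N)$ (the full group $C^*$-algebra) and coproduct $g\mapsto g\otimes g$ for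 $g\in\mathbb F_N$. A compact quantum group $\mathbb H$ is a quantum subgroup of $\mathbb G$ if there is a surjective unital $*$-homomorphism $\pi:C(\mathbb G)\to C(\mathbb H)$ intertwining the coproducts. *)

theory Defs
  imports "HOL-Analysis.Analysis" "HOL-Algebra.Ring" "HOL-Library.Extended_Nat"
begin

section \<open>Unital *-algebras and C*-algebras with explicit carriers\<close>

record 'a star_algebra = "'a ring" +
  scl :: "complex \<Rightarrow> 'a \<Rightarrow> 'a"
  str :: "'a \<Rightarrow> 'a"

record 'a cstar = "'a star_algebra" +
  nrm :: "'a \<Rightarrow> real"

definition is_star_algebra :: "('a, 'm) star_algebra_scheme \<Rightarrow> bool" where
  "is_star_algebra A \<longleftrightarrow> ring A
    \<and> (\<forall>c. \<forall>x\<in>carrier A. scl A c x \<in> carrier A)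
    \<and> (\<forall>x\<in>carrier A. scl A 1 x = x)
    \<and> (\<forall>c d. \<forall>x\<in>carrier A. scl A c (scl A d x) = scl A (c * d) x)
    \<and> (\<forall>c d. \<forall>x\<in>carrier A. scl A (c + d) x = scl A c x \<oplus>\<^bsub>A\<^esub> scl A d x)
    \<and> (\<forall>c. \<forall>x\<in>carrier A. \<forall>y\<in>carrier A.
          scl A c (x \<oplus>\<^bsub>A\<^esub> y) = scl A c x \<oplus>\<^bsub>A\<^esub> scl A c y
        \<and> scl A c (x \<otimes>\<^bsub>A\<^esub> y) = scl A c x \<otimes>\<^bsub>A\<^esub> y
        \<and> scl A c (x \<otimes>\<^bsub>A\<^esub> y) = x \<otimes>\<^bsub>A\<^esub> scl A c y)
    \<and> (\<forall>x\<in>carrier A. str A x \<in> carrier A \<and> str A (str A x) = x)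
    \<and> (\<forall>c. \<forall>x\<in>carrier A. str A (scl A c x) = scl A (cnj c) (str A x))
    \<and> (\<forall>x\<in>carrier A. \<forall>y\<in>carrier A.
          str A (x \<oplus>\<^bsub>A\<^esub> y) = str A x \<oplus>\<^bsub>A\<^esub> str A y
        \<and> str A (x \<otimes>\<^bsub>A\<^esub> y) = str A y \<otimes>\<^bsub>A\<^esub> str A x)"

definition cstar_seminorm :: "('a, 'm) star_algebra_scheme \<Rightarrow> ('a \<Rightarrow> real) \<Rightarrow> bool" where
  "cstar_seminorm A p \<longleftrightarrow>
      (\<forall>x\<in>carrier A. 0 \<le> p x)
    \<and> (\<forall>x\<in>carrier A. \<forall>y\<in>carrier A. p (x \<oplus>\<^bsub>A\<^esub> y) \<le> p x + p y)
    \<and> (\<forall>c. \<forall>x\<in>carrier A. p (scl A c x) = cmod c * p x)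
    \<and> (\<forall>x\<in>carrier A. \<forall>y\<in>carrier A. p (x \<otimes>\<^bsub>A\<^esub> y) \<le> p x * p y)
    \<and> (\<forall>x\<in>carrier A. p (str A x \<otimes>\<^bsub>A\<^esub> x) = (p x)\<^sup>2)"

definition cauchy_seqs :: "('a, 'm) star_algebra_scheme \<Rightarrow> ('a \<Rightarrow> real) \<Rightarrow> (nat \<Rightarrow> 'a) set" where
  "cauchy_seqs A p = {x. (\<forall>n. x n \<in> carrier A) \<and>
     (\<forall>e>0. \<exists>M. \<forall>m\<ge>M. \<forall>n\<ge>M. p (x m \<ominus>\<^bsub>A\<^esub> x n) < e)}"

definition cstar_algebra :: "('a, 'm) cstar_scheme \<Rightarrow> bool" where
  "cstar_algebra A \<longleftrightarrow> is_star_algebra A \<and> cstar_seminorm A (nrm A)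
    \<and> (\<forall>x\<in>carrier A. nrm A x = 0 \<longrightarrow> x = \<zero>\<^bsub>A\<^esub>)
    \<and> (\<forall>x\<in>cauchy_seqs A (nrm A). \<exists>a\<in>carrier A. (\<lambda>n. nrm A (x n \<ominus>\<^bsub>A\<^esub> a)) \<longlonglongrightarrow> 0)"

definition star_hom ::
  "('a, 'm) star_algebra_scheme \<Rightarrow> ('b, 'k) star_algebra_scheme \<Rightarrow> ('a \<Rightarrow> 'b) \<Rightarrow> bool" where
  "star_hom A B f \<longleftrightarrow> f ` carrier A \<subseteq> carrier B \<and> f \<one>\<^bsub>A\<^esub> = \<one>\<^bsub>B\<^esub>
    \<and> (\<forall>x\<in>carrier A. \<forall>y\<in>carrier A. f (x \<oplus>\<^bsub>A\<^esub> y) = f x \<oplus>\<^bsub>B\<^esub> f y \<and> f (x \<otimes>\<^bsub>A\<^esub> y) = f x \<otimes>\<^bsub>B\<^esub> f y)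
    \<and> (\<forall>c. \<forall>x\<in>carrier A. f (scl A c x) = scl B c (f x))
    \<and> (\<forall>x\<in>carrier A. f (str A x) = str B (f x))"

section \<open>Hausdorff completion of a seminormed *-algebra\<close>

definition cauchy_rel ::
  "('a, 'm) star_algebra_scheme \<Rightarrow> ('a \<Rightarrow> real) \<Rightarrow> ((nat \<Rightarrow> 'a) \<times> (nat \<Rightarrow> 'a)) set" where
  "cauchy_rel A p = {(x, y). x \<in> cauchy_seqs A p \<and> y \<in> cauchy_seqs A p \<and>
     (\<lambda>n. p (x n \<ominus>\<^bsub>A\<^esub> y n)) \<longlonglongrightarrow> 0}"

definition cauchy_class ::
  "('a, 'm) star_algebra_scheme \<Rightarrow> ('a \<Rightarrow> real) \<Rightarrow> (nat \<Rightarrow> 'a) \<Rightarrow> (nat \<Rightarrow> 'a) set" where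
  "cauchy_class A p x = cauchy_rel A p `` {x}"

definition repr :: "(nat \<Rightarrow> 'a) set \<Rightarrow> nat \<Rightarrow> 'a" where
  "repr X = (SOME x. x \<in> X)"

definition completion ::
  "('a, 'm) star_algebra_scheme \<Rightarrow> ('a \<Rightarrow> real) \<Rightarrow> (nat \<Rightarrow> 'a) set cstar" where
  "completion A p =
    \<lparr> carrier = cauchy_seqs A p // cauchy_rel A p,
      mult = (\<lambda>X Y. cauchy_class A p (\<lambda>n. repr X n \<otimes>\<^bsub>A\<^esub> repr Y n)),
      one = cauchy_class A p (\<lambda>n. \<one>\<^bsub>A\<^esub>),
      zero = cauchy_class A p (\<lambda>n. \<zero>\<^bsub>A\<^esub>),
      add = (\<lambda>X Y. cauchy_class A p (\<lambda>n. repr X n \<oplus>\<^bsub>A\<^esub> repr Y n)),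
      scl = (\<lambda>c X. cauchy_class A p (\<lambda>n. scl A c (repr X n))),
      str = (\<lambda>X. cauchy_class A p (\<lambda>n. str A (repr X n))),
      nrm = (\<lambda>X. lim (\<lambda>n. p (repr X n))) \<rparr>"

definition incl ::
  "('a, 'm) star_algebra_scheme \<Rightarrow> ('a \<Rightarrow> real) \<Rightarrow> 'a \<Rightarrow> (nat \<Rightarrow> 'a) set" where
  "incl A p a = cauchy_class A p (\<lambda>n. a)"

section \<open>The *-algebra of a monoid with involution\<close>

definition supp :: "('m \<Rightarrow> complex) \<Rightarrow> 'm set" where
  "supp f = {x. f x \<noteq> 0}"

definition delta :: "'m \<Rightarrow> 'm \<Rightarrow> complex" where
  "delta m = (\<lambda>x. if x = m then 1 else 0)"

text \<open>
  Finitely supported functions \<open>f\<close>, read as formal sums of \<open>f m \<cdot> m\<close>, with the bilinear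
  extension of the product of \<open>M\<close> and the antilinear extension of the involution \<open>st\<close>.
\<close>

definition monoid_algebra ::
  "('m, 'k) monoid_scheme \<Rightarrow> ('m \<Rightarrow> 'm) \<Rightarrow> ('m \<Rightarrow> complex) star_algebra" where
  "monoid_algebra M st =
    \<lparr> carrier = {f. finite (supp f) \<and> supp f \<subseteq> carrier M},
      mult = (\<lambda>f g z. \<Sum>x\<in>supp f. \<Sum>y\<in>supp g. if x \<otimes>\<^bsub>M\<^esub> y = z then f x * g y else 0),
      one = delta \<one>\<^bsub>M\<^esub>,
      zero = (\<lambda>z. 0),
      add = (\<lambda>f g z. f z + g z),
      scl = (\<lambda>c f z. c * f z),
      str = (\<lambda>f z. \<Sum>x\<in>supp f. if st x = z then cnj (f x) else 0) \<rparr>"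

section \<open>Universal C*-algebras\<close>

text \<open>
  The universal unital C*-algebra of a unital *-algebra \<open>P\<close> subject to relations \<open>R\<close> (a pair
  \<open>(x, y)\<close> stands for \<open>x = y\<close>) is the completion of \<open>P\<close> in the largest C*-seminorm that
  respects \<open>R\<close>. C*-seminorms on \<open>P\<close> are exactly the functions \<open>\<parallel>\<rho> x\<parallel>\<close> for *-homomorphisms
  \<open>\<rho>\<close> to C*-algebras, so this is the supremum over all representations of the relations. In
  the uses below the generators are partial isometries, so the supremum is finite.
\<close>

definition univ_seminorm ::
  "('a, 'm) star_algebra_scheme \<Rightarrow> ('a \<times> 'a) set \<Rightarrow> 'a \<Rightarrow> real" where
  "univ_seminorm P R x =
     Sup {p x | p. cstar_seminorm P p \<and> (\<forall>(a, b)\<in>R. p (a \<ominus>\<^bsub>P\<^esub> b) = 0)}"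

definition universal_cstar ::
  "('a, 'm) star_algebra_scheme \<Rightarrow> ('a \<times> 'a) set \<Rightarrow> (nat \<Rightarrow> 'a) set cstar" where
  "universal_cstar P R = completion P (univ_seminorm P R)"

text \<open>
  The free unital *-algebra on \<open>'g\<close>: the letter \<open>(g, False)\<close> is the generator \<open>g\<close> and
  \<open>(g, True)\<close> is its adjoint.
\<close>

definition free_star_algebra :: "(('g \<times> bool) list \<Rightarrow> complex) star_algebra" where
  "free_star_algebra =
     monoid_algebra \<lparr> carrier = UNIV, mult = (@), one = [] \<rparr>
       (\<lambda>w. rev (map (\<lambda>(g, b). (g, \<not> b)) w))"

definition free_gen :: "'g \<Rightarrow> ('g \<times> bool) list \<Rightarrow> complex" where
  "free_gen g = delta [(g, False)]"

section \<open>Minimal tensor product\<close>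

definition state :: "('a, 'm) cstar_scheme \<Rightarrow> ('a \<Rightarrow> complex) \<Rightarrow> bool" where
  "state A \<phi> \<longleftrightarrow>
      (\<forall>x\<in>carrier A. \<forall>y\<in>carrier A. \<phi> (x \<oplus>\<^bsub>A\<^esub> y) = \<phi> x + \<phi> y)
    \<and> (\<forall>c. \<forall>x\<in>carrier A. \<phi> (scl A c x) = c * \<phi> x)
    \<and> (\<forall>x\<in>carrier A. Im (\<phi> (str A x \<otimes>\<^bsub>A\<^esub> x)) = 0 \<and> 0 \<le> Re (\<phi> (str A x \<otimes>\<^bsub>A\<^esub> x)))
    \<and> (\<forall>x\<in>carrier A. cmod (\<phi> x) \<le> nrm A x)
    \<and> \<phi> \<one>\<^bsub>A\<^esub> = 1"

text \<open>
  Formal sums of simple tensors \<open>a \<otimes> b\<close>. The bilinearity relations are not imposed here: they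
  are null for the spatial seminorm below, which is a norm on the algebraic tensor product, so
  they are divided out (and nothing else is) when passing to the Hausdorff completion.
\<close>

definition pre_tensor ::
  "('a, 'm) cstar_scheme \<Rightarrow> ('b, 'k) cstar_scheme \<Rightarrow> ('a \<times> 'b \<Rightarrow> complex) star_algebra" where
  "pre_tensor A B = monoid_algebra (A \<times>\<times> B) (\<lambda>(a, b). (str A a, str B b))"

definition product_functional ::
  "('a \<Rightarrow> complex) \<Rightarrow> ('b \<Rightarrow> complex) \<Rightarrow> ('a \<times> 'b \<Rightarrow> complex) \<Rightarrow> complex" where
  "product_functional \<phi> \<psi> f = (\<Sum>(a, b)\<in>supp f. f (a, b) * \<phi> a * \<psi> b)"

text \<open>
  The spatial norm: the supremum of the operator norms of \<open>x\<close> in the GNS representations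
  \<open>\<pi>\<^sub>\<phi> \<otimes> \<pi>\<^sub>\<psi>\<close> of product states, tested on the unit vectors given by the algebraic tensor
  product. Every representation is a direct sum of cyclic ones, so this is the supremum over all
  pairs of representations. The \<open>insert 0\<close> only matters for the zero algebra.
\<close>

definition spatial_seminorm ::
  "('a, 'm) cstar_scheme \<Rightarrow> ('b, 'k) cstar_scheme \<Rightarrow> ('a \<times> 'b \<Rightarrow> complex) \<Rightarrow> real" where
  "spatial_seminorm A B x = (let T = pre_tensor A B in
     Sup (insert 0
       {sqrt (Re (product_functional \<phi> \<psi>
            (str T y \<otimes>\<^bsub>T\<^esub> (str T x \<otimes>\<^bsub>T\<^esub> x) \<otimes>\<^bsub>T\<^esub> y))) | \<phi> \<psi> y.
          state A \<phi> \<and> state B \<psi> \<and> y \<in> carrier T \<and>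
          product_functional \<phi> \<psi> (str T y \<otimes>\<^bsub>T\<^esub> y) = 1}))"

definition min_tensor ::
  "('a, 'm) cstar_scheme \<Rightarrow> ('b, 'k) cstar_scheme \<Rightarrow> (nat \<Rightarrow> 'a \<times> 'b \<Rightarrow> complex) set cstar" where
  "min_tensor A B = completion (pre_tensor A B) (spatial_seminorm A B)"

definition tns ::
  "('a, 'm) cstar_scheme \<Rightarrow> ('b, 'k) cstar_scheme \<Rightarrow> 'a \<Rightarrow> 'b
    \<Rightarrow> (nat \<Rightarrow> 'a \<times> 'b \<Rightarrow> complex) set" where
  "tns A B a b = incl (pre_tensor A B) (spatial_seminorm A B) (delta (a, b))"

section \<open>Compact quantum groups\<close>

text \<open>A C*-algebra together with a comultiplication into its minimal tensor square.\<close>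

type_synonym 'a qgroup = "'a cstar \<times> ('a \<Rightarrow> (nat \<Rightarrow> 'a \<times> 'a \<Rightarrow> complex) set)"

definition generates :: "('a, 'm) cstar_scheme \<Rightarrow> 'a set \<Rightarrow> bool" where
  "generates A G \<longleftrightarrow> (\<forall>S \<subseteq> carrier A.
      G \<subseteq> S \<and> \<one>\<^bsub>A\<^esub> \<in> S
      \<and> (\<forall>x\<in>S. \<forall>y\<in>S. x \<oplus>\<^bsub>A\<^esub> y \<in> S \<and> x \<otimes>\<^bsub>A\<^esub> y \<in> S)
      \<and> (\<forall>x\<in>S. str A x \<in> S \<and> (\<forall>c. scl A c x \<in> S))
      \<and> (\<forall>x a. (\<forall>n. x n \<in> S) \<and> a \<in> carrier A \<and> (\<lambda>n. nrm A (x n \<ominus>\<^bsub>A\<^esub> a)) \<longlonglongrightarrow> 0 \<longrightarrow> a \<in> S)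
      \<longrightarrow> S = carrier A)"

definition invertible_matrix ::
  "('a, 'm) cstar_scheme \<Rightarrow> nat \<Rightarrow> (nat \<Rightarrow> nat \<Rightarrow> 'a) \<Rightarrow> bool" where
  "invertible_matrix A n u \<longleftrightarrow> (\<exists>v. (\<forall>i<n. \<forall>j<n. v i j \<in> carrier A) \<and>
      (\<forall>i<n. \<forall>j<n.
          finsum A (\<lambda>k. u i k \<otimes>\<^bsub>A\<^esub> v k j) {..<n} = (if i = j then \<one>\<^bsub>A\<^esub> else \<zero>\<^bsub>A\<^esub>)
        \<and> finsum A (\<lambda>k. v i k \<otimes>\<^bsub>A\<^esub> u k j) {..<n} = (if i = j then \<one>\<^bsub>A\<^esub> else \<zero>\<^bsub>A\<^esub>)))"

text \<open>
  Woronowicz's compact matrix quantum groups, i.e. compact quantum groups with a finite fundamental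
  representation: the C*-algebra is generated by the entries of a matrix \<open>u\<close> that is invertible
  together with its entrywise adjoint, and \<open>\<Delta>(u i j) = (\<Sum>k. u i k \<otimes> u k j)\<close> for a unital
  *-homomorphism \<open>\<Delta>\<close>. Coassociativity and density of \<open>\<Delta>(A)(1 \<otimes> A)\<close> and \<open>\<Delta>(A)(A \<otimes> 1)\<close> are
  consequences.
\<close>

definition compact_matrix_quantum_group :: "'a qgroup \<Rightarrow> bool" where
  "compact_matrix_quantum_group = (\<lambda>(A, \<Delta>). cstar_algebra A \<and> star_hom A (min_tensor A A) \<Delta> \<and>
     (\<exists>n u. (\<forall>i<n. \<forall>j<n. u i j \<in> carrier A)
        \<and> generates A {u i j | i j. i < n \<and> j < n}
        \<and> invertible_matrix A n u \<and> invertible_matrix A n (\<lambda>i j. str A (u i j))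
        \<and> (\<forall>i<n. \<forall>j<n. \<Delta> (u i j) =
              finsum (min_tensor A A) (\<lambda>k. tns A A (u i k) (u k j)) {..<n})))"

text \<open>
  \<open>B\<close> is a quantum subgroup of \<open>A\<close>. \<open>\<Theta>\<close> is the map \<open>\<pi> \<otimes> \<pi>\<close>, determined by its values on
  simple tensors since *-homomorphisms of C*-algebras are contractive.
\<close>

definition quantum_subgroup :: "'b qgroup \<Rightarrow> 'a qgroup \<Rightarrow> bool" where
  "quantum_subgroup = (\<lambda>(B, \<Delta>\<^sub>B) (A, \<Delta>\<^sub>A).
     compact_matrix_quantum_group (B, \<Delta>\<^sub>B) \<and> compact_matrix_quantum_group (A, \<Delta>\<^sub>A) \<and>
     (\<exists>\<pi> \<Theta>. star_hom A B \<pi> \<and> \<pi> ` carrier A = carrier B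
        \<and> star_hom (min_tensor A A) (min_tensor B B) \<Theta>
        \<and> (\<forall>a\<in>carrier A. \<forall>b\<in>carrier A. \<Theta> (tns A A a b) = tns B B (\<pi> a) (\<pi> b))
        \<and> (\<forall>a\<in>carrier A. \<Theta> (\<Delta>\<^sub>A a) = \<Delta>\<^sub>B (\<pi> a))))"

section \<open>Duals of discrete groups and free groups\<close>

text \<open>
  Group elements are unitary, so without further relations the universal construction gives the
  full group C*-algebra.
\<close>

definition group_cstar :: "('g, 'm) monoid_scheme \<Rightarrow> (nat \<Rightarrow> 'g \<Rightarrow> complex) set cstar" where
  "group_cstar G = universal_cstar (monoid_algebra G (m_inv G)) {}"

definition group_elem :: "('g, 'm) monoid_scheme \<Rightarrow> 'g \<Rightarrow> (nat \<Rightarrow> 'g \<Rightarrow> complex) set" where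
  "group_elem G g = (let P = monoid_algebra G (m_inv G) in incl P (univ_seminorm P {}) (delta g))"

text \<open>
  Both comultiplications below are determined on the carrier by their values on generators; that
  they exist as *-homomorphisms is part of what \<open>compact_matrix_quantum_group\<close> asserts.
\<close>

definition group_comult ::
  "('g, 'm) monoid_scheme \<Rightarrow> (nat \<Rightarrow> 'g \<Rightarrow> complex) set
    \<Rightarrow> (nat \<Rightarrow> (nat \<Rightarrow> 'g \<Rightarrow> complex) set \<times> (nat \<Rightarrow> 'g \<Rightarrow> complex) set \<Rightarrow> complex) set" where
  "group_comult G = (let B = group_cstar G in
     SOME \<Delta>. star_hom B (min_tensor B B) \<Delta> \<and>
       (\<forall>g\<in>carrier G. \<Delta> (group_elem G g) = tns B B (group_elem G g) (group_elem G g)))"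

definition group_dual :: "('g, 'm) monoid_scheme \<Rightarrow> (nat \<Rightarrow> 'g \<Rightarrow> complex) set qgroup" where
  "group_dual G = (group_cstar G, group_comult G)"

text \<open>
  The free group on \<open>'n\<close> as reduced words: \<open>(i, True)\<close> is the generator \<open>i\<close> and
  \<open>(i, False)\<close> its inverse.
\<close>

definition flip :: "'n \<times> bool \<Rightarrow> 'n \<times> bool" where
  "flip = (\<lambda>(i, b). (i, \<not> b))"

definition red_cons :: "'n \<times> bool \<Rightarrow> ('n \<times> bool) list \<Rightarrow> ('n \<times> bool) list" where
  "red_cons x w = (if w \<noteq> [] \<and> hd w = flip x then tl w else x # w)"

definition free_group :: "('n \<times> bool) list monoid" where
  "free_group =
    \<lparr> carrier = {w. successively (\<lambda>x y. y \<noteq> flip x) w},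
      mult = (\<lambda>v w. foldr red_cons v w),
      one = [] \<rparr>"

section \<open>Primitive matrices and the quantum groups \<open>G\<^sub>A\<^sup>l\<close>\<close>

definition primitive_matrix :: "real^'n^'n \<Rightarrow> bool" where
  "primitive_matrix A \<longleftrightarrow> (\<exists>k>0. \<forall>i j. 0 < (((**) A ^^ k) (mat 1)) $ i $ j)"

text \<open>A positive eigenvector of a primitive matrix belongs to the Perron-Frobenius eigenvalue.\<close>

definition right_perron_vector :: "real^'n^'n \<Rightarrow> real^'n \<Rightarrow> bool" where
  "right_perron_vector A v \<longleftrightarrow>
     (\<exists>r. A *v v = r *\<^sub>R v) \<and> (\<forall>i. 0 < v $ i) \<and> (\<Sum>i\<in>UNIV. v $ i) = 1"

definition words :: "real^'n^'n \<Rightarrow> nat \<Rightarrow> 'n list set" where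
  "words A n = {x. length x = n \<and> (\<forall>i. Suc i < n \<longrightarrow> A $ (x ! i) $ (x ! Suc i) = 1)}"

definition word_prod ::
  "('a, 'm) monoid_scheme \<Rightarrow> ('n \<Rightarrow> 'n \<Rightarrow> 'a) \<Rightarrow> 'n list \<Rightarrow> 'n list \<Rightarrow> 'a" where
  "word_prod P u \<alpha> \<beta> = foldr (\<lambda>(a, b) x. u a b \<otimes>\<^bsub>P\<^esub> x) (zip \<alpha> \<beta>) \<one>\<^bsub>P\<^esub>"

definition partial_isometry_rel :: "('a, 'm) star_algebra_scheme \<Rightarrow> 'a \<Rightarrow> 'a \<times> 'a" where
  "partial_isometry_rel P x = (x \<otimes>\<^bsub>P\<^esub> str P x \<otimes>\<^bsub>P\<^esub> x, x)"

definition magic_unitary_rels ::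
  "('a, 'm) star_algebra_scheme \<Rightarrow> ('n::finite \<Rightarrow> 'n \<Rightarrow> 'a) \<Rightarrow> ('a \<times> 'a) set" where
  "magic_unitary_rels P p =
      {(str P (p \<alpha> \<beta>), p \<alpha> \<beta>) | \<alpha> \<beta>. True}
    \<union> {(p \<alpha> \<beta> \<otimes>\<^bsub>P\<^esub> p \<alpha> \<beta>, p \<alpha> \<beta>) | \<alpha> \<beta>. True}
    \<union> {(finsum P (\<lambda>\<beta>. p \<alpha> \<beta>) UNIV, \<one>\<^bsub>P\<^esub>) | \<alpha>. True}
    \<union> {(finsum P (\<lambda>\<alpha>. p \<alpha> \<beta>) UNIV, \<one>\<^bsub>P\<^esub>) | \<beta>. True}"

definition vector_rels ::
  "('a, 'm) star_algebra_scheme \<Rightarrow> real^'n \<Rightarrow> ('n::finite \<Rightarrow> 'n \<Rightarrow> 'a) \<Rightarrow> ('a \<times> 'a) set" where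
  "vector_rels P v p =
     {(finsum P (\<lambda>\<beta>. scl P (of_real (v $ \<beta>)) (p \<alpha> \<beta>)) UNIV, scl P (of_real (v $ \<alpha>)) \<one>\<^bsub>P\<^esub>) | \<alpha>. True}"

definition GA_rels ::
  "('a, 'm) star_algebra_scheme \<Rightarrow> real^'n^'n \<Rightarrow> real^'n \<Rightarrow> enat \<Rightarrow> ('n::finite \<Rightarrow> 'n \<Rightarrow> 'a)
    \<Rightarrow> ('a \<times> 'a) set" where
  "GA_rels P A v l u =
    (let p = (\<lambda>\<alpha> \<beta>. u \<alpha> \<beta> \<otimes>\<^bsub>P\<^esub> str P (u \<alpha> \<beta>));
         q = (\<lambda>\<alpha> \<beta>. str P (u \<alpha> \<beta>) \<otimes>\<^bsub>P\<^esub> u \<alpha> \<beta>)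
     in {partial_isometry_rel P (u \<alpha> \<beta>) | \<alpha> \<beta>. True}
      \<union> magic_unitary_rels P p \<union> magic_unitary_rels P q
      \<union> vector_rels P v p \<union> vector_rels P v q
      \<union> {(finsum P (\<lambda>\<gamma>. scl P (of_real (A $ \<alpha> $ \<gamma>)) (p \<gamma> \<beta>)) UNIV,
          finsum P (\<lambda>\<gamma>. scl P (of_real (A $ \<gamma> $ \<beta>)) (q \<alpha> \<gamma>)) UNIV) | \<alpha> \<beta>. True}
      \<union> {partial_isometry_rel P (word_prod P u \<alpha> \<beta>) | \<alpha> \<beta> n.
          enat n \<le> l \<and> \<alpha> \<in> words A n \<and> \<beta> \<in> words A n})"

abbreviation GA_pres ::
  "real^'n^'n \<Rightarrow> real^'n \<Rightarrow> enat
    \<Rightarrow> (((('n::finite \<times> 'n) \<times> bool) list \<Rightarrow> complex) \<times> ((('n \<times> 'n) \<times> bool) list \<Rightarrow> complex)) set" where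
  "GA_pres A v l \<equiv> GA_rels free_star_algebra A v l (\<lambda>\<alpha> \<beta>. free_gen (\<alpha>, \<beta>))"

definition GA_cstar ::
  "real^'n^'n \<Rightarrow> real^'n \<Rightarrow> enat
    \<Rightarrow> (nat \<Rightarrow> (('n::finite \<times> 'n) \<times> bool) list \<Rightarrow> complex) set cstar" where
  "GA_cstar A v l = universal_cstar free_star_algebra (GA_pres A v l)"

definition GA_gen ::
  "real^'n^'n \<Rightarrow> real^'n \<Rightarrow> enat \<Rightarrow> 'n \<Rightarrow> 'n
    \<Rightarrow> (nat \<Rightarrow> (('n::finite \<times> 'n) \<times> bool) list \<Rightarrow> complex) set" where
  "GA_gen A v l \<alpha> \<beta> =
     incl free_star_algebra (univ_seminorm free_star_algebra (GA_pres A v l)) (free_gen (\<alpha>, \<beta>))"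

definition GA_comult ::
  "real^'n^'n \<Rightarrow> real^'n \<Rightarrow> enat
    \<Rightarrow> (nat \<Rightarrow> (('n::finite \<times> 'n) \<times> bool) list \<Rightarrow> complex) set
    \<Rightarrow> (nat \<Rightarrow> (nat \<Rightarrow> (('n \<times> 'n) \<times> bool) list \<Rightarrow> complex) set
            \<times> (nat \<Rightarrow> (('n \<times> 'n) \<times> bool) list \<Rightarrow> complex) set \<Rightarrow> complex) set" where
  "GA_comult A v l = (let C = GA_cstar A v l; u = GA_gen A v l in
     SOME \<Delta>. star_hom C (min_tensor C C) \<Delta> \<and>
       (\<forall>\<alpha> \<beta>. \<Delta> (u \<alpha> \<beta>) =
          finsum (min_tensor C C) (\<lambda>\<gamma>. tns C C (u \<alpha> \<gamma>) (u \<gamma> \<beta>)) UNIV))"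

definition GA ::
  "real^'n^'n \<Rightarrow> real^'n \<Rightarrow> enat
    \<Rightarrow> (nat \<Rightarrow> (('n::finite \<times> 'n) \<times> bool) list \<Rightarrow> complex) set qgroup" where
  "GA A v l = (GA_cstar A v l, GA_comult A v l)"

end

theory Submission
  imports Defs "HOL-Library.Complex_Order"
begin

text \<open>
  Sending \<open>u \<alpha> \<beta>\<close> to the free generator \<open>g \<alpha>\<close> if \<open>\<alpha> = \<beta>\<close> and to \<open>0\<close> otherwise turns both magic
  unitaries into the identity matrix and every word in the \<open>u \<alpha> \<beta>\<close> into a unitary or \<open>0\<close>, so all
  relations hold and there is a *-homomorphism \<open>\<pi>\<close> from \<open>C(G\<^sub>A\<^sup>l)\<close> to the group C*-algebra. It
  intertwines the coproducts because it does so on generators.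

  The coproduct of \<open>C(G\<^sub>A\<^sup>l)\<close> exists because the elements \<open>\<Sum>\<gamma>. u \<alpha> \<gamma> \<otimes> u \<gamma> \<beta>\<close> satisfy the
  relations again: projections that sum to \<open>1\<close> are orthogonal, which makes products of such sums
  diagonal; \<open>A p = q A\<close> annihilates the words \<open>u \<alpha> \<gamma>\<close> with \<open>\<alpha>\<close> admissible and \<open>\<gamma>\<close> not; and
  relation (III) makes the source and range projections along a word commute, which gives the
  orthogonality needed for (III) itself.

  Spectral theory is replaced by two fixed points of contractions. A square root of \<open>1 - h\<^sup>2\<close>
  for selfadjoint \<open>h\<close> with \<open>\<parallel>h\<parallel> < 1\<close> shows that *-homomorphisms are contractive, and an inverse of
  \<open>1 + a\<^sup>2\<close> lifts a selfadjoint \<open>b\<close> approximately, with norm control, through \<open>a (1 + a\<^sup>2)\<^sup>-\<^sup>1\<close>;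
  successive approximation then shows that \<open>\<pi>\<close>, having dense image, is surjective.
\<close>

section \<open>Star algebras and C*-seminorms\<close>

text \<open>No Hilbert space occurs: representations enter only through the C*-seminorms that they
  induce, and positivity only through numbers \<open>w (x^* x)\<close>. This shapes the tensor
  product. The spatial seminorm is a supremum over product states, so its finiteness,
  submultiplicativity and C*-identity have to be derived from positive functionals alone; a product
  of two states is positive because the entrywise product of two Gram matrices is positive
  semidefinite. It also explains why surjectivity of \<open>\<pi>\<close> is settled before
  \<open>\<pi> \<otimes> \<pi>\<close> is built: contractivity for the spatial seminorms is shown by
  lifting each test vector of the target through \<open>\<pi>\<close>. Orthogonality of projections
  that sum to \<open>1\<close> would be immediate from the order on self-adjoint elements; here a
  perturbation that stays in the unit ball in both directions is enlarged by a fixed factor again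
  and again, which only zero survives. Both comultiplications are defined by choice, so all their
  properties rest on existence proofs through universal properties.\<close>

locale star_alg = ring A for A :: "('a, 'm) star_algebra_scheme" (structure) +
  assumes scl_closed [simp, intro]: "x \<in> carrier A \<Longrightarrow> scl A c x \<in> carrier A"
    and scl_one [simp]: "x \<in> carrier A \<Longrightarrow> scl A 1 x = x"
    and scl_scl [simp]: "x \<in> carrier A \<Longrightarrow> scl A c (scl A d x) = scl A (c * d) x"
    and scl_add_left: "x \<in> carrier A \<Longrightarrow> scl A (c + d) x = scl A c x \<oplus> scl A d x"
    and scl_add_right: "x \<in> carrier A \<Longrightarrow> y \<in> carrier A \<Longrightarrow> scl A c (x \<oplus> y) = scl A c x \<oplus> scl A c y"
    and scl_mult_left': "x \<in> carrier A \<Longrightarrow> y \<in> carrier A \<Longrightarrow> scl A c (x \<otimes> y) = scl A c x \<otimes> y"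
    and scl_mult_right': "x \<in> carrier A \<Longrightarrow> y \<in> carrier A \<Longrightarrow> scl A c (x \<otimes> y) = x \<otimes> scl A c y"
    and str_closed [simp, intro]: "x \<in> carrier A \<Longrightarrow> str A x \<in> carrier A"
    and str_str [simp]: "x \<in> carrier A \<Longrightarrow> str A (str A x) = x"
    and str_scl [simp]: "x \<in> carrier A \<Longrightarrow> str A (scl A c x) = scl A (cnj c) (str A x)"
    and str_add [simp]: "x \<in> carrier A \<Longrightarrow> y \<in> carrier A \<Longrightarrow> str A (x \<oplus> y) = str A x \<oplus> str A y"
    and str_mult [simp]: "x \<in> carrier A \<Longrightarrow> y \<in> carrier A \<Longrightarrow> str A (x \<otimes> y) = str A y \<otimes> str A x"

lemma star_alg_iff: "star_alg A \<longleftrightarrow> is_star_algebra A"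
proof
  assume "star_alg A"
  then interpret star_alg A .
  show "is_star_algebra A"
    unfolding is_star_algebra_def
    by (intro conjI allI ballI ring_axioms)
      (assumption | rule scl_closed scl_one scl_scl scl_add_left scl_add_right scl_mult_left'
        scl_mult_right' str_closed str_str str_scl str_add str_mult)+
next
  assume *: "is_star_algebra A"
  show "star_alg A"
  proof (intro star_alg.intro star_alg_axioms.intro)
    show "ring A" using * by (simp add: is_star_algebra_def)
  qed (use *[unfolded is_star_algebra_def] in meson)+
qed

context star_alg
begin

text \<open>Reversed orientation of the axiom: rewriting now pulls all scalars out of
  products.\<close>

lemma scl_mult_left: "x \<in> carrier A \<Longrightarrow> y \<in> carrier A \<Longrightarrow> scl A c x \<otimes> y = scl A c (x \<otimes> y)"
  by (simp only: scl_mult_left')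

lemma scl_mult_right: "x \<in> carrier A \<Longrightarrow> y \<in> carrier A \<Longrightarrow> x \<otimes> scl A c y = scl A c (x \<otimes> y)"
  by (simp only: scl_mult_right')

lemma scl_zero_right [simp]: "scl A c \<zero> = \<zero>"
  using scl_add_right[of \<zero> \<zero> c] add.l_cancel_one'[of "scl A c \<zero>" "scl A c \<zero>"] by simp

lemma scl_zero_left [simp]: "x \<in> carrier A \<Longrightarrow> scl A 0 x = \<zero>"
  using scl_add_left[of x 0 0] add.l_cancel_one'[of "scl A 0 x" "scl A 0 x"] by simp

lemma scl_minus_left: "x \<in> carrier A \<Longrightarrow> scl A (- c) x = \<ominus> scl A c x"
  using scl_add_left[of x "- c" c] by (simp add: minus_equality)

lemma scl_minus_one [simp]: "x \<in> carrier A \<Longrightarrow> scl A (- 1) x = \<ominus> x"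
  using scl_minus_left[of x 1] by simp

lemma scl_minus_right [simp]: "x \<in> carrier A \<Longrightarrow> scl A c (\<ominus> x) = \<ominus> scl A c x"
  using scl_add_right[of "\<ominus> x" x c] by (simp add: l_neg minus_equality)

lemma scl_diff_right: "x \<in> carrier A \<Longrightarrow> y \<in> carrier A \<Longrightarrow> scl A c (x \<ominus> y) = scl A c x \<ominus> scl A c y"
  by (simp add: minus_eq scl_add_right)

lemma str_zero [simp]: "str A \<zero> = \<zero>"
  using str_scl[of \<zero> 0] by simp

lemma str_minus [simp]: "x \<in> carrier A \<Longrightarrow> str A (\<ominus> x) = \<ominus> str A x"
  using str_scl[of x "- 1"] by simp

lemma str_diff [simp]: "x \<in> carrier A \<Longrightarrow> y \<in> carrier A \<Longrightarrow> str A (x \<ominus> y) = str A x \<ominus> str A y"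
  by (simp add: minus_eq)

lemma str_one [simp]: "str A \<one> = \<one>"
  by (metis one_closed r_one str_closed str_mult str_str)

lemma finsum_scl:
  "finite I \<Longrightarrow> f \<in> I \<rightarrow> carrier A \<Longrightarrow> scl A c (finsum A f I) = finsum A (\<lambda>i. scl A c (f i)) I"
  by (induction I rule: finite_induct) (simp_all add: Pi_def scl_add_right)

lemma finsum_str:
  "finite I \<Longrightarrow> f \<in> I \<rightarrow> carrier A \<Longrightarrow> str A (finsum A f I) = finsum A (\<lambda>i. str A (f i)) I"
  by (induction I rule: finite_induct) (simp_all add: Pi_def)

end

context abelian_monoid
begin

lemma finsum_swap:
  assumes "finite I" "finite J" "\<And>i j. i \<in> I \<Longrightarrow> j \<in> J \<Longrightarrow> f i j \<in> carrier G"
  shows "finsum G (\<lambda>i. finsum G (f i) J) I = finsum G (\<lambda>j. finsum G (\<lambda>i. f i j) I) J"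
  using assms
proof (induction I rule: finite_induct)
  case (insert x F)
  have "finsum G (\<lambda>j. finsum G (\<lambda>i. f i j) (insert x F)) J
      = finsum G (\<lambda>j. f x j \<oplus> finsum G (\<lambda>i. f i j) F) J"
    using insert by (intro finsum_cong') (auto simp: Pi_def)
  also have "\<dots> = finsum G (f x) J \<oplus> finsum G (\<lambda>j. finsum G (\<lambda>i. f i j) F) J"
    using insert by (intro finsum_addf) auto
  finally show ?case using insert by (simp add: Pi_def)
qed (simp add: finsum_zero)

lemma finsum_mono_neutral:
  assumes "finite J" "I \<subseteq> J" "\<And>j. j \<in> J - I \<Longrightarrow> f j = \<zero>" "f \<in> I \<rightarrow> carrier G"
  shows "finsum G f J = finsum G f I"
proof -
  have "finsum G f (I \<union> (J - I)) = finsum G f I \<oplus> finsum G f (J - I)"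
    using assms by (intro finsum_Un_disjoint) (auto intro: finite_subset)
  moreover have "finsum G f (J - I) = finsum G (\<lambda>_. \<zero>) (J - I)"
    using assms by (intro finsum_cong') auto
  moreover have "I \<union> (J - I) = J" using assms by auto
  ultimately show ?thesis using assms by (simp add: finsum_zero)
qed

lemma finsum_single:
  assumes "finite I" "i \<in> I" "\<And>j. j \<in> I \<Longrightarrow> j \<noteq> i \<Longrightarrow> f j = \<zero>" "f i \<in> carrier G"
  shows "finsum G f I = f i"
  using finsum_mono_neutral[of I "{i}" f] assms by (auto simp: Pi_def)

lemma finsum_Sigma:
  assumes "finite I" "finite J" "\<And>i j. i \<in> I \<Longrightarrow> j \<in> J \<Longrightarrow> f (i, j) \<in> carrier G"
  shows "finsum G f (I \<times> J) = finsum G (\<lambda>i. finsum G (\<lambda>j. f (i, j)) J) I"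
  using assms
proof (induction I rule: finite_induct)
  case (insert x F)
  have "insert x F \<times> J = Pair x ` J \<union> F \<times> J" by auto
  moreover have "finsum G f (Pair x ` J \<union> F \<times> J) = finsum G f (Pair x ` J) \<oplus> finsum G f (F \<times> J)"
    using insert by (intro finsum_Un_disjoint) auto
  moreover have "finsum G f (Pair x ` J) = finsum G (\<lambda>j. f (x, j)) J"
    using insert by (intro finsum_reindex) (auto simp: inj_on_def)
  ultimately show ?case using insert by (simp add: Pi_def)
qed simp

end

lemma (in abelian_group) diff_add: "x \<in> carrier G \<Longrightarrow> y \<in> carrier G \<Longrightarrow> (x \<ominus> y) \<oplus> y = x"
  by (simp add: minus_eq a_assoc l_neg)

lemma (in abelian_group) minus_zero_iff:
  "x \<in> carrier G \<Longrightarrow> y \<in> carrier G \<Longrightarrow> x \<ominus> y = \<zero> \<longleftrightarrow> x = y"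
  by (metis diff_add l_zero minus_eq r_neg)

section \<open>C*-seminorms and complete C*-norms\<close>

locale seminormed_star_alg = star_alg A for A :: "('a, 'm) star_algebra_scheme" (structure) +
  fixes p :: "'a \<Rightarrow> real"
  assumes p_nonneg [simp]: "x \<in> carrier A \<Longrightarrow> 0 \<le> p x"
    and p_triangle: "x \<in> carrier A \<Longrightarrow> y \<in> carrier A \<Longrightarrow> p (x \<oplus> y) \<le> p x + p y"
    and p_scl [simp]: "x \<in> carrier A \<Longrightarrow> p (scl A c x) = cmod c * p x"
    and p_mult: "x \<in> carrier A \<Longrightarrow> y \<in> carrier A \<Longrightarrow> p (x \<otimes> y) \<le> p x * p y"
    and p_cstar: "x \<in> carrier A \<Longrightarrow> p (str A x \<otimes> x) = (p x)\<^sup>2"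

lemma seminormed_star_alg_iff:
  "seminormed_star_alg A p \<longleftrightarrow> is_star_algebra A \<and> cstar_seminorm A p"
  unfolding seminormed_star_alg_def seminormed_star_alg_axioms_def star_alg_iff cstar_seminorm_def
  by auto

context seminormed_star_alg
begin

lemma p_zero [simp]: "p \<zero> = 0"
  using p_scl[of \<zero> 0] by simp

lemma p_minus [simp]: "x \<in> carrier A \<Longrightarrow> p (\<ominus> x) = p x"
  using p_scl[of x "- 1"] by simp

lemma p_diff_triangle: "x \<in> carrier A \<Longrightarrow> y \<in> carrier A \<Longrightarrow> p (x \<ominus> y) \<le> p x + p y"
  using p_triangle[of x "\<ominus> y"] by (simp add: minus_eq)

lemma p_diff_commute: "x \<in> carrier A \<Longrightarrow> y \<in> carrier A \<Longrightarrow> p (x \<ominus> y) = p (y \<ominus> x)"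
  using p_minus[of "x \<ominus> y"] by (simp add: minus_eq minus_add a_comm)

lemma p_diff_trans:
  assumes "x \<in> carrier A" "y \<in> carrier A" "z \<in> carrier A"
  shows "p (x \<ominus> z) \<le> p (x \<ominus> y) + p (y \<ominus> z)"
proof -
  have "x \<ominus> z = (x \<ominus> y) \<oplus> (y \<ominus> z)"
    using assms by (simp add: minus_eq a_assoc r_neg1)
  then show ?thesis using p_triangle[of "x \<ominus> y" "y \<ominus> z"] assms by simp
qed

lemma p_diff_abs:
  assumes "x \<in> carrier A" "y \<in> carrier A"
  shows "\<bar>p x - p y\<bar> \<le> p (x \<ominus> y)"
  using p_diff_trans[of x y \<zero>] p_diff_trans[of y x \<zero>] p_diff_commute[of x y] assms
  by (simp add: minus_eq abs_le_iff)

text \<open>The C*-identity and submultiplicativity give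
  \<open>(p y)^2 \<le> p (str A y) * p y\<close>; cancelling \<open>p y\<close> and exchanging
  \<open>y\<close> with its adjoint yields both inequalities.\<close>

lemma p_str [simp]:
  assumes "x \<in> carrier A" shows "p (str A x) = p x"
proof -
  have *: "p y \<le> p (str A y)" if "y \<in> carrier A" for y
  proof (cases "p y = 0")
    case False
    have "p y * p y \<le> p (str A y) * p y"
      using p_mult[of "str A y" y] p_cstar[of y] that by (simp add: power2_eq_square)
    then show ?thesis using False p_nonneg[OF that] by (simp add: mult_le_cancel_right)
  qed (use that in simp)
  from *[of x] *[of "str A x"] assms show ?thesis by simp
qed

text \<open>\<open>p \<one>\<close> equals its own square, hence is \<open>0\<close> or
  \<open>1\<close>; the value \<open>0\<close> occurs for the zero seminorm.\<close>

lemma p_one_le: "p \<one> \<le> 1"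
proof -
  have "p \<one> = p \<one> * p \<one>" using p_cstar[of \<one>] by (simp add: power2_eq_square)
  then show ?thesis by (metis mult_cancel_left1 order_refl zero_le_one)
qed

lemma p_mult_diff:
  assumes "x \<in> carrier A" "y \<in> carrier A" "x' \<in> carrier A" "y' \<in> carrier A"
  shows "p (x \<otimes> y \<ominus> x' \<otimes> y') \<le> p x * p (y \<ominus> y') + p (x \<ominus> x') * p y'"
proof -
  have "x \<otimes> y \<ominus> x' \<otimes> y' = x \<otimes> (y \<ominus> y') \<oplus> (x \<ominus> x') \<otimes> y'"
    using assms by (simp add: minus_eq l_distr r_distr l_minus r_minus a_assoc r_neg1)
  then show ?thesis
    using p_triangle[of "x \<otimes> (y \<ominus> y')" "(x \<ominus> x') \<otimes> y'"] p_mult[of x "y \<ominus> y'"] p_mult[of "x \<ominus> x'" y'] assms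
    by simp
qed

lemma p_finsum_le:
  "finite I \<Longrightarrow> f \<in> I \<rightarrow> carrier A \<Longrightarrow> p (finsum A f I) \<le> (\<Sum>i\<in>I. p (f i))"
proof (induction I rule: finite_induct)
  case (insert x F)
  then show ?case using p_triangle[of "f x" "finsum A f F"] by (simp add: Pi_def finsum_closed)
qed simp

lemma p_projection_le:
  assumes "e \<in> carrier A" "str A e = e" "e \<otimes> e = e"
  shows "p e \<le> 1"
proof -
  have "p e = p e * p e" using p_cstar[of e] assms by (simp add: power2_eq_square)
  then show ?thesis by (metis mult_cancel_left1 order_refl zero_le_one)
qed

end

locale cstar_alg = star_alg A for A :: "('a, 'm) cstar_scheme" (structure) +
  assumes seminorm: "cstar_seminorm A (nrm A)"
    and nrm_zeroD: "x \<in> carrier A \<Longrightarrow> nrm A x = 0 \<Longrightarrow> x = \<zero>"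
    and complete: "X \<in> cauchy_seqs A (nrm A) \<Longrightarrow>
          \<exists>a\<in>carrier A. (\<lambda>n. nrm A (X n \<ominus> a)) \<longlonglongrightarrow> 0"

lemma cstar_alg_iff: "cstar_alg A \<longleftrightarrow> cstar_algebra A"
  unfolding cstar_alg_def cstar_alg_axioms_def star_alg_iff cstar_algebra_def by auto

sublocale cstar_alg \<subseteq> seminormed_star_alg A "nrm A"
  using seminorm star_alg_axioms by (simp add: seminormed_star_alg_iff star_alg_iff)

lemma tendsto_zero_le:
  fixes f g :: "nat \<Rightarrow> real"
  assumes "g \<longlonglongrightarrow> 0" "\<And>n. 0 \<le> f n" "\<And>n. f n \<le> g n"
  shows "f \<longlonglongrightarrow> 0"
  by (rule tendsto_sandwich[OF _ _ tendsto_const assms(1)]) (use assms in auto)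

context cstar_alg
begin

lemma nrm_eq_0_iff: "x \<in> carrier A \<Longrightarrow> nrm A x = 0 \<longleftrightarrow> x = \<zero>"
  using nrm_zeroD p_zero by blast

lemma eq_iff_nrm_diff: "x \<in> carrier A \<Longrightarrow> y \<in> carrier A \<Longrightarrow> x = y \<longleftrightarrow> nrm A (x \<ominus> y) = 0"
  by (simp add: nrm_eq_0_iff minus_zero_iff)

lemma limit_unique:
  assumes "(\<lambda>n. nrm A (x n \<ominus> a)) \<longlonglongrightarrow> 0" "(\<lambda>n. nrm A (x n \<ominus> b)) \<longlonglongrightarrow> 0"
    and [simp]: "\<And>n. x n \<in> carrier A" "a \<in> carrier A" "b \<in> carrier A"
  shows "a = b"
proof -
  have "(\<lambda>n. nrm A (x n \<ominus> a) + nrm A (x n \<ominus> b)) \<longlonglongrightarrow> 0"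
    using tendsto_add[OF assms(1,2)] by simp
  then have "(\<lambda>n. nrm A (a \<ominus> b)) \<longlonglongrightarrow> 0"
  proof (rule tendsto_zero_le)
    show "nrm A (a \<ominus> b) \<le> nrm A (x n \<ominus> a) + nrm A (x n \<ominus> b)" for n
      using p_diff_trans[of a "x n" b] p_diff_commute[of a "x n"] by simp
  qed simp
  then show ?thesis using eq_iff_nrm_diff by (simp add: LIMSEQ_const_iff)
qed

end

section \<open>Unital homomorphisms of star algebras\<close>

locale star_hom_pair =
  dom: star_alg A + cod: star_alg B
  for A :: "('a, 'm) star_algebra_scheme" and B :: "('b, 'k) star_algebra_scheme" +
  fixes f :: "'a \<Rightarrow> 'b"
  assumes star_hom: "star_hom A B f"
begin

lemma closed [simp, intro]: "x \<in> carrier A \<Longrightarrow> f x \<in> carrier B"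
  using star_hom by (auto simp: star_hom_def)

lemma hom_one [simp]: "f \<one>\<^bsub>A\<^esub> = \<one>\<^bsub>B\<^esub>"
  using star_hom by (auto simp: star_hom_def)

lemma hom_add [simp]: "x \<in> carrier A \<Longrightarrow> y \<in> carrier A \<Longrightarrow> f (x \<oplus>\<^bsub>A\<^esub> y) = f x \<oplus>\<^bsub>B\<^esub> f y"
  using star_hom by (auto simp: star_hom_def)

lemma hom_mult [simp]: "x \<in> carrier A \<Longrightarrow> y \<in> carrier A \<Longrightarrow> f (x \<otimes>\<^bsub>A\<^esub> y) = f x \<otimes>\<^bsub>B\<^esub> f y"
  using star_hom by (auto simp: star_hom_def)

lemma hom_scl [simp]: "x \<in> carrier A \<Longrightarrow> f (scl A c x) = scl B c (f x)"
  using star_hom by (auto simp: star_hom_def)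

lemma hom_str [simp]: "x \<in> carrier A \<Longrightarrow> f (str A x) = str B (f x)"
  using star_hom by (auto simp: star_hom_def)

lemma hom_zero [simp]: "f \<zero>\<^bsub>A\<^esub> = \<zero>\<^bsub>B\<^esub>"
  using hom_scl[of "\<zero>\<^bsub>A\<^esub>" 0] by simp

lemma hom_minus [simp]: "x \<in> carrier A \<Longrightarrow> f (\<ominus>\<^bsub>A\<^esub> x) = \<ominus>\<^bsub>B\<^esub> f x"
  using hom_scl[of x "- 1"] by simp

lemma hom_diff [simp]: "x \<in> carrier A \<Longrightarrow> y \<in> carrier A \<Longrightarrow> f (x \<ominus>\<^bsub>A\<^esub> y) = f x \<ominus>\<^bsub>B\<^esub> f y"
  by (simp add: dom.minus_eq cod.minus_eq)

lemma hom_finsum: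
  "finite I \<Longrightarrow> g \<in> I \<rightarrow> carrier A \<Longrightarrow> f (finsum A g I) = finsum B (\<lambda>i. f (g i)) I"
  by (induction I rule: finite_induct) (simp_all add: Pi_def dom.finsum_closed)

end

lemma star_homI:
  assumes "\<And>x. x \<in> carrier A \<Longrightarrow> f x \<in> carrier B" "f \<one>\<^bsub>A\<^esub> = \<one>\<^bsub>B\<^esub>"
    and "\<And>x y. x \<in> carrier A \<Longrightarrow> y \<in> carrier A \<Longrightarrow> f (x \<oplus>\<^bsub>A\<^esub> y) = f x \<oplus>\<^bsub>B\<^esub> f y"
    and "\<And>x y. x \<in> carrier A \<Longrightarrow> y \<in> carrier A \<Longrightarrow> f (x \<otimes>\<^bsub>A\<^esub> y) = f x \<otimes>\<^bsub>B\<^esub> f y"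
    and "\<And>c x. x \<in> carrier A \<Longrightarrow> f (scl A c x) = scl B c (f x)"
    and "\<And>x. x \<in> carrier A \<Longrightarrow> f (str A x) = str B (f x)"
  shows "star_hom A B f"
  using assms unfolding star_hom_def by auto

lemma star_hom_comp:
  "star_hom A B f \<Longrightarrow> star_hom B C g \<Longrightarrow> star_hom A C (\<lambda>x. g (f x))"
  unfolding star_hom_def by (simp add: image_subset_iff)

lemma star_hom_pairI:
  "star_alg A \<Longrightarrow> star_alg B \<Longrightarrow> star_hom A B f \<Longrightarrow> star_hom_pair A B f"
  by (simp add: star_hom_pair_def star_hom_pair_axioms_def)

lemma cstar_seminorm_pullback:
  assumes "star_hom_pair A B f" "cstar_seminorm B p"
  shows "cstar_seminorm A (\<lambda>x. p (f x))"
proof -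
  interpret star_hom_pair A B f by fact
  show ?thesis using assms(2) by (simp add: cstar_seminorm_def)
qed

section \<open>The *-algebra of a monoid with involution\<close>

text \<open>Linear extension of \<open>\<Phi>\<close> to formal sums, evaluated at \<open>f\<close>.
  Letting \<open>\<Phi>\<close> range over all functions makes these evaluations separate points,
  and convolution turns into an iterated evaluation, so algebra identities are checked by rewriting
  under \<open>lin\<close>.\<close>

definition lin :: "('m \<Rightarrow> complex) \<Rightarrow> ('m \<Rightarrow> complex) \<Rightarrow> complex" where
  "lin f \<Phi> = (\<Sum>x\<in>supp f. f x * \<Phi> x)"

lemma lin_superset: "finite S \<Longrightarrow> supp f \<subseteq> S \<Longrightarrow> lin f \<Phi> = (\<Sum>x\<in>S. f x * \<Phi> x)"
  unfolding lin_def by (rule sum.mono_neutral_left) (auto simp: supp_def)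

lemma lin_add:
  assumes "finite (supp f)" "finite (supp g)"
  shows "lin (\<lambda>z. f z + g z) \<Phi> = lin f \<Phi> + lin g \<Phi>"
proof -
  have "supp (\<lambda>z. f z + g z) \<subseteq> supp f \<union> supp g" by (auto simp: supp_def)
  then show ?thesis
    using assms by (simp add: lin_superset[of "supp f \<union> supp g"] sum.distrib distrib_right)
qed

lemma lin_scl: "lin (\<lambda>z. c * f z) \<Phi> = c * lin f \<Phi>"
proof (cases "c = 0")
  case False
  then have "supp (\<lambda>z. c * f z) = supp f" by (auto simp: supp_def)
  then show ?thesis by (simp add: lin_def sum_distrib_left mult.assoc)
qed (simp add: lin_def supp_def)

lemma lin_zero [simp]: "lin (\<lambda>z. 0) \<Phi> = 0"
  by (simp add: lin_def supp_def)

lemma supp_delta [simp]: "supp (delta m) = {m}"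
  by (auto simp: supp_def delta_def)

lemma lin_delta [simp]: "lin (delta m) \<Phi> = \<Phi> m"
  by (simp add: lin_def) (simp add: delta_def)

lemma lin_fun_add: "lin f (\<lambda>x. \<Phi> x + \<Psi> x) = lin f \<Phi> + lin f \<Psi>"
  by (simp add: lin_def distrib_left sum.distrib)

lemma lin_fun_mult: "lin f (\<lambda>x. c * \<Phi> x) = c * lin f \<Phi>"
  by (simp add: lin_def sum_distrib_left mult.left_commute)

lemma lin_fun_zero [simp]: "lin f (\<lambda>x. 0) = 0"
  by (simp add: lin_def)

lemma lin_swap: "lin f (\<lambda>x. lin g (F x)) = lin g (\<lambda>y. lin f (\<lambda>x. F x y))"
  unfolding lin_def sum_distrib_left by (subst sum.swap) (simp add: mult.left_commute)

lemma lin_apply: "finite (supp f) \<Longrightarrow> lin f (\<lambda>x. if x = z then 1 else 0) = f z"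
  by (auto simp: lin_def supp_def if_distrib cong: if_cong)

text \<open>Indicator functions as \<open>\<Phi>\<close> recover the coefficients.\<close>

lemma lin_ext:
  assumes "finite (supp f)" "finite (supp g)" "\<And>\<Phi>. lin f \<Phi> = lin g \<Phi>"
  shows "f = g"
  using assms lin_apply by (metis ext)

lemma lin_cong: "(\<And>x. x \<in> supp f \<Longrightarrow> \<Phi> x = \<Psi> x) \<Longrightarrow> lin f \<Phi> = lin f \<Psi>"
  by (simp add: lin_def)

text \<open>Instantiated three times: words with letterwise adjoint and reversal, pairs of algebra
  elements for the tensor product, and a group with inversion.\<close>

locale involutive_monoid = M: monoid M for M :: "('m, 'k) monoid_scheme" +
  fixes st :: "'m \<Rightarrow> 'm"
  assumes st_closed [simp]: "x \<in> carrier M \<Longrightarrow> st x \<in> carrier M"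
    and st_st [simp]: "x \<in> carrier M \<Longrightarrow> st (st x) = x"
    and st_mult [simp]: "x \<in> carrier M \<Longrightarrow> y \<in> carrier M \<Longrightarrow> st (x \<otimes>\<^bsub>M\<^esub> y) = st y \<otimes>\<^bsub>M\<^esub> st x"
begin

abbreviation "MA \<equiv> monoid_algebra M st"

lemma carrier_MA: "carrier MA = {f. finite (supp f) \<and> supp f \<subseteq> carrier M}"
  and mult_MA: "f \<otimes>\<^bsub>MA\<^esub> g = (\<lambda>z. \<Sum>x\<in>supp f. \<Sum>y\<in>supp g. if x \<otimes>\<^bsub>M\<^esub> y = z then f x * g y else 0)"
  and one_MA: "\<one>\<^bsub>MA\<^esub> = delta \<one>\<^bsub>M\<^esub>"
  and zero_MA: "\<zero>\<^bsub>MA\<^esub> = (\<lambda>z. 0)"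
  and add_MA: "f \<oplus>\<^bsub>MA\<^esub> g = (\<lambda>z. f z + g z)"
  and scl_MA: "scl MA c f = (\<lambda>z. c * f z)"
  and str_MA: "str MA f = (\<lambda>z. \<Sum>x\<in>supp f. if st x = z then cnj (f x) else 0)"
  by (simp_all add: monoid_algebra_def)

lemma finite_supp: "f \<in> carrier MA \<Longrightarrow> finite (supp f)"
  and supp_carrier: "f \<in> carrier MA \<Longrightarrow> x \<in> supp f \<Longrightarrow> x \<in> carrier M"
  by (auto simp: carrier_MA)

lemma lin_eqI: "f \<in> carrier MA \<Longrightarrow> g \<in> carrier MA \<Longrightarrow> (\<And>\<Phi>. lin f \<Phi> = lin g \<Phi>) \<Longrightarrow> f = g"
  by (rule lin_ext) (auto simp: finite_supp)

lemma lin_cong_carrier: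
  "f \<in> carrier MA \<Longrightarrow> (\<And>x. x \<in> carrier M \<Longrightarrow> \<Phi> x = \<Psi> x) \<Longrightarrow> lin f \<Phi> = lin f \<Psi>"
  by (rule lin_cong) (simp add: supp_carrier)

lemma delta_closed [simp, intro]: "m \<in> carrier M \<Longrightarrow> delta m \<in> carrier MA"
  by (simp add: carrier_MA)

lemma MA_mult_closed:
  assumes "f \<in> carrier MA" "g \<in> carrier MA"
  shows "f \<otimes>\<^bsub>MA\<^esub> g \<in> carrier MA"
proof -
  have *: "supp (f \<otimes>\<^bsub>MA\<^esub> g) \<subseteq> (\<lambda>(x, y). x \<otimes>\<^bsub>M\<^esub> y) ` (supp f \<times> supp g)"
  proof
    fix z assume "z \<in> supp (f \<otimes>\<^bsub>MA\<^esub> g)"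
    then have "(\<Sum>x\<in>supp f. \<Sum>y\<in>supp g. if x \<otimes>\<^bsub>M\<^esub> y = z then f x * g y else 0) \<noteq> 0"
      by (subst (asm) supp_def) (simp add: mult_MA)
    then obtain x where "x \<in> supp f" "(\<Sum>y\<in>supp g. if x \<otimes>\<^bsub>M\<^esub> y = z then f x * g y else 0) \<noteq> 0"
      by (rule sum.not_neutral_contains_not_neutral)
    moreover from this(2) obtain y where "y \<in> supp g" "x \<otimes>\<^bsub>M\<^esub> y = z"
      by (rule sum.not_neutral_contains_not_neutral) (auto split: if_splits)
    ultimately show "z \<in> (\<lambda>(x, y). x \<otimes>\<^bsub>M\<^esub> y) ` (supp f \<times> supp g)" by force
  qed
  moreover have "finite ((\<lambda>(x, y). x \<otimes>\<^bsub>M\<^esub> y) ` (supp f \<times> supp g))"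
    "(\<lambda>(x, y). x \<otimes>\<^bsub>M\<^esub> y) ` (supp f \<times> supp g) \<subseteq> carrier M"
    using assms by (auto simp: finite_supp supp_carrier)
  ultimately show ?thesis
    unfolding carrier_MA mem_Collect_eq by (blast intro: finite_subset)
qed

lemma MA_str_closed:
  assumes "f \<in> carrier MA"
  shows "str MA f \<in> carrier MA"
proof -
  have *: "supp (str MA f) \<subseteq> st ` supp f"
  proof
    fix z assume "z \<in> supp (str MA f)"
    then have "(\<Sum>x\<in>supp f. if st x = z then cnj (f x) else 0) \<noteq> 0"
      by (subst (asm) supp_def) (simp add: str_MA)
    then obtain x where "x \<in> supp f" "st x = z"
      by (rule sum.not_neutral_contains_not_neutral) (auto split: if_splits)
    then show "z \<in> st ` supp f" by blast
  qed
  moreover have "finite (st ` supp f)" "st ` supp f \<subseteq> carrier M"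
    using assms by (auto simp: finite_supp supp_carrier)
  ultimately show ?thesis
    unfolding carrier_MA mem_Collect_eq by (blast intro: finite_subset)
qed

lemma MA_add_closed: "f \<in> carrier MA \<Longrightarrow> g \<in> carrier MA \<Longrightarrow> f \<oplus>\<^bsub>MA\<^esub> g \<in> carrier MA"
proof -
  have "supp (\<lambda>z. f z + g z) \<subseteq> supp f \<union> supp g" by (auto simp: supp_def)
  then show "f \<in> carrier MA \<Longrightarrow> g \<in> carrier MA \<Longrightarrow> ?thesis"
    by (auto simp: carrier_MA add_MA intro: finite_subset)
qed

lemma MA_scl_closed: "f \<in> carrier MA \<Longrightarrow> scl MA c f \<in> carrier MA"
proof -
  have "supp (\<lambda>z. c * f z) \<subseteq> supp f" by (auto simp: supp_def)
  then show "f \<in> carrier MA \<Longrightarrow> ?thesis"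
    by (auto simp: carrier_MA scl_MA intro: finite_subset)
qed

lemma lin_MA_add [simp]:
  "f \<in> carrier MA \<Longrightarrow> g \<in> carrier MA \<Longrightarrow> lin (f \<oplus>\<^bsub>MA\<^esub> g) \<Phi> = lin f \<Phi> + lin g \<Phi>"
  by (simp add: add_MA lin_add finite_supp)

lemma lin_MA_scl [simp]: "lin (scl MA c f) \<Phi> = c * lin f \<Phi>"
  by (simp add: scl_MA lin_scl)

lemma lin_MA_mult:
  assumes "f \<in> carrier MA" "g \<in> carrier MA"
  shows "lin (f \<otimes>\<^bsub>MA\<^esub> g) \<Phi> = lin f (\<lambda>x. lin g (\<lambda>y. \<Phi> (x \<otimes>\<^bsub>M\<^esub> y)))"
proof -
  \<comment> \<open>Joining both sets makes the support inclusion immediate, while \<open>?S\<close>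
    still contains every product of support points, as the collapse of the inner sum
    requires.\<close>
  let ?S = "(\<lambda>(x, y). x \<otimes>\<^bsub>M\<^esub> y) ` (supp f \<times> supp g) \<union> supp (f \<otimes>\<^bsub>MA\<^esub> g)"
  have fin: "finite ?S" using assms MA_mult_closed[OF assms] by (simp add: finite_supp)
  have "lin (f \<otimes>\<^bsub>MA\<^esub> g) \<Phi> =
    (\<Sum>z\<in>?S. (\<Sum>x\<in>supp f. \<Sum>y\<in>supp g. if x \<otimes>\<^bsub>M\<^esub> y = z then f x * g y else 0) * \<Phi> z)"
    using fin by (subst lin_superset[of ?S]) (auto simp: mult_MA)
  also have "\<dots> = (\<Sum>x\<in>supp f. \<Sum>y\<in>supp g. \<Sum>z\<in>?S. if x \<otimes>\<^bsub>M\<^esub> y = z then f x * g y * \<Phi> z else 0)"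
    unfolding sum_distrib_right
    by (subst sum.swap, rule sum.cong[OF refl], subst sum.swap)
      (intro sum.cong refl, simp add: if_distrib[of "\<lambda>u. u * _"] cong: if_cong)
  also have "\<dots> = (\<Sum>x\<in>supp f. \<Sum>y\<in>supp g. f x * g y * \<Phi> (x \<otimes>\<^bsub>M\<^esub> y))"
    using fin by (intro sum.cong refl) (force simp: sum.delta')
  finally show ?thesis by (simp add: lin_def sum_distrib_left mult.assoc)
qed

lemma lin_MA_str:
  assumes "f \<in> carrier MA"
  shows "lin (str MA f) \<Phi> = cnj (lin f (\<lambda>x. cnj (\<Phi> (st x))))"
proof -
  let ?S = "st ` supp f \<union> supp (str MA f)"
  have fin: "finite ?S" using assms MA_str_closed[OF assms] by (simp add: finite_supp)
  have "lin (str MA f) \<Phi> = (\<Sum>z\<in>?S. (\<Sum>x\<in>supp f. if st x = z then cnj (f x) else 0) * \<Phi> z)"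
    using fin by (subst lin_superset[of ?S]) (auto simp: str_MA)
  also have "\<dots> = (\<Sum>x\<in>supp f. \<Sum>z\<in>?S. if st x = z then cnj (f x) * \<Phi> z else 0)"
    unfolding sum_distrib_right
    by (subst sum.swap) (intro sum.cong refl, simp add: if_distrib[of "\<lambda>u. u * _"] cong: if_cong)
  also have "\<dots> = (\<Sum>x\<in>supp f. cnj (f x) * \<Phi> (st x))"
    using fin by (intro sum.cong refl) (force simp: sum.delta')
  finally show ?thesis by (simp add: lin_def)
qed

lemma MA_zero_closed: "\<zero>\<^bsub>MA\<^esub> \<in> carrier MA"
  by (simp add: zero_MA carrier_MA supp_def)

lemma MA_one_closed: "\<one>\<^bsub>MA\<^esub> \<in> carrier MA"
  by (simp add: one_MA)

lemma MA_is_ring: "ring MA"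
proof (rule ringI)
  note [simp] = MA_mult_closed MA_add_closed MA_zero_closed MA_one_closed MA_scl_closed
  show "abelian_group MA"
  proof (rule abelian_groupI)
    fix x assume "x \<in> carrier MA"
    then show "\<exists>y\<in>carrier MA. y \<oplus>\<^bsub>MA\<^esub> x = \<zero>\<^bsub>MA\<^esub>"
      by (intro bexI[OF _ MA_scl_closed[of x "- 1"]]) (auto simp: add_MA zero_MA scl_MA)
  qed (simp_all, simp_all add: add_MA zero_MA add_ac)
  show "monoid MA"
  proof (rule monoidI)
    fix x y z assume [simp]: "x \<in> carrier MA" "y \<in> carrier MA" "z \<in> carrier MA"
    show "x \<otimes>\<^bsub>MA\<^esub> y \<otimes>\<^bsub>MA\<^esub> z = x \<otimes>\<^bsub>MA\<^esub> (y \<otimes>\<^bsub>MA\<^esub> z)"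
      by (rule lin_eqI) (auto simp: lin_MA_mult M.m_assoc intro!: lin_cong_carrier)
  next
    fix x assume [simp]: "x \<in> carrier MA"
    show "\<one>\<^bsub>MA\<^esub> \<otimes>\<^bsub>MA\<^esub> x = x"
      by (rule lin_eqI) (auto simp: lin_MA_mult one_MA intro!: lin_cong_carrier)
    show "x \<otimes>\<^bsub>MA\<^esub> \<one>\<^bsub>MA\<^esub> = x"
      by (rule lin_eqI) (auto simp: lin_MA_mult one_MA intro!: lin_cong_carrier)
  qed simp_all
  fix x y z assume [simp]: "x \<in> carrier MA" "y \<in> carrier MA" "z \<in> carrier MA"
  show "(x \<oplus>\<^bsub>MA\<^esub> y) \<otimes>\<^bsub>MA\<^esub> z = x \<otimes>\<^bsub>MA\<^esub> z \<oplus>\<^bsub>MA\<^esub> y \<otimes>\<^bsub>MA\<^esub> z"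
    by (rule lin_eqI) (simp_all add: lin_MA_mult)
  show "z \<otimes>\<^bsub>MA\<^esub> (x \<oplus>\<^bsub>MA\<^esub> y) = z \<otimes>\<^bsub>MA\<^esub> x \<oplus>\<^bsub>MA\<^esub> z \<otimes>\<^bsub>MA\<^esub> y"
    by (rule lin_eqI) (simp_all add: lin_MA_mult lin_fun_add)
qed

sublocale MA: star_alg "monoid_algebra M st"
proof (intro star_alg.intro star_alg_axioms.intro MA_is_ring)
  note [simp] = MA_mult_closed MA_add_closed MA_scl_closed MA_str_closed
  fix x y c d assume [simp]: "x \<in> carrier MA" "y \<in> carrier MA"
  show "scl MA c x \<in> carrier MA" by simp
  show "scl MA 1 x = x" "scl MA c (scl MA d x) = scl MA (c * d) x"
    "scl MA (c + d) x = scl MA c x \<oplus>\<^bsub>MA\<^esub> scl MA d x"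
    "scl MA c (x \<oplus>\<^bsub>MA\<^esub> y) = scl MA c x \<oplus>\<^bsub>MA\<^esub> scl MA c y"
    by (simp_all add: scl_MA add_MA algebra_simps)
  show "scl MA c (x \<otimes>\<^bsub>MA\<^esub> y) = scl MA c x \<otimes>\<^bsub>MA\<^esub> y"
    "scl MA c (x \<otimes>\<^bsub>MA\<^esub> y) = x \<otimes>\<^bsub>MA\<^esub> scl MA c y"
    by (rule lin_eqI; simp add: lin_MA_mult lin_fun_mult)+
  show "str MA x \<in> carrier MA" by simp
  show "str MA (str MA x) = x" "str MA (scl MA c x) = scl MA (cnj c) (str MA x)"
    "str MA (x \<oplus>\<^bsub>MA\<^esub> y) = str MA x \<oplus>\<^bsub>MA\<^esub> str MA y"
    by (rule lin_eqI; simp add: lin_MA_str cong: lin_cong_carrier)+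
  show "str MA (x \<otimes>\<^bsub>MA\<^esub> y) = str MA y \<otimes>\<^bsub>MA\<^esub> str MA x"
  proof (rule lin_eqI)
    fix \<Phi>
    have "lin (str MA (x \<otimes>\<^bsub>MA\<^esub> y)) \<Phi> = cnj (lin x (\<lambda>a. lin y (\<lambda>b. cnj (\<Phi> (st b \<otimes>\<^bsub>M\<^esub> st a)))))"
      by (simp add: lin_MA_str lin_MA_mult cong: lin_cong_carrier)
    also have "\<dots> = lin (str MA y \<otimes>\<^bsub>MA\<^esub> str MA x) \<Phi>"
      by (subst lin_swap) (simp add: lin_MA_str lin_MA_mult)
    finally show "lin (str MA (x \<otimes>\<^bsub>MA\<^esub> y)) \<Phi> = lin (str MA y \<otimes>\<^bsub>MA\<^esub> str MA x) \<Phi>" .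
  qed simp_all
qed

lemma delta_mult [simp]:
  "a \<in> carrier M \<Longrightarrow> b \<in> carrier M \<Longrightarrow> delta a \<otimes>\<^bsub>MA\<^esub> delta b = delta (a \<otimes>\<^bsub>M\<^esub> b)"
  by (rule lin_eqI) (simp_all add: lin_MA_mult)

lemma str_delta [simp]: "a \<in> carrier M \<Longrightarrow> str MA (delta a) = delta (st a)"
  by (rule lin_eqI) (simp_all add: lin_MA_str)

lemma lin_MA_minus [simp]: "f \<in> carrier MA \<Longrightarrow> lin (\<ominus>\<^bsub>MA\<^esub> f) \<Phi> = - lin f \<Phi>"
  using lin_MA_scl[of "- 1" f \<Phi>] by simp

lemma lin_MA_diff [simp]:
  "f \<in> carrier MA \<Longrightarrow> g \<in> carrier MA \<Longrightarrow> lin (f \<ominus>\<^bsub>MA\<^esub> g) \<Phi> = lin f \<Phi> - lin g \<Phi>"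
  by (simp add: MA.minus_eq)

text \<open>A finitely supported function is built up by restricting it to larger and larger parts
  of its support; each step adds one multiple of a basis element.\<close>

lemma MA_induct [consumes 1, case_names zero step]:
  assumes "f \<in> carrier MA" "P \<zero>\<^bsub>MA\<^esub>"
    and step: "\<And>f c m. f \<in> carrier MA \<Longrightarrow> m \<in> carrier M \<Longrightarrow> P f \<Longrightarrow> P (f \<oplus>\<^bsub>MA\<^esub> scl MA c (delta m))"
  shows "P f"
proof -
  let ?r = "\<lambda>S z. if z \<in> S then f z else 0"
  have supp_r: "supp (?r S) = supp f \<inter> S" for S by (auto simp: supp_def)
  have "S \<subseteq> supp f \<Longrightarrow> P (?r S)" if "finite S" for S
    using that
  proof (induction S rule: finite_induct)
    case empty
    then show ?case using assms(2) by (simp add: zero_MA)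
  next
    case (insert x S)
    have "?r (insert x S) = ?r S \<oplus>\<^bsub>MA\<^esub> scl MA (f x) (delta x)"
      using insert.hyps by (auto simp: add_MA scl_MA delta_def)
    moreover have "?r S \<in> carrier MA" "x \<in> carrier M"
      using insert assms(1) by (auto simp: carrier_MA supp_r)
    ultimately show ?case using insert by (simp add: step)
  qed
  from this[of "supp f"] have "P (?r (supp f))" using assms(1) by (simp add: finite_supp)
  moreover have "?r (supp f) = f" by (auto simp: supp_def)
  ultimately show ?thesis by simp
qed

definition extend :: "('a, 'n) star_algebra_scheme \<Rightarrow> ('m \<Rightarrow> 'a) \<Rightarrow> ('m \<Rightarrow> complex) \<Rightarrow> 'a" where
  "extend B h f = finsum B (\<lambda>x. scl B (f x) (h x)) (supp f)"

context
  fixes B :: "('a, 'n) star_algebra_scheme" and h :: "'m \<Rightarrow> 'a"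
  assumes B: "star_alg B"
    and h_closed [simp]: "\<And>x. x \<in> carrier M \<Longrightarrow> h x \<in> carrier B"
begin

interpretation B: star_alg B by (rule B)

lemma extend_superset:
  assumes "finite S" "supp f \<subseteq> S" "S \<subseteq> carrier M"
  shows "extend B h f = finsum B (\<lambda>x. scl B (f x) (h x)) S"
  unfolding extend_def using assms
  by (intro B.finsum_mono_neutral[symmetric]) (auto simp: supp_def subset_iff)

lemma extend_closed [simp]: "f \<in> carrier MA \<Longrightarrow> extend B h f \<in> carrier B"
  unfolding extend_def by (intro B.finsum_closed) (auto simp: supp_carrier)

lemma extend_add [simp]:
  assumes "f \<in> carrier MA" "g \<in> carrier MA"
  shows "extend B h (f \<oplus>\<^bsub>MA\<^esub> g) = extend B h f \<oplus>\<^bsub>B\<^esub> extend B h g"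
proof -
  let ?S = "supp f \<union> supp g"
  have S: "finite ?S" "?S \<subseteq> carrier M" "supp (f \<oplus>\<^bsub>MA\<^esub> g) \<subseteq> ?S"
    using assms by (auto simp: carrier_MA add_MA supp_def)
  have "extend B h (f \<oplus>\<^bsub>MA\<^esub> g) = finsum B (\<lambda>x. scl B (f x) (h x) \<oplus>\<^bsub>B\<^esub> scl B (g x) (h x)) ?S"
    unfolding extend_superset[OF S(1,3,2)] using S
    by (intro B.finsum_cong') (auto simp: add_MA B.scl_add_left subset_iff)
  also have "\<dots> = extend B h f \<oplus>\<^bsub>B\<^esub> extend B h g"
    using S by (subst (1 2) extend_superset[of ?S]) (auto intro!: B.finsum_addf)
  finally show ?thesis .
qed

lemma extend_scl [simp]:
  assumes "f \<in> carrier MA"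
  shows "extend B h (scl MA c f) = scl B c (extend B h f)"
proof -
  have S: "finite (supp f)" "supp f \<subseteq> carrier M" "supp (scl MA c f) \<subseteq> supp f"
    using assms by (auto simp: carrier_MA scl_MA supp_def)
  show ?thesis
    unfolding extend_superset[OF S(1,3,2)] extend_superset[OF S(1) subset_refl S(2)] using S
    by (subst B.finsum_scl) (auto simp: scl_MA intro!: B.finsum_cong')
qed

lemma extend_delta [simp]: "m \<in> carrier M \<Longrightarrow> extend B h (delta m) = h m"
  by (simp add: extend_def Pi_def) (simp add: delta_def)

lemma extend_zero [simp]: "extend B h \<zero>\<^bsub>MA\<^esub> = \<zero>\<^bsub>B\<^esub>"
  by (simp add: extend_def zero_MA supp_def)

text \<open>Both sides of multiplicativity are bilinear, so two nested inductions over formal sums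
  reduce it to \<open>h_mult\<close> on basis elements; the adjoint needs one induction.\<close>

lemma star_hom_extend:
  assumes h_one: "h \<one>\<^bsub>M\<^esub> = \<one>\<^bsub>B\<^esub>"
    and h_mult: "\<And>x y. x \<in> carrier M \<Longrightarrow> y \<in> carrier M \<Longrightarrow> h (x \<otimes>\<^bsub>M\<^esub> y) = h x \<otimes>\<^bsub>B\<^esub> h y"
    and h_st: "\<And>x. x \<in> carrier M \<Longrightarrow> h (st x) = str B (h x)"
  shows "star_hom MA B (extend B h)"
proof (rule star_homI)
  show "extend B h (f \<otimes>\<^bsub>MA\<^esub> g) = extend B h f \<otimes>\<^bsub>B\<^esub> extend B h g"
    if g: "g \<in> carrier MA" and f: "f \<in> carrier MA" for f g
    using f
  proof (induction f rule: MA_induct)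
    case (step f c m)
    have "extend B h (delta m \<otimes>\<^bsub>MA\<^esub> g) = h m \<otimes>\<^bsub>B\<^esub> extend B h g"
      using g
    proof (induction g rule: MA_induct)
      case (step f' c' m')
      then show ?case using \<open>m \<in> carrier M\<close>
        by (simp add: MA.r_distr B.r_distr MA.scl_mult_right B.scl_mult_right h_mult)
    qed (use \<open>m \<in> carrier M\<close> in simp)
    then show ?case using step g
      by (simp add: MA.l_distr B.l_distr MA.scl_mult_left B.scl_mult_left)
  qed (use g in simp)
  show "extend B h (str MA f) = str B (extend B h f)" if "f \<in> carrier MA" for f
    using that by (induction f rule: MA_induct) (simp_all add: h_st)
qed (simp_all add: one_MA h_one)

end

end

section \<open>Hausdorff completions\<close>

context seminormed_star_alg
begin

definition close :: "(nat \<Rightarrow> 'a) \<Rightarrow> (nat \<Rightarrow> 'a) \<Rightarrow> bool" where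
  "close x y \<longleftrightarrow> (\<lambda>n. p (x n \<ominus> y n)) \<longlonglongrightarrow> 0"

definition bdd :: "(nat \<Rightarrow> 'a) \<Rightarrow> bool" where
  "bdd x \<longleftrightarrow> (\<exists>K. \<forall>n. p (x n) \<le> K)"

abbreviation seq :: "(nat \<Rightarrow> 'a) \<Rightarrow> bool" where
  "seq x \<equiv> \<forall>n. x n \<in> carrier A"

lemma close_refl [simp]: "seq x \<Longrightarrow> close x x"
  by (simp add: close_def minus_eq r_neg)

lemma close_sym: "seq x \<Longrightarrow> seq y \<Longrightarrow> close x y \<Longrightarrow> close y x"
  by (simp add: close_def p_diff_commute[of "y _" "x _"])

lemma close_trans:
  assumes "seq x" "seq y" "seq z" "close x y" "close y z"
  shows "close x z"
  unfolding close_def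
  by (rule tendsto_zero_le[of "\<lambda>n. p (x n \<ominus> y n) + p (y n \<ominus> z n)"])
    (use assms p_diff_trans tendsto_add[of _ 0 _ _ 0] in \<open>auto simp: close_def\<close>)

lemma close_add:
  assumes "seq x" "seq y" "seq x'" "seq y'" "close x x'" "close y y'"
  shows "close (\<lambda>n. x n \<oplus> y n) (\<lambda>n. x' n \<oplus> y' n)"
  unfolding close_def
proof (rule tendsto_zero_le[of "\<lambda>n. p (x n \<ominus> x' n) + p (y n \<ominus> y' n)"])
  fix n
  have "x n \<oplus> y n \<ominus> (x' n \<oplus> y' n) = (x n \<ominus> x' n) \<oplus> (y n \<ominus> y' n)"
    using assms by (simp add: minus_eq minus_add a_ac)
  then show "p (x n \<oplus> y n \<ominus> (x' n \<oplus> y' n)) \<le> p (x n \<ominus> x' n) + p (y n \<ominus> y' n)"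
    using p_triangle[of "x n \<ominus> x' n" "y n \<ominus> y' n"] assms by simp
qed (use assms tendsto_add[of _ 0 _ _ 0] in \<open>auto simp: close_def\<close>)

text \<open>The telescoped difference \<open>x (y - y') + (x - x') y'\<close> keeps exactly
  \<open>x\<close> and \<open>y'\<close> as whole factors, hence the two boundedness
  hypotheses.\<close>

lemma close_mult:
  assumes "seq x" "seq y" "seq x'" "seq y'" "close x x'" "close y y'" "bdd x" "bdd y'"
  shows "close (\<lambda>n. x n \<otimes> y n) (\<lambda>n. x' n \<otimes> y' n)"
proof -
  obtain K L where K: "\<And>n. p (x n) \<le> K" and L: "\<And>n. p (y' n) \<le> L"
    using assms by (auto simp: bdd_def)
  show ?thesis
    unfolding close_def
  proof (rule tendsto_zero_le[of "\<lambda>n. K * p (y n \<ominus> y' n) + p (x n \<ominus> x' n) * L"])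
    fix n
    show "p (x n \<otimes> y n \<ominus> x' n \<otimes> y' n) \<le> K * p (y n \<ominus> y' n) + p (x n \<ominus> x' n) * L"
      using p_mult_diff[of "x n" "y n" "x' n" "y' n"] assms
        mult_right_mono[OF K[of n], of "p (y n \<ominus> y' n)"] mult_left_mono[OF L[of n], of "p (x n \<ominus> x' n)"]
      by simp
  next
    have "(\<lambda>n. K * p (y n \<ominus> y' n) + p (x n \<ominus> x' n) * L) \<longlonglongrightarrow> K * 0 + 0 * L"
      using assms by (intro tendsto_intros) (auto simp: close_def)
    then show "(\<lambda>n. K * p (y n \<ominus> y' n) + p (x n \<ominus> x' n) * L) \<longlonglongrightarrow> 0" by simp
  qed (use assms in auto)
qed

lemma close_scl:
  assumes "seq x" "seq y" "close x y"
  shows "close (\<lambda>n. scl A c (x n)) (\<lambda>n. scl A c (y n))"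
  using assms tendsto_mult_left[of "\<lambda>n. p (x n \<ominus> y n)" 0 _ "cmod c"]
  by (simp add: close_def scl_diff_right[symmetric])

lemma close_str:
  assumes "seq x" "seq y" "close x y"
  shows "close (\<lambda>n. str A (x n)) (\<lambda>n. str A (y n))"
  using assms by (simp add: close_def str_diff[symmetric] del: str_diff)

lemma close_p:
  assumes "seq x" "seq y" "close x y" "(\<lambda>n. p (y n)) \<longlonglongrightarrow> l"
  shows "(\<lambda>n. p (x n)) \<longlonglongrightarrow> l"
proof -
  have "(\<lambda>n. \<bar>p (x n) - p (y n)\<bar>) \<longlonglongrightarrow> 0"
    by (rule tendsto_zero_le[of "\<lambda>n. p (x n \<ominus> y n)"]) (use assms in \<open>auto simp: close_def p_diff_abs\<close>)
  then show ?thesis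
    using tendsto_add[OF _ assms(4), of "\<lambda>n. p (x n) - p (y n)" 0] by (simp add: tendsto_rabs_zero_iff)
qed

lemma bdd_const [simp]: "bdd (\<lambda>n. a)"
  by (auto simp: bdd_def)

lemma bdd_close:
  assumes "seq x" "seq y" "close x y" "bdd y"
  shows "bdd x"
proof -
  obtain K where K: "\<And>n. p (y n) \<le> K" using assms by (auto simp: bdd_def)
  obtain L where L: "\<And>n. \<bar>p (x n \<ominus> y n)\<bar> \<le> L"
    using convergent_imp_Bseq[of "\<lambda>n. p (x n \<ominus> y n)"] assms(3)
    by (auto simp: close_def convergent_def Bseq_def)
  have "p (x n) \<le> L + K" for n
    using p_diff_abs[of "x n" "y n"] K[of n] L[of n] assms by simp
  then show ?thesis by (auto simp: bdd_def)
qed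

abbreviation "CS \<equiv> cauchy_seqs A p"

lemma CS_seq: "x \<in> CS \<Longrightarrow> x n \<in> carrier A"
  by (simp add: cauchy_seqs_def)

lemma CS_const [simp, intro]: "a \<in> carrier A \<Longrightarrow> (\<lambda>n. a) \<in> CS"
  by (simp add: cauchy_seqs_def minus_eq r_neg)

lemma CS_D:
  assumes "x \<in> CS" "e > 0"
  obtains M where "\<And>m n. m \<ge> M \<Longrightarrow> n \<ge> M \<Longrightarrow> p (x m \<ominus> x n) < e"
  using assms unfolding cauchy_seqs_def by blast

lemma CS_I:
  assumes "\<And>n. x n \<in> carrier A" "\<And>e. e > 0 \<Longrightarrow> \<exists>M. \<forall>m\<ge>M. \<forall>n\<ge>M. p (x m \<ominus> x n) < e"
  shows "x \<in> CS"
  using assms unfolding cauchy_seqs_def by blast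

lemma CS_bdd:
  assumes "x \<in> CS" shows "bdd x"
proof -
  obtain M where M: "\<And>m n. m \<ge> M \<Longrightarrow> n \<ge> M \<Longrightarrow> p (x m \<ominus> x n) < 1"
    using CS_D[OF assms, of 1] by auto
  have "p (x n) \<le> Max (insert (1 + p (x M)) ((\<lambda>n. p (x n)) ` {..M}))" for n
  proof (cases "n \<le> M")
    case False
    then have "p (x n) \<le> 1 + p (x M)"
      using M[of n M] p_diff_abs[of "x n" "x M"] CS_seq[OF assms] by (simp add: abs_le_iff)
    then show ?thesis by (intro order.trans[OF _ Max_ge]) auto
  qed (intro Max_ge; simp)
  then show ?thesis by (auto simp: bdd_def)
qed

lemma CS_convergent:
  assumes "x \<in> CS" shows "convergent (\<lambda>n. p (x n))"
proof (intro Cauchy_convergent metric_CauchyI)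
  fix e :: real assume "e > 0"
  then obtain M where M: "\<And>m n. m \<ge> M \<Longrightarrow> n \<ge> M \<Longrightarrow> p (x m \<ominus> x n) < e"
    using CS_D[OF assms] by blast
  then show "\<exists>M. \<forall>m\<ge>M. \<forall>n\<ge>M. dist (p (x m)) (p (x n)) < e"
    using p_diff_abs CS_seq[OF assms] unfolding dist_real_def by (meson le_less_trans)
qed

lemma CS_map:
  assumes "x \<in> CS" "\<And>n. g (x n) \<in> carrier A"
    and "\<And>m n. p (g (x m) \<ominus> g (x n)) \<le> K * p (x m \<ominus> x n)"
  shows "(\<lambda>n. g (x n)) \<in> CS"
proof (rule CS_I)
  fix e :: real assume e: "e > 0"
  \<comment> \<open>The divisor \<open>\<bar>K\<bar> + 1\<close> is positive whatever the value of
    \<open>K\<close>.\<close>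
  then have "e / (\<bar>K\<bar> + 1) > 0" by simp
  then obtain M where M: "\<And>m n. m \<ge> M \<Longrightarrow> n \<ge> M \<Longrightarrow> p (x m \<ominus> x n) < e / (\<bar>K\<bar> + 1)"
    using CS_D[OF assms(1)] by blast
  have "p (g (x m) \<ominus> g (x n)) < e" if "m \<ge> M" "n \<ge> M" for m n
  proof -
    have "K * p (x m \<ominus> x n) \<le> (\<bar>K\<bar> + 1) * p (x m \<ominus> x n)"
      using CS_seq[OF assms(1)] by (intro mult_right_mono) auto
    also have "\<dots> < e" using M[OF that] by (simp add: field_simps)
    finally show ?thesis using assms(3)[of m n] by simp
  qed
  then show "\<exists>M. \<forall>m\<ge>M. \<forall>n\<ge>M. p (g (x m) \<ominus> g (x n)) < e" by blast
qed (use assms in auto)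

lemma CS_scl [simp, intro]: "x \<in> CS \<Longrightarrow> (\<lambda>n. scl A c (x n)) \<in> CS"
  by (rule CS_map[where K = "cmod c"]) (auto simp: CS_seq scl_diff_right[symmetric])

lemma CS_str [simp, intro]: "x \<in> CS \<Longrightarrow> (\<lambda>n. str A (x n)) \<in> CS"
  by (rule CS_map[where K = 1]) (auto simp: CS_seq str_diff[symmetric] simp del: str_diff)

lemma CS_add [simp, intro]:
  assumes "x \<in> CS" "y \<in> CS" shows "(\<lambda>n. x n \<oplus> y n) \<in> CS"
proof (rule CS_I)
  fix e :: real assume e: "e > 0"
  obtain M where M: "\<And>m n. m \<ge> M \<Longrightarrow> n \<ge> M \<Longrightarrow> p (x m \<ominus> x n) < e / 2"
    using CS_D[OF assms(1)] e half_gt_zero by blast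
  obtain N where N: "\<And>m n. m \<ge> N \<Longrightarrow> n \<ge> N \<Longrightarrow> p (y m \<ominus> y n) < e / 2"
    using CS_D[OF assms(2)] e half_gt_zero by blast
  have "p (x m \<oplus> y m \<ominus> (x n \<oplus> y n)) < e" if "m \<ge> max M N" "n \<ge> max M N" for m n
  proof -
    have "x m \<oplus> y m \<ominus> (x n \<oplus> y n) = (x m \<ominus> x n) \<oplus> (y m \<ominus> y n)"
      using assms by (simp add: minus_eq minus_add a_ac CS_seq)
    then show ?thesis
      using p_triangle[of "x m \<ominus> x n" "y m \<ominus> y n"] M[of m n] N[of m n] that assms
      by (simp add: CS_seq)
  qed
  then show "\<exists>M. \<forall>m\<ge>M. \<forall>n\<ge>M. p (x m \<oplus> y m \<ominus> (x n \<oplus> y n)) < e" by blast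
qed (use assms in \<open>auto simp: CS_seq\<close>)

lemma CS_mult [simp, intro]:
  assumes "x \<in> CS" "y \<in> CS" shows "(\<lambda>n. x n \<otimes> y n) \<in> CS"
proof (rule CS_I)
  fix e :: real assume e: "e > 0"
  obtain K0 L0 where K0: "\<And>n. p (x n) \<le> K0" and L0: "\<And>n. p (y n) \<le> L0"
    using CS_bdd assms by (auto simp: bdd_def) metis
  define K where "K = \<bar>K0\<bar> + \<bar>L0\<bar> + 1"
  have K: "p (x n) \<le> K" "p (y n) \<le> K" "K > 0" for n
    using K0[of n] L0[of n] by (auto simp: K_def)
  have e': "e / (2 * K) > 0" using e K by simp
  obtain M where M: "\<And>m n. m \<ge> M \<Longrightarrow> n \<ge> M \<Longrightarrow> p (x m \<ominus> x n) < e / (2 * K)"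
    using CS_D[OF assms(1) e'] by blast
  obtain N where N: "\<And>m n. m \<ge> N \<Longrightarrow> n \<ge> N \<Longrightarrow> p (y m \<ominus> y n) < e / (2 * K)"
    using CS_D[OF assms(2) e'] by blast
  have "p (x m \<otimes> y m \<ominus> x n \<otimes> y n) < e" if "m \<ge> max M N" "n \<ge> max M N" for m n
  proof -
    have "p (x m \<otimes> y m \<ominus> x n \<otimes> y n) \<le> p (x m) * p (y m \<ominus> y n) + p (x m \<ominus> x n) * p (y n)"
      using assms by (intro p_mult_diff) (auto simp: CS_seq)
    also have "\<dots> \<le> K * p (y m \<ominus> y n) + p (x m \<ominus> x n) * K"
      using assms K by (intro add_mono mult_right_mono mult_left_mono) (auto simp: CS_seq)
    also have "\<dots> < K * (e / (2 * K)) + e / (2 * K) * K"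
      using M[of m n] N[of m n] that K
      by (intro add_strict_mono mult_strict_left_mono mult_strict_right_mono) auto
    also have "\<dots> = e" using K(3) by simp
    finally show ?thesis .
  qed
  then show "\<exists>M. \<forall>m\<ge>M. \<forall>n\<ge>M. p (x m \<otimes> y m \<ominus> x n \<otimes> y n) < e" by blast
qed (use assms in \<open>auto simp: CS_seq\<close>)

abbreviation "cls \<equiv> cauchy_class A p"

abbreviation "Cp \<equiv> completion A p"

lemma cauchy_rel_iff: "(x, y) \<in> cauchy_rel A p \<longleftrightarrow> x \<in> CS \<and> y \<in> CS \<and> close x y"
  by (simp add: cauchy_rel_def close_def)

lemma mem_cls: "y \<in> cls x \<longleftrightarrow> x \<in> CS \<and> y \<in> CS \<and> close x y"
  by (simp add: cauchy_class_def cauchy_rel_iff)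

lemma cls_eqI:
  assumes "x \<in> CS" "y \<in> CS" "close x y" shows "cls x = cls y"
proof -
  have *: "cls v \<subseteq> cls u" if "u \<in> CS" "v \<in> CS" "close u v" for u v
  proof
    fix z assume "z \<in> cls v"
    then show "z \<in> cls u"
      using that close_trans[of u v z] CS_seq by (simp add: mem_cls)
  qed
  from *[of x y] *[of y x] show ?thesis
    using assms close_sym[of x y] CS_seq by auto
qed

lemma carrier_Cp: "carrier Cp = cls ` CS"
  by (auto simp: completion_def quotient_def cauchy_class_def)

lemma cls_closed [simp, intro]: "x \<in> CS \<Longrightarrow> cls x \<in> carrier Cp"
  by (simp add: carrier_Cp)

lemma carrier_CpE:
  assumes "X \<in> carrier Cp" obtains x where "x \<in> CS" "X = cls x"
  using assms by (auto simp: carrier_Cp)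

text \<open>The operations of \<open>completion\<close> act on chosen representatives. A
  representative is asymptotically equal to any sequence of its class, so \<open>cls_eqI\<close>
  makes the operations independent of the choice.\<close>

lemma repr_cls:
  assumes "x \<in> CS" shows "repr (cls x) \<in> CS" "close (repr (cls x)) x"
proof -
  have "x \<in> cls x" using assms by (auto simp: mem_cls CS_seq)
  then have "repr (cls x) \<in> cls x" unfolding repr_def by (metis someI)
  then show "repr (cls x) \<in> CS" "close (repr (cls x)) x"
    using close_sym assms by (auto simp: mem_cls CS_seq)
qed

lemma zero_Cp: "\<zero>\<^bsub>Cp\<^esub> = cls (\<lambda>n. \<zero>)"
  and one_Cp: "\<one>\<^bsub>Cp\<^esub> = cls (\<lambda>n. \<one>)"
  by (simp_all add: completion_def)

lemma add_Cp: "x \<in> CS \<Longrightarrow> y \<in> CS \<Longrightarrow> cls x \<oplus>\<^bsub>Cp\<^esub> cls y = cls (\<lambda>n. x n \<oplus> y n)"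
  unfolding completion_def by simp (intro cls_eqI close_add; simp add: repr_cls CS_seq)

lemma mult_Cp: "x \<in> CS \<Longrightarrow> y \<in> CS \<Longrightarrow> cls x \<otimes>\<^bsub>Cp\<^esub> cls y = cls (\<lambda>n. x n \<otimes> y n)"
  unfolding completion_def by simp (intro cls_eqI close_mult; simp add: repr_cls CS_seq CS_bdd)

lemma scl_Cp: "x \<in> CS \<Longrightarrow> scl Cp c (cls x) = cls (\<lambda>n. scl A c (x n))"
  unfolding completion_def by simp (intro cls_eqI close_scl; simp add: repr_cls CS_seq)

lemma str_Cp: "x \<in> CS \<Longrightarrow> str Cp (cls x) = cls (\<lambda>n. str A (x n))"
  unfolding completion_def by simp (intro cls_eqI close_str; simp add: repr_cls CS_seq)

lemma nrm_Cp_tendsto: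
  assumes "x \<in> CS" shows "(\<lambda>n. p (x n)) \<longlonglongrightarrow> nrm Cp (cls x)"
proof -
  have "(\<lambda>n. p (x n)) \<longlonglongrightarrow> lim (\<lambda>n. p (x n))"
    using CS_convergent[OF assms] by (simp add: convergent_LIMSEQ_iff)
  moreover from this have "(\<lambda>n. p (repr (cls x) n)) \<longlonglongrightarrow> lim (\<lambda>n. p (x n))"
    using close_p repr_cls[OF assms] CS_seq assms by blast
  then have "nrm Cp (cls x) = lim (\<lambda>n. p (x n))"
    by (simp add: completion_def limI)
  ultimately show ?thesis by simp
qed

lemmas Cp_simps = zero_Cp one_Cp add_Cp mult_Cp scl_Cp str_Cp CS_seq

lemma Cp_ring: "ring Cp"
proof (rule ringI)
  show "abelian_group Cp"
  proof (rule abelian_groupI)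
    show "X \<oplus>\<^bsub>Cp\<^esub> Y \<in> carrier Cp" if "X \<in> carrier Cp" "Y \<in> carrier Cp" for X Y
      using that by (elim carrier_CpE) (simp add: Cp_simps)
    show "X \<oplus>\<^bsub>Cp\<^esub> Y \<oplus>\<^bsub>Cp\<^esub> Z = X \<oplus>\<^bsub>Cp\<^esub> (Y \<oplus>\<^bsub>Cp\<^esub> Z)"
      if "X \<in> carrier Cp" "Y \<in> carrier Cp" "Z \<in> carrier Cp" for X Y Z
      using that by (elim carrier_CpE) (simp add: Cp_simps a_assoc)
    show "X \<oplus>\<^bsub>Cp\<^esub> Y = Y \<oplus>\<^bsub>Cp\<^esub> X" if "X \<in> carrier Cp" "Y \<in> carrier Cp" for X Y
      using that by (elim carrier_CpE) (simp add: Cp_simps a_comm)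
    show "\<zero>\<^bsub>Cp\<^esub> \<oplus>\<^bsub>Cp\<^esub> X = X" if "X \<in> carrier Cp" for X
      using that by (elim carrier_CpE) (simp add: Cp_simps)
    show "\<exists>Y\<in>carrier Cp. Y \<oplus>\<^bsub>Cp\<^esub> X = \<zero>\<^bsub>Cp\<^esub>" if X: "X \<in> carrier Cp" for X
    proof -
      obtain x where x: "x \<in> CS" "X = cls x" using X by (rule carrier_CpE)
      then have "cls (\<lambda>n. scl A (- 1) (x n)) \<oplus>\<^bsub>Cp\<^esub> X = cls (\<lambda>n. scl A (- 1) (x n) \<oplus> x n)"
        by (simp only: add_Cp CS_scl)
      also have "\<dots> = \<zero>\<^bsub>Cp\<^esub>" using x by (simp add: Cp_simps l_neg)
      finally show ?thesis using x by blast
    qed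
  qed (simp add: Cp_simps)
  show "monoid Cp"
  proof (rule monoidI)
    show "X \<otimes>\<^bsub>Cp\<^esub> Y \<in> carrier Cp" if "X \<in> carrier Cp" "Y \<in> carrier Cp" for X Y
      using that by (elim carrier_CpE) (simp add: Cp_simps)
    show "X \<otimes>\<^bsub>Cp\<^esub> Y \<otimes>\<^bsub>Cp\<^esub> Z = X \<otimes>\<^bsub>Cp\<^esub> (Y \<otimes>\<^bsub>Cp\<^esub> Z)"
      if "X \<in> carrier Cp" "Y \<in> carrier Cp" "Z \<in> carrier Cp" for X Y Z
      using that by (elim carrier_CpE) (simp add: Cp_simps m_assoc)
    show "\<one>\<^bsub>Cp\<^esub> \<otimes>\<^bsub>Cp\<^esub> X = X" "X \<otimes>\<^bsub>Cp\<^esub> \<one>\<^bsub>Cp\<^esub> = X" if "X \<in> carrier Cp" for X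
      using that by (elim carrier_CpE, simp add: Cp_simps)+
  qed (simp add: Cp_simps)
  show "(X \<oplus>\<^bsub>Cp\<^esub> Y) \<otimes>\<^bsub>Cp\<^esub> Z = X \<otimes>\<^bsub>Cp\<^esub> Z \<oplus>\<^bsub>Cp\<^esub> Y \<otimes>\<^bsub>Cp\<^esub> Z"
    "Z \<otimes>\<^bsub>Cp\<^esub> (X \<oplus>\<^bsub>Cp\<^esub> Y) = Z \<otimes>\<^bsub>Cp\<^esub> X \<oplus>\<^bsub>Cp\<^esub> Z \<otimes>\<^bsub>Cp\<^esub> Y"
    if "X \<in> carrier Cp" "Y \<in> carrier Cp" "Z \<in> carrier Cp" for X Y Z
    using that by (elim carrier_CpE, simp add: Cp_simps l_distr r_distr)+
qed

lemma Cp_star_alg: "star_alg Cp"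
proof (intro star_alg.intro star_alg_axioms.intro Cp_ring)
  fix X Y c d assume X: "X \<in> carrier Cp"
  show "scl Cp c X \<in> carrier Cp" "scl Cp 1 X = X" "scl Cp c (scl Cp d X) = scl Cp (c * d) X"
    "scl Cp (c + d) X = scl Cp c X \<oplus>\<^bsub>Cp\<^esub> scl Cp d X" "str Cp X \<in> carrier Cp" "str Cp (str Cp X) = X"
    "str Cp (scl Cp c X) = scl Cp (cnj c) (str Cp X)"
    using X by (elim carrier_CpE, simp add: Cp_simps scl_add_left)+
  assume Y: "Y \<in> carrier Cp"
  show "scl Cp c (X \<oplus>\<^bsub>Cp\<^esub> Y) = scl Cp c X \<oplus>\<^bsub>Cp\<^esub> scl Cp c Y"
    "scl Cp c (X \<otimes>\<^bsub>Cp\<^esub> Y) = scl Cp c X \<otimes>\<^bsub>Cp\<^esub> Y"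
    "scl Cp c (X \<otimes>\<^bsub>Cp\<^esub> Y) = X \<otimes>\<^bsub>Cp\<^esub> scl Cp c Y"
    "str Cp (X \<oplus>\<^bsub>Cp\<^esub> Y) = str Cp X \<oplus>\<^bsub>Cp\<^esub> str Cp Y"
    "str Cp (X \<otimes>\<^bsub>Cp\<^esub> Y) = str Cp Y \<otimes>\<^bsub>Cp\<^esub> str Cp X"
    using X Y by (elim carrier_CpE, simp add: Cp_simps scl_add_right scl_mult_left scl_mult_right)+
qed

interpretation C: star_alg Cp by (rule Cp_star_alg)

lemma minus_Cp: "x \<in> CS \<Longrightarrow> \<ominus>\<^bsub>Cp\<^esub> cls x = cls (\<lambda>n. \<ominus> x n)"
  using scl_Cp[of x "- 1"] by (simp add: CS_seq)

lemma CS_minus [simp, intro]: "x \<in> CS \<Longrightarrow> (\<lambda>n. \<ominus> x n) \<in> CS"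
  using CS_scl[of x "- 1"] by (simp add: CS_seq)

lemma CS_diff [simp, intro]: "x \<in> CS \<Longrightarrow> y \<in> CS \<Longrightarrow> (\<lambda>n. x n \<ominus> y n) \<in> CS"
  using CS_add[of x "\<lambda>n. \<ominus> y n"] by (simp add: minus_eq)

lemma diff_Cp: "x \<in> CS \<Longrightarrow> y \<in> CS \<Longrightarrow> cls x \<ominus>\<^bsub>Cp\<^esub> cls y = cls (\<lambda>n. x n \<ominus> y n)"
  by (simp add: C.minus_eq minus_Cp add_Cp minus_eq)

lemma Cp_seminorm: "cstar_seminorm Cp (nrm Cp)"
proof -
  have "0 \<le> nrm Cp X" if "X \<in> carrier Cp" for X
    using that
    by (elim carrier_CpE) (auto intro!: LIMSEQ_le_const nrm_Cp_tendsto simp: CS_seq)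
  moreover have "nrm Cp (X \<oplus>\<^bsub>Cp\<^esub> Y) \<le> nrm Cp X + nrm Cp Y" if XY: "X \<in> carrier Cp" "Y \<in> carrier Cp" for X Y
  proof -
    obtain x where [simp]: "x \<in> CS" "X = cls x" using XY(1) by (rule carrier_CpE)
    obtain y where [simp]: "y \<in> CS" "Y = cls y" using XY(2) by (rule carrier_CpE)
    show ?thesis
      using LIMSEQ_le[OF nrm_Cp_tendsto[of "\<lambda>n. x n \<oplus> y n"] tendsto_add[OF nrm_Cp_tendsto[of x] nrm_Cp_tendsto[of y]]]
      by (auto simp: p_triangle CS_seq add_Cp)
  qed
  moreover have "nrm Cp (X \<otimes>\<^bsub>Cp\<^esub> Y) \<le> nrm Cp X * nrm Cp Y" if XY: "X \<in> carrier Cp" "Y \<in> carrier Cp" for X Y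
  proof -
    obtain x where [simp]: "x \<in> CS" "X = cls x" using XY(1) by (rule carrier_CpE)
    obtain y where [simp]: "y \<in> CS" "Y = cls y" using XY(2) by (rule carrier_CpE)
    show ?thesis
      using LIMSEQ_le[OF nrm_Cp_tendsto[of "\<lambda>n. x n \<otimes> y n"] tendsto_mult[OF nrm_Cp_tendsto[of x] nrm_Cp_tendsto[of y]]]
      by (auto simp: p_mult CS_seq mult_Cp)
  qed
  moreover have "nrm Cp (scl Cp c X) = cmod c * nrm Cp X" if XY: "X \<in> carrier Cp" for X c
  proof -
    obtain x where [simp]: "x \<in> CS" "X = cls x" using XY by (rule carrier_CpE)
    have "(\<lambda>n. cmod c * p (x n)) \<longlonglongrightarrow> nrm Cp (scl Cp c X)"
      using nrm_Cp_tendsto[of "\<lambda>n. scl A c (x n)"] by (simp add: CS_seq scl_Cp)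
    from LIMSEQ_unique[OF this tendsto_mult_left[OF nrm_Cp_tendsto[of x]]] show ?thesis by simp
  qed
  moreover have "nrm Cp (str Cp X \<otimes>\<^bsub>Cp\<^esub> X) = (nrm Cp X)\<^sup>2" if XY: "X \<in> carrier Cp" for X
  proof -
    obtain x where [simp]: "x \<in> CS" "X = cls x" using XY by (rule carrier_CpE)
    have "(\<lambda>n. (p (x n))\<^sup>2) \<longlonglongrightarrow> nrm Cp (str Cp X \<otimes>\<^bsub>Cp\<^esub> X)"
      using nrm_Cp_tendsto[of "\<lambda>n. str A (x n) \<otimes> x n"] by (simp add: CS_seq str_Cp mult_Cp p_cstar)
    from LIMSEQ_unique[OF this tendsto_power[OF nrm_Cp_tendsto[of x]]] show ?thesis by simp
  qed
  ultimately show ?thesis by (auto simp: cstar_seminorm_def)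
qed

interpretation C: seminormed_star_alg Cp "nrm Cp"
  using Cp_seminorm Cp_star_alg by (simp add: seminormed_star_alg_iff star_alg_iff)

abbreviation "inc \<equiv> incl A p"

lemma inc_closed [simp, intro]: "a \<in> carrier A \<Longrightarrow> inc a \<in> carrier Cp"
  by (simp add: incl_def)

lemma star_hom_inc: "star_hom A Cp inc"
  by (rule star_homI) (simp_all add: incl_def Cp_simps)

lemma nrm_inc [simp]: "a \<in> carrier A \<Longrightarrow> nrm Cp (inc a) = p a"
  using LIMSEQ_unique[OF nrm_Cp_tendsto[of "\<lambda>n. a"] tendsto_const] by (simp add: incl_def)

lemma inc_tendsto:
  assumes "x \<in> CS" shows "(\<lambda>n. nrm Cp (inc (x n) \<ominus>\<^bsub>Cp\<^esub> cls x)) \<longlonglongrightarrow> 0"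
proof (rule LIMSEQ_I)
  fix e :: real assume "e > 0"
  then obtain M where M: "\<And>m n. m \<ge> M \<Longrightarrow> n \<ge> M \<Longrightarrow> p (x m \<ominus> x n) < e / 2"
    using CS_D[OF assms, of "e / 2"] by auto
  have "norm (nrm Cp (inc (x m) \<ominus>\<^bsub>Cp\<^esub> cls x) - 0) < e" if m: "m \<ge> M" for m
  proof -
    have [simp]: "x m \<in> carrier A" using assms by (rule CS_seq)
    have "(\<lambda>n. p (x m \<ominus> x n)) \<longlonglongrightarrow> nrm Cp (inc (x m) \<ominus>\<^bsub>Cp\<^esub> cls x)"
      using nrm_Cp_tendsto[of "\<lambda>n. x m \<ominus> x n"] assms by (simp add: incl_def diff_Cp CS_diff[OF CS_const])
    then have "nrm Cp (inc (x m) \<ominus>\<^bsub>Cp\<^esub> cls x) \<le> e / 2"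
      by (rule LIMSEQ_le_const2) (use M[OF m] in \<open>auto intro!: exI[of _ M] less_imp_le\<close>)
    then show ?thesis using \<open>e > 0\<close> assms by simp
  qed
  then show "\<exists>M. \<forall>m\<ge>M. norm (nrm Cp (inc (x m) \<ominus>\<^bsub>Cp\<^esub> cls x) - 0) < e" by blast
qed

lemma inc_dense:
  assumes "X \<in> carrier Cp" "e > 0"
  obtains a where "a \<in> carrier A" "nrm Cp (inc a \<ominus>\<^bsub>Cp\<^esub> X) < e"
proof -
  obtain x where x: "x \<in> CS" "X = cls x" using assms(1) by (rule carrier_CpE)
  obtain n where "norm (nrm Cp (inc (x n) \<ominus>\<^bsub>Cp\<^esub> X) - 0) < e"
    using LIMSEQ_D[OF inc_tendsto[OF x(1)] assms(2)] x by blast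
  then show ?thesis using that[of "x n"] x CS_seq by auto
qed

text \<open>For completeness, the n-th term of a Cauchy sequence of classes is replaced by an
  element of \<open>A\<close> at distance below \<open>1 / (n + 1)\<close>; the resulting sequence
  is Cauchy in \<open>A\<close>, and its class is the limit.\<close>

lemma cstar_alg_Cp: "cstar_alg Cp"
proof (intro cstar_alg.intro cstar_alg_axioms.intro Cp_star_alg Cp_seminorm)
  fix X assume X: "X \<in> carrier Cp" "nrm Cp X = 0"
  obtain x where x: "x \<in> CS" "X = cls x" using X(1) by (rule carrier_CpE)
  then have "(\<lambda>n. p (x n)) \<longlonglongrightarrow> 0" using nrm_Cp_tendsto[of x] X(2) by simp
  then have "close x (\<lambda>n. \<zero>)" using x by (simp add: close_def minus_eq CS_seq)
  then show "X = \<zero>\<^bsub>Cp\<^esub>" using x by (simp add: zero_Cp cls_eqI)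
next
  fix X assume X: "X \<in> cauchy_seqs Cp (nrm Cp)"
  then have Xc: "X n \<in> carrier Cp" for n by (simp add: cauchy_seqs_def)
  have "\<exists>a. a \<in> carrier A \<and> nrm Cp (inc a \<ominus>\<^bsub>Cp\<^esub> X n) < 1 / real (Suc n)" for n
    by (rule inc_dense[OF Xc[of n], of "1 / real (Suc n)"]) auto
  then obtain a where a: "a n \<in> carrier A" "nrm Cp (inc (a n) \<ominus>\<^bsub>Cp\<^esub> X n) < 1 / real (Suc n)" for n
    by metis
  have p_eq: "p (a m \<ominus> a n) = nrm Cp (inc (a m) \<ominus>\<^bsub>Cp\<^esub> inc (a n))" for m n
    using a(1) by (subst nrm_inc[symmetric]) (simp_all add: incl_def diff_Cp del: nrm_inc)
  have aCS: "a \<in> CS"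
  proof (rule CS_I)
    fix e :: real assume e: "e > 0"
    \<comment> \<open>Two approximation errors and one Cauchy distance get a third of
      \<open>e\<close> each.\<close>
    obtain M where M: "\<And>m n. m \<ge> M \<Longrightarrow> n \<ge> M \<Longrightarrow> nrm Cp (X m \<ominus>\<^bsub>Cp\<^esub> X n) < e / 3"
      using C.CS_D[OF X, of "e / 3"] e by auto
    obtain N where N: "1 / real (Suc N) < e / 3"
      using e nat_approx_posE[of "e / 3"] by auto
    have "p (a m \<ominus> a n) < e" if mn: "m \<ge> max M N" "n \<ge> max M N" for m n
    proof -
      have *: "nrm Cp (inc (a k) \<ominus>\<^bsub>Cp\<^esub> X k) < e / 3" if "k \<ge> N" for k
      proof -
        have "1 / real (Suc k) \<le> 1 / real (Suc N)" using that by (simp add: frac_le)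
        then show ?thesis using a(2)[of k] N by linarith
      qed
      have "p (a m \<ominus> a n) \<le> nrm Cp (inc (a m) \<ominus>\<^bsub>Cp\<^esub> X m) + nrm Cp (X m \<ominus>\<^bsub>Cp\<^esub> inc (a n))"
        unfolding p_eq by (intro C.p_diff_trans) (auto simp: a Xc)
      also have "nrm Cp (X m \<ominus>\<^bsub>Cp\<^esub> inc (a n)) \<le> nrm Cp (X m \<ominus>\<^bsub>Cp\<^esub> X n) + nrm Cp (X n \<ominus>\<^bsub>Cp\<^esub> inc (a n))"
        by (intro C.p_diff_trans) (auto simp: a Xc)
      also have "nrm Cp (X n \<ominus>\<^bsub>Cp\<^esub> inc (a n)) = nrm Cp (inc (a n) \<ominus>\<^bsub>Cp\<^esub> X n)"
        by (intro C.p_diff_commute) (auto simp: a Xc)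
      finally show ?thesis using *[of m] *[of n] M[of m n] mn by simp
    qed
    then show "\<exists>M. \<forall>m\<ge>M. \<forall>n\<ge>M. p (a m \<ominus> a n) < e" by blast
  qed (rule a)
  have "(\<lambda>n. nrm Cp (X n \<ominus>\<^bsub>Cp\<^esub> cls a)) \<longlonglongrightarrow> 0"
  proof (rule tendsto_zero_le)
    show "(\<lambda>n. 1 / real (Suc n) + nrm Cp (inc (a n) \<ominus>\<^bsub>Cp\<^esub> cls a)) \<longlonglongrightarrow> 0"
      using tendsto_add[OF LIMSEQ_Suc[OF lim_1_over_n] inc_tendsto[OF aCS]] by simp
    fix n
    have "nrm Cp (X n \<ominus>\<^bsub>Cp\<^esub> cls a) \<le> nrm Cp (X n \<ominus>\<^bsub>Cp\<^esub> inc (a n)) + nrm Cp (inc (a n) \<ominus>\<^bsub>Cp\<^esub> cls a)"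
      by (intro C.p_diff_trans) (auto simp: a Xc aCS)
    then show "nrm Cp (X n \<ominus>\<^bsub>Cp\<^esub> cls a) \<le> 1 / real (Suc n) + nrm Cp (inc (a n) \<ominus>\<^bsub>Cp\<^esub> cls a)"
      using a(2)[of n] C.p_diff_commute[of "X n" "inc (a n)"] Xc[of n] a(1)[of n] by simp
  qed (auto simp: Xc aCS)
  then show "\<exists>a\<in>carrier Cp. (\<lambda>n. nrm Cp (X n \<ominus>\<^bsub>Cp\<^esub> a)) \<longlonglongrightarrow> 0" using aCS by blast
qed

text \<open>A contractive homomorphism maps Cauchy sequences to Cauchy sequences, whose limits in
  \<open>B\<close> depend only on the class; products pass to the limit because the image sequences
  are bounded.\<close>

lemma completion_extend:
  fixes B :: "('b, 'k) cstar_scheme"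
  assumes B: "cstar_alg B" and f: "star_hom A B f"
    and le: "\<And>a. a \<in> carrier A \<Longrightarrow> nrm B (f a) \<le> p a"
  obtains F where "star_hom Cp B F" "\<And>a. a \<in> carrier A \<Longrightarrow> F (inc a) = f a"
    "\<And>X. X \<in> carrier Cp \<Longrightarrow> nrm B (F X) \<le> nrm Cp X"
proof -
  interpret B: cstar_alg B by fact
  interpret f: star_hom_pair A B f
    using f star_alg_axioms B.star_alg_axioms by (intro star_hom_pairI)
  define F where "F X = (SOME b. b \<in> carrier B \<and> B.close (\<lambda>n. f (repr X n)) (\<lambda>n. b))" for X
  have limit: "\<exists>b. b \<in> carrier B \<and> B.close (\<lambda>n. f (x n)) (\<lambda>n. b)" if x: "x \<in> CS" for x
  proof -
    have "(\<lambda>n. f (x n)) \<in> B.CS"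
    proof (rule B.CS_I)
      fix e :: real assume "e > 0"
      then obtain M where M: "\<And>m n. m \<ge> M \<Longrightarrow> n \<ge> M \<Longrightarrow> p (x m \<ominus> x n) < e"
        using CS_D[OF x] by blast
      have "nrm B (f (x m) \<ominus>\<^bsub>B\<^esub> f (x n)) \<le> p (x m \<ominus> x n)" for m n
        using le[of "x m \<ominus> x n"] CS_seq[OF x] by simp
      then show "\<exists>M. \<forall>m\<ge>M. \<forall>n\<ge>M. nrm B (f (x m) \<ominus>\<^bsub>B\<^esub> f (x n)) < e"
        using M by (meson le_less_trans)
    qed (use CS_seq[OF x] in simp)
    then show ?thesis using B.complete unfolding B.close_def by blast
  qed
  have F: "F (cls x) \<in> carrier B" "B.close (\<lambda>n. f (x n)) (\<lambda>n. F (cls x))" if x: "x \<in> CS" for x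
  proof -
    note r = repr_cls[OF x]
    have *: "F (cls x) \<in> carrier B \<and> B.close (\<lambda>n. f (repr (cls x) n)) (\<lambda>n. F (cls x))"
      unfolding F_def by (rule someI_ex) (rule limit[OF r(1)])
    then show "F (cls x) \<in> carrier B" by simp
    have "B.close (\<lambda>n. f (repr (cls x) n)) (\<lambda>n. f (x n))"
      unfolding B.close_def
    proof (rule tendsto_zero_le)
      show "(\<lambda>n. p (repr (cls x) n \<ominus> x n)) \<longlonglongrightarrow> 0" using r(2) by (simp add: close_def)
      show "nrm B (f (repr (cls x) n) \<ominus>\<^bsub>B\<^esub> f (x n)) \<le> p (repr (cls x) n \<ominus> x n)" for n
        using le[of "repr (cls x) n \<ominus> x n"] CS_seq[OF x] CS_seq[OF r(1)] by simp
    qed (use CS_seq[OF x] CS_seq[OF r(1)] in simp)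
    then show "B.close (\<lambda>n. f (x n)) (\<lambda>n. F (cls x))"
      using * CS_seq[OF x] CS_seq[OF r(1)] by (meson B.close_sym B.close_trans f.closed)
  qed
  have F_eq: "F (cls x) = b" if "x \<in> CS" "b \<in> carrier B" "B.close (\<lambda>n. f (x n)) (\<lambda>n. b)" for x b
    using B.limit_unique[of "\<lambda>n. f (x n)"] F[OF that(1)] that CS_seq[OF that(1)]
    by (auto simp: B.close_def)
  have Fbdd: "B.bdd (\<lambda>n. f (x n))" if "x \<in> CS" for x
    using B.bdd_close[of "\<lambda>n. f (x n)" "\<lambda>n. F (cls x)"] F[OF that] CS_seq[OF that] by simp
  have "star_hom Cp B F"
  proof (rule star_homI)
    fix X assume "X \<in> carrier Cp"
    then obtain x where x [simp]: "x \<in> CS" "X = cls x" by (rule carrier_CpE)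
    show "F X \<in> carrier B" by (simp add: F)
    show "F (scl Cp c X) = scl B c (F X)" for c
      using B.close_scl[of "\<lambda>n. f (x n)" "\<lambda>n. F (cls x)"] F[OF x(1)] CS_seq[OF x(1)]
      by (auto simp: scl_Cp intro!: F_eq)
    show "F (str Cp X) = str B (F X)"
      using B.close_str[of "\<lambda>n. f (x n)" "\<lambda>n. F (cls x)"] F[OF x(1)] CS_seq[OF x(1)]
      by (auto simp: str_Cp intro!: F_eq)
    fix Y assume "Y \<in> carrier Cp"
    then obtain y where y [simp]: "y \<in> CS" "Y = cls y" by (rule carrier_CpE)
    show "F (X \<oplus>\<^bsub>Cp\<^esub> Y) = F X \<oplus>\<^bsub>B\<^esub> F Y"
      using B.close_add[of "\<lambda>n. f (x n)" "\<lambda>n. f (y n)" "\<lambda>n. F (cls x)" "\<lambda>n. F (cls y)"]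
        F[OF x(1)] F[OF y(1)] CS_seq[OF x(1)] CS_seq[OF y(1)]
      by (auto simp: add_Cp intro!: F_eq)
    show "F (X \<otimes>\<^bsub>Cp\<^esub> Y) = F X \<otimes>\<^bsub>B\<^esub> F Y"
      using B.close_mult[of "\<lambda>n. f (x n)" "\<lambda>n. f (y n)" "\<lambda>n. F (cls x)" "\<lambda>n. F (cls y)"]
        F[OF x(1)] F[OF y(1)] CS_seq[OF x(1)] CS_seq[OF y(1)] Fbdd
      by (auto simp: mult_Cp intro!: F_eq)
  next
    show "F \<one>\<^bsub>Cp\<^esub> = \<one>\<^bsub>B\<^esub>" unfolding one_Cp by (rule F_eq) auto
  qed
  moreover have "F (inc a) = f a" if "a \<in> carrier A" for a
    unfolding incl_def by (rule F_eq) (use that in auto)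
  moreover have "nrm B (F X) \<le> nrm Cp X" if XY: "X \<in> carrier Cp" for X
  proof -
    obtain x where x [simp]: "x \<in> CS" "X = cls x" using XY by (rule carrier_CpE)
    have "(\<lambda>n. nrm B (f (x n))) \<longlonglongrightarrow> nrm B (F (cls x))"
      using F[OF x(1)] CS_seq[OF x(1)]
        B.close_p[of "\<lambda>n. f (x n)" "\<lambda>n. F (cls x)" "nrm B (F (cls x))"] by simp
    then show ?thesis
      using LIMSEQ_le[OF _ nrm_Cp_tendsto[OF x(1)]] le CS_seq[OF x(1)] by simp
  qed
  ultimately show ?thesis by (rule that)
qed

end

section \<open>Universal C*-algebras\<close>

text \<open>\<open>univ_seminorm\<close> is a supremum of reals, so it is meaningful only under a
  bound such as \<open>R_bounded\<close>; the zero seminorm, which respects every set of relations,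
  keeps the set nonempty.\<close>

locale universal_star_alg = star_alg P for P :: "('a, 'm) star_algebra_scheme" (structure) +
  fixes R :: "('a \<times> 'a) set"
  assumes R_closed: "(a, b) \<in> R \<Longrightarrow> a \<in> carrier P \<and> b \<in> carrier P"
    and R_bounded: "x \<in> carrier P \<Longrightarrow>
      \<exists>K. \<forall>p. cstar_seminorm P p \<and> (\<forall>(a, b)\<in>R. p (a \<ominus> b) = 0) \<longrightarrow> p x \<le> K"
begin

definition adm :: "('a \<Rightarrow> real) \<Rightarrow> bool" where
  "adm p \<longleftrightarrow> cstar_seminorm P p \<and> (\<forall>(a, b)\<in>R. p (a \<ominus> b) = 0)"

abbreviation "U \<equiv> univ_seminorm P R"

lemma U_alt: "U x = Sup {p x | p. adm p}"
  by (simp add: univ_seminorm_def adm_def)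

lemma adm_seminormed: "adm p \<Longrightarrow> seminormed_star_alg P p"
  using star_alg_axioms by (simp add: seminormed_star_alg_iff star_alg_iff adm_def)

lemma adm_zero: "adm (\<lambda>x. 0)"
  by (auto simp: adm_def cstar_seminorm_def)

lemma U_ge: "x \<in> carrier P \<Longrightarrow> adm p \<Longrightarrow> p x \<le> U x"
  unfolding U_alt using R_bounded[of x] by (intro cSup_upper) (auto simp: adm_def bdd_above_def)

lemma U_least: "(\<And>p. adm p \<Longrightarrow> p x \<le> K) \<Longrightarrow> U x \<le> K"
  unfolding U_alt using adm_zero by (intro cSup_least) auto

lemma U_nonneg: "x \<in> carrier P \<Longrightarrow> 0 \<le> U x"
  using U_ge[OF _ adm_zero] by simp

lemma U_seminorm: "cstar_seminorm P U"
proof -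
  have "U (x \<oplus> y) \<le> U x + U y" if xy: "x \<in> carrier P" "y \<in> carrier P" for x y
  proof (rule U_least)
    fix p assume p: "adm p"
    interpret seminormed_star_alg P p using p by (rule adm_seminormed)
    show "p (x \<oplus> y) \<le> U x + U y"
      using p_triangle[OF xy] U_ge[OF xy(1) p] U_ge[OF xy(2) p] by simp
  qed
  moreover have "U (x \<otimes> y) \<le> U x * U y" if xy: "x \<in> carrier P" "y \<in> carrier P" for x y
  proof (rule U_least)
    fix p assume p: "adm p"
    interpret seminormed_star_alg P p using p by (rule adm_seminormed)
    have "p x * p y \<le> U x * U y"
      using U_ge[OF xy(1) p] U_ge[OF xy(2) p] xy U_nonneg by (intro mult_mono) auto
    then show "p (x \<otimes> y) \<le> U x * U y"
      using p_mult[OF xy] by simp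
  qed
  moreover have scl_le: "U (scl P c x) \<le> cmod c * U x" if x: "x \<in> carrier P" for c x
  proof (rule U_least)
    fix p assume p: "adm p"
    interpret seminormed_star_alg P p using p by (rule adm_seminormed)
    show "p (scl P c x) \<le> cmod c * U x"
      using U_ge[OF x p] x by (simp add: mult_left_mono)
  qed
  have "U (scl P c x) = cmod c * U x" if x: "x \<in> carrier P" for c x
  proof (cases "c = 0")
    case True
    then show ?thesis using scl_le[OF x, of 0] U_nonneg[of "scl P 0 x"] x by simp
  next
    case False
    \<comment> \<open>The converse inequality comes from applying \<open>scl_le\<close> to the
      inverse scalar.\<close>
    have "cmod c * U x = cmod c * U (scl P (1 / c) (scl P c x))" using False x by simp
    also have "\<dots> \<le> cmod c * (cmod (1 / c) * U (scl P c x))"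
      using x by (intro mult_left_mono scl_le) auto
    also have "\<dots> = U (scl P c x)" using False by (simp add: norm_divide)
    finally show ?thesis using scl_le[OF x, of c] by simp
  qed
  moreover have "U (str P x \<otimes> x) = (U x)\<^sup>2" if x: "x \<in> carrier P" for x
  proof (rule antisym)
    show "U (str P x \<otimes> x) \<le> (U x)\<^sup>2"
    proof (rule U_least)
      fix p assume p: "adm p"
      interpret seminormed_star_alg P p using p by (rule adm_seminormed)
      show "p (str P x \<otimes> x) \<le> (U x)\<^sup>2"
        using U_ge[OF x p] p_nonneg[OF x] x by (simp add: p_cstar power_mono)
    qed
    \<comment> \<open>Taking the root first puts the inequality into the form that
      \<open>U_least\<close> proves, one seminorm at a time.\<close>
    have "U x \<le> sqrt (U (str P x \<otimes> x))"
    proof (rule U_least)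
      fix p assume p: "adm p"
      interpret seminormed_star_alg P p using p by (rule adm_seminormed)
      have "(p x)\<^sup>2 \<le> U (str P x \<otimes> x)" using U_ge[OF _ p, of "str P x \<otimes> x"] x by (simp add: p_cstar)
      then show "p x \<le> sqrt (U (str P x \<otimes> x))" by (rule real_le_rsqrt)
    qed
    then have "(U x)\<^sup>2 \<le> (sqrt (U (str P x \<otimes> x)))\<^sup>2"
      using U_nonneg[OF x] by (rule power_mono)
    then show "(U x)\<^sup>2 \<le> U (str P x \<otimes> x)" using U_nonneg[of "str P x \<otimes> x"] x by simp
  qed
  ultimately show ?thesis using U_nonneg by (auto simp: cstar_seminorm_def)
qed

sublocale U: seminormed_star_alg P "univ_seminorm P R"
  using U_seminorm star_alg_axioms by (simp add: seminormed_star_alg_iff star_alg_iff)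

lemma U_rel:
  assumes "(a, b) \<in> R" shows "U (a \<ominus> b) = 0"
proof (rule antisym)
  show "U (a \<ominus> b) \<le> 0" using assms by (intro U_least) (auto simp: adm_def)
qed (use R_closed assms in \<open>auto intro!: U_nonneg\<close>)

lemma cstar_alg_universal: "cstar_alg (universal_cstar P R)"
  unfolding universal_cstar_def by (rule U.cstar_alg_Cp)

lemma inc_rel:
  assumes "(a, b) \<in> R" shows "incl P U a = incl P U b"
  unfolding incl_def using R_closed[OF assms] U_rel[OF assms]
  by (intro U.cls_eqI) (auto simp: U.close_def)

text \<open>The norm of \<open>B\<close> pulled back along \<open>f\<close> is one of the seminorms
  in the supremum, so \<open>f\<close> is contractive for \<open>U\<close> and extends to the
  completion.\<close>

lemma universal_extend:
  fixes B :: "('b, 'k) cstar_scheme"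
  assumes B: "cstar_alg B" and f: "star_hom P B f"
    and rel: "\<And>a b. (a, b) \<in> R \<Longrightarrow> f a = f b"
  obtains F where "star_hom (universal_cstar P R) B F" "\<And>a. a \<in> carrier P \<Longrightarrow> F (incl P U a) = f a"
    "\<And>X. X \<in> carrier (universal_cstar P R) \<Longrightarrow> nrm B (F X) \<le> nrm (universal_cstar P R) X"
proof -
  interpret B: cstar_alg B by fact
  interpret f: star_hom_pair P B f
    using f star_alg_axioms B.star_alg_axioms by (intro star_hom_pairI)
  have "adm (\<lambda>x. nrm B (f x))"
    unfolding adm_def
  proof (intro conjI ballI)
    show "cstar_seminorm P (\<lambda>x. nrm B (f x))"
      using f.star_hom_pair_axioms B.seminorm by (rule cstar_seminorm_pullback)
    fix ab assume "ab \<in> R"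
    then show "case ab of (a, b) \<Rightarrow> nrm B (f (a \<ominus> b)) = 0"
      using rel R_closed by (auto simp: B.minus_eq B.r_neg)
  qed
  then have "nrm B (f a) \<le> U a" if "a \<in> carrier P" for a
    using U_ge[OF that, of "\<lambda>x. nrm B (f x)"] by simp
  from U.completion_extend[OF B f this] that show ?thesis
    unfolding universal_cstar_def by metis
qed

end

section \<open>Positive functionals\<close>

text \<open>The four numbers are the values of a sesquilinear form on two vectors \<open>a\<close>
  and \<open>b\<close>, and \<open>pos\<close> is positivity at \<open>a + c b\<close>, which for
  complex numbers includes being real. This serves both positive functionals and positive
  semidefinite kernels.\<close>

lemma sesquilinear_Cauchy_Schwarz:
  fixes qaa qab qba qbb :: complex
  assumes pos: "\<And>c. 0 \<le> qaa + c * qab + cnj c * qba + c * cnj c * qbb"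
    and qbb: "0 \<le> qbb"
  shows "qba = cnj qab" "(cmod qab)\<^sup>2 \<le> Re qaa * Re qbb"
proof -
  have im: "Im qaa = 0" "Im qbb = 0" "0 \<le> Re qaa" "0 \<le> Re qbb"
    using pos[of 0] qbb by (auto simp: less_eq_complex_def)
  \<comment> \<open>The imaginary parts in \<open>pos\<close> vanish at \<open>c = 1\<close> and at
    \<open>c = \<i>\<close>, which forces hermitian symmetry.\<close>
  have "Im qab + Im qba = 0" "Re qab - Re qba = 0"
    using pos[of 1] pos[of \<i>] im by (auto simp: less_eq_complex_def)
  then show ba: "qba = cnj qab" by (auto simp: complex_eq_iff)
  define s where "s = (cmod qab)\<^sup>2"
  \<comment> \<open>The choice \<open>c = - t * cnj qab\<close> turns the expression into a real
    quadratic polynomial in \<open>t\<close>.\<close>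
  have key: "0 \<le> Re qaa - 2 * t * s + t\<^sup>2 * s * Re qbb" for t :: real
  proof -
    have "0 \<le> qaa + (- t * cnj qab) * qab + cnj (- t * cnj qab) * cnj qab
       + (- t * cnj qab) * cnj (- t * cnj qab) * qbb"
      using pos[of "- t * cnj qab"] by (simp only: ba)
    also have "\<dots> = qaa - 2 * t * (qab * cnj qab) + t\<^sup>2 * (qab * cnj qab) * qbb"
      by (simp add: algebra_simps power2_eq_square)
    also have "qab * cnj qab = of_real s" unfolding s_def by (rule complex_norm_square[symmetric])
    finally show ?thesis by (simp add: less_eq_complex_def im)
  qed
  show "(cmod qab)\<^sup>2 \<le> Re qaa * Re qbb"
  proof (cases "Re qbb = 0")
    case True
    have "s = 0"
    proof (rule ccontr)
      assume "s \<noteq> 0"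
      then show False
        \<comment> \<open>For vanishing \<open>Re qbb\<close> the polynomial is affine; at this
          \<open>t\<close> it equals \<open>- 1\<close>.\<close>
        using key[of "(Re qaa + 1) / (2 * s)"] True by (simp add: field_simps)
    qed
    then show ?thesis using True by (simp add: s_def)
  next
    case False
    \<comment> \<open>For positive \<open>s\<close>, the polynomial takes its minimum at
      \<open>t = 1 / Re qbb\<close>.\<close>
    then have "0 \<le> (Re qaa - 2 * (1 / Re qbb) * s + (1 / Re qbb)\<^sup>2 * s * Re qbb) * Re qbb"
      using key[of "1 / Re qbb"] im by (intro mult_nonneg_nonneg) auto
    also have "\<dots> = Re qaa * Re qbb - s" using False by (simp add: field_simps power2_eq_square)
    finally show ?thesis by (simp add: s_def)
  qed
qed

text \<open>\<open>C\<close> is any submultiplicative bound that adjoints do not increase, possibly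
  much larger than the operator norm; in the application it is a weighted l1 norm of formal
  sums.\<close>

locale positive_functional = star_alg T for T :: "('a, 'm) star_algebra_scheme" (structure) +
  fixes w :: "'a \<Rightarrow> complex" and C :: "'a \<Rightarrow> real"
  assumes w_add: "x \<in> carrier T \<Longrightarrow> y \<in> carrier T \<Longrightarrow> w (x \<oplus> y) = w x + w y"
    and w_scl: "x \<in> carrier T \<Longrightarrow> w (scl T c x) = c * w x"
    and w_pos: "x \<in> carrier T \<Longrightarrow> 0 \<le> w (str T x \<otimes> x)"
    and C_nonneg: "x \<in> carrier T \<Longrightarrow> 0 \<le> C x"
    and C_mult: "x \<in> carrier T \<Longrightarrow> y \<in> carrier T \<Longrightarrow> C (x \<otimes> y) \<le> C x * C y"
    and C_str: "x \<in> carrier T \<Longrightarrow> C (str T x) \<le> C x"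
    and w_le: "x \<in> carrier T \<Longrightarrow> cmod (w x) \<le> C x"
begin

text \<open>The length of the vector of \<open>x\<close> in the GNS space of
  \<open>w\<close>.\<close>

definition N :: "'a \<Rightarrow> real" where "N x = sqrt (Re (w (str T x \<otimes> x)))"

lemma N_nonneg [simp]: "x \<in> carrier T \<Longrightarrow> 0 \<le> N x"
  using w_pos by (simp add: N_def less_eq_complex_def)

lemma N_square: "x \<in> carrier T \<Longrightarrow> w (str T x \<otimes> x) = of_real ((N x)\<^sup>2)"
  using w_pos[of x] by (simp add: N_def less_eq_complex_def complex_eq_iff)

lemma Cauchy_Schwarz:
  assumes [simp]: "x \<in> carrier T" "y \<in> carrier T"
  shows "w (str T y \<otimes> x) = cnj (w (str T x \<otimes> y))" "cmod (w (str T x \<otimes> y)) \<le> N x * N y"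
proof -
  have *: "0 \<le> w (str T x \<otimes> x) + c * w (str T x \<otimes> y) + cnj c * w (str T y \<otimes> x) + c * cnj c * w (str T y \<otimes> y)" for c
    using w_pos[of "x \<oplus> scl T c y"]
    by (simp add: w_add w_scl l_distr r_distr scl_mult_left scl_mult_right algebra_simps)
  note cs = sesquilinear_Cauchy_Schwarz[OF this w_pos[of y]]
  show "w (str T y \<otimes> x) = cnj (w (str T x \<otimes> y))" using cs(1) by simp
  have "(cmod (w (str T x \<otimes> y)))\<^sup>2 \<le> (N x * N y)\<^sup>2"
    using cs(2) by (simp add: N_square power_mult_distrib)
  then show "cmod (w (str T x \<otimes> y)) \<le> N x * N y"
    by (rule power2_le_imp_le) simp
qed

lemma N_add:
  assumes [simp]: "x \<in> carrier T" "y \<in> carrier T"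
  shows "N (x \<oplus> y) \<le> N x + N y"
proof -
  have "w (str T (x \<oplus> y) \<otimes> (x \<oplus> y))
    = w (str T x \<otimes> x) + w (str T x \<otimes> y) + cnj (w (str T x \<otimes> y)) + w (str T y \<otimes> y)"
    by (simp add: w_add l_distr r_distr Cauchy_Schwarz(1)[of x y] algebra_simps)
  then have "complex_of_real ((N (x \<oplus> y))\<^sup>2) =
      of_real ((N x)\<^sup>2) + w (str T x \<otimes> y) + cnj (w (str T x \<otimes> y)) + of_real ((N y)\<^sup>2)"
    by (simp only: N_square a_closed assms)
  then have "(N (x \<oplus> y))\<^sup>2 = (N x)\<^sup>2 + 2 * Re (w (str T x \<otimes> y)) + (N y)\<^sup>2"
    by (auto simp: complex_eq_iff simp del: of_real_power)
  also have "\<dots> \<le> (N x + N y)\<^sup>2"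
    using Cauchy_Schwarz(2)[of x y] complex_Re_le_cmod[of "w (str T x \<otimes> y)"]
    by (simp add: power2_sum)
  finally show ?thesis by (rule power2_le_imp_le) simp
qed

lemma N_scl: "x \<in> carrier T \<Longrightarrow> N (scl T c x) = cmod c * N x"
proof -
  assume [simp]: "x \<in> carrier T"
  have "w (str T (scl T c x) \<otimes> scl T c x) = (c * cnj c) * w (str T x \<otimes> x)"
    by (simp add: w_scl scl_mult_left scl_mult_right)
  then have "complex_of_real ((N (scl T c x))\<^sup>2) = of_real ((cmod c)\<^sup>2) * of_real ((N x)\<^sup>2)"
    by (simp only: N_square scl_closed complex_norm_square \<open>x \<in> carrier T\<close>)
  then have "(N (scl T c x))\<^sup>2 = (cmod c * N x)\<^sup>2"
    by (simp only: of_real_mult[symmetric] of_real_eq_iff power_mult_distrib)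
  then show ?thesis by simp
qed

text \<open>
  Iterating the Cauchy--Schwarz inequality on the powers \<open>h^(2^n)\<close> of \<open>h = x\<^sup>* x\<close> removes
  the dependence of the crude bound \<open>C (y\<^sup>*) C (h^(2^n)) C y\<close> on \<open>y\<close>.
\<close>
lemma N_mult_le:
  assumes x [simp]: "x \<in> carrier T" and y [simp]: "y \<in> carrier T"
  shows "N (x \<otimes> y) \<le> C x * N y"
proof -
  define h where "h = rec_nat (str T x \<otimes> x) (\<lambda>n z. z \<otimes> z)"
  have h0: "h 0 = str T x \<otimes> x" and hS: "h (Suc n) = h n \<otimes> h n" for n by (simp_all add: h_def)
  have hc [simp]: "h n \<in> carrier T" for n by (induction n) (simp_all add: h0 hS)
  have hstr [simp]: "str T (h n) = h n" for n by (induction n) (simp_all add: h0 hS)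
  have Ch: "C (h n) \<le> (C x)\<^sup>2 ^ 2 ^ n" for n
  proof (induction n)
    case 0
    have "C (h 0) \<le> C (str T x) * C x" unfolding h0 by (intro C_mult) auto
    also have "\<dots> \<le> C x * C x" using C_str[of x] C_nonneg[of x] by (intro mult_right_mono) auto
    finally show ?case by (simp add: power2_eq_square)
  next
    case (Suc n)
    have "C (h (Suc n)) \<le> C (h n) * C (h n)" unfolding hS by (intro C_mult) auto
    also have "\<dots> \<le> (C x)\<^sup>2 ^ 2 ^ n * (C x)\<^sup>2 ^ 2 ^ n"
      using Suc C_nonneg[of "h n"] by (intro mult_mono) auto
    finally show ?case by (simp add: power_add[symmetric] mult_2)
  qed
  define a where "a n = N (h n \<otimes> y)" for n
  have an [simp]: "0 \<le> a n" for n by (simp add: a_def)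
  have step: "(a n)\<^sup>2 \<le> N y * a (Suc n)" for n
  proof -
    have "w (str T (h n \<otimes> y) \<otimes> (h n \<otimes> y)) = w (str T y \<otimes> (h (Suc n) \<otimes> y))"
      by (simp add: hS m_assoc)
    then have "(a n)\<^sup>2 = cmod (w (str T y \<otimes> (h (Suc n) \<otimes> y)))"
      unfolding a_def by (metis N_square hc m_closed norm_of_real abs_power2 y)
    then show ?thesis using Cauchy_Schwarz(2)[of y "h (Suc n) \<otimes> y"] by (simp add: a_def)
  qed
  have base: "(N (x \<otimes> y))\<^sup>2 \<le> N y * a 0"
  proof -
    have "w (str T (x \<otimes> y) \<otimes> (x \<otimes> y)) = w (str T y \<otimes> (h 0 \<otimes> y))"
      by (simp add: h0 m_assoc)
    then have "(N (x \<otimes> y))\<^sup>2 = cmod (w (str T y \<otimes> (h 0 \<otimes> y)))"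
      by (metis N_square m_closed norm_of_real abs_power2 x y)
    then show ?thesis using Cauchy_Schwarz(2)[of y "h 0 \<otimes> y"] by (simp add: a_def)
  qed
  define K where "K = C y * C y"
  have ale: "(a n)\<^sup>2 \<le> K * ((C x)\<^sup>2 ^ 2 ^ n)\<^sup>2" for n
  proof -
    have "(a n)\<^sup>2 = cmod (w (str T (h n \<otimes> y) \<otimes> (h n \<otimes> y)))"
      unfolding a_def by (subst N_square) (auto simp del: of_real_power)
    also have "\<dots> \<le> C (str T (h n \<otimes> y) \<otimes> (h n \<otimes> y))" by (intro w_le) auto
    also have "\<dots> \<le> C (str T (h n \<otimes> y)) * C (h n \<otimes> y)" by (intro C_mult) auto
    also have "\<dots> \<le> C (h n \<otimes> y) * C (h n \<otimes> y)" by (intro mult_right_mono C_str C_nonneg) auto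
    also have "\<dots> \<le> (C (h n) * C y) * (C (h n) * C y)"
      using C_mult C_nonneg by (intro mult_mono) (auto intro!: mult_nonneg_nonneg)
    also have "\<dots> = K * (C (h n))\<^sup>2" by (simp add: K_def power2_eq_square)
    also have "\<dots> \<le> K * ((C x)\<^sup>2 ^ 2 ^ n)\<^sup>2"
      using Ch[of n] C_nonneg by (intro mult_left_mono power_mono) (auto simp: K_def)
    finally show ?thesis .
  qed
  show ?thesis
  proof (cases "N y = 0")
    case True
    then show ?thesis using base by simp
  next
    case False
    then have Ny: "N y > 0" by (auto simp: order_less_le)
    define b where "b n = a n / N y" for n
    have bstep: "(b n)\<^sup>2 \<le> b (Suc n)" for n
      using step[of n] Ny by (simp add: b_def power_divide field_simps power2_eq_square)
    have bn: "b 0 ^ 2 ^ n \<le> b n" for n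
    proof (induction n)
      case (Suc n)
      have "b 0 ^ 2 ^ Suc n = (b 0 ^ 2 ^ n)\<^sup>2" by (simp flip: power_mult add: mult.commute)
      also have "\<dots> \<le> (b n)\<^sup>2" using Suc Ny by (intro power_mono) (auto simp: b_def)
      finally show ?case using bstep[of n] by simp
    qed simp
    define r where "r = (C x)\<^sup>2"
    have r0: "0 \<le> r" by (simp add: r_def)
    have bK: "(b 0 ^ 2 ^ n)\<^sup>2 \<le> K / (N y)\<^sup>2 * (r ^ 2 ^ n)\<^sup>2" for n
    proof -
      have "(b 0 ^ 2 ^ n)\<^sup>2 \<le> (b n)\<^sup>2" using bn[of n] Ny by (intro power_mono) (auto simp: b_def)
      also have "\<dots> \<le> K / (N y)\<^sup>2 * (r ^ 2 ^ n)\<^sup>2"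
        using ale[of n] Ny by (simp add: b_def power_divide r_def divide_right_mono)
      finally show ?thesis .
    qed
    \<comment> \<open>By \<open>bK\<close> the powers of the ratio \<open>b 0 / r\<close> are
      bounded by a constant, so it cannot exceed \<open>1\<close>.\<close>
    have "b 0 \<le> r"
    proof (rule ccontr)
      assume "\<not> b 0 \<le> r"
      then have br: "r < b 0" by simp
      show False
      proof (cases "r = 0")
        case True
        then show False using bK[of 0] br by simp
      next
        case False
        then have r: "r > 0" using r0 by simp
        define q where "q = b 0 / r"
        have q: "q > 1" using br r by (simp add: q_def)
        have qK: "q ^ n \<le> K / (N y)\<^sup>2" for n
        proof -
          have "n \<le> 2 ^ n" by (simp add: less_imp_le)
          then have "q ^ n \<le> q ^ 2 ^ n" using q by (intro power_increasing) auto
          also have "\<dots> \<le> q ^ 2 ^ n * q ^ 2 ^ n" using q by (simp add: one_le_power)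
          also have "\<dots> = (b 0 ^ 2 ^ n)\<^sup>2 / (r ^ 2 ^ n)\<^sup>2" by (simp add: q_def power_divide power2_eq_square)
          also have "\<dots> \<le> K / (N y)\<^sup>2" using bK[of n] r by (simp add: pos_divide_le_eq)
          finally show ?thesis .
        qed
        obtain n where "K / (N y)\<^sup>2 < q ^ n" using real_arch_pow[OF q] by blast
        then show False using qK[of n] by simp
      qed
    qed
    then have "N y * a 0 \<le> N y * (r * N y)" using Ny by (intro mult_left_mono) (auto simp: b_def field_simps)
    then have "(N (x \<otimes> y))\<^sup>2 \<le> (C x * N y)\<^sup>2"
      using base by (simp add: r_def power2_eq_square mult_ac)
    then show ?thesis by (rule power2_le_imp_le) (simp add: C_nonneg)
  qed
qed

end

text \<open>The supremum of the operator norms in the GNS representations of all functionals in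
  \<open>\<Omega>\<close>. It copies the shape of \<open>spatial_seminorm\<close> with an arbitrary
  set in place of the product functionals, which separates the C*-identity from tensor
  products.\<close>

definition gns_seminorm ::
  "('a, 'm) star_algebra_scheme \<Rightarrow> ('a \<Rightarrow> complex) set \<Rightarrow> 'a \<Rightarrow> real" where
  "gns_seminorm T \<Omega> x = Sup (insert 0 {sqrt (Re (w (str T y \<otimes>\<^bsub>T\<^esub> (str T x \<otimes>\<^bsub>T\<^esub> x) \<otimes>\<^bsub>T\<^esub> y))) | w y.
     w \<in> \<Omega> \<and> y \<in> carrier T \<and> w (str T y \<otimes>\<^bsub>T\<^esub> y) = 1})"

text \<open>One bound \<open>C\<close> is shared by all functionals; this makes the supremum
  finite.\<close>

locale positive_functionals = star_alg T for T :: "('a, 'm) star_algebra_scheme" (structure) +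
  fixes \<Omega> :: "('a \<Rightarrow> complex) set" and C :: "'a \<Rightarrow> real"
  assumes functional: "w \<in> \<Omega> \<Longrightarrow> positive_functional T w C"
    and C_nonneg': "x \<in> carrier T \<Longrightarrow> 0 \<le> C x"
begin

abbreviation "NN \<equiv> \<lambda>w x. positive_functional.N T w x"

abbreviation "G \<equiv> gns_seminorm T \<Omega>"

lemma G_alt:
  assumes [simp]: "x \<in> carrier T"
  shows "G x = Sup (insert 0 {NN w (x \<otimes> y) | w y. w \<in> \<Omega> \<and> y \<in> carrier T \<and> w (str T y \<otimes> y) = 1})"
proof -
  have *: "sqrt (Re (w (str T y \<otimes> (str T x \<otimes> x) \<otimes> y))) = NN w (x \<otimes> y)"
    if "w \<in> \<Omega>" "y \<in> carrier T" for w y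
    using that by (simp add: positive_functional.N_def[OF functional[OF that(1)]] m_assoc)
  have "{sqrt (Re (w (str T y \<otimes> (str T x \<otimes> x) \<otimes> y))) | w y.
      w \<in> \<Omega> \<and> y \<in> carrier T \<and> w (str T y \<otimes> y) = 1}
    = {NN w (x \<otimes> y) | w y. w \<in> \<Omega> \<and> y \<in> carrier T \<and> w (str T y \<otimes> y) = 1}"
    by (intro Collect_cong ex_cong1) (auto simp: *)
  then show ?thesis by (simp only: gns_seminorm_def)
qed

lemma G_least:
  assumes "x \<in> carrier T" "0 \<le> K"
    and "\<And>w y. w \<in> \<Omega> \<Longrightarrow> y \<in> carrier T \<Longrightarrow> w (str T y \<otimes> y) = 1 \<Longrightarrow> NN w (x \<otimes> y) \<le> K"
  shows "G x \<le> K"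
  unfolding G_alt[OF assms(1)] using assms by (intro cSup_least) auto

lemma G_bdd:
  assumes [simp]: "x \<in> carrier T"
  shows "bdd_above (insert 0 {NN w (x \<otimes> y) | w y. w \<in> \<Omega> \<and> y \<in> carrier T \<and> w (str T y \<otimes> y) = 1})"
proof (rule bdd_aboveI[of _ "C x"])
  fix z assume "z \<in> insert 0 {NN w (x \<otimes> y) | w y. w \<in> \<Omega> \<and> y \<in> carrier T \<and> w (str T y \<otimes> y) = 1}"
  then consider "z = 0" | w y where "z = NN w (x \<otimes> y)" "w \<in> \<Omega>" "y \<in> carrier T" "w (str T y \<otimes> y) = 1"
    by auto
  then show "z \<le> C x"
  proof cases
    case 2
    interpret positive_functional T w C using functional[OF 2(2)] .
    have "N y = 1" using 2(4) by (simp add: N_def)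
    then show ?thesis using N_mult_le[of x y] 2 by simp
  qed (simp add: C_nonneg')
qed

lemma G_nonneg: "x \<in> carrier T \<Longrightarrow> 0 \<le> G x"
  unfolding G_alt by (intro cSup_upper G_bdd) auto

text \<open>Dividing \<open>y\<close> by its length reduces the claim to the defining supremum. A
  \<open>y\<close> of length zero cannot be normalised; there \<open>N_mult_le\<close> shows that
  \<open>x \<otimes> y\<close> has length zero as well.\<close>

lemma G_ge:
  assumes w: "w \<in> \<Omega>" and [simp]: "x \<in> carrier T" "y \<in> carrier T"
  shows "NN w (x \<otimes> y) \<le> G x * NN w y"
proof -
  interpret positive_functional T w C using functional[OF w] .
  show ?thesis
  proof (cases "N y = 0")
    case True
    then show ?thesis using N_mult_le[of x y] by simp
  next
    case False
    define c where "c = 1 / N y"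
    have c: "N y * c = 1" "0 < c" using False by (auto simp: c_def order_less_le)
    have "N (scl T c y) = 1" using c by (simp add: N_scl mult.commute)
    then have "w (str T (scl T c y) \<otimes> scl T c y) = 1" by (subst N_square) auto
    with w have "N (x \<otimes> scl T c y) \<in>
        {NN w (x \<otimes> y) | w y. w \<in> \<Omega> \<and> y \<in> carrier T \<and> w (str T y \<otimes> y) = 1}"
      using scl_closed[OF assms(3)] by blast
    then have "N (x \<otimes> scl T c y) \<le> G x"
      unfolding G_alt[OF assms(2)] by (intro cSup_upper G_bdd) auto
    then have "c * N (x \<otimes> y) \<le> G x" using c by (simp add: scl_mult_right N_scl)
    then have "N y * (c * N (x \<otimes> y)) \<le> N y * G x" by (intro mult_left_mono) auto
    then show ?thesis using c by (simp add: mult.assoc[symmetric] mult.commute)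
  qed
qed

lemma G_seminorm: "cstar_seminorm T G"
proof -
  have "G (x \<oplus> y) \<le> G x + G y" if [simp]: "x \<in> carrier T" "y \<in> carrier T" for x y
  proof (rule G_least)
    fix w z assume *: "w \<in> \<Omega>" "z \<in> carrier T" "w (str T z \<otimes> z) = 1"
    interpret positive_functional T w C using functional[OF *(1)] .
    have "N z = 1" using * by (simp add: N_def)
    then show "N ((x \<oplus> y) \<otimes> z) \<le> G x + G y"
      using N_add[of "x \<otimes> z" "y \<otimes> z"] G_ge[OF *(1) _ *(2), of x] G_ge[OF *(1) _ *(2), of y] *
      by (simp add: l_distr)
  qed (auto simp: G_nonneg)
  moreover have mult_le: "G (x \<otimes> y) \<le> G x * G y" if [simp]: "x \<in> carrier T" "y \<in> carrier T" for x y
  proof (rule G_least)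
    fix w z assume *: "w \<in> \<Omega>" "z \<in> carrier T" "w (str T z \<otimes> z) = 1"
    interpret positive_functional T w C using functional[OF *(1)] .
    have [simp]: "z \<in> carrier T" by fact
    have "N z = 1" using * by (simp add: N_def)
    then have "N (x \<otimes> (y \<otimes> z)) \<le> G x * G y"
      using G_ge[OF *(1), of x "y \<otimes> z"] mult_left_mono[OF G_ge[OF *(1), of y z], of "G x"] G_nonneg[of x]
      by simp
    then show "N ((x \<otimes> y) \<otimes> z) \<le> G x * G y" by (simp add: m_assoc)
  qed (auto simp: G_nonneg)
  moreover have scl_le: "G (scl T c x) \<le> cmod c * G x" if [simp]: "x \<in> carrier T" for c x
  proof (rule G_least)
    fix w z assume *: "w \<in> \<Omega>" "z \<in> carrier T" "w (str T z \<otimes> z) = 1"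
    interpret positive_functional T w C using functional[OF *(1)] .
    have "N z = 1" using * by (simp add: N_def)
    then show "N (scl T c x \<otimes> z) \<le> cmod c * G x"
      using G_ge[OF *(1) _ *(2), of x] * by (simp add: scl_mult_left N_scl mult_left_mono)
  qed (auto simp: G_nonneg)
  have "G (scl T c x) = cmod c * G x" if x: "x \<in> carrier T" for c x
  proof (cases "c = 0")
    case True
    then show ?thesis using scl_le[OF x, of 0] G_nonneg[of "scl T 0 x"] x by simp
  next
    case False
    have "cmod c * G x = cmod c * G (scl T (1 / c) (scl T c x))" using False x by simp
    also have "\<dots> \<le> cmod c * (cmod (1 / c) * G (scl T c x))"
      using x by (intro mult_left_mono scl_le) auto
    also have "\<dots> = G (scl T c x)" using False by (simp add: norm_divide)
    finally show ?thesis using scl_le[OF x, of c] by simp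
  qed
  moreover have "G (str T x \<otimes> x) = (G x)\<^sup>2" if [simp]: "x \<in> carrier T" for x
  proof (rule antisym)
    \<comment> \<open>For \<open>z\<close> of length one, Cauchy--Schwarz for \<open>z\<close> and
      \<open>str T v \<otimes> v \<otimes> z\<close> bounds the squared length of
      \<open>v \<otimes> z\<close>.\<close>
    have sq: "(G v)\<^sup>2 \<le> G (str T v \<otimes> v)" if [simp]: "v \<in> carrier T" for v
    proof -
      have "G v \<le> sqrt (G (str T v \<otimes> v))"
      proof (rule G_least)
        fix w z assume *: "w \<in> \<Omega>" "z \<in> carrier T" "w (str T z \<otimes> z) = 1"
        interpret positive_functional T w C using functional[OF *(1)] .
        have [simp]: "z \<in> carrier T" by fact
        have Nz: "N z = 1" using * by (simp add: N_def)
        have "(N (v \<otimes> z))\<^sup>2 = cmod (w (str T (v \<otimes> z) \<otimes> (v \<otimes> z)))"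
          by (subst N_square) (auto simp del: of_real_power)
        also have "str T (v \<otimes> z) \<otimes> (v \<otimes> z) = str T z \<otimes> (str T v \<otimes> v \<otimes> z)" by (simp add: m_assoc)
        also have "cmod (w \<dots>) \<le> N z * N (str T v \<otimes> v \<otimes> z)" by (rule Cauchy_Schwarz) auto
        also have "\<dots> \<le> G (str T v \<otimes> v)" using G_ge[OF *(1), of "str T v \<otimes> v" z] Nz by simp
        finally show "N (v \<otimes> z) \<le> sqrt (G (str T v \<otimes> v))" by (rule real_le_rsqrt)
      qed (auto simp: G_nonneg)
      then have "(G v)\<^sup>2 \<le> (sqrt (G (str T v \<otimes> v)))\<^sup>2" by (rule power_mono) (simp add: G_nonneg)
      then show ?thesis by (simp add: G_nonneg)
    qed
    then show "(G x)\<^sup>2 \<le> G (str T x \<otimes> x)" by simp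
    \<comment> \<open>\<open>sq\<close> at the adjoint of \<open>x\<close> and submultiplicativity
      suffice, after cancelling one factor.\<close>
    have "G (str T x) \<le> G x"
    proof (cases "G (str T x) = 0")
      case False
      have "G (str T x) * G (str T x) \<le> G x * G (str T x)"
        using sq[of "str T x"] mult_le[of x "str T x"] by (simp add: power2_eq_square)
      then show ?thesis using False G_nonneg[of "str T x"] by (simp add: mult_le_cancel_right)
    qed (simp add: G_nonneg)
    then have "G (str T x) * G x \<le> G x * G x" by (intro mult_right_mono) (auto simp: G_nonneg)
    then show "G (str T x \<otimes> x) \<le> (G x)\<^sup>2"
      using mult_le[of "str T x" x] by (simp add: power2_eq_square)
  qed
  ultimately show ?thesis using G_nonneg by (auto simp: cstar_seminorm_def)
qed

end

section \<open>Positive semidefinite kernels\<close>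

definition psd :: "'i set \<Rightarrow> ('i \<Rightarrow> 'i \<Rightarrow> complex) \<Rightarrow> bool" where
  "psd I K \<longleftrightarrow> (\<forall>c. 0 \<le> (\<Sum>i\<in>I. \<Sum>j\<in>I. cnj (c i) * c j * K i j))"

lemma psdD: "psd I K \<Longrightarrow> 0 \<le> (\<Sum>i\<in>I. \<Sum>j\<in>I. cnj (c i) * c j * K i j)"
  by (simp add: psd_def)

lemma psd_subset:
  assumes "psd I K" "J \<subseteq> I" "finite I" shows "psd J K"
  unfolding psd_def
proof
  fix c :: "'a \<Rightarrow> complex"
  let ?c = "\<lambda>i. if i \<in> J then c i else 0"
  have "(\<Sum>i\<in>I. \<Sum>j\<in>I. cnj (?c i) * ?c j * K i j) = (\<Sum>i\<in>J. \<Sum>j\<in>I. cnj (?c i) * ?c j * K i j)"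
    using assms by (intro sum.mono_neutral_right) auto
  also have "\<dots> = (\<Sum>i\<in>J. \<Sum>j\<in>J. cnj (?c i) * ?c j * K i j)"
    using assms by (intro sum.cong[OF refl] sum.mono_neutral_right) auto
  also have "\<dots> = (\<Sum>i\<in>J. \<Sum>j\<in>J. cnj (c i) * c j * K i j)" by simp
  finally show "0 \<le> (\<Sum>i\<in>J. \<Sum>j\<in>J. cnj (c i) * c j * K i j)" using psdD[OF assms(1), of ?c] by simp
qed

text \<open>Cauchy--Schwarz for the form of \<open>K\<close> on the vector \<open>c\<close> and the
  basis vector at \<open>k\<close>; positivity and symmetry are read off on the way.\<close>

lemma psd_pivot:
  assumes K: "psd I K" and I: "finite I" "k \<in> I"
  shows "0 \<le> K k k"
    and "(\<Sum>i\<in>I. cnj (c i) * K i k) = cnj (\<Sum>j\<in>I. c j * K k j)"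
    and "(cmod (\<Sum>j\<in>I. c j * K k j))\<^sup>2 \<le> Re (\<Sum>i\<in>I. \<Sum>j\<in>I. cnj (c i) * c j * K i j) * Re (K k k)"
proof -
  let ?e = "\<lambda>i. if i = k then 1 else 0 :: complex"
  let ?F = "\<Sum>i\<in>I. \<Sum>j\<in>I. cnj (c i) * c j * K i j"
  have e1: "(\<Sum>i\<in>I. ?e i * g i) = g k" for g using I by (simp add: if_distrib[of "\<lambda>u. u * _"] cong: if_cong)
  show pos: "0 \<le> K k k"
  proof -
    have "(\<Sum>i\<in>I. \<Sum>j\<in>I. cnj (?e i) * ?e j * K i j) = (\<Sum>i\<in>I. ?e i * (\<Sum>j\<in>I. ?e j * K i j))"
      by (simp add: sum_distrib_left mult.assoc if_distrib[of cnj] cong: if_cong)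
    also have "\<dots> = K k k" by (simp only: e1)
    finally show ?thesis using psdD[OF K, of ?e] by simp
  qed
  have "0 \<le> ?F + t * (\<Sum>i\<in>I. cnj (c i) * K i k) + cnj t * (\<Sum>j\<in>I. c j * K k j) + t * cnj t * K k k" for t
  proof -
    have "(\<Sum>i\<in>I. \<Sum>j\<in>I. cnj (c i + t * ?e i) * (c j + t * ?e j) * K i j)
      = (\<Sum>i\<in>I. (\<Sum>j\<in>I. cnj (c i) * c j * K i j) + t * (cnj (c i) * (\<Sum>j\<in>I. ?e j * K i j))
         + cnj t * (?e i * (\<Sum>j\<in>I. c j * K i j)) + t * cnj t * (?e i * (\<Sum>j\<in>I. ?e j * K i j)))"
      by (simp only: sum.distrib[symmetric] sum_distrib_left, intro sum.cong refl)
        (auto simp: algebra_simps)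
    also have "\<dots> = ?F + t * (\<Sum>i\<in>I. cnj (c i) * K i k) + cnj t * (\<Sum>j\<in>I. c j * K k j) + t * cnj t * K k k"
      by (simp only: sum.distrib sum_distrib_left[symmetric] e1)
    finally show ?thesis using psdD[OF K, of "\<lambda>i. c i + t * ?e i"] by simp
  qed
  note cs = sesquilinear_Cauchy_Schwarz[OF this pos]
  show "(\<Sum>i\<in>I. cnj (c i) * K i k) = cnj (\<Sum>j\<in>I. c j * K k j)"
    unfolding cs(1) by (rule complex_cnj_cnj[symmetric])
  show "(cmod (\<Sum>j\<in>I. c j * K k j))\<^sup>2 \<le> Re ?F * Re (K k k)"
    unfolding cs(1) complex_mod_cnj by (rule cs(2))
qed

lemma psd_hermitian:
  assumes "psd I K" "finite I" "k \<in> I" "i \<in> I"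
  shows "K i k = cnj (K k i)"
proof -
  have e1: "(\<Sum>j\<in>I. (if j = i then 1 else 0) * g j) = g i" for g :: "_ \<Rightarrow> complex"
    using assms by (simp add: if_distrib[of "\<lambda>u. u * _"] cong: if_cong)
  show ?thesis
    using psd_pivot(2)[OF assms(1-3), of "\<lambda>j. if j = i then 1 else 0"]
    by (simp only: e1 if_distrib[of cnj] complex_cnj_one complex_cnj_zero)
qed

text \<open>
  Eliminate one index at a time: subtracting from \<open>K\<close> the rank-one
  kernel \<open>K i k * K k j / K k k\<close> clears row and column \<open>k\<close> and keeps it positive semidefinite.
\<close>
lemma psd_Schur_sum:
  assumes "finite I" "psd I K" "psd I L"
  shows "0 \<le> (\<Sum>i\<in>I. \<Sum>j\<in>I. K i j * L i j)"
  using assms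
proof (induction I arbitrary: K L rule: finite_induct)
  case (insert k I)
  let ?I = "insert k I"
  have fin: "finite ?I" and k: "k \<in> ?I" using insert by auto
  \<comment> \<open>A kernel \<open>M\<close> with vanishing row and column at \<open>k\<close>
    contributes nothing there, so the sum lives on \<open>I\<close> and the induction hypothesis
    applies.\<close>
  have clear: "0 \<le> (\<Sum>i\<in>?I. \<Sum>j\<in>?I. M i j * L i j)"
    if M: "psd ?I M" and 0: "\<And>j. j \<in> ?I \<Longrightarrow> M k j = 0" "\<And>j. j \<in> ?I \<Longrightarrow> M j k = 0" for M
  proof -
    have "(\<Sum>i\<in>?I. \<Sum>j\<in>?I. M i j * L i j) = (\<Sum>i\<in>I. \<Sum>j\<in>I. M i j * L i j)"
      using insert.hyps 0 by simp
    moreover have "psd I M" "psd I L"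
      using psd_subset[OF M _ fin] psd_subset[OF insert.prems(2) _ fin] by auto
    ultimately show ?thesis using insert.IH by simp
  qed
  note pivot = psd_pivot[OF insert.prems(1) fin k]
  show ?case
  proof (cases "K k k = 0")
    case True
    \<comment> \<open>A vanishing diagonal entry forces the whole row to vanish by Cauchy--Schwarz,
      so \<open>K\<close> itself can be passed to \<open>clear\<close>.\<close>
    have row: "K k j = 0" if j: "j \<in> ?I" for j
    proof -
      let ?e = "\<lambda>i. if i = j then 1 else 0 :: complex"
      have "(\<Sum>i\<in>?I. ?e i * K k i) = K k j"
        using fin j by (simp add: if_distrib[of "\<lambda>u. u * _"] del: sum.insert cong: if_cong)
      then show ?thesis using pivot(3)[of ?e] True by simp
    qed
    show ?thesis
      using row psd_hermitian[OF insert.prems(1) fin k] by (intro clear insert.prems) auto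
  next
    case False
    define r where "r = Re (K k k)"
    have Kkk: "K k k = of_real r" and r: "r > 0"
      using pivot(1) False by (auto simp: r_def less_eq_complex_def complex_eq_iff)
    define M where "M i j = K i j - K i k * K k j / r" for i j
    have "psd ?I M"
      unfolding psd_def
    proof
      fix c :: "'a \<Rightarrow> complex"
      let ?F = "\<Sum>i\<in>?I. \<Sum>j\<in>?I. cnj (c i) * c j * K i j"
      let ?s = "\<Sum>j\<in>?I. c j * K k j"
      have "(\<Sum>i\<in>?I. \<Sum>j\<in>?I. cnj (c i) * c j * M i j)
        = ?F - (\<Sum>i\<in>?I. cnj (c i) * K i k) * ?s / r"
        by (simp only: M_def right_diff_distrib sum_subtractf sum_product sum_divide_distrib)
          (simp only: times_divide_eq_right mult_ac)
      also have "\<dots> = ?F - of_real ((cmod ?s)\<^sup>2 / r)"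
        unfolding pivot(2) by (simp only: of_real_divide complex_norm_square mult.commute)
      also have "0 \<le> \<dots>"
        using psdD[OF insert.prems(1), of c] pivot(3)[of c] r Kkk
        by (simp only: less_eq_complex_def) (simp only: minus_complex.sel Re_complex_of_real Im_complex_of_real zero_complex.sel, simp add: field_simps)
      finally show "0 \<le> (\<Sum>i\<in>?I. \<Sum>j\<in>?I. cnj (c i) * c j * M i j)" .
    qed
    then have MpL: "0 \<le> (\<Sum>i\<in>?I. \<Sum>j\<in>?I. M i j * L i j)"
    proof (rule clear)
      show "M k j = 0" "M j k = 0" for j using r by (simp_all add: M_def Kkk)
    qed
    \<comment> \<open>Paired with \<open>L\<close>, the subtracted kernel is, up to the positive
      factor \<open>1 / r\<close>, the form of \<open>L\<close> at the vector
      \<open>K k\<close>.\<close>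
    have rank_one: "0 \<le> (\<Sum>i\<in>?I. \<Sum>j\<in>?I. cnj (K k i) * K k j * L i j) / r"
      using psdD[OF insert.prems(2), of "K k"] r
      by (simp only: less_eq_complex_def) (simp only: Re_divide_of_real Im_divide_of_real zero_complex.sel, simp)
    have split: "(\<Sum>i\<in>?I. \<Sum>j\<in>?I. K i j * L i j)
      = (\<Sum>i\<in>?I. \<Sum>j\<in>?I. M i j * L i j) + (\<Sum>i\<in>?I. \<Sum>j\<in>?I. cnj (K k i) * K k j * L i j) / r"
    proof -
      have "K i j * L i j = M i j * L i j + cnj (K k i) * K k j * L i j / r" if "i \<in> ?I" for i j
        using psd_hermitian[OF insert.prems(1) fin k that] by (simp add: M_def algebra_simps)
      then show ?thesis
        by (simp only: sum_divide_distrib sum.distrib[symmetric] cong: sum.cong)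
    qed
    show ?thesis unfolding split by (rule add_nonneg_nonneg[OF MpL rank_one])
  qed
qed simp

section \<open>The minimal tensor product\<close>

context involutive_monoid
begin

definition l1 :: "('m \<Rightarrow> real) \<Rightarrow> ('m \<Rightarrow> complex) \<Rightarrow> real" where
  "l1 v f = (\<Sum>x\<in>supp f. cmod (f x) * v x)"

lemma lin_le_l1: "(\<And>x. x \<in> supp f \<Longrightarrow> cmod (\<Phi> x) \<le> v x) \<Longrightarrow> cmod (lin f \<Phi>) \<le> l1 v f"
  unfolding lin_def l1_def
  by (rule order.trans[OF norm_sum]) (auto simp: norm_mult intro!: sum_mono mult_left_mono)

text \<open>The phases of the coefficients \<open>f x\<close> are absorbed into
  \<open>\<Phi>\<close>, so the norm is attained by a functional dominated by the weight; estimates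
  for products and adjoints then follow from the formulas for \<open>lin\<close>.\<close>

lemma l1_eq_lin:
  assumes "\<And>x. x \<in> supp f \<Longrightarrow> 0 \<le> v x"
  obtains \<Phi> where "of_real (l1 v f) = lin f \<Phi>" "\<And>x. cmod (\<Phi> x) \<le> \<bar>v x\<bar>"
proof
  let ?\<Phi> = "\<lambda>x. cnj (sgn (f x)) * of_real (v x)"
  have "f x * cnj (sgn (f x)) = of_real (cmod (f x))" for x
    by (cases "f x = 0") (simp_all add: sgn_div_norm scaleR_conv_of_real complex_norm_square[symmetric] power2_eq_square field_simps)
  then show "of_real (l1 v f) = lin f ?\<Phi>"
    by (simp add: l1_def lin_def mult.assoc[symmetric])
  show "cmod (?\<Phi> x) \<le> \<bar>v x\<bar>" for x
    by (cases "f x = 0") (simp_all add: norm_mult norm_sgn)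
qed

context
  fixes v :: "'m \<Rightarrow> real"
  assumes v_nonneg: "\<And>x. x \<in> carrier M \<Longrightarrow> 0 \<le> v x"
    and v_mult: "\<And>x y. x \<in> carrier M \<Longrightarrow> y \<in> carrier M \<Longrightarrow> v (x \<otimes>\<^bsub>M\<^esub> y) \<le> v x * v y"
    and v_st: "\<And>x. x \<in> carrier M \<Longrightarrow> v (st x) \<le> v x"
begin

lemma l1_nonneg: "f \<in> carrier MA \<Longrightarrow> 0 \<le> l1 v f"
  by (auto simp: l1_def supp_carrier v_nonneg intro!: sum_nonneg)

lemma l1_mult:
  assumes f: "f \<in> carrier MA" and g: "g \<in> carrier MA"
  shows "l1 v (f \<otimes>\<^bsub>MA\<^esub> g) \<le> l1 v f * l1 v g"
proof -
  have fg: "f \<otimes>\<^bsub>MA\<^esub> g \<in> carrier MA" using f g by simp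
  obtain \<Phi> where \<Phi>: "of_real (l1 v (f \<otimes>\<^bsub>MA\<^esub> g)) = lin (f \<otimes>\<^bsub>MA\<^esub> g) \<Phi>" "\<And>x. cmod (\<Phi> x) \<le> \<bar>v x\<bar>"
    using l1_eq_lin[of "f \<otimes>\<^bsub>MA\<^esub> g" v] supp_carrier[OF fg] v_nonneg by blast
  have \<Phi>v: "cmod (\<Phi> x) \<le> v x" if "x \<in> carrier M" for x
    using \<Phi>(2)[of x] v_nonneg[OF that] by simp
  have "l1 v (f \<otimes>\<^bsub>MA\<^esub> g) \<le> cmod (of_real (l1 v (f \<otimes>\<^bsub>MA\<^esub> g)))" by simp
  also have "\<dots> = cmod (lin f (\<lambda>x. lin g (\<lambda>y. \<Phi> (x \<otimes>\<^bsub>M\<^esub> y))))"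
    unfolding \<Phi>(1) lin_MA_mult[OF f g] ..
  also have "\<dots> \<le> l1 (\<lambda>x. v x * l1 v g) f"
  proof (rule lin_le_l1)
    fix x assume "x \<in> supp f"
    then have x: "x \<in> carrier M" using supp_carrier[OF f] by simp
    have "cmod (lin g (\<lambda>y. \<Phi> (x \<otimes>\<^bsub>M\<^esub> y))) \<le> l1 (\<lambda>y. v x * v y) g"
      using x supp_carrier[OF g] \<Phi>v v_mult by (intro lin_le_l1) (meson M.m_closed order_trans)
    also have "\<dots> = v x * l1 v g" by (simp add: l1_def sum_distrib_left mult_ac)
    finally show "cmod (lin g (\<lambda>y. \<Phi> (x \<otimes>\<^bsub>M\<^esub> y))) \<le> v x * l1 v g" .
  qed
  also have "\<dots> = l1 v f * l1 v g" by (simp add: l1_def sum_distrib_right mult.assoc)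
  finally show ?thesis .
qed

lemma l1_str:
  assumes f: "f \<in> carrier MA"
  shows "l1 v (str MA f) \<le> l1 v f"
proof -
  have sf: "str MA f \<in> carrier MA" using f by simp
  obtain \<Phi> where \<Phi>: "of_real (l1 v (str MA f)) = lin (str MA f) \<Phi>" "\<And>x. cmod (\<Phi> x) \<le> \<bar>v x\<bar>"
    using l1_eq_lin[of "str MA f" v] supp_carrier[OF sf] v_nonneg by blast
  have "l1 v (str MA f) \<le> cmod (of_real (l1 v (str MA f)))" by simp
  also have "\<dots> = cmod (lin f (\<lambda>x. cnj (\<Phi> (st x))))"
    unfolding \<Phi>(1) lin_MA_str[OF f] by simp
  also have "\<dots> \<le> l1 v f"
  proof (rule lin_le_l1)
    fix x assume "x \<in> supp f"
    then have x: "x \<in> carrier M" using supp_carrier[OF f] by simp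
    show "cmod (cnj (\<Phi> (st x))) \<le> v x"
      using \<Phi>(2)[of "st x"] v_nonneg[of "st x"] v_st[OF x] x by simp
  qed
  finally show ?thesis .
qed

end

lemma lin_str_mult:
  assumes f: "f \<in> carrier MA"
  shows "lin (str MA f \<otimes>\<^bsub>MA\<^esub> f) \<Phi> = (\<Sum>x\<in>supp f. \<Sum>y\<in>supp f. cnj (f x) * f y * \<Phi> (st x \<otimes>\<^bsub>M\<^esub> y))"
  using f by (simp add: lin_MA_mult lin_MA_str) (simp add: lin_def sum_distrib_left mult.assoc)

end

section \<open>States and their Gram kernels\<close>

locale state_on = cstar_alg A for A :: "('a, 'm) cstar_scheme" (structure) +
  fixes \<phi> :: "'a \<Rightarrow> complex"
  assumes state: "state A \<phi>"
begin

lemma state_add: "x \<in> carrier A \<Longrightarrow> y \<in> carrier A \<Longrightarrow> \<phi> (x \<oplus> y) = \<phi> x + \<phi> y"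
  and state_scl: "x \<in> carrier A \<Longrightarrow> \<phi> (scl A c x) = c * \<phi> x"
  and state_le: "x \<in> carrier A \<Longrightarrow> cmod (\<phi> x) \<le> nrm A x"
  and state_pos: "x \<in> carrier A \<Longrightarrow> 0 \<le> \<phi> (str A x \<otimes> x)"
  using state by (auto simp: state_def less_eq_complex_def)

lemma state_finsum:
  "finite I \<Longrightarrow> f \<in> I \<rightarrow> carrier A \<Longrightarrow> \<phi> (finsum A f I) = (\<Sum>i\<in>I. \<phi> (f i))"
proof (induction I rule: finite_induct)
  case empty
  then show ?case using state_scl[of \<zero> 0] by simp
qed (simp add: Pi_def state_add finsum_closed)

text \<open>The quadratic form at \<open>c\<close> is \<open>\<phi> (str A X \<otimes> X)\<close>,
  where \<open>X\<close> is the linear combination of the \<open>a i\<close> with coefficients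
  \<open>c i\<close>.\<close>

lemma psd_state:
  assumes I: "finite I" and a: "\<And>i. i \<in> I \<Longrightarrow> a i \<in> carrier A"
  shows "psd I (\<lambda>i j. \<phi> (str A (a i) \<otimes> a j))"
  unfolding psd_def
proof
  fix c
  let ?X = "finsum A (\<lambda>i. scl A (c i) (a i)) I"
  have X: "?X \<in> carrier A" using a by (intro finsum_closed) auto
  have "str A ?X = finsum A (\<lambda>i. scl A (cnj (c i)) (str A (a i))) I"
    using a I by (subst finsum_str) (auto intro!: finsum_cong')
  then have "str A ?X \<otimes> ?X = finsum A (\<lambda>i. scl A (cnj (c i)) (str A (a i)) \<otimes> ?X) I"
    using a I X by (simp only:) (intro finsum_ldistr; auto)
  also have "\<phi> \<dots> = (\<Sum>i\<in>I. \<phi> (scl A (cnj (c i)) (str A (a i)) \<otimes> ?X))"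
    using a I X by (intro state_finsum) auto
  also have "\<dots> = (\<Sum>i\<in>I. \<Sum>j\<in>I. cnj (c i) * c j * \<phi> (str A (a i) \<otimes> a j))"
  proof (rule sum.cong[OF refl])
    fix i assume i: "i \<in> I"
    have "scl A (cnj (c i)) (str A (a i)) \<otimes> ?X
      = finsum A (\<lambda>j. scl A (cnj (c i)) (str A (a i)) \<otimes> scl A (c j) (a j)) I"
      using a I i by (intro finsum_rdistr) auto
    also have "\<phi> \<dots> = (\<Sum>j\<in>I. \<phi> (scl A (cnj (c i)) (str A (a i)) \<otimes> scl A (c j) (a j)))"
      using a I i by (intro state_finsum) auto
    also have "\<dots> = (\<Sum>j\<in>I. cnj (c i) * c j * \<phi> (str A (a i) \<otimes> a j))"
      using a i by (intro sum.cong refl) (simp add: scl_mult_left scl_mult_right state_scl mult.commute)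
    finally show "\<phi> (scl A (cnj (c i)) (str A (a i)) \<otimes> ?X) = (\<Sum>j\<in>I. cnj (c i) * c j * \<phi> (str A (a i) \<otimes> a j))" .
  qed
  finally show "0 \<le> (\<Sum>i\<in>I. \<Sum>j\<in>I. cnj (c i) * c j * \<phi> (str A (a i) \<otimes> a j))"
    using state_pos[OF X] by simp
qed

end

section \<open>The spatial seminorm as a GNS seminorm\<close>

locale tensor = A: cstar_alg A + B: cstar_alg B
  for A :: "('a, 'm) cstar_scheme" and B :: "('b, 'k) cstar_scheme"
begin

sublocale T: involutive_monoid "A \<times>\<times> B" "\<lambda>(a, b). (str A a, str B b)"
  by (intro involutive_monoid.intro involutive_monoid_axioms.intro DirProd_monoid A.monoid_axioms B.monoid_axioms)
    (auto simp: DirProd_def)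

abbreviation "T \<equiv> pre_tensor A B"

lemma T_def: "T = T.MA"
  by (simp add: pre_tensor_def)

lemma carrier_DirProd: "carrier (A \<times>\<times> B) = carrier A \<times> carrier B"
  and mult_DirProd_case: "x \<otimes>\<^bsub>A \<times>\<times> B\<^esub> y = (fst x \<otimes>\<^bsub>A\<^esub> fst y, snd x \<otimes>\<^bsub>B\<^esub> snd y)"
  and one_DirProd': "\<one>\<^bsub>A \<times>\<times> B\<^esub> = (\<one>\<^bsub>A\<^esub>, \<one>\<^bsub>B\<^esub>)"
  by (simp_all add: DirProd_def case_prod_unfold)

text \<open>Each term is weighted with the product of the norms of its two legs; this dominates
  every product of states and supplies the bound \<open>C\<close> for all of them at once.\<close>

definition l1_norm :: "('a \<times> 'b \<Rightarrow> complex) \<Rightarrow> real" where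
  "l1_norm = T.l1 (\<lambda>(a, b). nrm A a * nrm B b)"

lemma product_functional_lin: "product_functional \<phi> \<psi> f = lin f (\<lambda>(a, b). \<phi> a * \<psi> b)"
  by (simp add: product_functional_def lin_def case_prod_unfold mult.assoc)

text \<open>Expanding the functional at the product of \<open>x\<close> with its adjoint gives a sum
  over pairs of terms of \<open>x\<close>, whose entries are products of two Gram kernels;
  positivity is then an instance of \<open>psd_Schur_sum\<close>.\<close>

lemma positive_product:
  assumes \<phi>: "state A \<phi>" and \<psi>: "state B \<psi>"
  shows "positive_functional T (product_functional \<phi> \<psi>) l1_norm"
proof -
  interpret \<phi>: state_on A \<phi> using \<phi> A.cstar_alg_axioms by (simp add: state_on_def state_on_axioms_def)
  interpret \<psi>: state_on B \<psi> using \<psi> B.cstar_alg_axioms by (simp add: state_on_def state_on_axioms_def)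
  let ?v = "\<lambda>(a, b). nrm A a * nrm B b"
  have v: "\<And>x. x \<in> carrier (A \<times>\<times> B) \<Longrightarrow> 0 \<le> ?v x"
    "\<And>x y. x \<in> carrier (A \<times>\<times> B) \<Longrightarrow> y \<in> carrier (A \<times>\<times> B) \<Longrightarrow> ?v (x \<otimes>\<^bsub>A \<times>\<times> B\<^esub> y) \<le> ?v x * ?v y"
    "\<And>x. x \<in> carrier (A \<times>\<times> B) \<Longrightarrow> ?v ((\<lambda>(a, b). (str A a, str B b)) x) \<le> ?v x"
  proof -
    fix x y assume "x \<in> carrier (A \<times>\<times> B)" "y \<in> carrier (A \<times>\<times> B)"
    then have xy: "fst x \<in> carrier A" "fst y \<in> carrier A" "snd x \<in> carrier B" "snd y \<in> carrier B"
      by (auto simp: carrier_DirProd)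
    have "nrm A (fst x \<otimes>\<^bsub>A\<^esub> fst y) * nrm B (snd x \<otimes>\<^bsub>B\<^esub> snd y)
      \<le> (nrm A (fst x) * nrm A (fst y)) * (nrm B (snd x) * nrm B (snd y))"
      using xy by (intro mult_mono A.p_mult B.p_mult) auto
    then show "?v (x \<otimes>\<^bsub>A \<times>\<times> B\<^esub> y) \<le> ?v x * ?v y"
      by (simp add: mult_DirProd_case case_prod_unfold mult_ac)
  qed (auto simp: carrier_DirProd)
  show ?thesis
    unfolding T_def
  proof (intro positive_functional.intro positive_functional_axioms.intro T.MA.star_alg_axioms)
    fix x y c assume x: "x \<in> carrier T.MA" and y: "y \<in> carrier T.MA"
    show "product_functional \<phi> \<psi> (x \<oplus>\<^bsub>T.MA\<^esub> y) = product_functional \<phi> \<psi> x + product_functional \<phi> \<psi> y"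
      using x y by (simp add: product_functional_lin)
    show "product_functional \<phi> \<psi> (scl T.MA c x) = c * product_functional \<phi> \<psi> x"
      by (simp add: product_functional_lin)
    show "0 \<le> l1_norm x"
      unfolding l1_norm_def by (rule T.l1_nonneg[OF v x])
    show "l1_norm (x \<otimes>\<^bsub>T.MA\<^esub> y) \<le> l1_norm x * l1_norm y"
      unfolding l1_norm_def by (rule T.l1_mult[OF v x y])
    show "l1_norm (str T.MA x) \<le> l1_norm x"
      unfolding l1_norm_def by (rule T.l1_str[OF v x])
    show "cmod (product_functional \<phi> \<psi> x) \<le> l1_norm x"
      unfolding product_functional_lin l1_norm_def
      using T.supp_carrier[OF x] \<phi>.state_le \<psi>.state_le
      by (intro T.lin_le_l1) (force simp: norm_mult carrier_DirProd intro!: mult_mono)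
    show "0 \<le> product_functional \<phi> \<psi> (str T.MA x \<otimes>\<^bsub>T.MA\<^esub> x)"
    proof -
      let ?S = "supp x"
      have S: "finite ?S" "\<And>s. s \<in> ?S \<Longrightarrow> fst s \<in> carrier A \<and> snd s \<in> carrier B"
        using T.finite_supp[OF x] T.supp_carrier[OF x] by (auto simp: carrier_DirProd)
      have "psd ?S (\<lambda>s t. \<phi> (str A (fst s) \<otimes>\<^bsub>A\<^esub> fst t))" "psd ?S (\<lambda>s t. \<psi> (str B (snd s) \<otimes>\<^bsub>B\<^esub> snd t))"
        using S by (auto intro!: \<phi>.psd_state \<psi>.psd_state)
      \<comment> \<open>The coefficients of \<open>x\<close> are absorbed into the first kernel,
        where they only rescale the test vector.\<close>
      moreover from this(1) have "psd ?S (\<lambda>s t. cnj (x s) * x t * \<phi> (str A (fst s) \<otimes>\<^bsub>A\<^esub> fst t))"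
        unfolding psd_def
      proof (intro allI)
        fix c assume "\<forall>c. 0 \<le> (\<Sum>i\<in>?S. \<Sum>j\<in>?S. cnj (c i) * c j * \<phi> (str A (fst i) \<otimes>\<^bsub>A\<^esub> fst j))"
        from spec[OF this, of "\<lambda>s. c s * x s"]
        show "0 \<le> (\<Sum>i\<in>?S. \<Sum>j\<in>?S. cnj (c i) * c j * (cnj (x i) * x j * \<phi> (str A (fst i) \<otimes>\<^bsub>A\<^esub> fst j)))"
          by (simp add: mult_ac)
      qed
      ultimately have "0 \<le> (\<Sum>s\<in>?S. \<Sum>t\<in>?S. cnj (x s) * x t * \<phi> (str A (fst s) \<otimes>\<^bsub>A\<^esub> fst t)
          * \<psi> (str B (snd s) \<otimes>\<^bsub>B\<^esub> snd t))"
        using S(1) by (intro psd_Schur_sum)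
      then show ?thesis
        unfolding product_functional_lin T.lin_str_mult[OF x]
        by (simp add: mult_DirProd_case case_prod_unfold mult.assoc)
    qed
  qed
qed

definition product_states :: "(('a \<times> 'b \<Rightarrow> complex) \<Rightarrow> complex) set" where
  "product_states = {product_functional \<phi> \<psi> | \<phi> \<psi>. state A \<phi> \<and> state B \<psi>}"

lemma spatial_gns: "spatial_seminorm A B = gns_seminorm T product_states"
proof
  fix x
  have "{sqrt (Re (product_functional \<phi> \<psi> (str T y \<otimes>\<^bsub>T\<^esub> (str T x \<otimes>\<^bsub>T\<^esub> x) \<otimes>\<^bsub>T\<^esub> y))) | \<phi> \<psi> y.
          state A \<phi> \<and> state B \<psi> \<and> y \<in> carrier T \<and> product_functional \<phi> \<psi> (str T y \<otimes>\<^bsub>T\<^esub> y) = 1}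
    = {sqrt (Re (w (str T y \<otimes>\<^bsub>T\<^esub> (str T x \<otimes>\<^bsub>T\<^esub> x) \<otimes>\<^bsub>T\<^esub> y))) | w y.
     w \<in> product_states \<and> y \<in> carrier T \<and> w (str T y \<otimes>\<^bsub>T\<^esub> y) = 1}"
    unfolding product_states_def by (intro Collect_cong) blast
  then show "spatial_seminorm A B x = gns_seminorm T product_states x"
    by (simp only: spatial_seminorm_def gns_seminorm_def Let_def)
qed

sublocale G: positive_functionals T product_states l1_norm
proof (intro positive_functionals.intro positive_functionals_axioms.intro)
  show "star_alg T" using T.MA.star_alg_axioms by (simp add: T_def)
  show "positive_functional T w l1_norm" if "w \<in> product_states" for w
    using that positive_product by (auto simp: product_states_def)
  show "0 \<le> l1_norm x" if "x \<in> carrier T" for x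
    unfolding l1_norm_def T.l1_def using that T.supp_carrier
    by (force simp: T_def carrier_DirProd intro!: sum_nonneg mult_nonneg_nonneg)
qed

sublocale S: seminormed_star_alg T "spatial_seminorm A B"
  using G.G_seminorm G.star_alg_axioms by (simp add: seminormed_star_alg_iff star_alg_iff spatial_gns)

abbreviation "D \<equiv> min_tensor A B"

abbreviation "t \<equiv> tns A B"

lemma D_def: "D = completion T (spatial_seminorm A B)"
  by (simp add: min_tensor_def)

sublocale D: cstar_alg D
  unfolding D_def by (rule S.cstar_alg_Cp)

lemma t_def: "t a b = incl T (spatial_seminorm A B) (delta (a, b))"
  by (simp add: tns_def)

lemma delta_T [simp, intro]: "a \<in> carrier A \<Longrightarrow> b \<in> carrier B \<Longrightarrow> delta (a, b) \<in> carrier T"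
  by (simp add: T_def carrier_DirProd)

lemma t_closed [simp, intro]: "a \<in> carrier A \<Longrightarrow> b \<in> carrier B \<Longrightarrow> t a b \<in> carrier D"
  unfolding t_def D_def by (intro S.inc_closed) auto

sublocale I: star_hom_pair T D "incl T (spatial_seminorm A B)"
  using S.star_hom_inc G.star_alg_axioms D.star_alg_axioms by (intro star_hom_pairI) (simp_all add: D_def)

lemma t_mult:
  assumes "a \<in> carrier A" "b \<in> carrier B" "a' \<in> carrier A" "b' \<in> carrier B"
  shows "t a b \<otimes>\<^bsub>D\<^esub> t a' b' = t (a \<otimes>\<^bsub>A\<^esub> a') (b \<otimes>\<^bsub>B\<^esub> b')"
proof -
  have "delta (a, b) \<otimes>\<^bsub>T\<^esub> delta (a', b') = delta (a \<otimes>\<^bsub>A\<^esub> a', b \<otimes>\<^bsub>B\<^esub> b')"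
    using assms T.delta_mult[of "(a, b)" "(a', b')"] by (simp add: carrier_DirProd mult_DirProd_case T_def)
  then show ?thesis using I.hom_mult[of "delta (a, b)" "delta (a', b')"] assms by (simp add: t_def)
qed

lemma t_str:
  assumes "a \<in> carrier A" "b \<in> carrier B"
  shows "str D (t a b) = t (str A a) (str B b)"
proof -
  have "str T (delta (a, b)) = delta (str A a, str B b)"
    using assms T.str_delta[of "(a, b)"] by (simp add: carrier_DirProd T_def)
  then show ?thesis using I.hom_str[of "delta (a, b)"] assms by (simp add: t_def)
qed

lemma t_one: "t \<one>\<^bsub>A\<^esub> \<one>\<^bsub>B\<^esub> = \<one>\<^bsub>D\<^esub>"
  using I.hom_one by (simp add: t_def T_def T.one_MA one_DirProd')

text \<open>In \<open>T\<close> simple tensors are formal symbols, so bilinearity can only come from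
  elements of seminorm zero. The squared length of \<open>x \<otimes> y\<close> in a GNS space
  expands into values of a product state at \<open>x\<close> multiplied on both sides by simple
  tensors, and these vanish by \<open>null\<close>.\<close>

lemma spatial_null:
  assumes x: "x \<in> carrier T"
    and null: "\<And>\<phi> \<psi> c d c' d'. state A \<phi> \<Longrightarrow> state B \<psi> \<Longrightarrow> c \<in> carrier A \<Longrightarrow> c' \<in> carrier A \<Longrightarrow>
      d \<in> carrier B \<Longrightarrow> d' \<in> carrier B \<Longrightarrow>
      lin x (\<lambda>(a, b). \<phi> (c \<otimes>\<^bsub>A\<^esub> (a \<otimes>\<^bsub>A\<^esub> c')) * \<psi> (d \<otimes>\<^bsub>B\<^esub> (b \<otimes>\<^bsub>B\<^esub> d'))) = 0"
  shows "incl T (spatial_seminorm A B) x = \<zero>\<^bsub>D\<^esub>"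
proof -
  have "spatial_seminorm A B x \<le> 0"
    unfolding spatial_gns
  proof (rule G.G_least[OF x])
    fix w y assume *: "w \<in> product_states" "y \<in> carrier T" "w (str T y \<otimes>\<^bsub>T\<^esub> y) = 1"
    then obtain \<phi> \<psi> where w: "w = product_functional \<phi> \<psi>" "state A \<phi>" "state B \<psi>"
      by (auto simp: product_states_def)
    let ?z = "str T (x \<otimes>\<^bsub>T\<^esub> y)"
    have z: "?z \<in> carrier T" using x * by simp
    have "w (?z \<otimes>\<^bsub>T\<^esub> (x \<otimes>\<^bsub>T\<^esub> y)) = lin ?z (\<lambda>s. lin x (\<lambda>u. lin y (\<lambda>v.
        (\<lambda>(a, b). \<phi> a * \<psi> b) (s \<otimes>\<^bsub>A \<times>\<times> B\<^esub> (u \<otimes>\<^bsub>A \<times>\<times> B\<^esub> v)))))"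
      using x z *(2) unfolding w product_functional_lin T_def
      by (subst T.lin_MA_mult) (auto simp: T.lin_MA_mult)
    \<comment> \<open>Moving the sum over \<open>x\<close> inside exposes the expression that
      \<open>null\<close> annihilates.\<close>
    also have "\<dots> = lin ?z (\<lambda>s. lin y (\<lambda>v. lin x (\<lambda>u.
        (\<lambda>(a, b). \<phi> a * \<psi> b) (s \<otimes>\<^bsub>A \<times>\<times> B\<^esub> (u \<otimes>\<^bsub>A \<times>\<times> B\<^esub> v)))))"
      by (subst lin_swap) simp
    also have "\<dots> = lin ?z (\<lambda>s. lin y (\<lambda>v. 0))"
      using z *(2) null[OF w(2,3)] unfolding T_def
      by (intro T.lin_cong_carrier) (auto simp: carrier_DirProd mult_DirProd_case case_prod_unfold)
    finally show "positive_functional.N T w (x \<otimes>\<^bsub>T\<^esub> y) \<le> 0"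
      using positive_functional.N_def[OF G.functional[OF *(1)]] by simp
  qed simp
  then have "nrm D (incl T (spatial_seminorm A B) x) = 0"
    using x S.nrm_inc[OF x] S.p_nonneg[OF x] by (simp add: D_def)
  then show ?thesis using D.nrm_eq_0_iff x I.closed by blast
qed

lemma t_eqI:
  assumes x: "x \<in> carrier T" and y: "y \<in> carrier T"
    and "\<And>\<phi> \<psi> c d c' d'. state A \<phi> \<Longrightarrow> state B \<psi> \<Longrightarrow> c \<in> carrier A \<Longrightarrow> c' \<in> carrier A \<Longrightarrow>
      d \<in> carrier B \<Longrightarrow> d' \<in> carrier B \<Longrightarrow>
      lin x (\<lambda>(a, b). \<phi> (c \<otimes>\<^bsub>A\<^esub> (a \<otimes>\<^bsub>A\<^esub> c')) * \<psi> (d \<otimes>\<^bsub>B\<^esub> (b \<otimes>\<^bsub>B\<^esub> d')))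
      = lin y (\<lambda>(a, b). \<phi> (c \<otimes>\<^bsub>A\<^esub> (a \<otimes>\<^bsub>A\<^esub> c')) * \<psi> (d \<otimes>\<^bsub>B\<^esub> (b \<otimes>\<^bsub>B\<^esub> d')))"
  shows "incl T (spatial_seminorm A B) x = incl T (spatial_seminorm A B) y"
proof -
  have "incl T (spatial_seminorm A B) (x \<ominus>\<^bsub>T\<^esub> y) = \<zero>\<^bsub>D\<^esub>"
    using assms T.lin_MA_diff[of x y] by (intro spatial_null) (auto simp: T_def)
  then show ?thesis using x y D.minus_zero_iff by simp
qed

lemma state_simps:
  assumes "state A \<phi>" "state B \<psi>"
  shows "a \<in> carrier A \<Longrightarrow> a' \<in> carrier A \<Longrightarrow> \<phi> (a \<oplus>\<^bsub>A\<^esub> a') = \<phi> a + \<phi> a'"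
    "b \<in> carrier B \<Longrightarrow> b' \<in> carrier B \<Longrightarrow> \<psi> (b \<oplus>\<^bsub>B\<^esub> b') = \<psi> b + \<psi> b'"
    "a \<in> carrier A \<Longrightarrow> \<phi> (scl A c a) = c * \<phi> a"
    "b \<in> carrier B \<Longrightarrow> \<psi> (scl B c b) = c * \<psi> b"
  using assms by (auto simp: state_def)

lemma t_add_left:
  assumes "a \<in> carrier A" "a' \<in> carrier A" "b \<in> carrier B"
  shows "t (a \<oplus>\<^bsub>A\<^esub> a') b = t a b \<oplus>\<^bsub>D\<^esub> t a' b"
proof -
  have "incl T (spatial_seminorm A B) (delta (a \<oplus>\<^bsub>A\<^esub> a', b))
    = incl T (spatial_seminorm A B) (delta (a, b) \<oplus>\<^bsub>T\<^esub> delta (a', b))"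
    using assms by (intro t_eqI; simp add: T_def carrier_DirProd state_simps A.l_distr A.r_distr distrib_right)
  then show ?thesis using assms by (simp add: t_def)
qed

lemma t_add_right:
  assumes "a \<in> carrier A" "b' \<in> carrier B" "b \<in> carrier B"
  shows "t a (b \<oplus>\<^bsub>B\<^esub> b') = t a b \<oplus>\<^bsub>D\<^esub> t a b'"
proof -
  have "incl T (spatial_seminorm A B) (delta (a, b \<oplus>\<^bsub>B\<^esub> b'))
    = incl T (spatial_seminorm A B) (delta (a, b) \<oplus>\<^bsub>T\<^esub> delta (a, b'))"
    using assms by (intro t_eqI; simp add: T_def carrier_DirProd state_simps B.l_distr B.r_distr distrib_left)
  then show ?thesis using assms by (simp add: t_def)
qed

lemma t_scl_left:
  assumes "a \<in> carrier A" "b \<in> carrier B"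
  shows "t (scl A c a) b = scl D c (t a b)"
proof -
  have "incl T (spatial_seminorm A B) (delta (scl A c a, b))
    = incl T (spatial_seminorm A B) (scl T c (delta (a, b)))"
    using assms by (intro t_eqI; simp add: T_def carrier_DirProd state_simps A.scl_mult_left A.scl_mult_right)
  then show ?thesis using assms by (simp add: t_def)
qed

lemma t_scl_right:
  assumes "a \<in> carrier A" "b \<in> carrier B"
  shows "t a (scl B c b) = scl D c (t a b)"
proof -
  have "incl T (spatial_seminorm A B) (delta (a, scl B c b))
    = incl T (spatial_seminorm A B) (scl T c (delta (a, b)))"
    using assms by (intro t_eqI; simp add: T_def carrier_DirProd state_simps B.scl_mult_left B.scl_mult_right mult.left_commute)
  then show ?thesis using assms by (simp add: t_def)
qed

lemma t_zero_left [simp]: "b \<in> carrier B \<Longrightarrow> t \<zero>\<^bsub>A\<^esub> b = \<zero>\<^bsub>D\<^esub>"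
  using t_scl_left[of "\<zero>\<^bsub>A\<^esub>" b 0] by simp

lemma t_zero_right [simp]: "a \<in> carrier A \<Longrightarrow> t a \<zero>\<^bsub>B\<^esub> = \<zero>\<^bsub>D\<^esub>"
  using t_scl_right[of a "\<zero>\<^bsub>B\<^esub>" 0] by simp

lemma t_finsum_left:
  "finite I \<Longrightarrow> f \<in> I \<rightarrow> carrier A \<Longrightarrow> b \<in> carrier B \<Longrightarrow>
    t (finsum A f I) b = finsum D (\<lambda>i. t (f i) b) I"
  by (induction I rule: finite_induct) (simp_all add: Pi_def t_add_left A.finsum_closed)

lemma t_finsum_right:
  "finite I \<Longrightarrow> f \<in> I \<rightarrow> carrier B \<Longrightarrow> a \<in> carrier A \<Longrightarrow>
    t a (finsum B f I) = finsum D (\<lambda>i. t a (f i)) I"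
  by (induction I rule: finite_induct) (simp_all add: Pi_def t_add_right B.finsum_closed)

end

section \<open>Functoriality of the tensor square\<close>

lemma state_pullback:
  assumes "star_hom_pair A B f" "state B \<phi>" "\<And>x. x \<in> carrier A \<Longrightarrow> nrm B (f x) \<le> nrm A x"
  shows "state A (\<lambda>x. \<phi> (f x))"
proof -
  interpret star_hom_pair A B f by fact
  show ?thesis
    using assms(2) unfolding state_def by (auto intro: order_trans[OF _ assms(3)])
qed

text \<open>States of \<open>B\<close> pull back to states of \<open>A\<close>, and test vectors for
  \<open>B\<close> lift because \<open>f\<close> is onto. Lengths are preserved by this
  correspondence, so every quantity in the supremum for the image is bounded by the seminorm of
  \<open>x\<close> itself.\<close>

lemma tensor_square_hom:
  fixes A :: "('a, 'm) cstar_scheme" and B :: "('b, 'k) cstar_scheme"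
  assumes A: "cstar_alg A" and B: "cstar_alg B" and f: "star_hom A B f"
    and le: "\<And>x. x \<in> carrier A \<Longrightarrow> nrm B (f x) \<le> nrm A x"
    and surj: "f ` carrier A = carrier B"
  obtains \<Theta> where "star_hom (min_tensor A A) (min_tensor B B) \<Theta>"
    "\<And>a b. a \<in> carrier A \<Longrightarrow> b \<in> carrier A \<Longrightarrow> \<Theta> (tns A A a b) = tns B B (f a) (f b)"
proof -
  interpret AA: tensor A A using A by (simp add: tensor_def)
  interpret BB: tensor B B using B by (simp add: tensor_def)
  interpret f: star_hom_pair A B f
    using f AA.A.star_alg_axioms BB.A.star_alg_axioms by (intro star_hom_pairI)
  let ?h = "\<lambda>(a, b). delta (f a, f b)"
  \<comment> \<open>The map \<open>f \<otimes> f\<close> on formal sums, before completion.\<close>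
  let ?push = "AA.T.extend BB.T ?h"
  have T_B: "star_alg BB.T" by (rule BB.G.star_alg_axioms)
  have h: "?h x \<in> carrier BB.T" if "x \<in> carrier (A \<times>\<times> A)" for x
    using that by (auto simp: AA.carrier_DirProd)
  have push: "star_hom AA.T BB.T ?push"
    unfolding AA.T_def using T_B h
  proof (rule AA.T.star_hom_extend)
    show "?h \<one>\<^bsub>A \<times>\<times> A\<^esub> = \<one>\<^bsub>BB.T\<^esub>"
      by (simp add: AA.one_DirProd' BB.one_DirProd' BB.T_def BB.T.one_MA)
    show "?h (x \<otimes>\<^bsub>A \<times>\<times> A\<^esub> y) = ?h x \<otimes>\<^bsub>BB.T\<^esub> ?h y"
      if "x \<in> carrier (A \<times>\<times> A)" "y \<in> carrier (A \<times>\<times> A)" for x y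
      using that BB.T.delta_mult[of "(f (fst x), f (snd x))" "(f (fst y), f (snd y))"]
      by (auto simp: AA.carrier_DirProd BB.carrier_DirProd AA.mult_DirProd_case BB.mult_DirProd_case BB.T_def)
    show "?h (case x of (a, b) \<Rightarrow> (str A a, str A b)) = str BB.T (?h x)"
      if "x \<in> carrier (A \<times>\<times> A)" for x
      using that BB.T.str_delta[of "(f (fst x), f (snd x))"]
      by (auto simp: AA.carrier_DirProd BB.carrier_DirProd BB.T_def)
  qed
  interpret push: star_hom_pair AA.T BB.T ?push
    using push AA.G.star_alg_axioms T_B by (intro star_hom_pairI)
  have push_delta: "?push (delta (a, b)) = delta (f a, f b)" if "a \<in> carrier A" "b \<in> carrier A" for a b
    using that AA.T.extend_delta[OF T_B h, where m = "(a, b)"] by (simp add: AA.carrier_DirProd)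
  have BB_lin: "lin (u \<oplus>\<^bsub>BB.T\<^esub> scl BB.T c v) \<Phi> = lin u \<Phi> + c * lin v \<Phi>"
    if "u \<in> carrier BB.T" "v \<in> carrier BB.T" for u v c \<Phi>
    using that by (simp add: BB.T_def)
  have lin_push: "lin (?push x) \<Phi> = lin x (\<lambda>(a, b). \<Phi> (f a, f b))" if "x \<in> carrier AA.T" for x \<Phi>
    using that unfolding AA.T_def
  proof (induction x rule: AA.T.MA_induct)
    case zero
    then show ?case using push.hom_zero by (simp add: AA.T_def BB.T_def AA.T.zero_MA BB.T.zero_MA)
  next
    case (step x c m)
    obtain a b where m: "m = (a, b)" "a \<in> carrier A" "b \<in> carrier A"
      using step by (auto simp: AA.carrier_DirProd)
    have "x \<in> carrier AA.T" "delta m \<in> carrier AA.T" using step m by (auto simp: AA.T_def)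
    moreover have "?push x \<in> carrier BB.T" "scl BB.T c (delta (f a, f b)) \<in> carrier BB.T"
      using m \<open>x \<in> carrier AA.T\<close> BB.delta_T[of "f a" "f b"] BB.G.scl_closed by auto
    ultimately have "lin (?push (x \<oplus>\<^bsub>AA.T\<^esub> scl AA.T c (delta m))) \<Phi> = lin (?push x) \<Phi> + c * \<Phi> (f a, f b)"
      using m push_delta BB_lin by (simp add: push.hom_add push.hom_scl)
    then show ?case using step m by (simp add: AA.T_def)
  qed
  have push_surj: "\<exists>x\<in>carrier AA.T. ?push x = y" if "y \<in> carrier BB.T" for y
    using that[unfolded BB.T_def]
  proof (induction y rule: BB.T.MA_induct)
    case zero
    then show ?case using push.hom_zero AA.G.zero_closed by (metis BB.T_def)
  next
    case (step y c m)
    obtain x where x: "x \<in> carrier AA.T" "?push x = y" using step.IH by blast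
    have "m \<in> f ` carrier A \<times> f ` carrier A"
      using step.hyps surj by (simp add: BB.carrier_DirProd)
    then obtain a b where m: "m = (f a, f b)" "a \<in> carrier A" "b \<in> carrier A" by blast
    have "?push (x \<oplus>\<^bsub>AA.T\<^esub> scl AA.T c (delta (a, b))) = y \<oplus>\<^bsub>BB.T\<^esub> scl BB.T c (delta m)"
      using x m push_delta by simp
    then have "?push (x \<oplus>\<^bsub>AA.T\<^esub> scl AA.T c (delta (a, b))) = y \<oplus>\<^bsub>BB.T.MA\<^esub> scl BB.T.MA c (delta m)"
      by (simp only: BB.T_def)
    moreover have "x \<oplus>\<^bsub>AA.T\<^esub> scl AA.T c (delta (a, b)) \<in> carrier AA.T" using x m by simp
    ultimately show ?case by (rule bexI)
  qed
  have push_le: "spatial_seminorm B B (?push x) \<le> spatial_seminorm A A x" if x: "x \<in> carrier AA.T" for x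
    unfolding BB.spatial_gns
  proof (rule BB.G.G_least)
    show "0 \<le> spatial_seminorm A A x" using x by (rule AA.S.p_nonneg)
    fix w y assume *: "w \<in> BB.product_states" "y \<in> carrier BB.T" "w (str BB.T y \<otimes>\<^bsub>BB.T\<^esub> y) = 1"
    then obtain \<phi> \<psi> where w: "w = product_functional \<phi> \<psi>" "state B \<phi>" "state B \<psi>"
      by (auto simp: BB.product_states_def)
    obtain z where z: "z \<in> carrier AA.T" "?push z = y" using push_surj[OF *(2)] by blast
    let ?w = "product_functional (\<lambda>a. \<phi> (f a)) (\<lambda>a. \<psi> (f a))"
    have w': "?w \<in> AA.product_states"
      using state_pullback[OF f.star_hom_pair_axioms _ le] w by (auto simp: AA.product_states_def)
    have w_push: "w (?push g) = ?w g" if "g \<in> carrier AA.T" for g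
      using lin_push[OF that] by (simp add: w AA.product_functional_lin BB.product_functional_lin)
    have N_push: "positive_functional.N BB.T w (?push g) = positive_functional.N AA.T ?w g"
      if g: "g \<in> carrier AA.T" for g
      using w_push[of "str AA.T g \<otimes>\<^bsub>AA.T\<^esub> g"] g
      by (simp add: positive_functional.N_def[OF AA.G.functional[OF w']] positive_functional.N_def[OF BB.G.functional[OF *(1)]])
    have "positive_functional.N BB.T w y = 1"
      using *(3) by (simp add: positive_functional.N_def[OF BB.G.functional[OF *(1)]])
    then have "positive_functional.N AA.T ?w z = 1" using N_push[OF z(1)] z(2) by simp
    then show "positive_functional.N BB.T w (?push x \<otimes>\<^bsub>BB.T\<^esub> y) \<le> spatial_seminorm A A x"
      using AA.G.G_ge[OF w' x z(1)] N_push[of "x \<otimes>\<^bsub>AA.T\<^esub> z"] x z by (simp add: AA.spatial_gns)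
  qed (use x in simp)
  have hom: "star_hom AA.T BB.D (\<lambda>x. incl BB.T (spatial_seminorm B B) (?push x))"
    by (rule star_hom_comp[OF push BB.I.star_hom])
  have bound: "nrm BB.D (incl BB.T (spatial_seminorm B B) (?push x)) \<le> spatial_seminorm A A x"
    if "x \<in> carrier AA.T" for x
    using push_le[OF that] BB.S.nrm_inc[of "?push x"] that by (simp add: BB.D_def)
  show ?thesis
  proof (rule AA.S.completion_extend[OF BB.D.cstar_alg_axioms hom bound])
    fix \<Theta> assume \<Theta>: "star_hom (completion AA.T (spatial_seminorm A A)) BB.D \<Theta>"
      "\<And>x. x \<in> carrier AA.T \<Longrightarrow> \<Theta> (incl AA.T (spatial_seminorm A A) x) = incl BB.T (spatial_seminorm B B) (?push x)"
    show ?thesis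
    proof (rule that)
    show "star_hom AA.D BB.D \<Theta>" using \<Theta>(1) by (simp only: AA.D_def)
    fix a b assume "a \<in> carrier A" "b \<in> carrier A"
    then show "\<Theta> (AA.t a b) = BB.t (f a) (f b)"
      using \<Theta>(2)[of "delta (a, b)"] push_delta[of a b] by (simp add: AA.t_def BB.t_def)
    qed
  qed
qed

section \<open>Elementary C*-algebra theory\<close>

lemma (in abelian_group) add_diff_cancel: "x \<in> carrier G \<Longrightarrow> y \<in> carrier G \<Longrightarrow> (y \<oplus> x) \<ominus> y = x"
  by (simp add: minus_eq a_comm[of y x] a_assoc r_neg)

lemma (in abelian_group) add_diff_add_cancel:
  assumes "x \<in> carrier G" "y \<in> carrier G" "z \<in> carrier G"
  shows "(z \<oplus> x) \<ominus> (z \<oplus> y) = x \<ominus> y" "(x \<oplus> z) \<ominus> (y \<oplus> z) = x \<ominus> y"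
  using assms by (simp_all add: minus_eq minus_add a_comm[of _ z] a_assoc a_lcomm[of x "\<ominus> z"] r_neg2)

section \<open>Fixed points, square roots and contractivity\<close>

context cstar_alg
begin

lemma geometric_CS:
  assumes x: "\<And>n. x n \<in> carrier A" and c: "0 \<le> c" "c < 1"
    and step: "\<And>n. nrm A (x (Suc n) \<ominus> x n) \<le> d * c ^ n"
  shows "x \<in> CS"
proof (rule CS_I)
  fix e :: real assume e: "e > 0"
  have "0 \<le> nrm A (x (Suc 0) \<ominus> x 0)" using x by simp
  then have d: "0 \<le> d" using step[of 0] by simp
  have dist: "nrm A (x (n + k) \<ominus> x n) \<le> d * c ^ n / (1 - c)" for n k
  proof -
    have "nrm A (x (n + k) \<ominus> x n) \<le> d * c ^ n * (\<Sum>i<k. c ^ i)"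
    proof (induction k)
      case (Suc k)
      have "nrm A (x (n + Suc k) \<ominus> x n) \<le> nrm A (x (Suc (n + k)) \<ominus> x (n + k)) + nrm A (x (n + k) \<ominus> x n)"
        using p_diff_trans[of "x (Suc (n + k))" "x (n + k)" "x n"] x by simp
      then show ?case using Suc step[of "n + k"] by (simp add: power_add algebra_simps)
    qed (use x in \<open>simp add: minus_eq r_neg\<close>)
    also have "\<dots> \<le> d * c ^ n * (1 / (1 - c))"
      using c d by (intro mult_left_mono) (auto simp: sum_gp_strict divide_right_mono)
    finally show ?thesis by simp
  qed
  have "(\<lambda>n. d * c ^ n / (1 - c)) \<longlonglongrightarrow> d * 0 / (1 - c)"
    using c by (intro tendsto_intros LIMSEQ_power_zero) auto
  then obtain N where "\<And>n. n \<ge> N \<Longrightarrow> norm (d * c ^ n / (1 - c) - d * 0 / (1 - c)) < e / 2"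
    using e LIMSEQ_D[of _ _ "e / 2"] by (meson half_gt_zero)
  from this[OF order_refl] have N: "d * c ^ N / (1 - c) < e / 2"
    by (simp only: real_norm_def abs_less_iff mult_zero_right div_0 diff_zero)
  have near: "nrm A (x m \<ominus> x N) < e / 2" if "m \<ge> N" for m
    using order.strict_trans1[OF dist[of N "m - N"] N] that by simp
  have "nrm A (x m \<ominus> x n) < e" if "m \<ge> N" "n \<ge> N" for m n
    using p_diff_trans[of "x m" "x N" "x n"] p_diff_commute[of "x N" "x n"] near[OF that(1)] near[OF that(2)] x
    by simp
  then show "\<exists>M. \<forall>m\<ge>M. \<forall>n\<ge>M. nrm A (x m \<ominus> x n) < e" by blast
qed (rule x)

lemma CS_limit:
  assumes "x \<in> CS" obtains a where "a \<in> carrier A" "close x (\<lambda>n. a)"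
  using complete[OF assms] by (auto simp: close_def)

lemma close_unique:
  assumes "close x (\<lambda>n. a)" "close x (\<lambda>n. b)" "seq x" "a \<in> carrier A" "b \<in> carrier A"
  shows "a = b"
  using limit_unique[of x a b] assms by (simp add: close_def)

lemma close_nrm_le:
  assumes "close x (\<lambda>n. a)" "seq x" "a \<in> carrier A" "\<And>n. nrm A (x n) \<le> t"
  shows "nrm A a \<le> t"
proof -
  have "(\<lambda>n. t + nrm A (x n \<ominus> a)) \<longlonglongrightarrow> t + 0"
    using assms(1) by (intro tendsto_intros) (simp add: close_def)
  moreover have "nrm A a \<le> t + nrm A (x n \<ominus> a)" for n
    using p_diff_abs[of "x n" a] assms(2,3) assms(4)[of n] by (simp add: abs_le_iff)
  ultimately show ?thesis using LIMSEQ_le_const by fastforce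
qed

lemma close_selfadjoint:
  assumes "close x (\<lambda>n. a)" "seq x" "a \<in> carrier A" "\<And>n. str A (x n) = x n"
  shows "str A a = a"
  using close_unique[OF close_str[OF _ _ assms(1)] _] assms by simp

lemma close_commute:
  assumes "close x (\<lambda>n. a)" "seq x" "a \<in> carrier A" "h \<in> carrier A" "\<And>n. x n \<otimes> h = h \<otimes> x n"
  shows "a \<otimes> h = h \<otimes> a"
proof (rule close_unique)
  have b: "bdd x" using bdd_close[OF _ _ assms(1)] assms by simp
  show "close (\<lambda>n. x n \<otimes> h) (\<lambda>n. a \<otimes> h)"
    using assms b by (intro close_mult[of x "\<lambda>n. h" "\<lambda>n. a" "\<lambda>n. h"]) auto
  have "close (\<lambda>n. h \<otimes> x n) (\<lambda>n. h \<otimes> a)"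
    using assms b by (intro close_mult[of "\<lambda>n. h" x "\<lambda>n. h" "\<lambda>n. a"]) auto
  then show "close (\<lambda>n. x n \<otimes> h) (\<lambda>n. h \<otimes> a)" using assms by simp
qed (use assms in auto)

text \<open>Banach's argument inside a closed subset. In each use \<open>M\<close> is chosen so that
  self-adjointness, commutation with a given element and, where needed, a norm bound pass to the
  fixed point.\<close>

lemma contraction_fixpoint:
  assumes M: "M \<subseteq> carrier A" "a0 \<in> M" and F: "\<And>x. x \<in> M \<Longrightarrow> F x \<in> M"
    and c: "0 \<le> c" "c < 1"
    and lip: "\<And>x y. x \<in> M \<Longrightarrow> y \<in> M \<Longrightarrow> nrm A (F x \<ominus> F y) \<le> c * nrm A (x \<ominus> y)"
    and closed: "\<And>x a. (\<And>n. x n \<in> M) \<Longrightarrow> a \<in> carrier A \<Longrightarrow> close x (\<lambda>n. a) \<Longrightarrow> a \<in> M"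
  obtains y where "y \<in> M" "F y = y"
proof -
  define x where "x n = (F ^^ n) a0" for n
  have xS: "x (Suc n) = F (x n)" for n by (simp add: x_def)
  have xM: "x n \<in> M" for n by (induction n) (auto simp: x_def M F)
  have xc: "x n \<in> carrier A" for n using xM M by blast
  have "nrm A (x (Suc n) \<ominus> x n) \<le> nrm A (x 1 \<ominus> x 0) * c ^ n" for n
  proof (induction n)
    case (Suc n)
    have "nrm A (x (Suc (Suc n)) \<ominus> x (Suc n)) \<le> c * nrm A (x (Suc n) \<ominus> x n)"
      using lip[OF xM xM, of "Suc n" n] by (simp add: xS)
    also have "\<dots> \<le> c * (nrm A (x 1 \<ominus> x 0) * c ^ n)" using Suc c by (intro mult_left_mono)
    finally show ?case by (simp add: mult_ac)
  qed simp
  then have "x \<in> CS" using xc c by (intro geometric_CS)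
  then obtain a where a: "a \<in> carrier A" "close x (\<lambda>n. a)" by (rule CS_limit)
  have aM: "a \<in> M" using closed[OF xM a] .
  have Fa: "F a \<in> carrier A" using F[OF aM] M by blast
  have "close (\<lambda>n. x (Suc n)) (\<lambda>n. a)"
    using a(2) unfolding close_def by (rule LIMSEQ_Suc)
  moreover have "close (\<lambda>n. x (Suc n)) (\<lambda>n. F a)"
    unfolding close_def
  proof (rule tendsto_zero_le)
    show "(\<lambda>n. c * nrm A (x n \<ominus> a)) \<longlonglongrightarrow> 0"
      using tendsto_mult_left[OF a(2)[unfolded close_def], of c] by simp
    show "nrm A (x (Suc n) \<ominus> F a) \<le> c * nrm A (x n \<ominus> a)" for n
      using lip[OF xM aM] by (simp add: xS)
    show "0 \<le> nrm A (x (Suc n) \<ominus> F a)" for n using xc[of "Suc n"] Fa by simp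
  qed
  ultimately have "a = F a" using close_unique[of "\<lambda>n. x (Suc n)" a "F a"] xc a Fa by blast
  with aM show ?thesis using that by metis
qed

text \<open>\<open>x\<close> and \<open>y\<close> are the real and imaginary parts of the normal
  element \<open>z = x + \<i> y\<close>, and \<open>z^* z\<close> is the sum of squares.\<close>

lemma nrm_square_le_sum_squares:
  assumes [simp]: "x \<in> carrier A" "y \<in> carrier A" "str A x = x" "str A y = y" and xy: "x \<otimes> y = y \<otimes> x"
  shows "(nrm A x)\<^sup>2 \<le> nrm A (x \<otimes> x \<oplus> y \<otimes> y)"
proof -
  define z where "z = x \<oplus> scl A \<i> y"
  have [simp]: "z \<in> carrier A" by (simp add: z_def)
  have "str A z \<otimes> z = x \<otimes> x \<oplus> y \<otimes> y"
    by (simp add: z_def l_distr r_distr scl_mult_left scl_mult_right scl_minus_left xy[symmetric])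
      (simp add: scl_add_right l_minus r_minus scl_mult_left scl_mult_right xy a_ac r_neg1 r_neg2 l_neg r_neg)
  then have "(nrm A z)\<^sup>2 = nrm A (x \<otimes> x \<oplus> y \<otimes> y)" using p_cstar[of z] by simp
  \<comment> \<open>\<open>2 x\<close> is the sum of \<open>z\<close> and its adjoint, which have
    the same norm.\<close>
  moreover have "nrm A x \<le> nrm A z"
  proof -
    have "scl A 2 x = x \<oplus> x" using scl_add_left[of x 1 1] by simp
    then have "z \<oplus> str A z = scl A 2 x"
      by (simp add: z_def scl_minus_left a_ac r_neg1 r_neg2 l_neg r_neg)
    then show ?thesis using p_triangle[of z "str A z"] p_scl[of x 2] by simp
  qed
  ultimately show ?thesis by (metis p_nonneg power_mono assms(1))
qed

lemma nrm_selfadjoint_square: "x \<in> carrier A \<Longrightarrow> str A x = x \<Longrightarrow> nrm A (x \<otimes> x) = (nrm A x)\<^sup>2"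
  using p_cstar[of x] by simp

lemma scl_double: "x \<in> carrier A \<Longrightarrow> scl A 2 x = x \<oplus> x"
  using scl_add_left[of x 1 1] by simp

text \<open>
  The root \<open>s\<close> is \<open>1 - y\<close> for the fixed point \<open>y\<close> of the contraction \<open>y \<mapsto> (h\<^sup>2 + y\<^sup>2) / 2\<close>
  of a small ball.
\<close>
lemma sqrt_complement:
  assumes h [simp]: "h \<in> carrier A" "str A h = h" and lt: "nrm A h < 1"
  obtains s where "s \<in> carrier A" "str A s = s" "s \<otimes> h = h \<otimes> s" "h \<otimes> h \<oplus> s \<otimes> s = \<one>"
proof -
  define r where "r = (nrm A h)\<^sup>2"
  have r: "0 \<le> r" "r < 1" using lt p_nonneg[of h] by (simp_all add: r_def power_less_one_iff abs_square_less_1)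
  \<comment> \<open>The smaller root of \<open>(r + t^2) / 2 = t\<close>: the ball of radius
    \<open>t\<close> is mapped into itself, and \<open>t\<close> is also the contraction constant on
    it.\<close>
  define t where "t = 1 - sqrt (1 - r)"
  have t: "0 \<le> t" "t < 1" "(r + t\<^sup>2) / 2 = t"
    using r by (auto simp: t_def power2_eq_square field_simps)
  define F where "F y = scl A (1 / 2) (h \<otimes> h \<oplus> y \<otimes> y)" for y
  define M where "M = {y \<in> carrier A. str A y = y \<and> y \<otimes> h = h \<otimes> y \<and> nrm A y \<le> t}"
  obtain y where y: "y \<in> M" "F y = y"
  proof (rule contraction_fixpoint[of M \<zero> F t])
    show "\<zero> \<in> M" using t by (simp add: M_def)
    show "F y \<in> M" if "y \<in> M" for y
    proof -
      have [simp]: "y \<in> carrier A" "str A y = y" and yh: "y \<otimes> h = h \<otimes> y" and yt: "nrm A y \<le> t"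
        using that by (auto simp: M_def)
      have "y \<otimes> y \<otimes> h = h \<otimes> (y \<otimes> y)"
        by (metis m_assoc yh \<open>y \<in> carrier A\<close> h(1))
      then have "F y \<otimes> h = h \<otimes> F y"
        by (simp add: F_def scl_mult_left scl_mult_right l_distr r_distr m_assoc)
      moreover have "nrm A (F y) \<le> (r + t\<^sup>2) / 2"
      proof -
        have "nrm A (h \<otimes> h \<oplus> y \<otimes> y) \<le> r + (nrm A y)\<^sup>2"
          using p_triangle[of "h \<otimes> h" "y \<otimes> y"] by (simp add: r_def nrm_selfadjoint_square)
        moreover have "(nrm A y)\<^sup>2 \<le> t\<^sup>2" using yt by (intro power_mono) auto
        ultimately show ?thesis by (simp add: F_def)
      qed
      ultimately show ?thesis using t(3) by (simp add: M_def) (simp add: F_def)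
    qed
    show "nrm A (F x \<ominus> F y) \<le> t * nrm A (x \<ominus> y)" if "x \<in> M" "y \<in> M" for x y
    proof -
      have [simp]: "x \<in> carrier A" "y \<in> carrier A" and le: "nrm A x \<le> t" "nrm A y \<le> t"
        using that by (auto simp: M_def)
      have "F x \<ominus> F y = scl A (1 / 2) (x \<otimes> x \<ominus> y \<otimes> y)"
        by (simp add: F_def scl_diff_right[symmetric] add_diff_add_cancel)
      then have "nrm A (F x \<ominus> F y) \<le> (nrm A x * nrm A (x \<ominus> y) + nrm A (x \<ominus> y) * nrm A y) / 2"
        using p_mult_diff[of x x y y] by simp
      also have "\<dots> \<le> (t * nrm A (x \<ominus> y) + nrm A (x \<ominus> y) * t) / 2"
        using le t by (intro divide_right_mono add_mono mult_mono) auto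
      finally show ?thesis by simp
    qed
    show "a \<in> M" if x: "\<And>n. x n \<in> M" and a: "a \<in> carrier A" "close x (\<lambda>n. a)" for x a
    proof -
      have "x n \<in> carrier A" "str A (x n) = x n" "x n \<otimes> h = h \<otimes> x n" "nrm A (x n) \<le> t" for n
        using x[of n] by (auto simp: M_def)
      then show ?thesis
        using a close_selfadjoint[of x a] close_commute[of x a h] close_nrm_le[of x a t] by (simp add: M_def)
    qed
  qed (use t in \<open>auto simp: M_def\<close>)
  have yc [simp]: "y \<in> carrier A" "str A y = y" and yh: "y \<otimes> h = h \<otimes> y" using y by (auto simp: M_def)
  have "h \<otimes> h \<oplus> y \<otimes> y = scl A 2 (F y)" by (simp add: F_def)
  then have hy: "h \<otimes> h \<oplus> y \<otimes> y = y \<oplus> y" using y by (simp add: scl_double)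
  \<comment> \<open>In the expansion \<open>h^2 + y^2\<close> equals \<open>2 y\<close> by the
    fixed-point equation and cancels the mixed terms.\<close>
  have "h \<otimes> h \<oplus> (\<one> \<ominus> y) \<otimes> (\<one> \<ominus> y) = (h \<otimes> h \<oplus> y \<otimes> y) \<oplus> (\<one> \<oplus> (\<ominus> y \<oplus> \<ominus> y))"
    by (simp add: minus_eq l_distr r_distr l_minus r_minus minus_add a_ac)
  also have "\<dots> = \<one>" unfolding hy by (simp add: a_ac r_neg1 r_neg2 r_neg l_neg)
  finally have "h \<otimes> h \<oplus> (\<one> \<ominus> y) \<otimes> (\<one> \<ominus> y) = \<one>" .
  moreover have "(\<one> \<ominus> y) \<otimes> h = h \<otimes> (\<one> \<ominus> y)" using yh by (simp add: minus_eq l_distr r_distr l_minus r_minus)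
  ultimately show ?thesis using that[of "\<one> \<ominus> y"] by simp
qed

end

text \<open>The identity \<open>h^2 + s^2 = 1\<close> from \<open>sqrt_complement\<close> is
  preserved by \<open>f\<close>, and a sum of commuting self-adjoint squares dominates each of them
  in norm, so \<open>f h\<close> has norm at most one. Scaling extends this to all self-adjoint
  elements, and the C*-identity to all elements.\<close>

lemma star_hom_contractive:
  assumes A: "cstar_alg A" and B: "cstar_alg B" and f: "star_hom A B f" and x: "x \<in> carrier A"
  shows "nrm B (f x) \<le> nrm A x"
proof -
  interpret A: cstar_alg A by fact
  interpret B: cstar_alg B by fact
  interpret f: star_hom_pair A B f
    using f A.star_alg_axioms B.star_alg_axioms by (intro star_hom_pairI)
  have unit: "nrm B (f h) \<le> 1" if h: "h \<in> carrier A" "str A h = h" "nrm A h < 1" for h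
  proof -
    obtain s where s: "s \<in> carrier A" "str A s = s" "s \<otimes>\<^bsub>A\<^esub> h = h \<otimes>\<^bsub>A\<^esub> s"
      "h \<otimes>\<^bsub>A\<^esub> h \<oplus>\<^bsub>A\<^esub> s \<otimes>\<^bsub>A\<^esub> s = \<one>\<^bsub>A\<^esub>"
      using A.sqrt_complement[OF h] .
    have "str B (f h) = f h" "str B (f s) = f s" "f h \<otimes>\<^bsub>B\<^esub> f s = f s \<otimes>\<^bsub>B\<^esub> f h"
      using h s f.hom_str[of h] f.hom_str[of s] f.hom_mult[of h s] f.hom_mult[of s h] by simp_all
    then have "(nrm B (f h))\<^sup>2 \<le> nrm B (f h \<otimes>\<^bsub>B\<^esub> f h \<oplus>\<^bsub>B\<^esub> f s \<otimes>\<^bsub>B\<^esub> f s)"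
      using h s by (intro B.nrm_square_le_sum_squares) auto
    also have "f h \<otimes>\<^bsub>B\<^esub> f h \<oplus>\<^bsub>B\<^esub> f s \<otimes>\<^bsub>B\<^esub> f s = \<one>\<^bsub>B\<^esub>"
      using f.hom_add[of "h \<otimes>\<^bsub>A\<^esub> h" "s \<otimes>\<^bsub>A\<^esub> s"] h s by simp
    finally have "(nrm B (f h))\<^sup>2 \<le> 1\<^sup>2" using B.p_one_le by simp
    then show ?thesis by (rule power2_le_imp_le) simp
  qed
  have sa: "nrm B (f h) \<le> nrm A h" if h: "h \<in> carrier A" "str A h = h" for h
  proof (rule field_le_epsilon)
    fix e :: real assume e: "e > 0"
    \<comment> \<open>Adding \<open>e\<close> brings the scaled element strictly below norm one, as
      \<open>sqrt_complement\<close> demands.\<close>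
    define c where "c = nrm A h + e"
    have c: "c > 0" using e h by (simp add: c_def add_nonneg_pos)
    let ?c = "complex_of_real (1 / c)"
    have "nrm A (scl A ?c h) < 1" using h e c by (simp add: norm_divide) (simp add: c_def)
    then have "nrm B (f (scl A ?c h)) \<le> 1" using h by (intro unit) auto
    then have "nrm B (f h) / c \<le> 1" using h c by (simp add: norm_divide)
    then show "nrm B (f h) \<le> nrm A h + e" using c by (simp add: c_def)
  qed
  have "(nrm B (f x))\<^sup>2 = nrm B (f (str A x \<otimes>\<^bsub>A\<^esub> x))" using x B.p_cstar[of "f x"] by simp
  also have "\<dots> \<le> nrm A (str A x \<otimes>\<^bsub>A\<^esub> x)" using x by (intro sa) auto
  also have "\<dots> = (nrm A x)\<^sup>2" using x by (rule A.p_cstar)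
  finally show ?thesis by (rule power2_le_imp_le) (use x in simp)
qed

context cstar_alg
begin

text \<open>\<open>r\<close> is the inverse of \<open>1 + a^2\<close>, so
  \<open>a \<otimes> r\<close> is bounded by one however large \<open>a\<close> is, and it differs
  from \<open>a\<close> only by \<open>a^3 r\<close>. With
  \<open>c > \<parallel>a\<parallel>\<close> this inverse solves
  \<open>(1 + c^2) r = (c^2 - a^2) r + 1\<close>, a fixed-point equation with contraction constant
  \<open>c^2 / (1 + c^2)\<close>.\<close>

lemma bounded_transform:
  assumes a [simp]: "a \<in> carrier A" "str A a = a"
  obtains r where "r \<in> carrier A" "str A r = r" "r \<otimes> a = a \<otimes> r" "r \<oplus> a \<otimes> (a \<otimes> r) = \<one>"
    "nrm A r \<le> 1" "nrm A (a \<otimes> r) \<le> 1"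
proof -
  define c where "c = nrm A a + 1"
  have c: "c > 0" "nrm A a < c" by (simp_all add: c_def add_nonneg_pos)
  define b where "b = scl A (of_real (c\<^sup>2)) \<one> \<ominus> a \<otimes> a"
  have b [simp]: "b \<in> carrier A" "str A b = b" by (simp_all add: b_def)
  have ba: "b \<otimes> a = a \<otimes> b"
    by (simp add: b_def minus_eq l_distr r_distr l_minus r_minus scl_mult_left scl_mult_right m_assoc)
  \<comment> \<open>\<open>c^2 - a^2\<close> is \<open>c^2\<close> times the square that complements
    \<open>(a / c)^2\<close> to \<open>1\<close>, so its norm does not exceed
    \<open>c^2\<close>.\<close>
  have nb: "nrm A b \<le> c\<^sup>2"
  proof -
    define h where "h = scl A (of_real (1 / c)) a"
    have h: "h \<in> carrier A" "str A h = h" "nrm A h < 1" using c by (simp_all add: h_def norm_divide)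
    obtain s where s: "s \<in> carrier A" "str A s = s" "s \<otimes> h = h \<otimes> s" "h \<otimes> h \<oplus> s \<otimes> s = \<one>"
      using sqrt_complement[OF h] .
    have "(nrm A s)\<^sup>2 \<le> nrm A (s \<otimes> s \<oplus> h \<otimes> h)" using h s by (intro nrm_square_le_sum_squares) auto
    also have "s \<otimes> s \<oplus> h \<otimes> h = \<one>" using s h by (simp add: a_comm)
    finally have ss: "nrm A (s \<otimes> s) \<le> 1" using p_one_le s by (simp add: nrm_selfadjoint_square)
    have "s \<otimes> s = (h \<otimes> h \<oplus> s \<otimes> s) \<ominus> h \<otimes> h"
      using h s(1) by (simp add: add_diff_cancel)
    then have "s \<otimes> s = \<one> \<ominus> h \<otimes> h" using s(4) by simp
    moreover have "scl A (of_real (c\<^sup>2)) (h \<otimes> h) = a \<otimes> a"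
      using c by (simp add: h_def scl_mult_left scl_mult_right power2_eq_square)
    ultimately have "scl A (of_real (c\<^sup>2)) (s \<otimes> s) = b" using h by (simp add: b_def scl_diff_right)
    moreover have "nrm A (scl A (of_real (c\<^sup>2)) (s \<otimes> s)) \<le> c\<^sup>2"
      using ss s mult_left_mono[OF ss, of "c\<^sup>2"] by (simp add: norm_power)
    ultimately show ?thesis by simp
  qed
  define k where "k = 1 / (1 + c\<^sup>2)"
  have k: "k > 0" "k * c\<^sup>2 < 1" "k * (1 + c\<^sup>2) = 1"
  proof -
    have "1 + c\<^sup>2 > 0" by (simp add: add_pos_nonneg)
    then show "k > 0" "k * c\<^sup>2 < 1" "k * (1 + c\<^sup>2) = 1" by (simp_all add: k_def)
  qed
  define F where "F r = scl A (of_real k) (b \<otimes> r \<oplus> \<one>)" for r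
  define M where "M = {r \<in> carrier A. str A r = r \<and> r \<otimes> a = a \<otimes> r}"
  \<comment> \<open>Commutation with \<open>b\<close> keeps \<open>b \<otimes> r\<close>
    self-adjoint.\<close>
  have comm_b: "r \<otimes> b = b \<otimes> r" if "r \<in> M" for r
  proof -
    have [simp]: "r \<in> carrier A" and ra: "r \<otimes> a = a \<otimes> r" using that by (auto simp: M_def)
    have "r \<otimes> (a \<otimes> a) = a \<otimes> a \<otimes> r" by (metis m_assoc ra \<open>r \<in> carrier A\<close> a(1))
    then show ?thesis
      by (simp add: b_def minus_eq l_distr r_distr l_minus r_minus scl_mult_left scl_mult_right)
  qed
  obtain r where r: "r \<in> M" "F r = r"
  proof (rule contraction_fixpoint[of M \<zero> F "k * c\<^sup>2"])
    show "F r \<in> M" if "r \<in> M" for r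
    proof -
      have [simp]: "r \<in> carrier A" "str A r = r" and ra: "r \<otimes> a = a \<otimes> r" using that by (auto simp: M_def)
      have "b \<otimes> r \<otimes> a = a \<otimes> (b \<otimes> r)" by (metis m_assoc ra ba \<open>r \<in> carrier A\<close> a(1) b(1))
      then show ?thesis using comm_b[OF that]
        by (simp add: M_def F_def scl_mult_left scl_mult_right l_distr r_distr)
    qed
    show "nrm A (F x \<ominus> F y) \<le> k * c\<^sup>2 * nrm A (x \<ominus> y)" if "x \<in> M" "y \<in> M" for x y
    proof -
      have [simp]: "x \<in> carrier A" "y \<in> carrier A" using that by (auto simp: M_def)
      have "F x \<ominus> F y = scl A (of_real k) (b \<otimes> (x \<ominus> y))"
        by (simp add: F_def scl_diff_right[symmetric] add_diff_add_cancel)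
          (simp add: minus_eq r_distr r_minus)
      moreover have "nrm A (b \<otimes> (x \<ominus> y)) \<le> c\<^sup>2 * nrm A (x \<ominus> y)"
        using p_mult[of b "x \<ominus> y"] mult_right_mono[OF nb, of "nrm A (x \<ominus> y)"] by simp
      ultimately show ?thesis using k by (simp add: mult.assoc)
    qed
    show "a' \<in> M" if x: "\<And>n. x n \<in> M" and a': "a' \<in> carrier A" "close x (\<lambda>n. a')" for x a'
    proof -
      have "x n \<in> carrier A" "str A (x n) = x n" "x n \<otimes> a = a \<otimes> x n" for n
        using x[of n] by (auto simp: M_def)
      then show ?thesis
        using a' close_selfadjoint[of x a'] close_commute[of x a' a] by (simp add: M_def)
    qed
  qed (use k in \<open>auto simp: M_def\<close>)
  have rc [simp]: "r \<in> carrier A" "str A r = r" and ra: "r \<otimes> a = a \<otimes> r" using r by (auto simp: M_def)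
  have "scl A (of_real (1 + c\<^sup>2)) (F r) = scl A (of_real (k * (1 + c\<^sup>2))) (b \<otimes> r \<oplus> \<one>)"
    by (simp add: F_def mult.commute)
  then have "scl A (of_real (1 + c\<^sup>2)) r = b \<otimes> r \<oplus> \<one>" unfolding r(2) k(3) by simp
  also have "b \<otimes> r = scl A (of_real (c\<^sup>2)) r \<ominus> a \<otimes> (a \<otimes> r)"
    by (simp add: b_def minus_eq l_distr l_minus scl_mult_left m_assoc)
  finally have eq: "r \<oplus> scl A (of_real (c\<^sup>2)) r = scl A (of_real (c\<^sup>2)) r \<ominus> a \<otimes> (a \<otimes> r) \<oplus> \<one>"
    by (simp add: scl_add_left)
  define z where "z = scl A (of_real (c\<^sup>2)) r"
  have [simp]: "z \<in> carrier A" by (simp add: z_def)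
  have "r \<oplus> a \<otimes> (a \<otimes> r) = (r \<oplus> z) \<oplus> (\<ominus> z \<oplus> a \<otimes> (a \<otimes> r))"
    by (simp add: a_ac r_neg1 r_neg2)
  also have "\<dots> = \<one>"
    unfolding eq[folded z_def]
    by (simp add: minus_eq a_ac r_neg1 r_neg2 r_neg l_neg) (simp add: a_lcomm[of z \<one>] r_neg)
  finally have inv: "r \<oplus> a \<otimes> (a \<otimes> r) = \<one>" .
  have ar: "str A (a \<otimes> r) = a \<otimes> r" by (simp add: ra)
  have arr: "r \<otimes> (a \<otimes> r) = a \<otimes> r \<otimes> r" by (metis m_assoc ra rc(1) a(1))
  \<comment> \<open>Multiplying \<open>inv\<close> by \<open>r\<close> exhibits \<open>r\<close> as
    the sum of the squares of \<open>r\<close> and \<open>a \<otimes> r\<close>, which bounds both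
    norms by one.\<close>
  have sq: "r \<otimes> r \<oplus> (a \<otimes> r) \<otimes> (a \<otimes> r) = r"
  proof -
    have "(a \<otimes> r) \<otimes> (a \<otimes> r) = r \<otimes> (a \<otimes> (a \<otimes> r))" by (metis m_assoc m_closed ra rc(1) a(1))
    then have "r \<otimes> r \<oplus> (a \<otimes> r) \<otimes> (a \<otimes> r) = r \<otimes> (r \<oplus> a \<otimes> (a \<otimes> r))" by (simp add: r_distr)
    then show ?thesis by (simp add: inv)
  qed
  have "(nrm A r)\<^sup>2 \<le> nrm A r"
    using nrm_square_le_sum_squares[of r "a \<otimes> r"] ar arr sq by simp
  then have nr: "nrm A r \<le> 1"
    using mult_strict_left_mono[of 1 "nrm A r" "nrm A r"] unfolding power2_eq_square by linarith
  have "(nrm A (a \<otimes> r))\<^sup>2 \<le> nrm A ((a \<otimes> r) \<otimes> (a \<otimes> r) \<oplus> r \<otimes> r)"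
    using ar arr by (intro nrm_square_le_sum_squares) auto
  also have "(a \<otimes> r) \<otimes> (a \<otimes> r) \<oplus> r \<otimes> r = r" using sq by (simp add: a_comm)
  finally have "(nrm A (a \<otimes> r))\<^sup>2 \<le> 1\<^sup>2" using nr by simp
  then have "nrm A (a \<otimes> r) \<le> 1" by (rule power2_le_imp_le) simp
  with nr inv ra show ?thesis using that[of r] by simp
qed

end

text \<open>Density gives an approximate preimage without any bound on its norm. The bounded
  transform replaces it by one of norm at most \<open>1\<close> at the price of a cubic error, which
  is small because \<open>b\<close> is first scaled to norm at most \<open>1 / 2\<close>.\<close>

lemma lift_selfadjoint_approx:
  assumes A: "cstar_alg A" and B: "cstar_alg B" and f: "star_hom A B f"
    and dense: "\<And>b e. b \<in> carrier B \<Longrightarrow> e > 0 \<Longrightarrow> \<exists>a\<in>carrier A. nrm B (f a \<ominus>\<^bsub>B\<^esub> b) < e"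
    and b: "b \<in> carrier B" "str B b = b" "nrm B b \<le> \<beta>" and \<beta>: "\<beta> > 0"
  obtains a where "a \<in> carrier A" "str A a = a" "nrm A a \<le> 2 * \<beta>" "nrm B (b \<ominus>\<^bsub>B\<^esub> f a) \<le> \<beta> / 2"
proof -
  interpret A: cstar_alg A by fact
  interpret B: cstar_alg B by fact
  interpret f: star_hom_pair A B f
    using f A.star_alg_axioms B.star_alg_axioms by (intro star_hom_pairI)
  \<comment> \<open>This factor brings \<open>b\<close> down to norm \<open>1 / 2\<close>. An
    approximation within \<open>1 / 16\<close> keeps the total error
    \<open>1 / 16 + (9 / 16)^3\<close> below \<open>1 / 4\<close>, and scaling back turns
    \<open>1 / 4\<close> into \<open>\<beta> / 2\<close>.\<close>
  let ?k = "complex_of_real (1 / (2 * \<beta>))"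
  define b' where "b' = scl B ?k b"
  have b' [simp]: "b' \<in> carrier B" "str B b' = b'" using b by (simp_all add: b'_def)
  have nb': "nrm B b' \<le> 1 / 2" using b \<beta> by (simp add: b'_def norm_divide)
  obtain a0 where a0: "a0 \<in> carrier A" "nrm B (f a0 \<ominus>\<^bsub>B\<^esub> b') < 1 / 16"
    using dense[of b' "1 / 16"] by auto
  \<comment> \<open>Symmetrising does not increase the error, since \<open>b'\<close> is
    self-adjoint.\<close>
  define a1 where "a1 = scl A (1 / 2) (a0 \<oplus>\<^bsub>A\<^esub> str A a0)"
  have a1 [simp]: "a1 \<in> carrier A" "str A a1 = a1" using a0 by (simp_all add: a1_def A.a_comm)
  let ?b1 = "f a1"
  have near: "nrm B (b' \<ominus>\<^bsub>B\<^esub> ?b1) \<le> 1 / 16"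
  proof -
    define d where "d = b' \<ominus>\<^bsub>B\<^esub> f a0"
    have d [simp]: "d \<in> carrier B" using a0 by (simp add: d_def)
    have "b' \<ominus>\<^bsub>B\<^esub> ?b1 = scl B (1 / 2) (d \<oplus>\<^bsub>B\<^esub> str B d)"
    proof -
      have "b' = scl B (1 / 2) (b' \<oplus>\<^bsub>B\<^esub> b')" by (simp add: B.scl_double[symmetric])
      then have "b' \<ominus>\<^bsub>B\<^esub> ?b1 = scl B (1 / 2) ((b' \<oplus>\<^bsub>B\<^esub> b') \<ominus>\<^bsub>B\<^esub> (f a0 \<oplus>\<^bsub>B\<^esub> str B (f a0)))"
        using a0 by (simp add: B.scl_diff_right a1_def)
      also have "(b' \<oplus>\<^bsub>B\<^esub> b') \<ominus>\<^bsub>B\<^esub> (f a0 \<oplus>\<^bsub>B\<^esub> str B (f a0)) = d \<oplus>\<^bsub>B\<^esub> str B d"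
        using a0 by (simp add: d_def B.minus_eq B.minus_add B.a_ac)
      finally show ?thesis .
    qed
    then have "nrm B (b' \<ominus>\<^bsub>B\<^esub> ?b1) \<le> nrm B d" using B.p_triangle[of d "str B d"] by simp
    then show ?thesis using a0 B.p_diff_commute[of "f a0" b'] by (simp add: d_def)
  qed
  have nb1: "nrm B ?b1 \<le> 9 / 16"
    using B.p_diff_abs[of ?b1 b'] B.p_diff_commute[of ?b1 b'] near nb' by simp
  obtain r where r [simp]: "r \<in> carrier A" "str A r = r" and ra: "r \<otimes>\<^bsub>A\<^esub> a1 = a1 \<otimes>\<^bsub>A\<^esub> r"
    and inv: "r \<oplus>\<^bsub>A\<^esub> a1 \<otimes>\<^bsub>A\<^esub> (a1 \<otimes>\<^bsub>A\<^esub> r) = \<one>\<^bsub>A\<^esub>" and nr: "nrm A r \<le> 1" "nrm A (a1 \<otimes>\<^bsub>A\<^esub> r) \<le> 1"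
    using A.bounded_transform[OF a1] .
  have nfr: "nrm B (f r) \<le> 1" using star_hom_contractive[OF A B f r(1)] nr by simp
  have inv': "f r \<oplus>\<^bsub>B\<^esub> ?b1 \<otimes>\<^bsub>B\<^esub> (?b1 \<otimes>\<^bsub>B\<^esub> f r) = \<one>\<^bsub>B\<^esub>"
    using arg_cong[OF inv, of f] by simp
  have "?b1 \<ominus>\<^bsub>B\<^esub> ?b1 \<otimes>\<^bsub>B\<^esub> f r = ?b1 \<otimes>\<^bsub>B\<^esub> (\<one>\<^bsub>B\<^esub> \<ominus>\<^bsub>B\<^esub> f r)"
    by (simp add: B.minus_eq B.r_distr B.r_minus)
  also have "\<one>\<^bsub>B\<^esub> \<ominus>\<^bsub>B\<^esub> f r = ?b1 \<otimes>\<^bsub>B\<^esub> (?b1 \<otimes>\<^bsub>B\<^esub> f r)"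
    unfolding inv'[symmetric] by (simp add: B.minus_eq B.a_ac B.r_neg1 B.r_neg2 B.r_neg)
  finally have err: "?b1 \<ominus>\<^bsub>B\<^esub> f (a1 \<otimes>\<^bsub>A\<^esub> r) = ?b1 \<otimes>\<^bsub>B\<^esub> (?b1 \<otimes>\<^bsub>B\<^esub> (?b1 \<otimes>\<^bsub>B\<^esub> f r))" by simp
  have bound: "nrm B (?b1 \<otimes>\<^bsub>B\<^esub> z) \<le> 9 / 16 * t" if "z \<in> carrier B" "nrm B z \<le> t" for z t
    using B.p_mult[of ?b1 z] mult_mono[OF nb1 that(2)] that by simp
  have "nrm B (?b1 \<ominus>\<^bsub>B\<^esub> f (a1 \<otimes>\<^bsub>A\<^esub> r)) \<le> 9 / 16 * (9 / 16 * (9 / 16 * 1))"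
    unfolding err by (intro bound nfr) auto
  then have close: "nrm B (b' \<ominus>\<^bsub>B\<^esub> f (a1 \<otimes>\<^bsub>A\<^esub> r)) \<le> 1 / 4"
    using B.p_diff_trans[of b' ?b1 "f (a1 \<otimes>\<^bsub>A\<^esub> r)"] near by simp
  let ?m = "complex_of_real (2 * \<beta>)"
  define a where "a = scl A ?m (a1 \<otimes>\<^bsub>A\<^esub> r)"
  have "a \<in> carrier A" "str A a = a" by (simp_all add: a_def ra)
  moreover have "nrm A a \<le> 2 * \<beta>" using nr \<beta> by (simp add: a_def norm_mult)
  moreover have "nrm B (b \<ominus>\<^bsub>B\<^esub> f a) \<le> \<beta> / 2"
  proof -
    have "b \<ominus>\<^bsub>B\<^esub> f a = scl B ?m (b' \<ominus>\<^bsub>B\<^esub> f (a1 \<otimes>\<^bsub>A\<^esub> r))"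
      using b \<beta> by (simp add: B.scl_diff_right a_def b'_def)
    then show ?thesis using close \<beta> by (simp add: norm_mult)
  qed
  ultimately show ?thesis by (rule that)
qed

text \<open>Each correction halves the bound on the remaining error and has norm at most twice the
  previous bound, so the partial sums form a geometric Cauchy sequence, whose limit is a
  preimage.\<close>

lemma star_hom_surj:
  assumes A: "cstar_alg A" and B: "cstar_alg B" and f: "star_hom A B f"
    and dense: "\<And>b e. b \<in> carrier B \<Longrightarrow> e > 0 \<Longrightarrow> \<exists>a\<in>carrier A. nrm B (f a \<ominus>\<^bsub>B\<^esub> b) < e"
  shows "f ` carrier A = carrier B"
proof -
  interpret A: cstar_alg A by fact
  interpret B: cstar_alg B by fact
  interpret f: star_hom_pair A B f
    using f A.star_alg_axioms B.star_alg_axioms by (intro star_hom_pairI)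
  have sa: "\<exists>a\<in>carrier A. f a = b" if b: "b \<in> carrier B" "str B b = b" for b
  proof -
    \<comment> \<open>The \<open>+ 1\<close> keeps every \<open>\<beta> n\<close> positive even when
      \<open>b\<close> is zero.\<close>
    define \<beta> where "\<beta> n = (nrm B b + 1) * (1 / 2) ^ n" for n :: nat
    have \<beta>: "\<beta> n > 0" for n using b by (simp add: \<beta>_def add_nonneg_pos)
    have "\<exists>S. \<forall>n. (S n \<in> carrier A \<and> str A (S n) = S n \<and> nrm B (b \<ominus>\<^bsub>B\<^esub> f (S n)) \<le> \<beta> n) \<and>
        nrm A (S (Suc n) \<ominus>\<^bsub>A\<^esub> S n) \<le> 2 * \<beta> n"
    proof (rule dependent_nat_choice)
      show "\<exists>x. x \<in> carrier A \<and> str A x = x \<and> nrm B (b \<ominus>\<^bsub>B\<^esub> f x) \<le> \<beta> 0"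
        using b by (intro exI[of _ "\<zero>\<^bsub>A\<^esub>"]) (simp add: \<beta>_def B.minus_eq)
      fix x n assume x: "x \<in> carrier A \<and> str A x = x \<and> nrm B (b \<ominus>\<^bsub>B\<^esub> f x) \<le> \<beta> n"
      have "str B (b \<ominus>\<^bsub>B\<^esub> f x) = b \<ominus>\<^bsub>B\<^esub> f x" using x b f.hom_str[of x] by simp
      then obtain a where a: "a \<in> carrier A" "str A a = a" "nrm A a \<le> 2 * \<beta> n"
        "nrm B (b \<ominus>\<^bsub>B\<^esub> f x \<ominus>\<^bsub>B\<^esub> f a) \<le> \<beta> n / 2"
        using lift_selfadjoint_approx[OF A B f dense, of "b \<ominus>\<^bsub>B\<^esub> f x" "\<beta> n"] x b \<beta>[of n] by auto
      have "b \<ominus>\<^bsub>B\<^esub> f (x \<oplus>\<^bsub>A\<^esub> a) = b \<ominus>\<^bsub>B\<^esub> f x \<ominus>\<^bsub>B\<^esub> f a"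
        using a x b by (simp add: B.minus_eq B.minus_add B.a_ac)
      moreover have "x \<oplus>\<^bsub>A\<^esub> a \<ominus>\<^bsub>A\<^esub> x = a" using a x by (simp add: A.minus_eq A.a_ac A.r_neg1 A.r_neg2 A.r_neg)
      ultimately show "\<exists>y. (y \<in> carrier A \<and> str A y = y \<and> nrm B (b \<ominus>\<^bsub>B\<^esub> f y) \<le> \<beta> (Suc n)) \<and>
          nrm A (y \<ominus>\<^bsub>A\<^esub> x) \<le> 2 * \<beta> n"
        using a x by (intro exI[of _ "x \<oplus>\<^bsub>A\<^esub> a"]) (simp add: \<beta>_def)
    qed
    then obtain S where S: "\<And>n. S n \<in> carrier A" "\<And>n. nrm B (b \<ominus>\<^bsub>B\<^esub> f (S n)) \<le> \<beta> n"
      "\<And>n. nrm A (S (Suc n) \<ominus>\<^bsub>A\<^esub> S n) \<le> 2 * \<beta> n" by blast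
    have "S \<in> A.CS"
      using S by (intro A.geometric_CS[of S "1 / 2" "2 * (nrm B b + 1)"]) (simp_all add: \<beta>_def algebra_simps)
    then obtain a where a: "a \<in> carrier A" "A.close S (\<lambda>n. a)" by (rule A.CS_limit)
    have "B.close (\<lambda>n. f (S n)) (\<lambda>n. f a)"
      unfolding B.close_def
    proof (rule tendsto_zero_le[OF a(2)[unfolded A.close_def]])
      show "nrm B (f (S n) \<ominus>\<^bsub>B\<^esub> f a) \<le> nrm A (S n \<ominus>\<^bsub>A\<^esub> a)" for n
        using star_hom_contractive[OF A B f, of "S n \<ominus>\<^bsub>A\<^esub> a"] S a by simp
    qed (use S a in simp)
    moreover have "B.close (\<lambda>n. f (S n)) (\<lambda>n. b)"
      unfolding B.close_def
    proof (rule tendsto_zero_le)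
      show "\<beta> \<longlonglongrightarrow> 0"
        unfolding \<beta>_def by (intro tendsto_mult_right_zero LIMSEQ_power_zero) simp
      show "nrm B (f (S n) \<ominus>\<^bsub>B\<^esub> b) \<le> \<beta> n" for n
        using S(2)[of n] B.p_diff_commute[of "f (S n)" b] S(1) b by simp
    qed (use S b in simp)
    ultimately have "f a = b" using B.close_unique[of "\<lambda>n. f (S n)" "f a" b] S a b by simp
    then show ?thesis using a by blast
  qed
  have "b \<in> f ` carrier A" if b: "b \<in> carrier B" for b
  proof -
    \<comment> \<open>Real and imaginary part: \<open>b = h + \<i> k\<close> with \<open>h\<close>
      and \<open>k\<close> self-adjoint, so \<open>sa\<close> lifts both.\<close>
    define h where "h = scl B (1 / 2) (b \<oplus>\<^bsub>B\<^esub> str B b)"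
    define k where "k = scl B (\<i> / 2) (str B b \<ominus>\<^bsub>B\<^esub> b)"
    have h: "h \<in> carrier B" "str B h = h" using b by (simp_all add: h_def B.a_comm)
    have k: "k \<in> carrier B" "str B k = k"
      using b by (simp_all add: k_def B.scl_minus_left B.scl_minus_right[symmetric] del: B.scl_minus_right)
        (simp add: B.minus_eq B.minus_add B.a_comm)
    obtain x y where x: "x \<in> carrier A" "f x = h" and y: "y \<in> carrier A" "f y = k"
      using sa[OF h] sa[OF k] by blast
    have "h \<oplus>\<^bsub>B\<^esub> scl B \<i> k = scl B (1 / 2) ((b \<oplus>\<^bsub>B\<^esub> str B b) \<oplus>\<^bsub>B\<^esub> \<ominus>\<^bsub>B\<^esub> (str B b \<ominus>\<^bsub>B\<^esub> b))"
      using b by (simp add: h_def k_def B.scl_add_right B.scl_minus_left)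
    also have "(b \<oplus>\<^bsub>B\<^esub> str B b) \<oplus>\<^bsub>B\<^esub> \<ominus>\<^bsub>B\<^esub> (str B b \<ominus>\<^bsub>B\<^esub> b) = scl B 2 b"
      using b by (simp add: B.scl_double B.minus_eq B.minus_add B.a_ac B.r_neg1 B.r_neg2 B.r_neg)
    finally have "b = f (x \<oplus>\<^bsub>A\<^esub> scl A \<i> y)" using x y b by simp
    then show ?thesis using x y by blast
  qed
  then show ?thesis by auto
qed

section \<open>Projections and partial isometries\<close>

text \<open>\<open>h\<close> is a self-adjoint element of the corner cut out by the projection
  \<open>e\<close>, and \<open>e\<close> is the unit of that corner.\<close>

locale corner_element = cstar_alg A for A :: "('a, 'm) cstar_scheme" (structure) +
  fixes e h :: 'a
  assumes e [simp]: "e \<in> carrier A" "str A e = e" "e \<otimes> e = e"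
    and h [simp]: "h \<in> carrier A" "str A h = h" "e \<otimes> h = h" "h \<otimes> e = h"
begin

text \<open>Polynomials in \<open>h\<close> of degree at most four, with \<open>e\<close> as
  constant term; sums, multiples and products with a linear factor become operations on
  coefficients.\<close>

definition pol :: "complex \<Rightarrow> complex \<Rightarrow> complex \<Rightarrow> complex \<Rightarrow> complex \<Rightarrow> 'a" where
  "pol a b c d f = scl A a e \<oplus> (scl A b h \<oplus> (scl A c (h \<otimes> h) \<oplus>
     (scl A d (h \<otimes> (h \<otimes> h)) \<oplus> scl A f (h \<otimes> (h \<otimes> (h \<otimes> h))))))"

lemma pol_closed [simp]: "pol a b c d f \<in> carrier A"
  by (simp add: pol_def)

lemma pol_add: "pol a b c d f \<oplus> pol a' b' c' d' f' = pol (a + a') (b + b') (c + c') (d + d') (f + f')"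
  by (simp add: pol_def scl_add_left a_ac)

lemma pol_scl: "scl A z (pol a b c d f) = pol (z * a) (z * b) (z * c) (z * d) (z * f)"
  by (simp add: pol_def scl_add_right)

lemma e_h_assoc: "x \<in> carrier A \<Longrightarrow> e \<otimes> (h \<otimes> x) = h \<otimes> x"
  by (metis m_assoc e(1) h(1,3))

lemma pol_mult: "pol 1 z 0 0 0 \<otimes> pol a b c d 0 = pol a (b + z * a) (c + z * b) (d + z * c) (z * d)"
  by (simp add: pol_def l_distr r_distr scl_mult_left scl_mult_right scl_add_left scl_add_right e_h_assoc a_ac mult.commute)

abbreviation unit_plus :: "complex \<Rightarrow> 'a" where
  "unit_plus z \<equiv> pol 1 z 0 0 0"

lemma unit_plus_alt: "unit_plus z = e \<oplus> scl A z h"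
  by (simp add: pol_def)

lemma str_unit_plus: "str A (unit_plus z) = unit_plus (cnj z)"
  by (simp add: unit_plus_alt)

end

text \<open>On the spectrum, \<open>1 + t\<close> and \<open>1 - t\<close> both at most
  \<open>1\<close> leave only \<open>t = 0\<close>; the estimates below reach
  \<open>h = \<zero>\<close> by norms alone.\<close>

locale corner_contraction = corner_element A for A :: "('a, 'm) cstar_scheme" (structure) +
  assumes plus: "nrm A (e \<oplus> h) \<le> 1" and minus: "nrm A (e \<ominus> h) \<le> 1"
begin

lemma mult_le_one: "x \<in> carrier A \<Longrightarrow> y \<in> carrier A \<Longrightarrow> nrm A x \<le> 1 \<Longrightarrow> nrm A y \<le> 1 \<Longrightarrow> nrm A (x \<otimes> y) \<le> 1"
  using p_mult[of x y] mult_mono[of "nrm A x" 1 "nrm A y" 1] by simp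

text \<open>The squared norm of \<open>e + \<i> h\<close> is the norm of \<open>e + h^2\<close>,
  which is the mean of the squares of the contractions \<open>e + h\<close> and
  \<open>e - h\<close>.\<close>

lemma unit_plus_le:
  assumes "z \<in> {1, - 1, \<i>, - \<i>}" shows "nrm A (unit_plus z) \<le> 1"
proof -
  have real: "nrm A (unit_plus 1) \<le> 1" "nrm A (unit_plus (- 1)) \<le> 1"
    using plus minus by (simp_all add: unit_plus_alt minus_eq)
  have "str A (unit_plus z) \<otimes> unit_plus z = scl A (1 / 2) (unit_plus 1 \<otimes> unit_plus 1 \<oplus> unit_plus (- 1) \<otimes> unit_plus (- 1))"
    if "z \<in> {\<i>, - \<i>}" for z
    using that by (auto simp: str_unit_plus pol_mult pol_add pol_scl)
  moreover have "nrm A (scl A (1 / 2) (unit_plus 1 \<otimes> unit_plus 1 \<oplus> unit_plus (- 1) \<otimes> unit_plus (- 1))) \<le> 1"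
    using p_triangle[of "unit_plus 1 \<otimes> unit_plus 1" "unit_plus (- 1) \<otimes> unit_plus (- 1)"]
      mult_le_one[OF _ _ real(1) real(1)] mult_le_one[OF _ _ real(2) real(2)] by simp
  ultimately have "(nrm A (unit_plus z))\<^sup>2 \<le> 1\<^sup>2" if "z \<in> {\<i>, - \<i>}" for z
    using that p_cstar[of "unit_plus z"] by simp
  then have "nrm A (unit_plus z) \<le> 1" if "z \<in> {\<i>, - \<i>}" for z
    by (rule power2_le_imp_le) (use that in auto)
  with real assms show ?thesis by auto
qed

text \<open>Summing \<open>(e + z h)^4\<close> with weights \<open>1 / z\<close> over the fourth
  roots of unity keeps only the linear term: the result is \<open>16 h\<close>, and each of the four
  summands has norm at most one.\<close>

lemma h_le: "nrm A h \<le> 1 / 4"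
proof -
  let ?q = "\<lambda>z. unit_plus z \<otimes> (unit_plus z \<otimes> (unit_plus z \<otimes> unit_plus z))"
  have q: "nrm A (?q z) \<le> 1" if "z \<in> {1, - 1, \<i>, - \<i>}" for z
    using unit_plus_le[OF that] by (intro mult_le_one) auto
  have "scl A 16 h = pol 0 16 0 0 0" by (simp add: pol_def)
  also have "\<dots> = (?q 1 \<oplus> scl A (- 1) (?q (- 1))) \<oplus> (scl A (- \<i>) (?q \<i>) \<oplus> scl A \<i> (?q (- \<i>)))"
    by (simp only: pol_mult pol_add pol_scl mult_zero_right add_0) (simp add: algebra_simps)
  finally have "nrm A (scl A 16 h) = nrm A ((?q 1 \<oplus> scl A (- 1) (?q (- 1))) \<oplus> (scl A (- \<i>) (?q \<i>) \<oplus> scl A \<i> (?q (- \<i>))))"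
    by (rule arg_cong)
  also have "\<dots> \<le> (nrm A (?q 1) + nrm A (scl A (- 1) (?q (- 1)))) + (nrm A (scl A (- \<i>) (?q \<i>)) + nrm A (scl A \<i> (?q (- \<i>))))"
    by (rule order.trans[OF p_triangle add_mono[OF p_triangle p_triangle]])
      (simp_all only: a_closed scl_closed m_closed pol_closed)
  also have "\<dots> \<le> 4" using q[of 1] q[of "- 1"] q[of \<i>] q[of "- \<i>"] by (simp only: p_scl m_closed pol_closed) simp
  finally show ?thesis by simp
qed

text \<open>
  The Fejer-type average \<open>(1/2) (e + h)\<^sup>3 + (1/4) (e + ih)\<^sup>3 + (1/4) (e - ih)\<^sup>3\<close> of contractions
  equals \<open>e + (3/2) h + (1/2) h\<^sup>3\<close>: the perturbation of \<open>e\<close> grows by a factor close to \<open>3/2\<close>.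
\<close>
lemma grown_le: "nrm A (pol 1 (3 / 2) 0 (1 / 2) 0) \<le> 1"
proof -
  let ?q = "\<lambda>z. unit_plus z \<otimes> (unit_plus z \<otimes> unit_plus z)"
  have q: "nrm A (?q z) \<le> 1" if "z \<in> {1, - 1, \<i>, - \<i>}" for z
    using unit_plus_le[OF that] by (intro mult_le_one) auto
  have eq: "pol 1 (3 / 2) 0 (1 / 2) 0 = scl A (1 / 2) (?q 1) \<oplus> (scl A (1 / 4) (?q \<i>) \<oplus> scl A (1 / 4) (?q (- \<i>)))"
    by (simp only: pol_mult pol_add pol_scl mult_zero_right add_0) (simp add: algebra_simps)
  have "nrm A (pol 1 (3 / 2) 0 (1 / 2) 0) \<le> nrm A (scl A (1 / 2) (?q 1)) + (nrm A (scl A (1 / 4) (?q \<i>)) + nrm A (scl A (1 / 4) (?q (- \<i>))))"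
    unfolding eq by (rule order.trans[OF p_triangle add_mono[OF order.refl p_triangle]])
      (simp_all only: a_closed scl_closed m_closed pol_closed)
  also have "\<dots> \<le> 1" using q[of 1] q[of \<i>] q[of "- \<i>"] by (simp only: p_scl m_closed pol_closed) simp
  finally show ?thesis .
qed

end

context cstar_alg
begin

text \<open>The new perturbation \<open>(3 / 2) h + (1 / 2) h^3\<close> is odd in \<open>h\<close>,
  so \<open>grown_le\<close> for \<open>h\<close> and for \<open>- h\<close> controls both signs. As
  \<open>\<parallel>h\<parallel> \<le> 1 / 4\<close>, the cubic term costs at most
  \<open>1 / 32\<close> of the norm, which leaves the factor \<open>47 / 32 > 7 / 5\<close>.\<close>

lemma corner_contraction_grow:
  assumes "corner_contraction e h A"
  obtains h' where "corner_contraction e h' A" "7 / 5 * nrm A h \<le> nrm A h'"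
proof -
  interpret corner_contraction e h A by fact
  interpret neg: corner_contraction e "\<ominus> h" A
    using plus minus by unfold_locales (auto simp: minus_eq l_minus r_minus)
  define h' where "h' = pol 0 (3 / 2) 0 (1 / 2) 0"
  have hh: "h \<otimes> (h \<otimes> h) \<otimes> e = h \<otimes> (h \<otimes> h)" by (simp add: m_assoc)
  have h': "h' = scl A (3 / 2) h \<oplus> scl A (1 / 2) (h \<otimes> (h \<otimes> h))" by (simp add: h'_def pol_def)
  have "e \<oplus> h' = pol 1 (3 / 2) 0 (1 / 2) 0" by (simp add: h' pol_def)
  moreover have "e \<ominus> h' = neg.pol 1 (3 / 2) 0 (1 / 2) 0"
    by (simp add: h' neg.pol_def l_minus r_minus minus_eq minus_add)
  ultimately have "nrm A (e \<oplus> h') \<le> 1" "nrm A (e \<ominus> h') \<le> 1"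
    using grown_le neg.grown_le by simp_all
  then have "corner_contraction e h' A"
    by unfold_locales (auto simp: h' l_distr r_distr scl_mult_left scl_mult_right e_h_assoc hh m_assoc)
  moreover have "7 / 5 * nrm A h \<le> nrm A h'"
  proof -
    have "nrm A (h \<otimes> (h \<otimes> h)) \<le> nrm A h * (nrm A h * nrm A h)"
      using p_mult[of h "h \<otimes> h"] mult_left_mono[OF p_mult[of h h], of "nrm A h"] by simp
    also have "\<dots> \<le> nrm A h * (1 / 4 * (1 / 4))"
      using h_le by (intro mult_left_mono mult_mono) auto
    finally have "nrm A (h \<otimes> (h \<otimes> h)) \<le> nrm A h / 16" by simp
    moreover have "nrm A (scl A (3 / 2) h) \<le> nrm A h' + nrm A (scl A (1 / 2) (h \<otimes> (h \<otimes> h)))"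
      using p_diff_triangle[of h' "scl A (1 / 2) (h \<otimes> (h \<otimes> h))"] by (simp add: h' minus_eq a_assoc r_neg)
    moreover have "0 \<le> nrm A h" by simp
    moreover have "nrm A (scl A (3 / 2) h) = 3 / 2 * nrm A h"
      "nrm A (scl A (1 / 2) (h \<otimes> (h \<otimes> h))) = 1 / 2 * nrm A (h \<otimes> (h \<otimes> h))" by simp_all
    ultimately show ?thesis by linarith
  qed
  ultimately show ?thesis by (rule that)
qed

text \<open>Growth by \<open>7 / 5\<close> in every round contradicts the uniform bound
  \<open>1 / 4\<close> unless \<open>h\<close> vanishes.\<close>

lemma corner_contraction_zero:
  assumes "corner_contraction e h A" shows "h = \<zero>"
proof -
  have le: "(7 / 5) ^ n * nrm A h \<le> 1 / 4" if "corner_contraction e h A" for n h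
    using that
  proof (induction n arbitrary: h)
    case 0
    then show ?case using corner_contraction.h_le by simp
  next
    case (Suc n)
    obtain h' where h': "corner_contraction e h' A" "7 / 5 * nrm A h \<le> nrm A h'"
      using corner_contraction_grow[OF Suc.prems] .
    then have "(7 / 5) ^ n * (7 / 5 * nrm A h) \<le> (7 / 5) ^ n * nrm A h'" by (intro mult_left_mono) auto
    also have "\<dots> \<le> 1 / 4" using h' by (intro Suc.IH)
    finally show ?case by simp
  qed
  interpret corner_contraction e h A by fact
  have "nrm A h = 0"
  proof (rule ccontr)
    assume "nrm A h \<noteq> 0"
    then have pos: "nrm A h > 0" by (auto simp: order_less_le)
    obtain n where n: "1 / (4 * nrm A h) < (7 / 5) ^ n" using real_arch_pow[of "7 / 5"] by auto
    then show False using le[OF assms, of n] pos by (simp add: field_simps)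
  qed
  then show ?thesis by (simp add: nrm_eq_0_iff)
qed

section \<open>Orthogonality of projections that sum to one\<close>

definition projection :: "'a \<Rightarrow> bool" where
  "projection x \<longleftrightarrow> x \<in> carrier A \<and> str A x = x \<and> x \<otimes> x = x"

lemma finsum_unit_minus:
  assumes "finite F" "e \<in> carrier A" "\<And>i. i \<in> F \<Longrightarrow> a i \<in> carrier A"
  shows "finsum A (\<lambda>i. e \<ominus> a i) F = scl A (of_nat (card F)) e \<ominus> finsum A a F"
  using assms
proof (induction F rule: finite_induct)
  case (insert x F)
  then have "finsum A (\<lambda>i. e \<ominus> a i) (insert x F) = (e \<ominus> a x) \<oplus> (scl A (of_nat (card F)) e \<ominus> finsum A a F)"
    by (simp add: Pi_def)
  also have "\<dots> = scl A (of_nat (card (insert x F))) e \<ominus> finsum A a (insert x F)"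
    using insert by (simp add: Pi_def scl_add_left minus_eq minus_add a_ac finsum_closed)
  finally show ?case .
qed (simp add: minus_eq)

text \<open>Compress by \<open>e = P k\<close>: the elements \<open>a i = e P i e\<close> sum to
  \<open>e = a k\<close>, so those with \<open>i\<close> other than \<open>k\<close> sum to zero.
  Then \<open>h = a j / m\<close>, with \<open>m\<close> the number of indices other than
  \<open>k\<close> and \<open>j\<close>, satisfies
  \<open>\<parallel>e \<plusminus> h\<parallel> \<le> 1\<close> and must vanish; finally,
  \<open>a j\<close> is the product of the adjoint of \<open>P j \<otimes> e\<close> with
  \<open>P j \<otimes> e\<close>.\<close>

lemma projections_orthogonal:
  assumes I: "finite I" and P: "\<And>i. i \<in> I \<Longrightarrow> projection (P i)" and sum: "finsum A P I = \<one>"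
    and jk: "j \<in> I" "k \<in> I" "j \<noteq> k"
  shows "P j \<otimes> P k = \<zero>"
proof -
  define e where "e = P k"
  have Pc [simp]: "P i \<in> carrier A" "str A (P i) = P i" "P i \<otimes> P i = P i" if "i \<in> I" for i
    using P[OF that] by (auto simp: projection_def)
  have e [simp]: "e \<in> carrier A" "str A e = e" "e \<otimes> e = e" using jk by (auto simp: e_def)
  have ee: "e \<otimes> (e \<otimes> x) = e \<otimes> x" if "x \<in> carrier A" for x using that by (metis m_assoc e(1,3))
  define a where "a i = e \<otimes> P i \<otimes> e" for i
  have a [simp]: "a i \<in> carrier A" "str A (a i) = a i" "e \<otimes> a i = a i" "a i \<otimes> e = a i" if "i \<in> I" for i
    using that by (auto simp: a_def m_assoc ee)
  \<comment> \<open>\<open>e - a i\<close> is the compression of the projection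
    \<open>1 - P i\<close>.\<close>
  have le: "nrm A (e \<ominus> a i) \<le> 1" if i: "i \<in> I" for i
  proof -
    have eq: "e \<ominus> a i = e \<otimes> (\<one> \<ominus> P i) \<otimes> e"
      using i by (simp add: a_def minus_eq l_distr r_distr l_minus r_minus)
    have "nrm A (\<one> \<ominus> P i) \<le> 1"
      using i by (intro p_projection_le) (auto simp: minus_eq l_distr r_distr l_minus r_minus minus_add a_ac r_neg1 r_neg2 r_neg l_neg)
    moreover have "nrm A e \<le> 1" by (intro p_projection_le) auto
    ultimately have "nrm A (e \<otimes> (\<one> \<ominus> P i)) \<le> 1" "nrm A e \<le> 1"
      using p_mult[of e "\<one> \<ominus> P i"] mult_mono[of "nrm A e" 1 "nrm A (\<one> \<ominus> P i)" 1] i by simp_all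
    then show ?thesis
      unfolding eq using p_mult[of "e \<otimes> (\<one> \<ominus> P i)" e] mult_mono[of "nrm A (e \<otimes> (\<one> \<ominus> P i))" 1 "nrm A e" 1] i by simp
  qed
  let ?F = "I - {k, j}"
  have F: "finite ?F" "?F \<subseteq> I" "I = insert k (insert j ?F)" using I jk by auto
  have sum_a: "finsum A a I = e"
  proof -
    have "finsum A a I = finsum A (\<lambda>i. e \<otimes> P i) I \<otimes> e"
      unfolding a_def using I by (intro finsum_ldistr[symmetric]) auto
    also have "finsum A (\<lambda>i. e \<otimes> P i) I = e \<otimes> finsum A P I"
      using I by (intro finsum_rdistr[symmetric]) auto
    finally show ?thesis by (simp add: sum)
  qed
  have sF: "finsum A a ?F \<in> carrier A" using F by (intro finsum_closed) auto
  have "finsum A a (insert k (insert j ?F)) = a k \<oplus> (a j \<oplus> finsum A a ?F)"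
    using F jk by (subst finsum_insert, (auto)[4], subst finsum_insert) (auto simp: subset_iff)
  then have "e = a k \<oplus> (a j \<oplus> finsum A a ?F)" using sum_a F(3) by simp
  moreover have "a k = e" using jk by (simp add: a_def e_def)
  ultimately have "a j \<oplus> finsum A a ?F = \<zero>"
    using add.l_cancel_one'[of e "a j \<oplus> finsum A a ?F"] jk sF by simp
  then have sum_F: "finsum A a ?F = \<ominus> a j"
    using sF jk by (metis a(1) a_comm minus_equality)
  have "a j = \<zero>"
  proof (cases "card ?F = 0")
    \<comment> \<open>Without further indices, the vanishing sum consists of \<open>a j\<close>
      alone.\<close>
    case True
    then have "?F = {}" using F by simp
    then have "\<ominus> a j = \<zero>" using sum_F by (simp only: finsum_empty)
    then show ?thesis using jk by (metis a(1) local.minus_minus minus_zero)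
  next
    case False
    define m where "m = real (card ?F)"
    have m: "m \<ge> 1" using False by (simp add: m_def)
    define h where "h = scl A (of_real (1 / m)) (a j)"
    have h: "h \<in> carrier A" using jk by (simp add: h_def)
    have mh: "scl A (of_real m) h = a j" using m jk by (simp add: h_def)
    have "corner_contraction e h A"
    proof unfold_locales
      \<comment> \<open>\<open>e + h\<close> is the mean of the contractions \<open>e - a i\<close>
        over \<open>?F\<close>, because the \<open>a i\<close> there add up to
        \<open>- a j\<close>.\<close>
      have "scl A (of_real m) (e \<oplus> h) = scl A (of_nat (card ?F)) e \<ominus> finsum A a ?F"
        using h mh jk by (simp add: scl_add_right sum_F minus_eq m_def)
      also have "\<dots> = finsum A (\<lambda>i. e \<ominus> a i) ?F"
        using F by (intro finsum_unit_minus[symmetric]) auto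
      finally have eq: "scl A (of_real m) (e \<oplus> h) = finsum A (\<lambda>i. e \<ominus> a i) ?F" .
      have "nrm A (scl A (of_real m) (e \<oplus> h)) \<le> (\<Sum>i\<in>?F. nrm A (e \<ominus> a i))"
        unfolding eq using F by (intro p_finsum_le) auto
      also have "\<dots> \<le> (\<Sum>i\<in>?F. 1)" using le by (intro sum_mono) auto
      finally have "m * nrm A (e \<oplus> h) \<le> m" using m h by (simp add: m_def)
      then show "nrm A (e \<oplus> h) \<le> 1" using m by simp
      \<comment> \<open>A convex combination of the contractions \<open>e\<close> and
        \<open>e - a j\<close>.\<close>
      have eq: "e \<ominus> h = scl A (of_real (1 - 1 / m)) e \<oplus> scl A (of_real (1 / m)) (e \<ominus> a j)"
      proof -
        have "e = scl A (of_real (1 - 1 / m) + of_real (1 / m)) e" by simp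
        then have "e \<ominus> h = (scl A (of_real (1 - 1 / m)) e \<oplus> scl A (of_real (1 / m)) e) \<ominus> h"
          by (simp only: scl_add_left e(1))
        then show ?thesis using jk h by (simp add: h_def minus_eq scl_add_right a_assoc)
      qed
      have "nrm A (e \<ominus> h) \<le> nrm A (scl A (of_real (1 - 1 / m)) e) + nrm A (scl A (of_real (1 / m)) (e \<ominus> a j))"
        unfolding eq using jk by (intro p_triangle) auto
      also have "\<dots> = (1 - 1 / m) * nrm A e + 1 / m * nrm A (e \<ominus> a j)"
        using m jk by (simp only: p_scl norm_of_real e(1) minus_closed a(1)) simp
      also have "\<dots> \<le> (1 - 1 / m) * 1 + 1 / m * 1"
        using m le[OF jk(1)] p_projection_le[of e] by (intro add_mono mult_left_mono) auto
      finally show "nrm A (e \<ominus> h) \<le> 1" by simp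
    qed (use jk in \<open>auto simp: h_def scl_mult_left scl_mult_right\<close>)
    then have "h = \<zero>" by (rule corner_contraction_zero)
    then show ?thesis using mh by simp
  qed
  moreover have "str A (P j \<otimes> e) \<otimes> (P j \<otimes> e) = a j"
    using jk by (simp add: a_def m_assoc) (metis Pc e(1) m_assoc m_closed)
  ultimately have "(nrm A (P j \<otimes> e))\<^sup>2 = 0" using p_cstar[of "P j \<otimes> e"] jk by simp
  then show ?thesis using jk by (simp add: nrm_eq_0_iff e_def)
qed

section \<open>Partial isometries and their source and range projections\<close>

definition partial_isometry :: "'a \<Rightarrow> bool" where
  "partial_isometry x \<longleftrightarrow> x \<in> carrier A \<and> x \<otimes> str A x \<otimes> x = x"

lemma partial_isometryD:
  assumes "partial_isometry x"
  shows "x \<in> carrier A" "x \<otimes> (str A x \<otimes> x) = x" "str A x \<otimes> (x \<otimes> str A x) = str A x"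
    "projection (x \<otimes> str A x)" "projection (str A x \<otimes> x)"
proof -
  show x: "x \<in> carrier A" and 1: "x \<otimes> (str A x \<otimes> x) = x"
    using assms by (auto simp: partial_isometry_def m_assoc)
  from arg_cong[OF 1, of "str A"] show 2: "str A x \<otimes> (x \<otimes> str A x) = str A x"
    using x by (simp add: m_assoc)
  show "projection (x \<otimes> str A x)" "projection (str A x \<otimes> x)"
    using x 1 2 by (auto simp: projection_def m_assoc)
qed

text \<open>
  The product \<open>q P\<close> is idempotent for the projections \<open>q = x\<^sup>* x\<close> and \<open>P = y y\<^sup>*\<close>; then \<open>\<parallel>q P - P q P\<parallel>\<^sup>2 = 0\<close> by expanding.
\<close>
lemma partial_isometry_commute:
  assumes x: "partial_isometry x" and y: "partial_isometry y" and xy: "partial_isometry (x \<otimes> y)"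
  shows "(str A x \<otimes> x) \<otimes> (y \<otimes> str A y) = (y \<otimes> str A y) \<otimes> (str A x \<otimes> x)"
proof -
  note X = partial_isometryD[OF x] and Y = partial_isometryD[OF y] and XY = partial_isometryD[OF xy]
  define q where "q = str A x \<otimes> x"
  define P where "P = y \<otimes> str A y"
  have q [simp]: "q \<in> carrier A" "str A q = q" "q \<otimes> q = q"
    and P [simp]: "P \<in> carrier A" "str A P = P" "P \<otimes> P = P"
    using X(5) Y(4) by (auto simp: q_def P_def projection_def)
  have [simp]: "x \<in> carrier A" "y \<in> carrier A" using X Y by auto
  have qq: "q \<otimes> (q \<otimes> z) = q \<otimes> z" and PP: "P \<otimes> (P \<otimes> z) = P \<otimes> z" if "z \<in> carrier A" for z
    using that by (metis m_assoc q(1,3), metis m_assoc P(1,3))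
  have "x \<otimes> (y \<otimes> (str A y \<otimes> (str A x \<otimes> (x \<otimes> y)))) = x \<otimes> y"
    using XY(2) by (simp add: m_assoc)
  then have "str A x \<otimes> (x \<otimes> (y \<otimes> (str A y \<otimes> (str A x \<otimes> (x \<otimes> y))))) \<otimes> str A y = str A x \<otimes> (x \<otimes> y) \<otimes> str A y"
    by simp
  then have idem: "q \<otimes> (P \<otimes> (q \<otimes> P)) = q \<otimes> P" by (simp add: q_def P_def m_assoc)
  have idem': "q \<otimes> (P \<otimes> (q \<otimes> (P \<otimes> z))) = q \<otimes> (P \<otimes> z)" if "z \<in> carrier A" for z
    using idem that by (metis m_assoc m_closed q(1) P(1))
  define d where "d = q \<otimes> P \<ominus> P \<otimes> (q \<otimes> P)"
  have "str A d \<otimes> d = \<zero>"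
    by (simp add: d_def minus_eq l_distr r_distr l_minus r_minus m_assoc qq PP idem idem')
      (simp add: a_ac r_neg l_neg r_neg1 r_neg2)
  then have "(nrm A d)\<^sup>2 = 0" using p_cstar[of d] by (simp add: d_def)
  then have "d = \<zero>" by (simp add: nrm_eq_0_iff d_def)
  then have eq: "q \<otimes> P = P \<otimes> (q \<otimes> P)" by (simp add: d_def minus_zero_iff)
  \<comment> \<open>\<open>P q P\<close> is self-adjoint, so the adjoint of \<open>eq\<close> has
    the same right-hand side.\<close>
  have "P \<otimes> q = P \<otimes> (q \<otimes> P)" using arg_cong[OF eq, of "str A"] by (simp add: m_assoc)
  then have "q \<otimes> P = P \<otimes> q" by (rule trans[OF eq sym])
  then show ?thesis by (simp add: q_def P_def)
qed

end

section \<open>The dual of the free group\<close>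

lemma flip_flip [simp]: "flip (flip x) = x"
  by (simp add: flip_def case_prod_unfold)

abbreviation reduced :: "('n \<times> bool) list \<Rightarrow> bool" where
  "reduced w \<equiv> successively (\<lambda>x y. y \<noteq> flip x) w"

lemma reduced_red_cons: "reduced w \<Longrightarrow> reduced (red_cons x w)"
  by (cases w) (auto simp: red_cons_def successively_Cons)

text \<open>Letters act on reduced words by permutations, with \<open>flip x\<close> inverting
  \<open>x\<close>; since the product is defined through this action, associativity reduces to
  it.\<close>

lemma red_cons_flip: "reduced w \<Longrightarrow> red_cons x (red_cons (flip x) w) = w"
  by (cases w) (auto simp: red_cons_def successively_Cons)

lemma red_cons_reduced: "reduced (x # w) \<Longrightarrow> red_cons x w = x # w"
  by (cases w) (auto simp: red_cons_def)

lemma reduced_ConsD: "reduced (x # w) \<Longrightarrow> reduced w"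
  by (cases w) auto

lemma reduced_foldr: "reduced w \<Longrightarrow> reduced (foldr red_cons v w)"
  by (induction v) (auto simp: reduced_red_cons)

text \<open>If \<open>x\<close> cancels the first letter of \<open>w\<close>, that letter is
  \<open>flip x\<close>, and its action on the product is undone by
  \<open>red_cons_flip\<close>.\<close>

lemma foldr_red_cons_red_cons:
  assumes "reduced w" "reduced z"
  shows "foldr red_cons (red_cons x w) z = red_cons x (foldr red_cons w z)"
proof (cases "w \<noteq> [] \<and> hd w = flip x")
  case True
  then obtain w' where w: "w = flip x # w'" by (cases w) auto
  then show ?thesis
    using red_cons_flip[OF reduced_foldr[OF assms(2)], of x w'] by (simp add: red_cons_def[of x "flip x # w'"])
qed (auto simp: red_cons_def)

lemma foldr_red_cons_assoc:
  assumes "reduced w" "reduced z"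
  shows "foldr red_cons (foldr red_cons v w) z = foldr red_cons v (foldr red_cons w z)"
  using assms by (induction v) (auto simp: foldr_red_cons_red_cons reduced_foldr)

lemma carrier_free_group: "carrier free_group = {w. reduced w}"
  and mult_free_group: "v \<otimes>\<^bsub>free_group\<^esub> w = foldr red_cons v w"
  and one_free_group: "\<one>\<^bsub>free_group\<^esub> = []"
  by (simp_all add: free_group_def)

lemma group_free_group: "group free_group"
proof (rule groupI)
  fix w :: "('n \<times> bool) list" assume "w \<in> carrier free_group"
  then have w: "reduced w" by (simp add: carrier_free_group)
  have "successively (\<lambda>x y. flip x \<noteq> y) w"
    using w by (rule successively_mono) (metis flip_flip)
  then have "reduced (rev (map flip w))"
    by (simp add: successively_rev successively_map)
  moreover have "foldr red_cons (rev (map flip w)) w = []"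
    by (induction w) (auto simp: red_cons_def)
  ultimately show "\<exists>v\<in>carrier free_group. v \<otimes>\<^bsub>free_group\<^esub> w = \<one>\<^bsub>free_group\<^esub>"
    by (intro bexI[of _ "rev (map flip w)"]) (simp_all add: carrier_free_group mult_free_group one_free_group)
qed (auto simp: carrier_free_group mult_free_group one_free_group reduced_foldr foldr_red_cons_assoc)

lemma inv_free_group_single: "inv\<^bsub>free_group\<^esub> [x] = [flip x]"
proof -
  interpret group free_group by (rule group_free_group)
  show ?thesis
    by (rule inv_equality) (auto simp: carrier_free_group mult_free_group one_free_group red_cons_def)
qed

section \<open>Full group C*-algebras and their comultiplication\<close>

context involutive_monoid
begin

text \<open>The bound has to be uniform over all seminorms satisfying \<open>Q\<close>; uniform
  bounds on the finitely many basis elements of \<open>f\<close> give one for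
  \<open>f\<close>.\<close>

lemma MA_bounded:
  assumes Q: "\<And>p. Q p \<Longrightarrow> cstar_seminorm MA p"
    and delta: "\<And>m. m \<in> carrier M \<Longrightarrow> \<exists>K. \<forall>p. Q p \<longrightarrow> p (delta m) \<le> K"
    and f: "f \<in> carrier MA"
  shows "\<exists>K. \<forall>p. Q p \<longrightarrow> p f \<le> K"
  using f
proof (induction f rule: MA_induct)
  case zero
  have "p \<zero>\<^bsub>MA\<^esub> \<le> 0" if "Q p" for p
  proof -
    interpret seminormed_star_alg MA p
      using Q[OF that] MA.star_alg_axioms by (simp add: seminormed_star_alg_iff star_alg_iff)
    show ?thesis by simp
  qed
  then show ?case by blast
next
  case (step f c m)
  obtain K where K: "\<And>p. Q p \<Longrightarrow> p f \<le> K" using step.IH by blast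
  obtain L where L: "\<And>p. Q p \<Longrightarrow> p (delta m) \<le> L" using delta step.hyps by blast
  have "p (f \<oplus>\<^bsub>MA\<^esub> scl MA c (delta m)) \<le> K + cmod c * L" if "Q p" for p
  proof -
    interpret seminormed_star_alg MA p
      using Q[OF that] MA.star_alg_axioms by (simp add: seminormed_star_alg_iff star_alg_iff)
    have "p (f \<oplus>\<^bsub>MA\<^esub> scl MA c (delta m)) \<le> p f + cmod c * p (delta m)"
      using p_triangle[of f "scl MA c (delta m)"] step.hyps by simp
    also have "\<dots> \<le> K + cmod c * L" using K[OF that] L[OF that] by (intro add_mono mult_left_mono) auto
    finally show ?thesis .
  qed
  then show ?case by blast
qed

text \<open>Formal sums are dense in the completion, so a closed star subalgebra need only contain
  the images of basis elements. The premise \<open>gen\<close> receives the algebraic closure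
  properties of \<open>S\<close>; limits are dealt with here.\<close>

lemma generates_completion:
  assumes p: "seminormed_star_alg MA p"
    and gen: "\<And>S. S \<subseteq> carrier (completion MA p) \<Longrightarrow> X \<subseteq> S \<Longrightarrow> \<one>\<^bsub>completion MA p\<^esub> \<in> S \<Longrightarrow>
      (\<And>x y. x \<in> S \<Longrightarrow> y \<in> S \<Longrightarrow> x \<oplus>\<^bsub>completion MA p\<^esub> y \<in> S \<and> x \<otimes>\<^bsub>completion MA p\<^esub> y \<in> S) \<Longrightarrow>
      (\<And>x c. x \<in> S \<Longrightarrow> str (completion MA p) x \<in> S \<and> scl (completion MA p) c x \<in> S) \<Longrightarrow>
      (\<And>m. m \<in> carrier M \<Longrightarrow> incl MA p (delta m) \<in> S)"
  shows "generates (completion MA p) X"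
  unfolding generates_def
proof (intro allI impI)
  interpret p: seminormed_star_alg MA p by (rule p)
  interpret C: cstar_alg "completion MA p" by (rule p.cstar_alg_Cp)
  interpret I: star_hom_pair MA "completion MA p" "incl MA p"
    using p.star_hom_inc MA.star_alg_axioms C.star_alg_axioms by (intro star_hom_pairI)
  fix S
  assume S: "S \<subseteq> carrier (completion MA p)" and *: "X \<subseteq> S \<and> \<one>\<^bsub>completion MA p\<^esub> \<in> S
      \<and> (\<forall>x\<in>S. \<forall>y\<in>S. x \<oplus>\<^bsub>completion MA p\<^esub> y \<in> S \<and> x \<otimes>\<^bsub>completion MA p\<^esub> y \<in> S)
      \<and> (\<forall>x\<in>S. str (completion MA p) x \<in> S \<and> (\<forall>c. scl (completion MA p) c x \<in> S))
      \<and> (\<forall>x a. (\<forall>n. x n \<in> S) \<and> a \<in> carrier (completion MA p) \<and>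
          (\<lambda>n. nrm (completion MA p) (x n \<ominus>\<^bsub>completion MA p\<^esub> a)) \<longlonglongrightarrow> 0 \<longrightarrow> a \<in> S)"
  have delta: "incl MA p (delta m) \<in> S" if "m \<in> carrier M" for m
    using * by (intro gen[OF S _ _ _ _ that]) auto
  have inc: "incl MA p f \<in> S" if "f \<in> carrier MA" for f
    using that
  proof (induction f rule: MA_induct)
    case zero
    have "scl (completion MA p) 0 \<one>\<^bsub>completion MA p\<^esub> \<in> S" using * by blast
    then show ?case by simp
  next
    case (step f c m)
    then show ?case using * delta[of m] by simp
  qed
  have "A \<in> S" if A: "A \<in> carrier (completion MA p)" for A
  proof -
    obtain x where x: "x \<in> cauchy_seqs MA p" "A = cauchy_class MA p x" using A by (rule p.carrier_CpE)
    then have "(\<forall>n. incl MA p (x n) \<in> S) \<and> A \<in> carrier (completion MA p) \<and>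
        (\<lambda>n. nrm (completion MA p) (incl MA p (x n) \<ominus>\<^bsub>completion MA p\<^esub> A)) \<longlonglongrightarrow> 0"
      using inc p.CS_seq[OF x(1)] A p.inc_tendsto[OF x(1)] by simp
    then show ?thesis using * by (elim conjE) (drule spec[of _ "\<lambda>n. incl MA p (x n)"], blast)
  qed
  then show "S = carrier (completion MA p)" using S by blast
qed

end

lemma invertible_matrix_diag:
  fixes A :: "('a, 'm) cstar_scheme"
  assumes "ring A" "\<And>i. a i \<in> carrier A" "\<And>i. b i \<in> carrier A"
    and "\<And>i. a i \<otimes>\<^bsub>A\<^esub> b i = \<one>\<^bsub>A\<^esub>" "\<And>i. b i \<otimes>\<^bsub>A\<^esub> a i = \<one>\<^bsub>A\<^esub>"
  shows "invertible_matrix A n (\<lambda>i j. if i = j then a i else \<zero>\<^bsub>A\<^esub>)"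
proof -
  interpret ring A by fact
  have *: "finsum A (\<lambda>k. (if i = k then x i else \<zero>\<^bsub>A\<^esub>) \<otimes>\<^bsub>A\<^esub> (if k = j then y k else \<zero>\<^bsub>A\<^esub>)) {..<n}
      = (if i = j then \<one>\<^bsub>A\<^esub> else \<zero>\<^bsub>A\<^esub>)"
    if "i < n" "\<And>i. x i \<in> carrier A" "\<And>i. y i \<in> carrier A" "\<And>i. x i \<otimes>\<^bsub>A\<^esub> y i = \<one>\<^bsub>A\<^esub>" for x y i j
    using that by (subst finsum_single[of _ i]) auto
  show ?thesis
    unfolding invertible_matrix_def using assms
    by (intro exI[of _ "\<lambda>i j. if i = j then b i else \<zero>\<^bsub>A\<^esub>"]) (auto simp: *)
qed

locale group_dual_locale = group G for G :: "('g, 'k) monoid_scheme" (structure)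
begin

sublocale involutive_monoid G "m_inv G"
  by unfold_locales (auto simp: inv_mult_group)

text \<open>\<open>delta g\<close> is unitary, so by the C*-identity its squared seminorm is the
  seminorm of the unit; this makes the universal seminorm finite without relations.\<close>

lemma p_delta_le_one:
  assumes "cstar_seminorm MA p" "g \<in> carrier G"
  shows "p (delta g) \<le> 1"
proof -
  interpret p: seminormed_star_alg MA p
    using assms MA.star_alg_axioms by (simp add: seminormed_star_alg_iff star_alg_iff)
  have "(p (delta g))\<^sup>2 = p (delta \<one>)"
    using p.p_cstar[of "delta g"] assms by simp
  also have "\<dots> \<le> 1\<^sup>2" using p.p_one_le by (simp add: one_MA)
  finally show ?thesis by (rule power2_le_imp_le) simp
qed

sublocale univ: universal_star_alg "monoid_algebra G (m_inv G)" "{}"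
proof unfold_locales
  fix x assume x: "x \<in> carrier MA"
  show "\<exists>K. \<forall>p. cstar_seminorm MA p \<and> (\<forall>(a, b)\<in>{}. p (a \<ominus>\<^bsub>MA\<^esub> b) = 0) \<longrightarrow> p x \<le> K"
    by (rule MA_bounded[OF _ _ x]) (auto intro: p_delta_le_one)
qed simp

abbreviation "B \<equiv> group_cstar G"

abbreviation "ge \<equiv> group_elem G"

lemma B_def: "B = completion MA (univ_seminorm MA {})"
  by (simp add: group_cstar_def universal_cstar_def)

sublocale B: cstar_alg "group_cstar G"
  unfolding group_cstar_def by (rule univ.cstar_alg_universal)

lemma ge_def: "ge g = incl MA (univ_seminorm MA {}) (delta g)"
  by (simp add: group_elem_def Let_def)

sublocale I: star_hom_pair "monoid_algebra G (m_inv G)" "group_cstar G" "incl MA (univ_seminorm MA {})"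
  using univ.U.star_hom_inc MA.star_alg_axioms B.star_alg_axioms
  by (intro star_hom_pairI) (simp_all add: B_def)

lemma ge_closed [simp, intro]: "g \<in> carrier G \<Longrightarrow> ge g \<in> carrier B"
  by (simp add: ge_def)

lemma ge_mult: "g \<in> carrier G \<Longrightarrow> h \<in> carrier G \<Longrightarrow> ge g \<otimes>\<^bsub>B\<^esub> ge h = ge (g \<otimes> h)"
  using I.hom_mult[of "delta g" "delta h"] by (simp add: ge_def)

lemma ge_one: "ge \<one> = \<one>\<^bsub>B\<^esub>"
  using I.hom_one by (simp add: ge_def one_MA)

lemma ge_str: "g \<in> carrier G \<Longrightarrow> str B (ge g) = ge (inv g)"
  using I.hom_str[of "delta g"] by (simp add: ge_def)

sublocale BB: tensor "group_cstar G" "group_cstar G"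
  by unfold_locales

text \<open>The comultiplication is a chosen one, so existence comes first:
  \<open>g \<mapsto> g \<otimes> g\<close> is multiplicative, sends inverses to adjoints, and
  extends by the universal property.\<close>

lemma group_comult:
  "star_hom B (min_tensor B B) (group_comult G)"
  "g \<in> carrier G \<Longrightarrow> group_comult G (ge g) = tns B B (ge g) (ge g)"
proof -
  let ?h = "\<lambda>g. tns B B (ge g) (ge g)"
  have h: "?h g \<in> carrier BB.D" if "g \<in> carrier G" for g using that by simp
  have hom: "star_hom MA BB.D (extend BB.D ?h)"
    by (rule star_hom_extend[OF BB.D.star_alg_axioms h])
      (auto simp: ge_one BB.t_one BB.t_mult BB.t_str ge_mult ge_str)
  have "\<exists>\<Delta>. star_hom B BB.D \<Delta> \<and> (\<forall>g\<in>carrier G. \<Delta> (ge g) = tns B B (ge g) (ge g))"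
  proof (rule univ.universal_extend[OF BB.D.cstar_alg_axioms hom])
    fix \<Delta> assume "star_hom (universal_cstar MA {}) BB.D \<Delta>"
      "\<And>a. a \<in> carrier MA \<Longrightarrow> \<Delta> (incl MA (univ_seminorm MA {}) a) = extend BB.D ?h a"
    then show ?thesis
      using extend_delta[OF BB.D.star_alg_axioms h]
      by (intro exI[of _ \<Delta>]) (auto simp: ge_def group_cstar_def)
  qed simp
  from someI_ex[OF this] show "star_hom B (min_tensor B B) (group_comult G)"
    "g \<in> carrier G \<Longrightarrow> group_comult G (ge g) = tns B B (ge g) (ge g)"
    unfolding group_comult_def Let_def by blast+
qed

end

text \<open>Inverse letters are the adjoints of the generators, and a reduced word is the product of
  its letters without cancellation.\<close>

lemma free_group_elem_induct:
  fixes S :: "(nat \<Rightarrow> ('n \<times> bool) list \<Rightarrow> complex) set set"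
  assumes gen: "\<And>i. group_elem free_group [(i, True)] \<in> S"
    and one: "\<one>\<^bsub>group_cstar free_group\<^esub> \<in> S"
    and mult: "\<And>x y. x \<in> S \<Longrightarrow> y \<in> S \<Longrightarrow> x \<otimes>\<^bsub>group_cstar free_group\<^esub> y \<in> S"
    and str: "\<And>x. x \<in> S \<Longrightarrow> str (group_cstar free_group) x \<in> S"
    and w: "w \<in> carrier free_group"
  shows "group_elem free_group w \<in> S"
proof -
  let ?F = "free_group :: ('n \<times> bool) list monoid"
  interpret group ?F by (rule group_free_group)
  interpret group_dual_locale ?F ..
  have single: "[x] \<in> carrier ?F" for x :: "'n \<times> bool" by (simp add: carrier_free_group)
  have letter: "ge [x] \<in> S" for x
  proof (cases x)
    case (Pair i b)
    have "str B (ge [(i, True)]) = ge [(i, False)]"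
      using single by (simp add: ge_str inv_free_group_single) (simp add: flip_def)
    then show ?thesis using gen[of i] str[OF gen[of i]] Pair by (cases b) auto
  qed
  from w show ?thesis
  proof (induction w)
    case Nil
    then show ?case using one ge_one by (simp add: one_free_group)
  next
    case (Cons x w)
    then have xw: "reduced (x # w)" by (simp add: carrier_free_group)
    then have w: "w \<in> carrier ?F" using reduced_ConsD by (simp add: carrier_free_group) blast
    have "ge (x # w) = ge [x] \<otimes>\<^bsub>B\<^esub> ge w"
      using w single xw by (simp add: ge_mult mult_free_group red_cons_reduced)
    then show ?case using mult letter Cons.IH[OF w] by simp
  qed
qed

lemma free_group_dual_cmqg:
  "compact_matrix_quantum_group (group_dual (free_group :: ('n::finite \<times> bool) list monoid))"
proof -
  let ?F = "free_group :: ('n \<times> bool) list monoid"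
  interpret group ?F by (rule group_free_group)
  interpret group_dual_locale ?F ..
  define n where "n = CARD('n)"
  \<comment> \<open>Matrices in \<open>compact_matrix_quantum_group\<close> are indexed by natural
    numbers, so the generators are enumerated; the fundamental representation is the diagonal matrix
    formed by them.\<close>
  obtain idx :: "nat \<Rightarrow> 'n" where idx: "bij_betw idx {0..<n} UNIV"
    using ex_bij_betw_nat_finite[of "UNIV :: 'n set"] by (auto simp: n_def)
  have single: "[x] \<in> carrier ?F" for x :: "'n \<times> bool" by (simp add: carrier_free_group)
  define a where "a i = ge [(idx i, True)]" for i
  define b where "b i = ge [(idx i, False)]" for i
  have ab: "a i \<in> carrier B" "b i \<in> carrier B" "a i \<otimes>\<^bsub>B\<^esub> b i = \<one>\<^bsub>B\<^esub>" "b i \<otimes>\<^bsub>B\<^esub> a i = \<one>\<^bsub>B\<^esub>" for i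
    using single ge_one
    by (auto simp: a_def b_def ge_mult mult_free_group one_free_group red_cons_def flip_def)
  have str_a: "str B (a i) = b i" for i
    using single by (simp add: a_def b_def ge_str inv_free_group_single) (simp add: flip_def)
  define u where "u i j = (if i = j then a i else \<zero>\<^bsub>B\<^esub>)" for i j
  have u: "u i j \<in> carrier B" for i j using ab by (simp add: u_def)
  have "generates B {u i j | i j. i < n \<and> j < n}"
  proof (rule generates_completion[OF univ.U.seminormed_star_alg_axioms, folded B_def ge_def])
    fix S and w :: "('n \<times> bool) list"
    assume S: "{u i j | i j. i < n \<and> j < n} \<subseteq> S" "\<one>\<^bsub>B\<^esub> \<in> S"
      "\<And>x y. x \<in> S \<Longrightarrow> y \<in> S \<Longrightarrow> x \<oplus>\<^bsub>B\<^esub> y \<in> S \<and> x \<otimes>\<^bsub>B\<^esub> y \<in> S"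
      "\<And>x c. x \<in> S \<Longrightarrow> str B x \<in> S \<and> scl B c x \<in> S"
    have gen: "ge [(i, True)] \<in> S" for i
    proof -
      obtain k where k: "k < n" "idx k = i"
        using idx by (metis UNIV_I atLeastLessThan_iff bij_betw_iff_bijections)
      have "u k k \<in> S" using S(1) k by blast
      then show ?thesis using k by (simp add: u_def a_def)
    qed
    assume w: "w \<in> carrier ?F"
    show "ge w \<in> S" by (rule free_group_elem_induct[OF gen S(2) _ _ w]) (use S in auto)
  qed
  moreover have "invertible_matrix B n u"
    using ab invertible_matrix_diag[of B a b n, OF B.ring_axioms] by (simp add: u_def[abs_def])
  moreover have "invertible_matrix B n (\<lambda>i j. str B (u i j))"
  proof -
    have "(\<lambda>i j. str B (u i j)) = (\<lambda>i j. if i = j then b i else \<zero>\<^bsub>B\<^esub>)"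
      by (auto simp: u_def str_a fun_eq_iff)
    then show ?thesis using ab invertible_matrix_diag[of B b a n, OF B.ring_axioms] by simp
  qed
  moreover have "group_comult ?F (u i j) = finsum (min_tensor B B) (\<lambda>k. tns B B (u i k) (u k j)) {..<n}"
    if "i < n" "j < n" for i j
  proof -
    interpret \<Delta>: star_hom_pair B BB.D "group_comult ?F"
      using group_comult(1) B.star_alg_axioms BB.D.star_alg_axioms by (intro star_hom_pairI)
    have "finsum BB.D (\<lambda>k. tns B B (u i k) (u k j)) {..<n} = tns B B (u i i) (u i j)"
      using that ab by (intro BB.D.finsum_single) (auto simp: u_def)
    then show ?thesis
      using ab single by (auto simp: u_def a_def group_comult(2))
  qed
  ultimately show ?thesis
    unfolding compact_matrix_quantum_group_def group_dual_def
    using u group_comult(1) B.cstar_alg_axioms[unfolded cstar_alg_iff]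
    by (simp, intro exI[of _ n] exI[of _ u], simp)
qed

section \<open>Families satisfying the relations of \<open>C(G\<^sub>A\<^sup>l)\<close>\<close>

lemma word_prod_Nil [simp]: "word_prod P u [] \<beta> = \<one>\<^bsub>P\<^esub>" "word_prod P u \<alpha> [] = \<one>\<^bsub>P\<^esub>"
  by (simp_all add: word_prod_def)

lemma word_prod_Cons [simp]:
  "word_prod P u (a # \<alpha>) (b # \<beta>) = u a b \<otimes>\<^bsub>P\<^esub> word_prod P u \<alpha> \<beta>"
  by (simp add: word_prod_def)

lemma (in star_alg) word_prod_closed:
  assumes "\<And>a b. u a b \<in> carrier A"
  shows "word_prod A u \<alpha> \<beta> \<in> carrier A"
proof (induction \<alpha> arbitrary: \<beta>)
  case (Cons a \<alpha>)
  then show ?case using assms by (cases \<beta>) auto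
qed simp

lemma (in star_hom_pair) hom_word_prod:
  assumes "\<And>a b. u a b \<in> carrier A"
  shows "f (word_prod A u \<alpha> \<beta>) = word_prod B (\<lambda>a b. f (u a b)) \<alpha> \<beta>"
proof (induction \<alpha> arbitrary: \<beta>)
  case (Cons a \<alpha>)
  then show ?case using assms by (cases \<beta>) (auto simp: dom.word_prod_closed)
qed simp

lemma words_Cons_iff: "a # \<alpha> \<in> words A (Suc n) \<longleftrightarrow> \<alpha> \<in> words A n \<and> (\<alpha> \<noteq> [] \<longrightarrow> A $ a $ hd \<alpha> = 1)"
proof -
  have *: "x \<in> words A m \<longleftrightarrow> length x = m \<and> successively (\<lambda>a b. A $ a $ b = 1) x" for x m
    by (auto simp: words_def successively_conv_nth)
  show ?thesis unfolding * by (auto simp: successively_Cons)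
qed

lemma words_length: "\<alpha> \<in> words A n \<Longrightarrow> length \<alpha> = n"
  by (simp add: words_def)

lemma Nil_words: "[] \<in> words A 0"
  by (simp add: words_def)

lemma image_Collect3: "F ` {h a b | a b n. Q a b n} = {F (h a b) | a b n. Q a b n}"
  by blast

lemma Collect2_Id: "{(f a b, g a b) | a b. True} \<subseteq> Id \<longleftrightarrow> (\<forall>a b. f a b = g a b)"
  by auto

lemma Collect3_Id: "{(f a b, g a b) | a b n. Q a b n} \<subseteq> Id \<longleftrightarrow> (\<forall>n a b. Q a b n \<longrightarrow> f a b = g a b)"
  by auto

text \<open>All relations are built from the star algebra operations, so a homomorphism carries them
  along. This serves twice: the presentation yields relations in the universal algebra, and
  relations in a target algebra let a homomorphism of the free algebra factor.\<close>

lemma (in star_hom_pair) GA_rels_hom: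
  fixes u :: "'n::finite \<Rightarrow> 'n \<Rightarrow> 'a"
  assumes u: "\<And>\<alpha> \<beta>. u \<alpha> \<beta> \<in> carrier A"
  shows "GA_rels B M v l (\<lambda>\<alpha> \<beta>. f (u \<alpha> \<beta>)) = map_prod f f ` GA_rels A M v l u"
proof -
  have two: "map_prod f f ` {g \<alpha> \<beta> | \<alpha> \<beta>. True} = {g' \<alpha> \<beta> | \<alpha> \<beta>. True}"
    if "\<And>\<alpha> \<beta>. map_prod f f (g \<alpha> \<beta>) = g' \<alpha> \<beta>" for g :: "'n \<Rightarrow> 'n \<Rightarrow> _" and g'
  proof -
    have *: "{h \<alpha> \<beta> | \<alpha> \<beta>. True} = (\<lambda>(\<alpha>, \<beta>). h \<alpha> \<beta>) ` UNIV" for h :: "'n \<Rightarrow> 'n \<Rightarrow> 'z" by auto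
    show ?thesis unfolding * image_image using that by (simp add: case_prod_unfold)
  qed
  have one: "map_prod f f ` {g \<alpha> | \<alpha>. True} = {g' \<alpha> | \<alpha>. True}"
    if "\<And>\<alpha>. map_prod f f (g \<alpha>) = g' \<alpha>" for g :: "'n \<Rightarrow> _" and g'
    using that by (simp add: full_SetCompr_eq image_image)
  have pi: "map_prod f f (partial_isometry_rel A x) = partial_isometry_rel B (f x)" if "x \<in> carrier A" for x
    using that by (simp add: partial_isometry_rel_def)
  have magic: "map_prod f f ` magic_unitary_rels A p = magic_unitary_rels B (\<lambda>\<alpha> \<beta>. f (p \<alpha> \<beta>))"
    if "\<And>\<alpha> \<beta>. p \<alpha> \<beta> \<in> carrier A" for p :: "'n \<Rightarrow> 'n \<Rightarrow> 'a"
    unfolding magic_unitary_rels_def image_Un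
    by (intro arg_cong2[of _ _ _ _ "(\<union>)"] two one) (use that in \<open>auto simp: hom_finsum\<close>)
  have vec: "map_prod f f ` vector_rels A v p = vector_rels B v (\<lambda>\<alpha> \<beta>. f (p \<alpha> \<beta>))"
    if "\<And>\<alpha> \<beta>. p \<alpha> \<beta> \<in> carrier A" for p :: "'n \<Rightarrow> 'n \<Rightarrow> 'a"
    unfolding vector_rels_def by (intro one) (use that in \<open>auto simp: hom_finsum\<close>)
  have word: "map_prod f f ` {partial_isometry_rel A (word_prod A u \<alpha> \<beta>) | \<alpha> \<beta> n.
          enat n \<le> l \<and> \<alpha> \<in> words M n \<and> \<beta> \<in> words M n}
     = {partial_isometry_rel B (word_prod B (\<lambda>\<alpha> \<beta>. f (u \<alpha> \<beta>)) \<alpha> \<beta>) | \<alpha> \<beta> n.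
          enat n \<le> l \<and> \<alpha> \<in> words M n \<and> \<beta> \<in> words M n}"
    unfolding hom_word_prod[OF u, symmetric]
      pi[OF dom.word_prod_closed[OF u], symmetric] by (rule image_Collect3)
  show ?thesis
    unfolding GA_rels_def Let_def image_Un word
    by (intro arg_cong2[of _ _ _ _ "(\<union>)"] two[symmetric] refl) (simp_all add: u pi magic vec hom_finsum)
qed

lemma (in star_alg) GA_rels_closed:
  fixes u :: "'n::finite \<Rightarrow> 'n \<Rightarrow> 'a"
  assumes "\<And>\<alpha> \<beta>. u \<alpha> \<beta> \<in> carrier A" and "(x, y) \<in> GA_rels A M v l u"
  shows "x \<in> carrier A \<and> y \<in> carrier A"
proof -
  have *: "finsum A f UNIV \<in> carrier A" if "\<And>i. f i \<in> carrier A" for f :: "'n \<Rightarrow> 'a"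
    using that by (intro finsum_closed) auto
  show ?thesis
    using assms
    unfolding GA_rels_def Let_def magic_unitary_rels_def vector_rels_def partial_isometry_rel_def
    by (auto simp: word_prod_closed intro!: *)
qed

locale magic_family = cstar_alg B for B :: "('a, 'm) cstar_scheme" (structure) +
  fixes v :: "real^'n::finite" and p :: "'n \<Rightarrow> 'n \<Rightarrow> 'a"
  assumes proj: "projection (p \<alpha> \<beta>)"
    and row: "finsum B (p \<alpha>) UNIV = \<one>"
    and col: "finsum B (\<lambda>\<alpha>. p \<alpha> \<beta>) UNIV = \<one>"
    and vec: "finsum B (\<lambda>\<beta>. scl B (of_real (v $ \<beta>)) (p \<alpha> \<beta>)) UNIV = scl B (of_real (v $ \<alpha>)) \<one>"
begin

lemma p_carrier [simp]: "p \<alpha> \<beta> \<in> carrier B"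
  using proj by (auto simp: projection_def)

lemma row_orth: "\<beta> \<noteq> \<gamma> \<Longrightarrow> p \<alpha> \<beta> \<otimes> p \<alpha> \<gamma> = \<zero>"
  using projections_orthogonal[of UNIV "p \<alpha>" \<beta> \<gamma>] proj row by simp

lemma col_orth: "\<beta> \<noteq> \<gamma> \<Longrightarrow> p \<beta> \<alpha> \<otimes> p \<gamma> \<alpha> = \<zero>"
  using projections_orthogonal[of UNIV "\<lambda>\<beta>. p \<beta> \<alpha>" \<beta> \<gamma>] proj col by simp

end

lemma magic_unitary_rels_Id:
  "magic_unitary_rels B p \<union> vector_rels B v p \<subseteq> Id \<longleftrightarrow>
    (\<forall>\<alpha> \<beta>. str B (p \<alpha> \<beta>) = p \<alpha> \<beta>) \<and> (\<forall>\<alpha> \<beta>. p \<alpha> \<beta> \<otimes>\<^bsub>B\<^esub> p \<alpha> \<beta> = p \<alpha> \<beta>) \<and>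
    (\<forall>\<alpha>. finsum B (\<lambda>\<beta>. p \<alpha> \<beta>) UNIV = \<one>\<^bsub>B\<^esub>) \<and> (\<forall>\<beta>. finsum B (\<lambda>\<alpha>. p \<alpha> \<beta>) UNIV = \<one>\<^bsub>B\<^esub>) \<and>
    (\<forall>\<alpha>. finsum B (\<lambda>\<beta>. scl B (of_real (v $ \<beta>)) (p \<alpha> \<beta>)) UNIV = scl B (of_real (v $ \<alpha>)) \<one>\<^bsub>B\<^esub>)"
  unfolding magic_unitary_rels_def vector_rels_def by auto

lemma (in cstar_alg) magic_family_iff:
  assumes "\<And>\<alpha> \<beta>. p \<alpha> \<beta> \<in> carrier A"
  shows "magic_family A v p \<longleftrightarrow> magic_unitary_rels A p \<union> vector_rels A v p \<subseteq> Id"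
  unfolding magic_unitary_rels_Id magic_family_def magic_family_axioms_def projection_def
  using assms cstar_alg_axioms by auto

locale GA_family = cstar_alg B for B :: "('a, 'm) cstar_scheme" (structure) +
  fixes A :: "real^'n::finite^'n" and v :: "real^'n" and l :: enat and U :: "'n \<Rightarrow> 'n \<Rightarrow> 'a"
  assumes entries: "A $ i $ j \<in> {0, 1}"
    and pi: "partial_isometry (U \<alpha> \<beta>)"
    and magic_p: "magic_family B v (\<lambda>\<alpha> \<beta>. U \<alpha> \<beta> \<otimes> str B (U \<alpha> \<beta>))"
    and magic_q: "magic_family B v (\<lambda>\<alpha> \<beta>. str B (U \<alpha> \<beta>) \<otimes> U \<alpha> \<beta>)"
    and intertwine: "finsum B (\<lambda>\<gamma>. scl B (of_real (A $ \<alpha> $ \<gamma>)) (U \<gamma> \<beta> \<otimes> str B (U \<gamma> \<beta>))) UNIV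
        = finsum B (\<lambda>\<gamma>. scl B (of_real (A $ \<gamma> $ \<beta>)) (str B (U \<alpha> \<gamma>) \<otimes> U \<alpha> \<gamma>)) UNIV"
    and word_pi: "enat n \<le> l \<Longrightarrow> x \<in> words A n \<Longrightarrow> y \<in> words A n \<Longrightarrow> partial_isometry (word_prod B U x y)"

text \<open>A pair stands for an equation, so inclusion in \<open>Id\<close> means that every
  relation holds.\<close>

lemma (in cstar_alg) GA_family_iff:
  assumes U: "\<And>\<alpha> \<beta>. U \<alpha> \<beta> \<in> carrier A" and M: "\<And>i j. M $ i $ j \<in> {0, 1}"
  shows "GA_family A M v l U \<longleftrightarrow> GA_rels A M v l U \<subseteq> Id"
proof -
  have [simp]: "word_prod A U \<alpha> \<beta> \<in> carrier A" for \<alpha> \<beta> using U by (rule word_prod_closed)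
  let ?p = "\<lambda>\<alpha> \<beta>. U \<alpha> \<beta> \<otimes> str A (U \<alpha> \<beta>)"
  let ?q = "\<lambda>\<alpha> \<beta>. str A (U \<alpha> \<beta>) \<otimes> U \<alpha> \<beta>"
  have split: "GA_rels A M v l U \<subseteq> Id \<longleftrightarrow>
    {partial_isometry_rel A (U \<alpha> \<beta>) | \<alpha> \<beta>. True} \<subseteq> Id \<and>
    magic_unitary_rels A ?p \<union> vector_rels A v ?p \<subseteq> Id \<and> magic_unitary_rels A ?q \<union> vector_rels A v ?q \<subseteq> Id \<and>
    {(finsum A (\<lambda>\<gamma>. scl A (of_real (M $ \<alpha> $ \<gamma>)) (?p \<gamma> \<beta>)) UNIV,
      finsum A (\<lambda>\<gamma>. scl A (of_real (M $ \<gamma> $ \<beta>)) (?q \<alpha> \<gamma>)) UNIV) | \<alpha> \<beta>. True} \<subseteq> Id \<and>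
    {partial_isometry_rel A (word_prod A U \<alpha> \<beta>) | \<alpha> \<beta> n. enat n \<le> l \<and> \<alpha> \<in> words M n \<and> \<beta> \<in> words M n} \<subseteq> Id"
    unfolding GA_rels_def Let_def by (simp only: Un_subset_iff) (simp only: conj_ac)
  have pis: "{partial_isometry_rel A (U \<alpha> \<beta>) | \<alpha> \<beta>. True} \<subseteq> Id \<longleftrightarrow> (\<forall>\<alpha> \<beta>. partial_isometry (U \<alpha> \<beta>))"
    unfolding partial_isometry_rel_def partial_isometry_def Collect2_Id using U by simp
  have words: "{partial_isometry_rel A (word_prod A U \<alpha> \<beta>) | \<alpha> \<beta> n. enat n \<le> l \<and> \<alpha> \<in> words M n \<and> \<beta> \<in> words M n} \<subseteq> Id
      \<longleftrightarrow> (\<forall>n \<alpha> \<beta>. enat n \<le> l \<longrightarrow> \<alpha> \<in> words M n \<longrightarrow> \<beta> \<in> words M n \<longrightarrow> partial_isometry (word_prod A U \<alpha> \<beta>))"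
    unfolding partial_isometry_rel_def partial_isometry_def Collect3_Id by auto
  have inter: "{(finsum A (\<lambda>\<gamma>. scl A (of_real (M $ \<alpha> $ \<gamma>)) (?p \<gamma> \<beta>)) UNIV,
      finsum A (\<lambda>\<gamma>. scl A (of_real (M $ \<gamma> $ \<beta>)) (?q \<alpha> \<gamma>)) UNIV) | \<alpha> \<beta>. True} \<subseteq> Id \<longleftrightarrow>
    (\<forall>\<alpha> \<beta>. finsum A (\<lambda>\<gamma>. scl A (of_real (M $ \<alpha> $ \<gamma>)) (?p \<gamma> \<beta>)) UNIV =
      finsum A (\<lambda>\<gamma>. scl A (of_real (M $ \<gamma> $ \<beta>)) (?q \<alpha> \<gamma>)) UNIV)"
    by auto
  have magic: "magic_family A v ?p \<longleftrightarrow> magic_unitary_rels A ?p \<union> vector_rels A v ?p \<subseteq> Id"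
    "magic_family A v ?q \<longleftrightarrow> magic_unitary_rels A ?q \<union> vector_rels A v ?q \<subseteq> Id"
    using U by (intro magic_family_iff; simp)+
  show ?thesis
    unfolding split pis words inter magic[symmetric] GA_family_def GA_family_axioms_def
    using cstar_alg_axioms M by auto
qed

section \<open>Orthogonality of words in the generators\<close>

context GA_family
begin

abbreviation "p \<alpha> \<beta> \<equiv> U \<alpha> \<beta> \<otimes> str B (U \<alpha> \<beta>)"
abbreviation "q \<alpha> \<beta> \<equiv> str B (U \<alpha> \<beta>) \<otimes> U \<alpha> \<beta>"
abbreviation "w \<equiv> word_prod B U"

lemma U_closed [simp]: "U \<alpha> \<beta> \<in> carrier B"
  using partial_isometryD(1)[OF pi] .

lemma w_closed [simp]: "w \<alpha> \<beta> \<in> carrier B"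
  by (rule word_prod_closed) simp

lemma U_q: "U \<alpha> \<beta> \<otimes> q \<alpha> \<beta> = U \<alpha> \<beta>" and q_U: "q \<alpha> \<beta> \<otimes> str B (U \<alpha> \<beta>) = str B (U \<alpha> \<beta>)"
  and p_U: "p \<alpha> \<beta> \<otimes> U \<alpha> \<beta> = U \<alpha> \<beta>" and U_p: "str B (U \<alpha> \<beta>) \<otimes> p \<alpha> \<beta> = str B (U \<alpha> \<beta>)"
  using partial_isometryD[OF pi[of \<alpha> \<beta>]] by (simp_all add: m_assoc)

text \<open>In the applications \<open>e\<close> and \<open>f\<close> are the source and range
  projections of the neighbouring factors.\<close>

lemma mult_zero_between:
  assumes "x \<otimes> e = x" "f \<otimes> y = y" "e \<otimes> f = \<zero>"
    and "x \<in> carrier B" "y \<in> carrier B" "e \<in> carrier B" "f \<in> carrier B"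
  shows "x \<otimes> y = \<zero>"
proof -
  have "x \<otimes> y = (x \<otimes> e) \<otimes> (f \<otimes> y)" using assms by simp
  also have "\<dots> = x \<otimes> ((e \<otimes> f) \<otimes> y)" using assms(4-) by (simp add: m_assoc)
  finally show ?thesis using assms by simp
qed

lemma U_Ustr_row: "\<beta> \<noteq> \<gamma> \<Longrightarrow> U \<alpha> \<beta> \<otimes> str B (U \<alpha> \<gamma>) = \<zero>"
  by (rule mult_zero_between[OF U_q q_U magic_family.row_orth[OF magic_q]]) auto

lemma U_Ustr_col: "\<beta> \<noteq> \<gamma> \<Longrightarrow> U \<beta> \<alpha> \<otimes> str B (U \<gamma> \<alpha>) = \<zero>"
  by (rule mult_zero_between[OF U_q q_U magic_family.col_orth[OF magic_q]]) auto

lemma Ustr_U_row: "\<beta> \<noteq> \<gamma> \<Longrightarrow> str B (U \<alpha> \<beta>) \<otimes> U \<alpha> \<gamma> = \<zero>"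
  by (rule mult_zero_between[OF U_p p_U magic_family.row_orth[OF magic_p]]) auto

lemma Ustr_U_col: "\<beta> \<noteq> \<gamma> \<Longrightarrow> str B (U \<beta> \<alpha>) \<otimes> U \<gamma> \<alpha> = \<zero>"
  by (rule mult_zero_between[OF U_p p_U magic_family.col_orth[OF magic_p]]) auto

text \<open>
  Multiply \<open>(\<Sum>\<gamma>. A a \<gamma> p \<gamma> d) = (\<Sum>\<gamma>. A \<gamma> d q a \<gamma>)\<close> by \<open>q a b\<close> on the left and by
  \<open>p c d\<close> on the right.
\<close>
lemma U_U_zero:
  assumes ac: "A $ a $ c = 1" and bd: "A $ b $ d \<noteq> 1"
  shows "U a b \<otimes> U c d = \<zero>"
proof -
  have bd0: "A $ b $ d = 0" using entries[of b d] bd by simp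
  \<comment> \<open>Row orthogonality leaves only the summand at \<open>b\<close>, whose coefficient
    \<open>A $ b $ d\<close> is zero.\<close>
  have term_zero: "q a b \<otimes> scl B (of_real (A $ \<gamma> $ d)) (q a \<gamma>) = \<zero>" for \<gamma>
    using magic_family.row_orth[OF magic_q, of b \<gamma> a] bd0 by (cases "\<gamma> = b") (simp_all add: scl_mult_right)
  have "q a b \<otimes> finsum B (\<lambda>\<gamma>. scl B (of_real (A $ \<gamma> $ d)) (q a \<gamma>)) UNIV = \<zero>"
    by (subst finsum_rdistr) (auto simp: term_zero finsum_zero)
  then have left: "q a b \<otimes> finsum B (\<lambda>\<gamma>. scl B (of_real (A $ a $ \<gamma>)) (p \<gamma> d)) UNIV = \<zero>"
    unfolding intertwine .
  \<comment> \<open>Column orthogonality leaves only the summand at \<open>c\<close>, whose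
    coefficient is one.\<close>
  have right: "finsum B (\<lambda>\<gamma>. scl B (of_real (A $ a $ \<gamma>)) (p \<gamma> d)) UNIV \<otimes> p c d = p c d"
  proof -
    have "finsum B (\<lambda>\<gamma>. scl B (of_real (A $ a $ \<gamma>)) (p \<gamma> d)) UNIV \<otimes> p c d
      = finsum B (\<lambda>\<gamma>. scl B (of_real (A $ a $ \<gamma>)) (p \<gamma> d) \<otimes> p c d) UNIV"
      by (intro finsum_ldistr) auto
    also have "\<dots> = scl B (of_real (A $ a $ c)) (p c d) \<otimes> p c d"
      using magic_family.col_orth[OF magic_p, of _ c d]
      by (intro finsum_single) (auto simp: scl_mult_left)
    also have "\<dots> = p c d"
      using magic_family.proj[OF magic_p, of c d] by (simp add: ac projection_def)
    finally show ?thesis .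
  qed
  let ?X = "finsum B (\<lambda>\<gamma>. scl B (of_real (A $ a $ \<gamma>)) (p \<gamma> d)) UNIV"
  have X: "?X \<in> carrier B" by (intro finsum_closed) auto
  have "q a b \<otimes> p c d = q a b \<otimes> ?X \<otimes> p c d" using X by (simp only: right m_assoc U_closed m_closed str_closed)
  then have "q a b \<otimes> p c d = \<zero>" unfolding left by simp
  then show ?thesis by (intro mult_zero_between[OF U_q p_U]) auto
qed

text \<open>An inadmissible \<open>\<gamma>\<close> contains a forbidden step, which meets an
  allowed step of \<open>\<alpha>\<close>; the two adjacent factors there multiply to zero by
  \<open>U_U_zero\<close>.\<close>

lemma w_zero:
  assumes "\<alpha> \<in> words A n" "length \<gamma> = n" "\<gamma> \<notin> words A n"
  shows "w \<alpha> \<gamma> = \<zero>"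
  using assms
proof (induction n arbitrary: \<alpha> \<gamma>)
  case 0
  then show ?case by (simp add: Nil_words)
next
  case (Suc n)
  obtain a \<alpha>' where \<alpha>: "\<alpha> = a # \<alpha>'" using Suc.prems(1) by (cases \<alpha>) (auto simp: words_def)
  obtain b \<gamma>' where \<gamma>: "\<gamma> = b # \<gamma>'" using Suc.prems(2) by (cases \<gamma>) auto
  have \<alpha>': "\<alpha>' \<in> words A n" "\<alpha>' \<noteq> [] \<Longrightarrow> A $ a $ hd \<alpha>' = 1" using Suc.prems(1) by (auto simp: \<alpha> words_Cons_iff)
  show ?case
  proof (cases "\<gamma>' \<in> words A n")
    case True
    then have ne: "\<gamma>' \<noteq> []" "A $ b $ hd \<gamma>' \<noteq> 1" using Suc.prems(3) by (auto simp: \<gamma> words_Cons_iff)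
    then obtain d \<gamma>'' where \<gamma>': "\<gamma>' = d # \<gamma>''" by (cases \<gamma>') auto
    have "length \<alpha>' = length \<gamma>'" using words_length[OF \<alpha>'(1)] Suc.prems(2) by (simp add: \<gamma>)
    then obtain c \<alpha>'' where \<alpha>'': "\<alpha>' = c # \<alpha>''" using \<gamma>' by (cases \<alpha>') auto
    have "U a b \<otimes> U c d = \<zero>" using \<alpha>'(2) ne by (intro U_U_zero) (auto simp: \<alpha>'' \<gamma>')
    then have "(U a b \<otimes> U c d) \<otimes> w \<alpha>'' \<gamma>'' = \<zero>" by simp
    then show ?thesis by (simp add: \<alpha> \<gamma> \<alpha>'' \<gamma>' m_assoc)
  next
    case False
    then show ?thesis using Suc.IH[OF \<alpha>'(1) _ False] Suc.prems(2) by (simp add: \<alpha> \<gamma>)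
  qed
qed

text \<open>Splitting off the first letter leaves the projection \<open>q a b\<close> beside a tail.
  Relation (III) for the lengths \<open>n\<close> and \<open>Suc n\<close> makes it commute with the
  range projection of that tail, so it can be moved out of the way.\<close>

lemma w_orth:
  assumes "enat n \<le> l" "\<alpha> \<in> words A n" "\<gamma> \<in> words A n" "\<delta> \<in> words A n" "\<gamma> \<noteq> \<delta>"
  shows "str B (w \<alpha> \<gamma>) \<otimes> w \<alpha> \<delta> = \<zero> \<and> w \<alpha> \<gamma> \<otimes> str B (w \<alpha> \<delta>) = \<zero>"
  using assms
proof (induction n arbitrary: \<alpha> \<gamma> \<delta>)
  case 0
  then show ?case by (simp add: words_def)
next
  case (Suc n)
  obtain a \<alpha>' where \<alpha>: "\<alpha> = a # \<alpha>'" using Suc.prems(2) by (cases \<alpha>) (auto simp: words_def)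
  obtain b \<gamma>' where \<gamma>: "\<gamma> = b # \<gamma>'" using Suc.prems(3) by (cases \<gamma>) (auto simp: words_def)
  obtain b' \<delta>' where \<delta>: "\<delta> = b' # \<delta>'" using Suc.prems(4) by (cases \<delta>) (auto simp: words_def)
  have ws: "\<alpha>' \<in> words A n" "\<gamma>' \<in> words A n" "\<delta>' \<in> words A n"
    using Suc.prems by (auto simp: \<alpha> \<gamma> \<delta> words_Cons_iff)
  have n: "enat n \<le> l" using Suc.prems(1) by (meson Suc_ile_eq order_less_imp_le)
  define x where "x = w \<alpha>' \<gamma>'"
  define y where "y = w \<alpha>' \<delta>'"
  have [simp]: "x \<in> carrier B" "y \<in> carrier B" by (simp_all add: x_def y_def)
  have x: "partial_isometry x" unfolding x_def using word_pi[OF n] ws by blast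
  have xU: "partial_isometry (U a b \<otimes> x)"
    using word_pi[OF Suc.prems(1,2,3)] by (simp add: \<alpha> \<gamma> x_def)
  have comm: "q a b \<otimes> (x \<otimes> str B x) = (x \<otimes> str B x) \<otimes> q a b"
    by (rule partial_isometry_commute[OF pi x xU])
  have xx: "str B x \<otimes> (x \<otimes> str B x) = str B x" by (rule partial_isometryD(3)[OF x])
  have IH: "\<gamma>' \<noteq> \<delta>' \<Longrightarrow> str B x \<otimes> y = \<zero> \<and> x \<otimes> str B y = \<zero>"
    unfolding x_def y_def using Suc.IH[OF n ws] .
  have "str B (U a b \<otimes> x) \<otimes> (U a b' \<otimes> y) = \<zero>"
  proof (cases "b = b'")
    case False
    have "str B (U a b \<otimes> x) \<otimes> (U a b' \<otimes> y) = str B x \<otimes> ((str B (U a b) \<otimes> U a b') \<otimes> y)"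
      by (simp add: m_assoc)
    then show ?thesis using Ustr_U_row[OF False] by simp
  next
    case True
    then have xy: "str B x \<otimes> y = \<zero>" using IH Suc.prems(5) by (auto simp: \<gamma> \<delta>)
    \<comment> \<open>Inserting the range projection of \<open>x\<close> beside \<open>q a b\<close>
      and commuting the two brings the adjoint of \<open>x\<close> next to \<open>y\<close>.\<close>
    have "str B (U a b \<otimes> x) \<otimes> (U a b' \<otimes> y) = (str B x \<otimes> (x \<otimes> str B x)) \<otimes> (q a b \<otimes> y)"
      by (simp add: xx True m_assoc)
    also have "\<dots> = str B x \<otimes> (((x \<otimes> str B x) \<otimes> q a b) \<otimes> y)" by (simp add: m_assoc)
    also have "\<dots> = str B x \<otimes> (q a b \<otimes> (x \<otimes> (str B x \<otimes> y)))"
      unfolding comm[symmetric] by (simp add: m_assoc)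
    finally show ?thesis by (simp add: xy)
  qed
  moreover have "(U a b \<otimes> x) \<otimes> str B (U a b' \<otimes> y) = \<zero>"
  proof (cases "\<gamma>' = \<delta>'")
    case False
    have "(U a b \<otimes> x) \<otimes> str B (U a b' \<otimes> y) = U a b \<otimes> ((x \<otimes> str B y) \<otimes> str B (U a b'))"
      by (simp add: m_assoc)
    then show ?thesis using IH[OF False] by simp
  next
    case True
    then have yx: "y = x" and bb: "b \<noteq> b'" using Suc.prems(5) by (auto simp: \<gamma> \<delta> x_def y_def)
    \<comment> \<open>Equal tails force different first letters. Commuting \<open>q a b\<close> past
      the range projection of \<open>x\<close> brings \<open>U a b\<close> next to the adjoint of
      \<open>U a b'\<close>.\<close>
    have "(U a b \<otimes> x) \<otimes> str B (U a b' \<otimes> y) = (U a b \<otimes> q a b) \<otimes> ((x \<otimes> str B x) \<otimes> str B (U a b'))"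
      unfolding U_q by (simp add: yx m_assoc)
    also have "\<dots> = U a b \<otimes> ((q a b \<otimes> (x \<otimes> str B x)) \<otimes> str B (U a b'))" by (simp add: m_assoc)
    also have "\<dots> = U a b \<otimes> ((x \<otimes> str B x) \<otimes> (str B (U a b) \<otimes> (U a b \<otimes> str B (U a b'))))"
      unfolding comm by (simp add: m_assoc)
    finally show ?thesis using U_Ustr_row[OF bb] by simp
  qed
  ultimately show ?case by (simp add: \<alpha> \<gamma> \<delta> x_def y_def)
qed

lemma rels: "GA_rels B A v l U \<subseteq> Id"
  using GA_family_iff[of U A v l] entries GA_family_axioms by simp

end

section \<open>The coproduct family\<close>

context tensor
begin

lemma finsum_t_mult:
  assumes J: "finite J" "finite K" and x: "\<And>i. i \<in> J \<Longrightarrow> x i \<in> carrier A" "\<And>i. i \<in> J \<Longrightarrow> y i \<in> carrier B"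
    and x': "\<And>i. i \<in> K \<Longrightarrow> x' i \<in> carrier A" "\<And>i. i \<in> K \<Longrightarrow> y' i \<in> carrier B"
  shows "finsum D (\<lambda>i. t (x i) (y i)) J \<otimes>\<^bsub>D\<^esub> finsum D (\<lambda>i. t (x' i) (y' i)) K
    = finsum D (\<lambda>i. finsum D (\<lambda>j. t (x i \<otimes>\<^bsub>A\<^esub> x' j) (y i \<otimes>\<^bsub>B\<^esub> y' j)) K) J"
proof -
  have K: "finsum D (\<lambda>i. t (x' i) (y' i)) K \<in> carrier D" using x' by (intro D.finsum_closed) auto
  have "finsum D (\<lambda>i. t (x i) (y i)) J \<otimes>\<^bsub>D\<^esub> finsum D (\<lambda>i. t (x' i) (y' i)) K
    = finsum D (\<lambda>i. t (x i) (y i) \<otimes>\<^bsub>D\<^esub> finsum D (\<lambda>i. t (x' i) (y' i)) K) J"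
    using J x K by (intro D.finsum_ldistr) auto
  also have "\<dots> = finsum D (\<lambda>i. finsum D (\<lambda>j. t (x i \<otimes>\<^bsub>A\<^esub> x' j) (y i \<otimes>\<^bsub>B\<^esub> y' j)) K) J"
  proof (intro D.finsum_cong' refl)
    fix i assume i: "i \<in> J"
    have "t (x i) (y i) \<otimes>\<^bsub>D\<^esub> finsum D (\<lambda>i. t (x' i) (y' i)) K = finsum D (\<lambda>j. t (x i) (y i) \<otimes>\<^bsub>D\<^esub> t (x' j) (y' j)) K"
      using J x x' i by (intro D.finsum_rdistr) auto
    also have "\<dots> = finsum D (\<lambda>j. t (x i \<otimes>\<^bsub>A\<^esub> x' j) (y i \<otimes>\<^bsub>B\<^esub> y' j)) K"
      using x x' i by (intro D.finsum_cong') (auto simp: t_mult)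
    finally show "t (x i) (y i) \<otimes>\<^bsub>D\<^esub> finsum D (\<lambda>i. t (x' i) (y' i)) K
      = finsum D (\<lambda>j. t (x i \<otimes>\<^bsub>A\<^esub> x' j) (y i \<otimes>\<^bsub>B\<^esub> y' j)) K" .
  qed (use x x' in \<open>auto intro!: D.finsum_closed\<close>)
  finally show ?thesis .
qed

text \<open>Orthogonal first legs kill every mixed term of the double sum.\<close>

lemma finsum_t_mult_orth:
  assumes J: "finite J" and x: "\<And>i. i \<in> J \<Longrightarrow> x i \<in> carrier A" "\<And>i. i \<in> J \<Longrightarrow> y i \<in> carrier B"
    and x': "\<And>i. i \<in> J \<Longrightarrow> x' i \<in> carrier A" "\<And>i. i \<in> J \<Longrightarrow> y' i \<in> carrier B"
    and orth: "\<And>i j. i \<in> J \<Longrightarrow> j \<in> J \<Longrightarrow> i \<noteq> j \<Longrightarrow> x i \<otimes>\<^bsub>A\<^esub> x' j = \<zero>\<^bsub>A\<^esub>"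
  shows "finsum D (\<lambda>i. t (x i) (y i)) J \<otimes>\<^bsub>D\<^esub> finsum D (\<lambda>i. t (x' i) (y' i)) J
    = finsum D (\<lambda>i. t (x i \<otimes>\<^bsub>A\<^esub> x' i) (y i \<otimes>\<^bsub>B\<^esub> y' i)) J"
proof -
  have "finsum D (\<lambda>j. t (x i \<otimes>\<^bsub>A\<^esub> x' j) (y i \<otimes>\<^bsub>B\<^esub> y' j)) J = t (x i \<otimes>\<^bsub>A\<^esub> x' i) (y i \<otimes>\<^bsub>B\<^esub> y' i)"
    if "i \<in> J" for i
    using J x x' orth that by (intro D.finsum_single) auto
  then have "finsum D (\<lambda>i. finsum D (\<lambda>j. t (x i \<otimes>\<^bsub>A\<^esub> x' j) (y i \<otimes>\<^bsub>B\<^esub> y' j)) J) J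
    = finsum D (\<lambda>i. t (x i \<otimes>\<^bsub>A\<^esub> x' i) (y i \<otimes>\<^bsub>B\<^esub> y' i)) J"
    using x x' by (intro D.finsum_cong' refl) simp_all
  then show ?thesis using finsum_t_mult[OF J J x x'] by simp
qed

text \<open>With first legs mutually orthogonal on both sides, the products of \<open>Z\<close> and
  its adjoint are diagonal, and the equation for a partial isometry holds term by term.\<close>

lemma finsum_t_partial_isometry:
  assumes J: "finite J" and x: "\<And>i. i \<in> J \<Longrightarrow> A.partial_isometry (x i)" and y: "\<And>i. i \<in> J \<Longrightarrow> B.partial_isometry (y i)"
    and orth: "\<And>i j. i \<in> J \<Longrightarrow> j \<in> J \<Longrightarrow> i \<noteq> j \<Longrightarrow>
      str A (x i) \<otimes>\<^bsub>A\<^esub> x j = \<zero>\<^bsub>A\<^esub> \<and> x i \<otimes>\<^bsub>A\<^esub> str A (x j) = \<zero>\<^bsub>A\<^esub>"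
  defines "Z \<equiv> finsum D (\<lambda>i. t (x i) (y i)) J"
  shows "Z \<otimes>\<^bsub>D\<^esub> str D Z = finsum D (\<lambda>i. t (x i \<otimes>\<^bsub>A\<^esub> str A (x i)) (y i \<otimes>\<^bsub>B\<^esub> str B (y i))) J"
    and "str D Z \<otimes>\<^bsub>D\<^esub> Z = finsum D (\<lambda>i. t (str A (x i) \<otimes>\<^bsub>A\<^esub> x i) (str B (y i) \<otimes>\<^bsub>B\<^esub> y i)) J"
    and "D.partial_isometry Z"
proof -
  have xc: "x i \<in> carrier A" "y i \<in> carrier B" if "i \<in> J" for i
    using A.partial_isometryD(1)[OF x[OF that]] B.partial_isometryD(1)[OF y[OF that]] by auto
  have "str D Z = finsum D (\<lambda>i. str D (t (x i) (y i))) J"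
    unfolding Z_def using J xc by (intro D.finsum_str) auto
  also have "\<dots> = finsum D (\<lambda>i. t (str A (x i)) (str B (y i))) J"
    using xc by (intro D.finsum_cong' refl) (simp_all add: t_str)
  finally have Zstr: "str D Z = finsum D (\<lambda>i. t (str A (x i)) (str B (y i))) J" .
  show 1: "Z \<otimes>\<^bsub>D\<^esub> str D Z = finsum D (\<lambda>i. t (x i \<otimes>\<^bsub>A\<^esub> str A (x i)) (y i \<otimes>\<^bsub>B\<^esub> str B (y i))) J"
    unfolding Zstr unfolding Z_def using J xc orth by (intro finsum_t_mult_orth) auto
  show "str D Z \<otimes>\<^bsub>D\<^esub> Z = finsum D (\<lambda>i. t (str A (x i) \<otimes>\<^bsub>A\<^esub> x i) (str B (y i) \<otimes>\<^bsub>B\<^esub> y i)) J"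
    unfolding Zstr unfolding Z_def using J xc orth by (intro finsum_t_mult_orth) auto
  have "Z \<otimes>\<^bsub>D\<^esub> str D Z \<otimes>\<^bsub>D\<^esub> Z
    = finsum D (\<lambda>i. t (x i \<otimes>\<^bsub>A\<^esub> str A (x i) \<otimes>\<^bsub>A\<^esub> x i) (y i \<otimes>\<^bsub>B\<^esub> str B (y i) \<otimes>\<^bsub>B\<^esub> y i)) J"
    unfolding 1 unfolding Z_def using J xc orth by (intro finsum_t_mult_orth) (auto simp: A.m_assoc)
  also have "\<dots> = Z"
    unfolding Z_def using x y xc
    by (intro D.finsum_cong') (auto simp: A.partial_isometry_def B.partial_isometry_def)
  finally show "D.partial_isometry Z"
    unfolding D.partial_isometry_def using xc by (auto simp: Z_def intro!: D.finsum_closed)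
qed

end

text \<open>That the sums are projections is taken as a premise, because in the application each one
  is a range or source projection of a partial isometry. The row, column and eigenvector conditions
  follow by summing over one leg after the other.\<close>

lemma tensor_magic_family:
  fixes v :: "real^'n::finite"
  assumes "magic_family B v p"
    and proj: "\<And>\<alpha> \<beta>. cstar_alg.projection (min_tensor B B) (finsum (min_tensor B B) (\<lambda>\<gamma>. tns B B (p \<alpha> \<gamma>) (p \<gamma> \<beta>)) UNIV)"
  shows "magic_family (min_tensor B B) v (\<lambda>\<alpha> \<beta>. finsum (min_tensor B B) (\<lambda>\<gamma>. tns B B (p \<alpha> \<gamma>) (p \<gamma> \<beta>)) UNIV)"
proof -
  interpret p: magic_family B v p by fact
  interpret T: tensor B B by unfold_locales
  let ?P = "\<lambda>\<alpha> \<beta>. finsum T.D (\<lambda>\<gamma>. T.t (p \<alpha> \<gamma>) (p \<gamma> \<beta>)) UNIV"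
  show ?thesis
  proof (intro magic_family.intro magic_family_axioms.intro T.D.cstar_alg_axioms proj)
    fix \<alpha> \<beta> :: 'n
    have "finsum T.D (?P \<alpha>) UNIV = finsum T.D (\<lambda>\<gamma>. finsum T.D (\<lambda>\<beta>. T.t (p \<alpha> \<gamma>) (p \<gamma> \<beta>)) UNIV) UNIV"
      by (rule T.D.finsum_swap) auto
    also have "\<dots> = finsum T.D (\<lambda>\<gamma>. T.t (p \<alpha> \<gamma>) \<one>\<^bsub>B\<^esub>) UNIV"
      using p.row by (intro T.D.finsum_cong') (auto simp: T.t_finsum_right[symmetric])
    also have "\<dots> = \<one>\<^bsub>T.D\<^esub>" using p.row by (simp add: T.t_finsum_left[symmetric] T.t_one)
    finally show "finsum T.D (?P \<alpha>) UNIV = \<one>\<^bsub>T.D\<^esub>" .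
    have "finsum T.D (\<lambda>\<alpha>. ?P \<alpha> \<beta>) UNIV = finsum T.D (\<lambda>\<gamma>. finsum T.D (\<lambda>\<alpha>. T.t (p \<alpha> \<gamma>) (p \<gamma> \<beta>)) UNIV) UNIV"
      by (rule T.D.finsum_swap) auto
    also have "\<dots> = finsum T.D (\<lambda>\<gamma>. T.t \<one>\<^bsub>B\<^esub> (p \<gamma> \<beta>)) UNIV"
      using p.col by (intro T.D.finsum_cong') (auto simp: T.t_finsum_left[symmetric])
    also have "\<dots> = \<one>\<^bsub>T.D\<^esub>" using p.col by (simp add: T.t_finsum_right[symmetric] T.t_one)
    finally show "finsum T.D (\<lambda>\<alpha>. ?P \<alpha> \<beta>) UNIV = \<one>\<^bsub>T.D\<^esub>" .
    have "finsum T.D (\<lambda>\<beta>. scl T.D (of_real (v $ \<beta>)) (?P \<alpha> \<beta>)) UNIV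
      = finsum T.D (\<lambda>\<beta>. finsum T.D (\<lambda>\<gamma>. T.t (p \<alpha> \<gamma>) (scl B (of_real (v $ \<beta>)) (p \<gamma> \<beta>))) UNIV) UNIV"
      by (intro T.D.finsum_cong') (auto simp: T.D.finsum_scl T.t_scl_right intro!: T.D.finsum_closed)
    also have "\<dots> = finsum T.D (\<lambda>\<gamma>. finsum T.D (\<lambda>\<beta>. T.t (p \<alpha> \<gamma>) (scl B (of_real (v $ \<beta>)) (p \<gamma> \<beta>))) UNIV) UNIV"
      by (rule T.D.finsum_swap) auto
    also have "\<dots> = finsum T.D (\<lambda>\<gamma>. T.t (scl B (of_real (v $ \<gamma>)) (p \<alpha> \<gamma>)) \<one>\<^bsub>B\<^esub>) UNIV"
    proof (intro T.D.finsum_cong' refl)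
      fix \<gamma>
      have "finsum T.D (\<lambda>\<beta>. T.t (p \<alpha> \<gamma>) (scl B (of_real (v $ \<beta>)) (p \<gamma> \<beta>))) UNIV
        = T.t (p \<alpha> \<gamma>) (scl B (of_real (v $ \<gamma>)) \<one>\<^bsub>B\<^esub>)"
        by (subst T.t_finsum_right[symmetric]) (auto simp: p.vec)
      then show "finsum T.D (\<lambda>\<beta>. T.t (p \<alpha> \<gamma>) (scl B (of_real (v $ \<beta>)) (p \<gamma> \<beta>))) UNIV
        = T.t (scl B (of_real (v $ \<gamma>)) (p \<alpha> \<gamma>)) \<one>\<^bsub>B\<^esub>"
        by (simp add: T.t_scl_right T.t_scl_left)
    qed simp
    also have "\<dots> = scl T.D (of_real (v $ \<alpha>)) \<one>\<^bsub>T.D\<^esub>"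
      by (subst T.t_finsum_left[symmetric]) (auto simp: p.vec T.t_scl_left T.t_one)
    finally show "finsum T.D (\<lambda>\<beta>. scl T.D (of_real (v $ \<beta>)) (?P \<alpha> \<beta>)) UNIV = scl T.D (of_real (v $ \<alpha>)) \<one>\<^bsub>T.D\<^esub>" .
  qed
qed

lemma finite_length_lists: "finite {\<gamma> :: 'n::finite list. length \<gamma> = n}"
  using finite_lists_length_eq[of "UNIV :: 'n set" n] by simp

lemma words_finite: "finite (words A n :: 'n::finite list set)"
  by (rule finite_subset[OF _ finite_length_lists[of n]]) (auto simp: words_def)

lemma tensor_GA_family:
  fixes A :: "real^'n::finite^'n"
  assumes "GA_family B A v l U"
  shows "GA_family (min_tensor B B) A v l (\<lambda>\<alpha> \<beta>. finsum (min_tensor B B) (\<lambda>\<gamma>. tns B B (U \<alpha> \<gamma>) (U \<gamma> \<beta>)) UNIV)"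
proof -
  interpret U: GA_family B A v l U by fact
  interpret T: tensor B B by unfold_locales
  define W where "W \<alpha> \<beta> = finsum T.D (\<lambda>\<gamma>. T.t (U \<alpha> \<gamma>) (U \<gamma> \<beta>)) UNIV" for \<alpha> \<beta>
  define P where "P \<alpha> \<beta> = finsum T.D (\<lambda>\<gamma>. T.t (U.p \<alpha> \<gamma>) (U.p \<gamma> \<beta>)) UNIV" for \<alpha> \<beta>
  define Q where "Q \<alpha> \<beta> = finsum T.D (\<lambda>\<gamma>. T.t (U.q \<alpha> \<gamma>) (U.q \<gamma> \<beta>)) UNIV" for \<alpha> \<beta>
  have W: "W \<alpha> \<beta> \<otimes>\<^bsub>T.D\<^esub> str T.D (W \<alpha> \<beta>) = P \<alpha> \<beta>" "str T.D (W \<alpha> \<beta>) \<otimes>\<^bsub>T.D\<^esub> W \<alpha> \<beta> = Q \<alpha> \<beta>"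
    "T.D.partial_isometry (W \<alpha> \<beta>)" for \<alpha> \<beta>
    using T.finsum_t_partial_isometry[of UNIV "\<lambda>\<gamma>. U \<alpha> \<gamma>" "\<lambda>\<gamma>. U \<gamma> \<beta>"] U.pi U.Ustr_U_row U.U_Ustr_row
    by (simp_all add: W_def P_def Q_def)
  have Wc [simp]: "W \<alpha> \<beta> \<in> carrier T.D" for \<alpha> \<beta>
    using W(3) by (rule T.D.partial_isometryD(1))
  have proj: "T.D.projection (P \<alpha> \<beta>)" "T.D.projection (Q \<alpha> \<beta>)" for \<alpha> \<beta>
    using T.D.partial_isometryD(4,5)[OF W(3)[of \<alpha> \<beta>]] by (simp_all add: W)
  have magic: "magic_family T.D v P" "magic_family T.D v Q"
    using tensor_magic_family[OF U.magic_p proj(1)[unfolded P_def]]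
      tensor_magic_family[OF U.magic_q proj(2)[unfolded Q_def]]
    by (simp_all add: P_def[abs_def] Q_def[abs_def])
  have scl_sum: "scl T.D c (finsum T.D (\<lambda>\<gamma>. T.t (x \<gamma>) (y \<gamma>)) UNIV) = finsum T.D (\<lambda>\<gamma>. T.t (scl B c (x \<gamma>)) (y \<gamma>)) UNIV"
    "scl T.D c (finsum T.D (\<lambda>\<gamma>. T.t (x \<gamma>) (y \<gamma>)) UNIV) = finsum T.D (\<lambda>\<gamma>. T.t (x \<gamma>) (scl B c (y \<gamma>))) UNIV"
    if "\<And>\<gamma>. x \<gamma> \<in> carrier B" "\<And>\<gamma>. y \<gamma> \<in> carrier B" for c and x y :: "'n \<Rightarrow> 'a"
    using that by (simp_all add: T.D.finsum_scl Pi_def T.t_scl_left T.t_scl_right)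
  \<comment> \<open>The matrix \<open>A\<close> travels from the first leg to the second: \<open>A p
    \<otimes> p = q A \<otimes> p = q \<otimes> A p = q \<otimes> q A\<close>, where the tensor sign
    includes the sum over the inner index.\<close>
  have inter: "finsum T.D (\<lambda>\<gamma>. scl T.D (of_real (A $ \<alpha> $ \<gamma>)) (P \<gamma> \<beta>)) UNIV
      = finsum T.D (\<lambda>\<gamma>. scl T.D (of_real (A $ \<gamma> $ \<beta>)) (Q \<alpha> \<gamma>)) UNIV" for \<alpha> \<beta>
  proof -
    have "finsum T.D (\<lambda>\<gamma>. scl T.D (of_real (A $ \<alpha> $ \<gamma>)) (P \<gamma> \<beta>)) UNIV
      = finsum T.D (\<lambda>\<gamma>. finsum T.D (\<lambda>\<delta>. T.t (scl B (of_real (A $ \<alpha> $ \<gamma>)) (U.p \<gamma> \<delta>)) (U.p \<delta> \<beta>)) UNIV) UNIV"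
      unfolding P_def by (subst scl_sum(1)) simp_all
    also have "\<dots> = finsum T.D (\<lambda>\<delta>. finsum T.D (\<lambda>\<gamma>. T.t (scl B (of_real (A $ \<alpha> $ \<gamma>)) (U.p \<gamma> \<delta>)) (U.p \<delta> \<beta>)) UNIV) UNIV"
      by (rule T.D.finsum_swap) simp_all
    also have "\<dots> = finsum T.D (\<lambda>\<delta>. T.t (finsum B (\<lambda>\<gamma>. scl B (of_real (A $ \<alpha> $ \<gamma>)) (U.p \<gamma> \<delta>)) UNIV) (U.p \<delta> \<beta>)) UNIV"
      by (subst T.t_finsum_left) simp_all
    also have "\<dots> = finsum T.D (\<lambda>\<delta>. T.t (finsum B (\<lambda>\<gamma>. scl B (of_real (A $ \<gamma> $ \<delta>)) (U.q \<alpha> \<gamma>)) UNIV) (U.p \<delta> \<beta>)) UNIV"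
      unfolding U.intertwine ..
    also have "\<dots> = finsum T.D (\<lambda>\<delta>. finsum T.D (\<lambda>\<gamma>. T.t (scl B (of_real (A $ \<gamma> $ \<delta>)) (U.q \<alpha> \<gamma>)) (U.p \<delta> \<beta>)) UNIV) UNIV"
      by (subst T.t_finsum_left) simp_all
    also have "\<dots> = finsum T.D (\<lambda>\<gamma>. finsum T.D (\<lambda>\<delta>. T.t (scl B (of_real (A $ \<gamma> $ \<delta>)) (U.q \<alpha> \<gamma>)) (U.p \<delta> \<beta>)) UNIV) UNIV"
      by (rule T.D.finsum_swap) simp_all
    also have "\<dots> = finsum T.D (\<lambda>\<gamma>. finsum T.D (\<lambda>\<delta>. T.t (U.q \<alpha> \<gamma>) (scl B (of_real (A $ \<gamma> $ \<delta>)) (U.p \<delta> \<beta>))) UNIV) UNIV"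
      by (simp only: T.t_scl_left T.t_scl_right U.U_closed U.m_closed U.str_closed)
    also have "\<dots> = finsum T.D (\<lambda>\<gamma>. T.t (U.q \<alpha> \<gamma>) (finsum B (\<lambda>\<delta>. scl B (of_real (A $ \<gamma> $ \<delta>)) (U.p \<delta> \<beta>)) UNIV)) UNIV"
      by (subst T.t_finsum_right) simp_all
    also have "\<dots> = finsum T.D (\<lambda>\<gamma>. T.t (U.q \<alpha> \<gamma>) (finsum B (\<lambda>\<delta>. scl B (of_real (A $ \<delta> $ \<beta>)) (U.q \<gamma> \<delta>)) UNIV)) UNIV"
      unfolding U.intertwine ..
    also have "\<dots> = finsum T.D (\<lambda>\<gamma>. finsum T.D (\<lambda>\<delta>. T.t (U.q \<alpha> \<gamma>) (scl B (of_real (A $ \<delta> $ \<beta>)) (U.q \<gamma> \<delta>))) UNIV) UNIV"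
      by (subst T.t_finsum_right) simp_all
    also have "\<dots> = finsum T.D (\<lambda>\<delta>. finsum T.D (\<lambda>\<gamma>. T.t (U.q \<alpha> \<gamma>) (scl B (of_real (A $ \<delta> $ \<beta>)) (U.q \<gamma> \<delta>))) UNIV) UNIV"
      by (rule T.D.finsum_swap) simp_all
    also have "\<dots> = finsum T.D (\<lambda>\<delta>. scl T.D (of_real (A $ \<delta> $ \<beta>)) (Q \<alpha> \<delta>)) UNIV"
      unfolding Q_def by (subst scl_sum(2)) simp_all
    finally show ?thesis .
  qed
  \<comment> \<open>The product of sums expands over all intermediate words of length
    \<open>n\<close>; inadmissible ones are discarded only afterwards, by
    \<open>w_zero\<close>.\<close>
  have word_sum: "word_prod T.D W \<alpha> \<beta> = finsum T.D (\<lambda>\<gamma>. T.t (U.w \<alpha> \<gamma>) (U.w \<gamma> \<beta>)) {\<gamma>. length \<gamma> = n}"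
    if "length \<alpha> = n" "length \<beta> = n" for \<alpha> \<beta> n
    using that
  proof (induction n arbitrary: \<alpha> \<beta>)
    case 0
    then show ?case by (simp add: T.t_one Pi_def)
  next
    case (Suc n)
    obtain a \<alpha>' b \<beta>' where ab: "\<alpha> = a # \<alpha>'" "\<beta> = b # \<beta>'" "length \<alpha>' = n" "length \<beta>' = n"
      using Suc.prems by (metis length_Suc_conv)
    let ?L = "{\<gamma> :: 'n list. length \<gamma> = n}"
    have L: "{\<gamma> :: 'n list. length \<gamma> = Suc n} = (\<lambda>(c, \<gamma>). c # \<gamma>) ` (UNIV \<times> ?L)"
      by (auto simp: length_Suc_conv image_iff)
    have "word_prod T.D W \<alpha> \<beta> = W a b \<otimes>\<^bsub>T.D\<^esub> finsum T.D (\<lambda>\<gamma>. T.t (U.w \<alpha>' \<gamma>) (U.w \<gamma> \<beta>')) ?L"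
      using Suc.IH[OF ab(3,4)] by (simp add: ab)
    also have "\<dots> = finsum T.D (\<lambda>c. finsum T.D (\<lambda>\<gamma>. T.t (U a c \<otimes>\<^bsub>B\<^esub> U.w \<alpha>' \<gamma>) (U c b \<otimes>\<^bsub>B\<^esub> U.w \<gamma> \<beta>')) ?L) UNIV"
      unfolding W_def by (rule T.finsum_t_mult) (auto simp: finite_length_lists)
    also have "\<dots> = finsum T.D (\<lambda>(c, \<gamma>). T.t (U.w \<alpha> (c # \<gamma>)) (U.w (c # \<gamma>) \<beta>)) (UNIV \<times> ?L)"
      by (subst T.D.finsum_Sigma) (auto simp: finite_length_lists ab)
    also have "\<dots> = finsum T.D (\<lambda>\<gamma>. T.t (U.w \<alpha> \<gamma>) (U.w \<gamma> \<beta>)) {\<gamma>. length \<gamma> = Suc n}"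
      unfolding L by (subst T.D.finsum_reindex) (auto simp: inj_on_def case_prod_unfold)
    finally show ?case .
  qed
  have "T.D.partial_isometry (word_prod T.D W x y)" if n: "enat n \<le> l" "x \<in> words A n" "y \<in> words A n" for n x y
  proof -
    have "word_prod T.D W x y = finsum T.D (\<lambda>\<gamma>. T.t (U.w x \<gamma>) (U.w \<gamma> y)) {\<gamma>. length \<gamma> = n}"
      using n by (intro word_sum) (auto simp: words_def)
    also have "\<dots> = finsum T.D (\<lambda>\<gamma>. T.t (U.w x \<gamma>) (U.w \<gamma> y)) (words A n)"
      using U.w_zero[OF n(2)]
      by (intro T.D.finsum_mono_neutral) (auto simp: finite_length_lists words_def[of A n])
    finally show ?thesis
      using n T.finsum_t_partial_isometry(3)[of "words A n" "U.w x" "\<lambda>\<gamma>. U.w \<gamma> y"]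
        U.word_pi[OF n(1)] U.w_orth[OF n(1,2)]
      by (simp add: words_finite)
  qed
  then have "GA_family T.D A v l W"
    using T.D.cstar_alg_axioms U.entries W(3) magic inter
    unfolding GA_family_def GA_family_axioms_def W by (simp add: W)
  then show ?thesis by (simp add: W_def[abs_def])
qed

section \<open>The quantum group \<open>G\<^sub>A\<^sup>l\<close>\<close>

lemma involutive_monoid_words:
  "involutive_monoid \<lparr>carrier = UNIV, mult = (@), one = []\<rparr> (\<lambda>w. rev (map (\<lambda>(g, b). (g, \<not> b)) w))"
  by unfold_locales (auto simp: rev_map comp_def case_prod_unfold)

text \<open>Homomorphisms are contractive, hence continuous, so the set where \<open>f\<close> and
  \<open>g\<close> agree is a closed star subalgebra.\<close>

lemma star_hom_eq_on_generators:
  assumes A: "cstar_alg A" and B: "cstar_alg B" and f: "star_hom A B f" and g: "star_hom A B g"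
    and X: "generates A X" "X \<subseteq> carrier A" and eq: "\<And>x. x \<in> X \<Longrightarrow> f x = g x"
    and a: "a \<in> carrier A"
  shows "f a = g a"
proof -
  interpret A: cstar_alg A by fact
  interpret B: cstar_alg B by fact
  interpret f: star_hom_pair A B f using f A.star_alg_axioms B.star_alg_axioms by (intro star_hom_pairI)
  interpret g: star_hom_pair A B g using g A.star_alg_axioms B.star_alg_axioms by (intro star_hom_pairI)
  let ?S = "{x \<in> carrier A. f x = g x}"
  have "a \<in> ?S" if x: "\<And>n. x n \<in> ?S" and a: "a \<in> carrier A" "(\<lambda>n. nrm A (x n \<ominus>\<^bsub>A\<^esub> a)) \<longlonglongrightarrow> 0" for x a
  proof -
    have lim: "(\<lambda>n. nrm B (h (x n) \<ominus>\<^bsub>B\<^esub> h a)) \<longlonglongrightarrow> 0" if h: "star_hom A B h" for h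
    proof (rule tendsto_zero_le[OF a(2)])
      interpret h: star_hom_pair A B h using h A.star_alg_axioms B.star_alg_axioms by (intro star_hom_pairI)
      fix n
      show "nrm B (h (x n) \<ominus>\<^bsub>B\<^esub> h a) \<le> nrm A (x n \<ominus>\<^bsub>A\<^esub> a)"
        using star_hom_contractive[OF A B h, of "x n \<ominus>\<^bsub>A\<^esub> a"] x[of n] a by simp
      show "0 \<le> nrm B (h (x n) \<ominus>\<^bsub>B\<^esub> h a)" using x[of n] a by simp
    qed
    have "f a = g a"
    proof (rule B.limit_unique[OF lim[OF f]])
      show "(\<lambda>n. nrm B (f (x n) \<ominus>\<^bsub>B\<^esub> g a)) \<longlonglongrightarrow> 0" using lim[OF g] x by simp
    qed (use x a in auto)
    then show ?thesis using a by simp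
  qed
  then have "?S = carrier A"
    using X eq by (intro X(1)[unfolded generates_def, rule_format]) auto
  then show ?thesis using a by blast
qed

locale GA_locale =
  fixes A :: "real^'n::finite^'n" and v :: "real^'n" and l :: enat
  assumes entries: "A $ i $ j \<in> {0, 1}"
begin

abbreviation P :: "((('n \<times> 'n) \<times> bool) list \<Rightarrow> complex) star_algebra" where
  "P \<equiv> free_star_algebra"

sublocale F: involutive_monoid "\<lparr>carrier = UNIV :: (('n \<times> 'n) \<times> bool) list set, mult = (@), one = []\<rparr>"
  "\<lambda>w. rev (map (\<lambda>(g, b). (g, \<not> b)) w)"
  by (rule involutive_monoid_words)

lemma P_MA: "P = F.MA"
  by (simp add: free_star_algebra_def)

sublocale P: star_alg P
  using F.MA.star_alg_axioms by (simp add: P_MA)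

lemma free_gen_closed [simp]: "free_gen g \<in> carrier P"
  by (simp add: free_gen_def P_MA)

text \<open>Modulo \<open>p\<close>, the relation makes \<open>s = x^* x\<close> idempotent, so
  \<open>p s\<close> equals its own square and \<open>p x \<le> 1\<close>; adjoints have the same
  seminorm, and words follow by submultiplicativity.\<close>

lemma p_delta_le_one:
  assumes p: "cstar_seminorm P p" and rel: "\<And>\<alpha> \<beta>. p (a \<alpha> \<beta> \<otimes>\<^bsub>P\<^esub> str P (a \<alpha> \<beta>) \<otimes>\<^bsub>P\<^esub> a \<alpha> \<beta> \<ominus>\<^bsub>P\<^esub> a \<alpha> \<beta>) = 0"
    and a: "a = (\<lambda>\<alpha> \<beta>. free_gen (\<alpha>, \<beta>))"
  shows "p (delta w) \<le> 1"
proof -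
  interpret p: seminormed_star_alg P p
    using p P.star_alg_axioms by (simp add: seminormed_star_alg_iff star_alg_iff)
  have gen: "p (free_gen (\<alpha>, \<beta>)) \<le> 1" for \<alpha> \<beta>
  proof -
    define x where "x = free_gen (\<alpha>, \<beta>)"
    have x [simp]: "x \<in> carrier P" by (simp add: x_def)
    define s where "s = str P x \<otimes>\<^bsub>P\<^esub> x"
    have s [simp]: "s \<in> carrier P" "str P s = s" by (simp_all add: s_def)
    let ?d = "x \<otimes>\<^bsub>P\<^esub> str P x \<otimes>\<^bsub>P\<^esub> x \<ominus>\<^bsub>P\<^esub> x"
    have "s \<otimes>\<^bsub>P\<^esub> s \<ominus>\<^bsub>P\<^esub> s = str P x \<otimes>\<^bsub>P\<^esub> ?d"
      by (simp add: s_def P.minus_eq P.r_distr P.r_minus P.m_assoc)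
    then have "p (s \<otimes>\<^bsub>P\<^esub> s \<ominus>\<^bsub>P\<^esub> s) \<le> p (str P x) * p ?d" using p.p_mult[of "str P x" ?d] by simp
    also have "p ?d = 0" using rel[of \<alpha> \<beta>] by (simp add: x_def a)
    finally have "p (s \<otimes>\<^bsub>P\<^esub> s) \<le> p s" and "p s \<le> p (s \<otimes>\<^bsub>P\<^esub> s)"
      using p.p_diff_abs[of "s \<otimes>\<^bsub>P\<^esub> s" s] by simp_all
    moreover have "p (s \<otimes>\<^bsub>P\<^esub> s) = p s * p s" using p.p_cstar[of s] by (simp add: power2_eq_square)
    ultimately have "p s * p s = p s" by simp
    then have "p s \<le> 1" by (metis mult_cancel_left1 order_refl zero_le_one)
    then have "(p x)\<^sup>2 \<le> 1\<^sup>2" using p.p_cstar[of x] by (simp add: s_def)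
    then show ?thesis unfolding x_def[symmetric] by (rule power2_le_imp_le) simp
  qed
  show ?thesis
  proof (induction w)
    case Nil
    then show ?case using p.p_one_le F.one_MA by (simp add: P_MA)
  next
    case (Cons x w)
    have letter: "p (delta [x]) \<le> 1"
    proof -
      obtain \<alpha> \<beta> b where x: "x = ((\<alpha>, \<beta>), b)" by (metis prod.collapse)
      have "str P (delta [((\<alpha>, \<beta>), False)]) = delta [((\<alpha>, \<beta>), True)]"
        using F.str_delta[of "[((\<alpha>, \<beta>), False)]"] by (simp add: P_MA)
      then have "p (delta [((\<alpha>, \<beta>), True)]) = p (free_gen (\<alpha>, \<beta>))"
        using p.p_str[OF free_gen_closed, of "(\<alpha>, \<beta>)"] by (simp add: free_gen_def)
      then show ?thesis using gen[of \<alpha> \<beta>] by (cases b) (auto simp: x free_gen_def)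
    qed
    have c: "delta u \<in> carrier P" for u by (simp add: P_MA)
    have "delta (x # w) = delta [x] \<otimes>\<^bsub>P\<^esub> delta w"
      using F.delta_mult[of "[x]" w] by (simp add: P_MA)
    then have "p (delta (x # w)) \<le> p (delta [x]) * p (delta w)" using p.p_mult[OF c c] by simp
    also have "\<dots> \<le> 1 * 1" using letter Cons c by (intro mult_mono) auto
    finally show ?case by simp
  qed
qed

sublocale univ: universal_star_alg P "GA_pres A v l"
proof unfold_locales
  show "a \<in> carrier P \<and> b \<in> carrier P" if "(a, b) \<in> GA_pres A v l" for a b
    by (rule P.GA_rels_closed[OF _ that]) simp
  fix x assume x: "x \<in> carrier P"
  let ?Q = "\<lambda>p. cstar_seminorm P p \<and> (\<forall>(a, b)\<in>GA_pres A v l. p (a \<ominus>\<^bsub>P\<^esub> b) = 0)"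
  let ?u = "\<lambda>\<alpha> \<beta>. free_gen (\<alpha>, \<beta>) :: (('n \<times> 'n) \<times> bool) list \<Rightarrow> complex"
  have pi: "partial_isometry_rel P (?u \<alpha> \<beta>) \<in> GA_pres A v l" for \<alpha> \<beta>
    unfolding GA_rels_def Let_def by blast
  have bound: "p (delta w) \<le> 1" if "?Q p" for p w
  proof (rule p_delta_le_one[OF _ _ refl])
    fix \<alpha> \<beta>
    show "p (?u \<alpha> \<beta> \<otimes>\<^bsub>P\<^esub> str P (?u \<alpha> \<beta>) \<otimes>\<^bsub>P\<^esub> ?u \<alpha> \<beta> \<ominus>\<^bsub>P\<^esub> ?u \<alpha> \<beta>) = 0"
      using that pi[of \<alpha> \<beta>] unfolding partial_isometry_rel_def by blast
  qed (use that in blast)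
  show "\<exists>K. \<forall>p. ?Q p \<longrightarrow> p x \<le> K"
  proof (rule F.MA_bounded[where Q = ?Q])
    show "cstar_seminorm F.MA p" if "?Q p" for p using that unfolding P_MA by (rule conjunct1)
    show "\<exists>K. \<forall>p. ?Q p \<longrightarrow> p (delta m) \<le> K" for m using bound by blast
    show "x \<in> carrier F.MA" using x unfolding P_MA .
  qed
qed

abbreviation "C \<equiv> GA_cstar A v l"

abbreviation "u \<equiv> GA_gen A v l"

lemma C_def: "C = completion P (univ_seminorm P (GA_pres A v l))"
  by (simp add: GA_cstar_def universal_cstar_def)

sublocale C: cstar_alg C
  unfolding GA_cstar_def by (rule univ.cstar_alg_universal)

sublocale I: star_hom_pair P C "incl P (univ_seminorm P (GA_pres A v l))"
  using univ.U.star_hom_inc P.star_alg_axioms C.star_alg_axioms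
  by (intro star_hom_pairI) (simp_all add: C_def)

lemma u_closed [simp]: "u \<alpha> \<beta> \<in> carrier C"
  by (simp add: GA_gen_def)

sublocale u: GA_family C A v l u
proof -
  have "GA_rels C A v l u \<subseteq> Id"
    unfolding GA_gen_def I.GA_rels_hom[OF free_gen_closed] using univ.inc_rel by auto
  then show "GA_family C A v l u"
    using C.GA_family_iff[of u A v l] entries by simp
qed

text \<open>A word is evaluated in \<open>B\<close> by putting \<open>U \<alpha> \<beta>\<close> or
  its adjoint for each letter, multiplicatively and compatibly with adjoints; by
  \<open>GA_rels_hom\<close> the resulting homomorphism of the free algebra respects the
  presentation.\<close>

lemma GA_universal:
  fixes B :: "('b, 'k) cstar_scheme"
  assumes "GA_family B A v l U"
  shows "\<exists>F. star_hom C B F \<and> (\<forall>\<alpha> \<beta>. F (u \<alpha> \<beta>) = U \<alpha> \<beta>)"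
proof -
  interpret U: GA_family B A v l U by fact
  define h where "h = foldr (\<lambda>((\<alpha>, \<beta>), b) x. (if b then str B (U \<alpha> \<beta>) else U \<alpha> \<beta>) \<otimes>\<^bsub>B\<^esub> x)"
  let ?h = "\<lambda>w. h w \<one>\<^bsub>B\<^esub>"
  have h_Cons: "?h (x # w) = ?h [x] \<otimes>\<^bsub>B\<^esub> ?h w" and hc [simp]: "?h w \<in> carrier B" for x w
  proof -
    show c: "?h w \<in> carrier B" for w by (induction w) (auto simp: h_def)
    show "?h (x # w) = ?h [x] \<otimes>\<^bsub>B\<^esub> ?h w" using c[of w] by (auto simp: h_def split: prod.splits)
  qed
  have h_Nil: "?h [] = \<one>\<^bsub>B\<^esub>" by (simp add: h_def)
  have h_append: "?h (x @ y) = ?h x \<otimes>\<^bsub>B\<^esub> ?h y" for x y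
  proof (induction x)
    case (Cons a x)
    then show ?case using h_Cons[of a "x @ y"] h_Cons[of a x] hc[of "[a]"] by (simp add: U.m_assoc)
  qed (simp add: h_Nil)
  have h_st: "?h (rev (map (\<lambda>(g, b). (g, \<not> b)) w)) = str B (?h w)" for w
  proof (induction w)
    case (Cons x w)
    have "?h [case x of (g, b) \<Rightarrow> (g, \<not> b)] = str B (?h [x])"
      by (auto simp: h_def split: prod.splits)
    then show ?case using Cons by (simp add: h_append h_Cons[of x w])
  qed (simp add: h_Nil)
  have f: "star_hom P B (F.extend B ?h)"
    unfolding P_MA by (rule F.star_hom_extend[OF U.star_alg_axioms]) (simp_all add: h_Nil h_append h_st)
  interpret f: star_hom_pair P B "F.extend B ?h"
    using f P.star_alg_axioms U.star_alg_axioms by (intro star_hom_pairI)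
  have gen: "F.extend B ?h (free_gen (\<alpha>, \<beta>)) = U \<alpha> \<beta>" for \<alpha> \<beta>
  proof -
    have "F.extend B ?h (free_gen (\<alpha>, \<beta>)) = ?h [((\<alpha>, \<beta>), False)]"
      unfolding free_gen_def by (rule F.extend_delta[OF U.star_alg_axioms]) simp_all
    then show ?thesis by (simp add: h_def)
  qed
  have rel: "F.extend B ?h a = F.extend B ?h b" if "(a, b) \<in> GA_pres A v l" for a b
  proof -
    have "(F.extend B ?h a, F.extend B ?h b) \<in> map_prod (F.extend B ?h) (F.extend B ?h) ` GA_pres A v l"
      using that by force
    then show ?thesis
      unfolding f.GA_rels_hom[OF free_gen_closed, symmetric] gen using U.rels by blast
  qed
  show ?thesis
  proof (rule univ.universal_extend[OF U.cstar_alg_axioms f rel])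
    fix F
    assume "star_hom (universal_cstar P (GA_pres A v l)) B F"
      "\<And>a. a \<in> carrier P \<Longrightarrow> F (incl P (univ_seminorm P (GA_pres A v l)) a) = F.extend B ?h a"
    then show ?thesis
      by (intro exI[of _ F]) (simp add: GA_cstar_def GA_gen_def gen)
  qed
qed

sublocale CC: tensor C C
  by unfold_locales

abbreviation "\<Delta> \<equiv> GA_comult A v l"

text \<open>Existence is the universal property applied to the coproduct family in the tensor
  square.\<close>

lemma comult:
  "star_hom C (min_tensor C C) \<Delta>"
  "\<Delta> (u \<alpha> \<beta>) = finsum (min_tensor C C) (\<lambda>\<gamma>. tns C C (u \<alpha> \<gamma>) (u \<gamma> \<beta>)) UNIV"
proof -
  have "\<exists>\<Delta>. star_hom C CC.D \<Delta> \<and> (\<forall>\<alpha> \<beta>. \<Delta> (u \<alpha> \<beta>) = finsum CC.D (\<lambda>\<gamma>. CC.t (u \<alpha> \<gamma>) (u \<gamma> \<beta>)) UNIV)"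
    by (rule GA_universal[OF tensor_GA_family[OF u.GA_family_axioms]])
  from someI_ex[OF this] show "star_hom C (min_tensor C C) \<Delta>"
    "\<Delta> (u \<alpha> \<beta>) = finsum (min_tensor C C) (\<lambda>\<gamma>. tns C C (u \<alpha> \<gamma>) (u \<gamma> \<beta>)) UNIV"
    unfolding GA_comult_def Let_def by blast+
qed

lemma generates_u: "generates C {u \<alpha> \<beta> | \<alpha> \<beta>. True}"
proof (rule F.generates_completion[where p = "univ_seminorm P (GA_pres A v l)", folded P_MA, folded C_def])
  show "seminormed_star_alg P (univ_seminorm P (GA_pres A v l))"
    by (rule univ.U.seminormed_star_alg_axioms)
  fix S and w :: "(('n \<times> 'n) \<times> bool) list"
  assume S: "{u \<alpha> \<beta> | \<alpha> \<beta>. True} \<subseteq> S" "\<one>\<^bsub>C\<^esub> \<in> S"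
    "\<And>x y. x \<in> S \<Longrightarrow> y \<in> S \<Longrightarrow> x \<oplus>\<^bsub>C\<^esub> y \<in> S \<and> x \<otimes>\<^bsub>C\<^esub> y \<in> S"
    "\<And>x c. x \<in> S \<Longrightarrow> str C x \<in> S \<and> scl C c x \<in> S"
  let ?i = "incl P (univ_seminorm P (GA_pres A v l))"
  have c: "delta w \<in> carrier P" for w :: "(('n \<times> 'n) \<times> bool) list" by (simp add: P_MA)
  have letter: "?i (delta [x]) \<in> S" for x
  proof -
    obtain \<alpha> \<beta> b where x: "x = ((\<alpha>, \<beta>), b)" by (metis prod.collapse)
    have "str P (delta [((\<alpha>, \<beta>), False)]) = delta [((\<alpha>, \<beta>), True)]"
      using F.str_delta[of "[((\<alpha>, \<beta>), False)]"] by (simp add: P_MA)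
    then have "?i (delta [((\<alpha>, \<beta>), True)]) = str C (u \<alpha> \<beta>)"
      using I.hom_str[OF c, of "[((\<alpha>, \<beta>), False)]"] by (simp add: GA_gen_def free_gen_def)
    moreover have "u \<alpha> \<beta> \<in> S" using S(1) by blast
    ultimately show ?thesis using S(4)[of "u \<alpha> \<beta>"] by (cases b) (auto simp: x GA_gen_def free_gen_def)
  qed
  show "?i (delta w) \<in> S"
  proof (induction w)
    case Nil
    have "delta [] = \<one>\<^bsub>P\<^esub>" using F.one_MA by (simp add: P_MA)
    then show ?case using S(2) by simp
  next
    case (Cons x w)
    have "delta (x # w) = delta [x] \<otimes>\<^bsub>P\<^esub> delta w"
      using F.delta_mult[of "[x]" w] by (simp add: P_MA)
    then have "?i (delta (x # w)) = ?i (delta [x]) \<otimes>\<^bsub>C\<^esub> ?i (delta w)" using I.hom_mult[OF c c] by simp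
    then show ?case using S(3) letter Cons by simp
  qed
qed

text \<open>The inverse of \<open>u\<close> is its adjoint matrix, and that of the entrywise adjoint
  is the transpose of \<open>u\<close>: diagonal entries are row or column sums of a magic unitary,
  off-diagonal entries vanish term by term by orthogonality.\<close>

lemma GA_cmqg: "compact_matrix_quantum_group (GA A v l)"
proof -
  define n where "n = CARD('n)"
  obtain idx :: "nat \<Rightarrow> 'n" where "bij_betw idx {0..<n} UNIV"
    using ex_bij_betw_nat_finite[of "UNIV :: 'n set"] by (auto simp: n_def)
  then have idx: "inj_on idx {..<n}" "idx ` {..<n} = UNIV" by (auto simp: bij_betw_def atLeast0LessThan)
  have reindex: "finsum C (\<lambda>k. f (idx k)) {..<n} = finsum C f UNIV" if "\<And>\<gamma>. f \<gamma> \<in> carrier C" for f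
    using C.finsum_reindex[of f idx "{..<n}"] idx that by auto
  have reindex_D: "finsum CC.D (\<lambda>k. f (idx k)) {..<n} = finsum CC.D f UNIV" if "\<And>\<gamma>. f \<gamma> \<in> carrier CC.D" for f
    using CC.D.finsum_reindex[of f idx "{..<n}"] idx that by auto
  let ?u = "\<lambda>i j. u (idx i) (idx j)"
  have "{?u i j | i j. i < n \<and> j < n} = {u \<alpha> \<beta> | \<alpha> \<beta>. True}"
  proof
    show "{u \<alpha> \<beta> | \<alpha> \<beta>. True} \<subseteq> {?u i j | i j. i < n \<and> j < n}"
    proof
      fix x assume "x \<in> {u \<alpha> \<beta> | \<alpha> \<beta>. True}"
      then obtain \<alpha> \<beta> where x: "x = u \<alpha> \<beta>" by blast
      have "\<alpha> \<in> idx ` {..<n}" "\<beta> \<in> idx ` {..<n}" using idx by auto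
      then show "x \<in> {?u i j | i j. i < n \<and> j < n}" unfolding x by auto
    qed
  qed auto
  then have gen: "generates C {?u i j | i j. i < n \<and> j < n}" using generates_u by simp
  have eq_iff: "idx i = idx j \<longleftrightarrow> i = j" if "i < n" "j < n" for i j
    using idx(1) that by (auto simp: inj_on_def)
  have kron: "finsum C f UNIV = (if \<alpha> = \<beta> then \<one>\<^bsub>C\<^esub> else \<zero>\<^bsub>C\<^esub>)"
    if "\<alpha> = \<beta> \<Longrightarrow> finsum C f UNIV = \<one>\<^bsub>C\<^esub>" "\<And>\<gamma>. \<alpha> \<noteq> \<beta> \<Longrightarrow> f \<gamma> = \<zero>\<^bsub>C\<^esub>" for f and \<alpha> \<beta> :: 'n
  proof (cases "\<alpha> = \<beta>")
    case False
    then have "f = (\<lambda>_. \<zero>\<^bsub>C\<^esub>)" using that(2) by blast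
    then show ?thesis using False by (simp add: C.finsum_zero)
  qed (use that in simp)
  note sums = magic_family.row[OF u.magic_p] magic_family.row[OF u.magic_q]
    magic_family.col[OF u.magic_p] magic_family.col[OF u.magic_q]
  have "invertible_matrix C n ?u"
    unfolding invertible_matrix_def
  proof (intro exI[of _ "\<lambda>i j. str C (u (idx j) (idx i))"] conjI allI impI)
    fix i j assume ij: "i < n" "j < n"
    show "finsum C (\<lambda>k. ?u i k \<otimes>\<^bsub>C\<^esub> str C (u (idx j) (idx k))) {..<n} = (if i = j then \<one>\<^bsub>C\<^esub> else \<zero>\<^bsub>C\<^esub>)"
      unfolding eq_iff[OF ij, symmetric]
      by (subst reindex, simp, rule kron) (simp_all add: sums u.U_Ustr_col)
    show "finsum C (\<lambda>k. str C (u (idx k) (idx i)) \<otimes>\<^bsub>C\<^esub> ?u k j) {..<n} = (if i = j then \<one>\<^bsub>C\<^esub> else \<zero>\<^bsub>C\<^esub>)"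
      unfolding eq_iff[OF ij, symmetric]
      by (subst reindex, simp, rule kron) (simp_all add: sums u.Ustr_U_row)
  qed simp
  moreover have "invertible_matrix C n (\<lambda>i j. str C (?u i j))"
    unfolding invertible_matrix_def
  proof (intro exI[of _ "\<lambda>i j. u (idx j) (idx i)"] conjI allI impI)
    fix i j assume ij: "i < n" "j < n"
    show "finsum C (\<lambda>k. str C (?u i k) \<otimes>\<^bsub>C\<^esub> u (idx j) (idx k)) {..<n} = (if i = j then \<one>\<^bsub>C\<^esub> else \<zero>\<^bsub>C\<^esub>)"
      unfolding eq_iff[OF ij, symmetric]
      by (subst reindex, simp, rule kron) (simp_all add: sums u.Ustr_U_col)
    show "finsum C (\<lambda>k. u (idx k) (idx i) \<otimes>\<^bsub>C\<^esub> str C (?u k j)) {..<n} = (if i = j then \<one>\<^bsub>C\<^esub> else \<zero>\<^bsub>C\<^esub>)"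
      unfolding eq_iff[OF ij, symmetric]
      by (subst reindex, simp, rule kron) (simp_all add: sums u.U_Ustr_row)
  qed simp
  moreover have "\<Delta> (?u i j) = finsum (min_tensor C C) (\<lambda>k. tns C C (?u i k) (?u k j)) {..<n}" for i j
    unfolding comult(2) by (rule reindex_D[symmetric]) simp
  ultimately show ?thesis
    unfolding compact_matrix_quantum_group_def GA_def
    using gen comult(1) C.cstar_alg_axioms[unfolded cstar_alg_iff]
    by (simp, intro exI[of _ n] exI[of _ ?u], simp)
qed

end

section \<open>The free group dual as a quantum subgroup\<close>

lemma free_group_GA_family:
  fixes A :: "real^'n::finite^'n" and v :: "real^'n"
  assumes entries: "\<And>i j. A $ i $ j \<in> {0, 1}"
  defines "B \<equiv> group_cstar (free_group :: ('n \<times> bool) list monoid)"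
  shows "GA_family B A v l (\<lambda>\<alpha> \<beta>. if \<alpha> = \<beta> then group_elem free_group [(\<alpha>, True)] else \<zero>\<^bsub>B\<^esub>)"
proof -
  let ?F = "free_group :: ('n \<times> bool) list monoid"
  interpret group ?F by (rule group_free_group)
  interpret G: group_dual_locale ?F ..
  interpret B: cstar_alg B unfolding B_def by (rule G.B.cstar_alg_axioms)
  let ?U = "\<lambda>\<alpha> \<beta>. if \<alpha> = \<beta> then G.ge [(\<alpha>, True)] else \<zero>\<^bsub>B\<^esub>"
  have single: "[x] \<in> carrier ?F" for x :: "'n \<times> bool" by (simp add: carrier_free_group)
  have gc [simp]: "G.ge [x] \<in> carrier B" for x using single by (simp add: B_def)
  have g: "str B (G.ge [(\<alpha>, True)]) = G.ge [(\<alpha>, False)]"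
    "G.ge [(\<alpha>, True)] \<otimes>\<^bsub>B\<^esub> G.ge [(\<alpha>, False)] = \<one>\<^bsub>B\<^esub>"
    "G.ge [(\<alpha>, False)] \<otimes>\<^bsub>B\<^esub> G.ge [(\<alpha>, True)] = \<one>\<^bsub>B\<^esub>" for \<alpha>
    using single G.ge_one unfolding B_def
    by (simp_all add: G.ge_str inv_free_group_single G.ge_mult mult_free_group one_free_group red_cons_def)
      (simp_all add: flip_def)
  have p: "?U \<alpha> \<beta> \<otimes>\<^bsub>B\<^esub> str B (?U \<alpha> \<beta>) = (if \<alpha> = \<beta> then \<one>\<^bsub>B\<^esub> else \<zero>\<^bsub>B\<^esub>)"
    and q: "str B (?U \<alpha> \<beta>) \<otimes>\<^bsub>B\<^esub> ?U \<alpha> \<beta> = (if \<alpha> = \<beta> then \<one>\<^bsub>B\<^esub> else \<zero>\<^bsub>B\<^esub>)" for \<alpha> \<beta>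
    by (simp_all add: g)
  have kron: "finsum B (\<lambda>\<gamma>. scl B (c \<gamma>) (if R \<gamma> then \<one>\<^bsub>B\<^esub> else \<zero>\<^bsub>B\<^esub>)) UNIV = scl B (c \<alpha>) \<one>\<^bsub>B\<^esub>"
    "finsum B (\<lambda>\<gamma>. if R \<gamma> then \<one>\<^bsub>B\<^esub> else \<zero>\<^bsub>B\<^esub>) UNIV = \<one>\<^bsub>B\<^esub>"
    if "\<And>\<gamma>. R \<gamma> \<longleftrightarrow> \<gamma> = \<alpha>" for c R and \<alpha> :: 'n
  proof -
    show "finsum B (\<lambda>\<gamma>. scl B (c \<gamma>) (if R \<gamma> then \<one>\<^bsub>B\<^esub> else \<zero>\<^bsub>B\<^esub>)) UNIV = scl B (c \<alpha>) \<one>\<^bsub>B\<^esub>"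
      using that by (subst B.finsum_single[of UNIV \<alpha>]) simp_all
    show "finsum B (\<lambda>\<gamma>. if R \<gamma> then \<one>\<^bsub>B\<^esub> else \<zero>\<^bsub>B\<^esub>) UNIV = \<one>\<^bsub>B\<^esub>"
      using that by (subst B.finsum_single[of UNIV \<alpha>]) simp_all
  qed
  have magic: "magic_family B v (\<lambda>\<alpha> \<beta>. if \<alpha> = \<beta> then \<one>\<^bsub>B\<^esub> else \<zero>\<^bsub>B\<^esub>)"
  proof unfold_locales
    fix \<alpha> \<beta> :: 'n
    show "B.projection (if \<alpha> = \<beta> then \<one>\<^bsub>B\<^esub> else \<zero>\<^bsub>B\<^esub>)" by (auto simp: B.projection_def)
    show "finsum B (\<lambda>\<beta>. if \<alpha> = \<beta> then \<one>\<^bsub>B\<^esub> else \<zero>\<^bsub>B\<^esub>) UNIV = \<one>\<^bsub>B\<^esub>"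
      by (rule kron) auto
    show "finsum B (\<lambda>\<alpha>. if \<alpha> = \<beta> then \<one>\<^bsub>B\<^esub> else \<zero>\<^bsub>B\<^esub>) UNIV = \<one>\<^bsub>B\<^esub>"
      by (rule kron) auto
    show "finsum B (\<lambda>\<beta>. scl B (of_real (v $ \<beta>)) (if \<alpha> = \<beta> then \<one>\<^bsub>B\<^esub> else \<zero>\<^bsub>B\<^esub>)) UNIV
      = scl B (of_real (v $ \<alpha>)) \<one>\<^bsub>B\<^esub>"
      by (rule kron) auto
  qed
  have U_closed: "?U \<alpha> \<beta> \<in> carrier B" for \<alpha> \<beta> by simp
  \<comment> \<open>A nonzero product consists of free generators only, so its product with its
    adjoint is \<open>1\<close>, which already makes it a partial isometry.\<close>
  have word: "word_prod B ?U x y = \<zero>\<^bsub>B\<^esub> \<or>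
    word_prod B ?U x y \<otimes>\<^bsub>B\<^esub> str B (word_prod B ?U x y) = \<one>\<^bsub>B\<^esub>" for x y
  proof (induction x arbitrary: y)
    case (Cons a x)
    show ?case
    proof (cases y)
      case y: (Cons b y')
      have c: "word_prod B ?U x y' \<in> carrier B" by (rule B.word_prod_closed) simp
      show ?thesis
      proof (cases "a = b \<and> word_prod B ?U x y' \<noteq> \<zero>\<^bsub>B\<^esub>")
        case True
        let ?w = "word_prod B ?U x y'" and ?g = "G.ge [(a, True)]"
        have ww: "?w \<otimes>\<^bsub>B\<^esub> str B ?w = \<one>\<^bsub>B\<^esub>" using Cons.IH[of y'] True by blast
        have "(?g \<otimes>\<^bsub>B\<^esub> ?w) \<otimes>\<^bsub>B\<^esub> str B (?g \<otimes>\<^bsub>B\<^esub> ?w) = ?g \<otimes>\<^bsub>B\<^esub> ((?w \<otimes>\<^bsub>B\<^esub> str B ?w) \<otimes>\<^bsub>B\<^esub> str B ?g)"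
          using c by (simp add: B.m_assoc)
        also have "\<dots> = \<one>\<^bsub>B\<^esub>" unfolding ww by (simp add: g)
        finally show ?thesis using True by (simp add: y)
      next
        case False
        then show ?thesis using c by (auto simp: y)
      qed
    qed simp
  qed simp
  show ?thesis
  proof (intro GA_family.intro GA_family_axioms.intro B.cstar_alg_axioms entries)
    fix \<alpha> \<beta> :: 'n
    show "B.partial_isometry (?U \<alpha> \<beta>)" by (auto simp: B.partial_isometry_def g B.m_assoc)
    show "magic_family B v (\<lambda>\<alpha> \<beta>. ?U \<alpha> \<beta> \<otimes>\<^bsub>B\<^esub> str B (?U \<alpha> \<beta>))" unfolding p by (rule magic)
    show "magic_family B v (\<lambda>\<alpha> \<beta>. str B (?U \<alpha> \<beta>) \<otimes>\<^bsub>B\<^esub> ?U \<alpha> \<beta>)" unfolding q by (rule magic)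
    have "finsum B (\<lambda>\<gamma>. scl B (of_real (A $ \<alpha> $ \<gamma>)) (if \<gamma> = \<beta> then \<one>\<^bsub>B\<^esub> else \<zero>\<^bsub>B\<^esub>)) UNIV
      = scl B (of_real (A $ \<alpha> $ \<beta>)) \<one>\<^bsub>B\<^esub>"
      by (rule kron) auto
    moreover have "finsum B (\<lambda>\<gamma>. scl B (of_real (A $ \<gamma> $ \<beta>)) (if \<alpha> = \<gamma> then \<one>\<^bsub>B\<^esub> else \<zero>\<^bsub>B\<^esub>)) UNIV
      = scl B (of_real (A $ \<alpha> $ \<beta>)) \<one>\<^bsub>B\<^esub>"
      by (rule kron) auto
    ultimately show "finsum B (\<lambda>\<gamma>. scl B (of_real (A $ \<alpha> $ \<gamma>)) (?U \<gamma> \<beta> \<otimes>\<^bsub>B\<^esub> str B (?U \<gamma> \<beta>))) UNIV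
      = finsum B (\<lambda>\<gamma>. scl B (of_real (A $ \<gamma> $ \<beta>)) (str B (?U \<alpha> \<gamma>) \<otimes>\<^bsub>B\<^esub> ?U \<alpha> \<gamma>)) UNIV"
      unfolding p q by simp
  next
    fix n x y
    have "word_prod B ?U x y \<in> carrier B" by (rule B.word_prod_closed) simp
    then show "B.partial_isometry (word_prod B ?U x y)"
      using word[of x y] by (elim disjE) (simp_all only: B.partial_isometry_def B.str_zero B.l_null B.zero_closed B.l_one simp_thms)
  qed
qed

text \<open>Stated for an arbitrary extended natural \<open>l\<close>, so that the finite levels and
  \<open>\<infinity>\<close> are covered by one argument.\<close>

lemma free_group_dual_quantum_subgroup:
  fixes A :: "real^'n::finite^'n" and v :: "real^'n"
  assumes entries: "\<And>i j. A $ i $ j \<in> {0, 1}"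
  shows "quantum_subgroup (group_dual (free_group :: ('n \<times> bool) list monoid)) (GA A v l)"
proof -
  let ?F = "free_group :: ('n \<times> bool) list monoid"
  interpret group ?F by (rule group_free_group)
  interpret G: group_dual_locale ?F ..
  interpret GA_locale A v l using entries by unfold_locales
  let ?U = "\<lambda>\<alpha> \<beta>. if \<alpha> = \<beta> then G.ge [(\<alpha>, True)] else \<zero>\<^bsub>G.B\<^esub>"
  obtain \<pi> where \<pi>: "star_hom C G.B \<pi>" "\<And>\<alpha> \<beta>. \<pi> (u \<alpha> \<beta>) = ?U \<alpha> \<beta>"
    using GA_universal[OF free_group_GA_family[OF entries]] by blast
  interpret \<pi>: star_hom_pair C G.B \<pi>
    using \<pi>(1) C.star_alg_axioms G.B.star_alg_axioms by (intro star_hom_pairI)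
  have single: "[x] \<in> carrier ?F" for x :: "'n \<times> bool" by (simp add: carrier_free_group)
  \<comment> \<open>The image of \<open>\<pi>\<close> is closed under products and adjoints, and
    \<open>u i i\<close> is sent to the generator \<open>i\<close>.\<close>
  have elem: "G.ge w \<in> \<pi> ` carrier C" if "w \<in> carrier ?F" for w
  proof (rule free_group_elem_induct[OF _ _ _ _ that])
    show "G.ge [(i, True)] \<in> \<pi> ` carrier C" for i
      by (rule image_eqI[of _ _ "u i i"]) (simp_all add: \<pi>(2))
    show "\<one>\<^bsub>G.B\<^esub> \<in> \<pi> ` carrier C" by (rule image_eqI[of _ _ "\<one>\<^bsub>C\<^esub>"]) simp_all
    show "x \<otimes>\<^bsub>G.B\<^esub> y \<in> \<pi> ` carrier C" if xy: "x \<in> \<pi> ` carrier C" "y \<in> \<pi> ` carrier C" for x y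
    proof -
      obtain a b where "x = \<pi> a" "a \<in> carrier C" "y = \<pi> b" "b \<in> carrier C" using xy by blast
      then show ?thesis by (intro image_eqI[of _ _ "a \<otimes>\<^bsub>C\<^esub> b"]) simp_all
    qed
    show "str G.B x \<in> \<pi> ` carrier C" if x: "x \<in> \<pi> ` carrier C" for x
    proof -
      obtain a where "x = \<pi> a" "a \<in> carrier C" using x by blast
      then show ?thesis by (intro image_eqI[of _ _ "str C a"]) simp_all
    qed
  qed
  \<comment> \<open>The image thus contains the formal sums over the group, which are dense, as
    \<open>star_hom_surj\<close> requires.\<close>
  have inc: "incl G.MA (univ_seminorm G.MA {}) f \<in> \<pi> ` carrier C" if "f \<in> carrier G.MA" for f
    using that
  proof (induction f rule: G.MA_induct)
    case zero
    show ?case by (rule image_eqI[of _ _ "\<zero>\<^bsub>C\<^esub>"]) simp_all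
  next
    case (step f c m)
    obtain a where a: "incl G.MA (univ_seminorm G.MA {}) f = \<pi> a" "a \<in> carrier C" using step.IH by blast
    obtain b where b: "G.ge m = \<pi> b" "b \<in> carrier C" using elem[OF step.hyps(2)] by blast
    have "incl G.MA (univ_seminorm G.MA {}) (f \<oplus>\<^bsub>G.MA\<^esub> scl G.MA c (delta m)) = \<pi> (a \<oplus>\<^bsub>C\<^esub> scl C c b)"
      using a b step.hyps by (simp add: G.ge_def[symmetric])
    then show ?case using a b by blast
  qed
  have surj: "\<pi> ` carrier C = carrier G.B"
  proof (rule star_hom_surj[OF C.cstar_alg_axioms G.B.cstar_alg_axioms \<pi>(1)])
    fix b and e :: real assume b: "b \<in> carrier G.B" "e > 0"
    obtain f where "f \<in> carrier G.MA" "nrm G.B (incl G.MA (univ_seminorm G.MA {}) f \<ominus>\<^bsub>G.B\<^esub> b) < e"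
      using G.univ.U.inc_dense[of b e] b unfolding G.B_def[symmetric] by blast
    then show "\<exists>a\<in>carrier C. nrm G.B (\<pi> a \<ominus>\<^bsub>G.B\<^esub> b) < e" using inc[of f] by auto
  qed
  obtain \<Theta> where \<Theta>: "star_hom CC.D G.BB.D \<Theta>"
    "\<And>a b. a \<in> carrier C \<Longrightarrow> b \<in> carrier C \<Longrightarrow> \<Theta> (CC.t a b) = G.BB.t (\<pi> a) (\<pi> b)"
    using tensor_square_hom[OF C.cstar_alg_axioms G.B.cstar_alg_axioms \<pi>(1)
        star_hom_contractive[OF C.cstar_alg_axioms G.B.cstar_alg_axioms \<pi>(1)] surj] by blast
  interpret \<Theta>: star_hom_pair CC.D G.BB.D \<Theta>
    using \<Theta>(1) CC.D.star_alg_axioms G.BB.D.star_alg_axioms by (intro star_hom_pairI)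
  interpret \<Delta>': star_hom_pair G.B G.BB.D "group_comult ?F"
    using G.group_comult(1) G.B.star_alg_axioms G.BB.D.star_alg_axioms by (intro star_hom_pairI)
  have "\<Theta> (\<Delta> a) = group_comult ?F (\<pi> a)" if "a \<in> carrier C" for a
  proof (rule star_hom_eq_on_generators[OF C.cstar_alg_axioms G.BB.D.cstar_alg_axioms _ _ generates_u _ _ that])
    show "star_hom C G.BB.D (\<lambda>a. \<Theta> (\<Delta> a))" by (rule star_hom_comp[OF comult(1) \<Theta>(1)])
    show "star_hom C G.BB.D (\<lambda>a. group_comult ?F (\<pi> a))" by (rule star_hom_comp[OF \<pi>(1) G.group_comult(1)])
    fix x assume "x \<in> {u \<alpha> \<beta> | \<alpha> \<beta>. True}"
    then obtain \<alpha> \<beta> where x: "x = u \<alpha> \<beta>" by blast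
    have "\<Theta> (\<Delta> x) = finsum G.BB.D (\<lambda>\<gamma>. \<Theta> (CC.t (u \<alpha> \<gamma>) (u \<gamma> \<beta>))) UNIV"
      unfolding x comult(2) by (rule \<Theta>.hom_finsum) auto
    also have "\<dots> = finsum G.BB.D (\<lambda>\<gamma>. G.BB.t (?U \<alpha> \<gamma>) (?U \<gamma> \<beta>)) UNIV"
      by (simp only: \<Theta>(2) u_closed \<pi>(2))
    \<comment> \<open>Only the summand \<open>\<gamma> = \<alpha>\<close> survives; it is
      \<open>g \<otimes> g\<close> on the diagonal and zero elsewhere.\<close>
    also have "\<dots> = G.BB.t (?U \<alpha> \<alpha>) (?U \<alpha> \<beta>)"
      using single by (intro G.BB.D.finsum_single) auto
    also have "\<dots> = group_comult ?F (\<pi> x)"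
      using single by (auto simp: x \<pi>(2) G.group_comult(2))
    finally show "\<Theta> (\<Delta> x) = group_comult ?F (\<pi> x)" .
  qed auto
  then show ?thesis
    unfolding quantum_subgroup_def group_dual_def GA_def
    using free_group_dual_cmqg[unfolded group_dual_def] GA_cmqg[unfolded GA_def] \<pi>(1) surj \<Theta>
    by (simp, intro exI[of _ \<pi>] exI[of _ \<Theta>] conjI ballI) simp_all
qed

theorem proposition5p10:
  fixes A :: "real^'n::finite^'n" and v :: "real^'n"
  assumes "CARD('n) \<ge> 2"
    and "\<forall>i j. A $ i $ j \<in> {0, 1}"
    and "primitive_matrix A"
    and "right_perron_vector A v"
  shows "quantum_subgroup (group_dual (free_group :: ('n \<times> bool) list monoid)) (GA A v \<infinity>)
    \<and> (\<forall>l::nat. quantum_subgroup (group_dual (free_group :: ('n \<times> bool) list monoid)) (GA A v (enat l)))"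
  using assms(2) by (auto intro!: free_group_dual_quantum_subgroup)

end
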